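(* Let $k\ge3$, and let $x_1,\ldots,x_k$ be distinct points on $S^2\setminus\{e_3\}$. Let $\tilde\mu$ be a positive real number and $\tilde\alpha_1,\ldots,\tilde\alpha_k$ be real numbers such that $\tilde\alpha_j>-\frac12$ for each $j$, and $\beta:=-1-\sum_{j=1}^k\tilde\alpha_j>0$. For each integer $n\ge2$ let $b_n:=\sqrt{\beta/(n-1)}$, so that $b_n>0$ and $b_n\to0$ as $n\to\infty$. Define, for $\rho\in\mathcal{P}'$, $S(\rho):=L(\rho)+2\beta R(\rho)+H(\rho)$. Then \begin{align*} &\lim_{n\to\infty}\frac1n\log\tilde C(\tilde\alpha_1/b_n,\ldots,\tilde\alpha_k/b_n;x_1,\ldots,x_k;b_n;\tilde\mu/b_n^2)\\ &=1+\ln\tilde\mu-\ln\beta-i\pi+(1-\ln4)\sum_{j=1}^k\frac{\tilde\alpha_j^2}{\beta}+\sum_{j=1}^k\frac{\tilde\alpha_j(1+\tilde\alpha_j)}{\beta}\ln g(\sigma(x_j))\\ &\qquad-\frac4\beta\sum_{1\le j<j'\le k}\tilde\alpha_j\tilde\alpha_{j'}G(x_j,x_{j'})-\inf_{\rho\in\mathcal{P}'}S(\rho). \end{align*} Moreover, the infimum on the right is attained at a unique (up to almost everywhere equivalence) $\hat\rho\in\mathcal{P}'$.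
   Context: Notation. $S^2\subset\mathbb{R}^3$ is the unit sphere with area measure $a$; $e_3=(0,0,1)$; $\sigma:S^2\setminus\{e_3\}\to\mathbb{C}$, $\sigma(x,y,z)=\frac{x+iy}{1-z}$; $g(z)=\frac{4}{(1+|z|^2)^2}$. $G(x,y)=-\ln\|x-y\|-\frac12+\ln2$ for distinct $x,y\in S^2$ (the Green's function of the spherical Laplacian, i.e. the inverse of $-\frac1{2\pi}\Delta_{S^2}$ on functions of zero mean). Functionals. $\mathcal{P}$ is the set of probability density functions on $S^2$ with respect to $a$; $$H(\rho)=\int_{S^2}\rho\ln\rho\,da,\quad R(\rho)=\int_{(S^2)^2}\rho(x)\rho(y)G(x,y)\,da(x)da(y),\quad L(\rho)=\sum_{j=1}^k4\tilde\alpha_j\int_{S^2}G(x_j,x)\rho(x)\,da(x);$$ $\mathcal{P}'=\{\rho\in\mathcal{P}:H(\rho)<\infty\}$ (for $\rho\in\mathcal{P}'$, $R(\rho)$ and $L(\rho)$ are finite). Wrong sign Gaussian expectation. If $h:\mathbb{R}^N\to\mathbb{C}$ extends to a holomorphic function $\tilde h$ on an open set containing $(\mathbb{R}\cup i\mathbb{R})^N$ and $\mathbb{E}|\tilde h(iW_1,\ldots,iW_N)|<\infty$ for i.i.d. standard Gaussians $W_i$, then for a vector $X$ of $N$ "independent $N(0,-1)$ variables", $\mathbb{E}(h(X)):=\mathbb{E}(\tilde h(iW_1,\ldots,iW_N))$. Correlation function $\tilde C$. For $b,\mu>0$ and complex $\alpha_1,\ldots,\alpha_k$: $Q=b-\frac1b$,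 $\chi=\ln4-1$, $\Delta_\alpha=\alpha(Q-\alpha)$, $w=(Q-\sum_j\alpha_j)/b$. $\{Y_{lm}\}$ are the real spherical harmonics, orthonormal in $L^2(S^2,a)$, with $\Delta_{S^2}Y_{lm}=-l(l+1)Y_{lm}$. For $\epsilon>0$, $\lambda\in(0,1)$, $L\ge1$ let $(X_{lm})_{0\le l\le L,-l\le m\le l}$ be i.i.d. $N(0,-1)$ variables (so that, with $N=(L+1)^2$, the expectation of a function $h$ of these variables is the wrong sign Gaussian expectation $\mathbb{E}(h(X)):=\mathbb{E}(\tilde h(iW_1,\ldots,iW_N))$, where $\tilde h$ is the holomorphic extension of $h$ and $W_1,\ldots,W_N$ are i.i.d. standard Gaussians), $$G_{\lambda,L}(x,y)=\sum_{l=1}^L\sum_{m=-l}^l\lambda^l\frac{2\pi}{l(l+1)}Y_{lm}(x)Y_{lm}(y),\quad X_{\lambda,L}(x)=\sum_{l=1}^L\sum_{m=-l}^l\lambda^{l/2}\sqrt{\tfrac{2\pi}{l(l+1)}}\,X_{lm}Y_{lm}(x),\quad D=\frac{X_{00}}{\sqrt{8\pi\epsilon}},$$ $$\tilde V_{X_{\lambda,L}}(\alpha,x)=e^{\chi\alpha(b-\alpha)}g(\sigma(x))^{-\Delta_\alpha}e^{2\alpha X_{\lambda,L}(x)+2\alpha^2G_{\lambda,L}(x,x)},$$ $$\tilde C_{\epsilon,\lambda,L}=\mathbb{E}\Bigl[\prod_{j=1}^k\tilde V_{X_{\lambda,L}}(\alpha_j,x_j)\exp\Bigl(-2bwD-\mu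 e^{2bD}\int_{S^2}e^{2bX_{\lambda,L}(x)+2b^2G_{\lambda,L}(x,x)}da(x)\Bigr)\Bigr],$$ and $\tilde C(\alpha_1,\ldots,\alpha_k;x_1,\ldots,x_k;b;\mu):=\lim_{\lambda\uparrow1}\lim_{L\to\infty}\lim_{\epsilon\to0}\tilde C_{\epsilon,\lambda,L}$. Logarithm convention. For the parameters in the theorem, $w=n$ and $\tilde C$ equals $e^{-i\pi w}$ times a positive real number; $\log\tilde C$ means $-i\pi w+\ln(e^{i\pi w}\tilde C)$. *)

theory Defs
  imports "HOL-Probability.Probability" "HOL-Computational_Algebra.Polynomial"
begin

subsection \<open>The sphere and its area measure\<close>

abbreviation S2 :: "(real^3) set" where
  "S2 \<equiv> sphere 0 1"

text \<open>The area of a Borel set \<open>A\<close> of the sphere is three times the volume of the cone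
  \<open>{t x | x \<in> A, 0 < t \<le> 1}\<close> over it (polar coordinates in three dimensions).\<close>

definition area :: "(real^3) measure" where
  "area = scale_measure 3
     (distr (restrict_space lborel (cball 0 1 - {0})) (restrict_space borel S2)
       (\<lambda>x. x /\<^sub>R norm x))"

lemma space_area [simp]: "space area = S2"
  by (simp add: area_def space_scale_measure space_restrict_space)

lemma sets_area [measurable_cong]: "sets area = sets (restrict_space borel S2)"
  by (simp add: area_def)

lemma measurable_radial_projection [measurable]:
  "(\<lambda>x::real^3. x /\<^sub>R norm x) \<in>
     restrict_space lborel (cball 0 1 - {0}) \<rightarrow>\<^sub>M restrict_space borel S2"
proof (rule measurable_restrict_space2)
  show "(\<lambda>x::real^3. x /\<^sub>R norm x) \<in> space (restrict_space lborel (cball 0 1 - {0})) \<rightarrow> S2"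
    by (auto simp: space_restrict_space)
  show "(\<lambda>x::real^3. x /\<^sub>R norm x) \<in> borel_measurable (restrict_space lborel (cball 0 1 - {0}))"
    by (intro measurable_restrict_space1) measurable
qed

lemma emeasure_area:
  assumes "A \<in> sets area"
  shows "emeasure area A =
    3 * emeasure lborel {x. x \<noteq> 0 \<and> norm x \<le> 1 \<and> x /\<^sub>R norm x \<in> A}"
proof -
  let ?f = "\<lambda>x::real^3. x /\<^sub>R norm x"
  have A: "A \<in> sets (restrict_space borel S2)"
    using assms by (simp add: sets_area)
  have eq: "?f -` A \<inter> space (restrict_space lborel (cball 0 1 - {0}))
      = {x. x \<noteq> 0 \<and> norm x \<le> 1 \<and> ?f x \<in> A}"
    by (auto simp: space_restrict_space)
  have "emeasure area A =
      3 * emeasure (restrict_space lborel (cball 0 1 - {0})) {x. x \<noteq> 0 \<and> norm x \<le> 1 \<and> ?f x \<in> A}"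
    unfolding area_def emeasure_scale_measure
    by (subst emeasure_distr[OF measurable_radial_projection A], subst eq, rule refl)
  also have "emeasure (restrict_space lborel (cball 0 1 - {0})) {x. x \<noteq> 0 \<and> norm x \<le> 1 \<and> ?f x \<in> A}
      = emeasure lborel {x. x \<noteq> 0 \<and> norm x \<le> 1 \<and> ?f x \<in> A}"
    by (rule emeasure_restrict_space) auto
  finally show ?thesis .
qed

lemma emeasure_area_S2: "emeasure area S2 = ennreal (4 * pi)"
proof -
  have "emeasure area S2 =
      3 * emeasure lborel {x::real^3. x \<noteq> 0 \<and> norm x \<le> 1 \<and> x /\<^sub>R norm x \<in> S2}"
    using sets.top[of area] by (intro emeasure_area) simp
  also have "{x::real^3. x \<noteq> 0 \<and> norm x \<le> 1 \<and> x /\<^sub>R norm x \<in> S2} = cball 0 1 - {0}"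
    by auto
  also have "emeasure lborel (cball (0::real^3) 1 - {0}) = emeasure lborel (cball (0::real^3) 1)"
    by (subst emeasure_Diff) (auto simp: emeasure_lborel_cbox)
  also have "\<dots> = ennreal (4 / 3 * pi)"
    by (subst emeasure_cball) (auto simp: unit_ball_vol_numeral fact_numeral)
  also have "(3::ennreal) * \<dots> = ennreal (4 * pi)"
    by (simp flip: ennreal_numeral ennreal_mult')
  finally show ?thesis .
qed

lemma finite_measure_area: "finite_measure area"
  by (rule finite_measureI) (simp add: emeasure_area_S2)

definition stereo :: "real^3 \<Rightarrow> complex" where
  "stereo x = Complex (x$1) (x$2) / of_real (1 - x$3)"

definition round_metric :: "complex \<Rightarrow> real" where
  "round_metric z = 4 / (1 + (cmod z)\<^sup>2)\<^sup>2"

text \<open>Only used for distinct points; the diagonal is a null set in all integrals below.\<close>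

definition Green :: "real^3 \<Rightarrow> real^3 \<Rightarrow> real" where
  "Green x y = - ln (norm (x - y)) - 1/2 + ln 2"

subsection \<open>Densities and functionals\<close>

definition densities :: "(real^3 \<Rightarrow> real) set" where
  "densities = {\<rho>. \<rho> \<in> borel_measurable area \<and> (\<forall>x\<in>S2. 0 \<le> \<rho> x) \<and>
                   (\<integral>\<^sup>+x. ennreal (\<rho> x) \<partial>area) = 1}"

text \<open>The integrand \<open>\<rho> ln \<rho>\<close> is bounded below, so its integral exists in \<open>(-\<infinity>, \<infinity>]\<close>.\<close>

definition entropy_fun :: "(real^3 \<Rightarrow> real) \<Rightarrow> ereal" where
  "entropy_fun \<rho> = enn2ereal (\<integral>\<^sup>+x. ennreal (\<rho> x * ln (\<rho> x)) \<partial>area)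
                  - enn2ereal (\<integral>\<^sup>+x. ennreal (- (\<rho> x * ln (\<rho> x))) \<partial>area)"

definition finite_entropy_densities :: "(real^3 \<Rightarrow> real) set" where
  "finite_entropy_densities = {\<rho> \<in> densities. entropy_fun \<rho> < \<infinity>}"

definition R_fun :: "(real^3 \<Rightarrow> real) \<Rightarrow> real" where
  "R_fun \<rho> = (LINT p|(area \<Otimes>\<^sub>M area). \<rho> (fst p) * \<rho> (snd p) * Green (fst p) (snd p))"

definition L_fun :: "nat \<Rightarrow> (nat \<Rightarrow> real) \<Rightarrow> (nat \<Rightarrow> real^3) \<Rightarrow> (real^3 \<Rightarrow> real) \<Rightarrow> real" where
  "L_fun k a x \<rho> = (\<Sum>j=1..k. 4 * a j * (LINT y|area. Green (x j) y * \<rho> y))"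

definition S_fun ::
    "nat \<Rightarrow> (nat \<Rightarrow> real) \<Rightarrow> (nat \<Rightarrow> real^3) \<Rightarrow> real \<Rightarrow> (real^3 \<Rightarrow> real) \<Rightarrow> real" where
  "S_fun k a x \<beta> \<rho> = L_fun k a x \<rho> + 2 * \<beta> * R_fun \<rho> + real_of_ereal (entropy_fun \<rho>)"

lemma mult_ln_ge: "- 1 \<le> r * ln r" if "0 \<le> r" for r :: real
proof (cases "r = 0")
  case False
  with that have r: "0 < r" by simp
  have "- ln r \<le> 1 / r - 1"
    using ln_le_minus_one[of "1 / r"] r by (simp add: ln_div)
  then have "r * (- ln r) \<le> r * (1 / r - 1)"
    using r by (intro mult_left_mono) auto
  then show ?thesis using r by (simp add: algebra_simps)
qed simp

lemma entropy_fun_eq_integral: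
  assumes "\<rho> \<in> finite_entropy_densities"
  shows "integrable area (\<lambda>x. \<rho> x * ln (\<rho> x))"
    and "entropy_fun \<rho> = ereal (LINT x|area. \<rho> x * ln (\<rho> x))"
proof -
  let ?f = "\<lambda>x. \<rho> x * ln (\<rho> x)"
  have m: "\<rho> \<in> borel_measurable area" and pos: "\<And>x. x \<in> S2 \<Longrightarrow> 0 \<le> \<rho> x"
    and fin: "entropy_fun \<rho> < \<infinity>"
    using assms by (auto simp: finite_entropy_densities_def densities_def)
  have "(\<integral>\<^sup>+x. ennreal (- ?f x) \<partial>area) \<le> (\<integral>\<^sup>+x. 1 \<partial>area)"
  proof (rule nn_integral_mono)
    fix x assume "x \<in> space area"
    then show "ennreal (- ?f x) \<le> 1"
      using mult_ln_ge[of "\<rho> x"] pos[of x] ennreal_leI[of "- ?f x" 1] by simp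
  qed
  also have "\<dots> < \<infinity>" by (simp add: emeasure_area_S2)
  finally have neg: "(\<integral>\<^sup>+x. ennreal (- ?f x) \<partial>area) < \<infinity>" .
  then obtain r where r: "0 \<le> r" "(\<integral>\<^sup>+x. ennreal (- ?f x) \<partial>area) = ennreal r"
    by (cases "\<integral>\<^sup>+x. ennreal (- ?f x) \<partial>area" rule: ennreal_cases) simp_all
  have "(\<integral>\<^sup>+x. ennreal (?f x) \<partial>area) \<noteq> \<infinity>"
  proof
    assume "(\<integral>\<^sup>+x. ennreal (?f x) \<partial>area) = \<infinity>"
    then have "entropy_fun \<rho> = \<infinity>"
      unfolding entropy_fun_def r using r(1) by (simp add: enn2ereal_ennreal)
    with fin show False by simp
  qed
  then obtain q where q: "0 \<le> q" "(\<integral>\<^sup>+x. ennreal (?f x) \<partial>area) = ennreal q"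
    by (cases "\<integral>\<^sup>+x. ennreal (?f x) \<partial>area" rule: ennreal_cases) simp_all
  have meas: "?f \<in> borel_measurable area"
    using m by measurable
  show int: "integrable area ?f"
    unfolding real_integrable_def using meas by (simp add: q r)
  show "entropy_fun \<rho> = ereal (LINT x|area. ?f x)"
    unfolding entropy_fun_def real_lebesgue_integral_def[OF int] q r
    using q(1) r(1) by (simp add: enn2ereal_ennreal)
qed

subsection \<open>Wrong sign Gaussian expectation\<close>

text \<open>Vectors indexed by a finite set \<open>I\<close> are extensional functions on \<open>I\<close>. Holomorphy in several
  variables means continuous and holomorphic in each variable separately.\<close>

definition holomorphic_several :: "'i set \<Rightarrow> ('i \<Rightarrow> complex) set \<Rightarrow> (('i \<Rightarrow> complex) \<Rightarrow> complex) \<Rightarrow> bool"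
  where
  "holomorphic_several I U f \<longleftrightarrow>
     continuous_map (subtopology (product_topology (\<lambda>_. euclidean) I) U) euclidean f \<and>
     (\<forall>z\<in>U. \<forall>i\<in>I. (\<lambda>\<zeta>. f (z(i := \<zeta>))) field_differentiable (at (z i)))"

definition holomorphic_extension ::
    "'i set \<Rightarrow> (('i \<Rightarrow> real) \<Rightarrow> complex) \<Rightarrow> (('i \<Rightarrow> complex) \<Rightarrow> complex) \<Rightarrow> bool" where
  "holomorphic_extension I h h' \<longleftrightarrow>
     (\<exists>U. openin (product_topology (\<lambda>_. euclidean) I) U \<and>
          (\<Pi>\<^sub>E i\<in>I. \<real> \<union> (*) \<i> ` \<real>) \<subseteq> U \<and> holomorphic_several I U h') \<and>
     (\<forall>x \<in> (\<Pi>\<^sub>E i\<in>I. UNIV). h' (\<lambda>i\<in>I. complex_of_real (x i)) = h x)"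

definition std_gaussian :: "'i set \<Rightarrow> ('i \<Rightarrow> real) measure" where
  "std_gaussian I = (\<Pi>\<^sub>M i\<in>I. density lborel std_normal_density)"

text \<open>By the identity theorem, all admissible extensions agree on purely imaginary vectors, so the
  described value is unique.\<close>

definition wrong_sign_expectation :: "'i set \<Rightarrow> (('i \<Rightarrow> real) \<Rightarrow> complex) \<Rightarrow> complex" where
  "wrong_sign_expectation I h =
     (THE v. \<exists>h'. holomorphic_extension I h h' \<and>
        integrable (std_gaussian I) (\<lambda>W. h' (\<lambda>i\<in>I. \<i> * complex_of_real (W i))) \<and>
        v = (LINT W|std_gaussian I. h' (\<lambda>i\<in>I. \<i> * complex_of_real (W i))))"

subsection \<open>Real spherical harmonics\<close>

text \<open>Rodrigues' formula.\<close>

definition legendre_poly :: "nat \<Rightarrow> real poly" where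
  "legendre_poly l = smult (1 / (2 ^ l * fact l)) ((pderiv ^^ l) ([:- 1, 0, 1:] ^ l))"

text \<open>In spherical coordinates, with \<open>M = \<bar>m\<bar>\<close>, this is the usual
  \<open>c P\<^sub>l\<^sup>M(cos \<theta>) cos (M \<phi>)\<close> for \<open>m \<ge> 0\<close> and
  \<open>c P\<^sub>l\<^sup>M(cos \<theta>) sin (M \<phi>)\<close> for \<open>m < 0\<close>,
  without the Condon-Shortley sign: the associated Legendre function is
  \<open>(sin \<theta>)\<^sup>M\<close> times the \<open>M\<close>-th derivative of the Legendre polynomial at
  \<open>cos \<theta>\<close>, and \<open>(sin \<theta>)\<^sup>M exp (i M \<phi>) = (x + i y)\<^sup>M\<close>.\<close>

definition Ylm :: "nat \<Rightarrow> int \<Rightarrow> real^3 \<Rightarrow> real" where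
  "Ylm l m x = (let M = nat \<bar>m\<bar>; u = Complex (x$1) (x$2) ^ M in
     sqrt ((if m = 0 then 1 else 2) * (2 * real l + 1) / (4 * pi) * fact (l - M) / fact (l + M))
     * poly ((pderiv ^^ M) (legendre_poly l)) (x$3)
     * (if m \<ge> 0 then Re u else Im u))"

subsection \<open>The correlation function\<close>

definition modes :: "nat \<Rightarrow> (nat \<times> int) set" where
  "modes L = {(l, m). l \<le> L \<and> \<bar>m\<bar> \<le> int l}"

definition G_reg :: "real \<Rightarrow> nat \<Rightarrow> real^3 \<Rightarrow> real^3 \<Rightarrow> real" where
  "G_reg lam L x y = (\<Sum>l=1..L. \<Sum>m=-int l..int l.
     lam ^ l * (2 * pi / (real l * (real l + 1))) * Ylm l m x * Ylm l m y)"

definition X_reg :: "real \<Rightarrow> nat \<Rightarrow> (nat \<times> int \<Rightarrow> real) \<Rightarrow> real^3 \<Rightarrow> real" where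
  "X_reg lam L X x = (\<Sum>l=1..L. \<Sum>m=-int l..int l.
     lam powr (real l / 2) * sqrt (2 * pi / (real l * (real l + 1))) * X (l, m) * Ylm l m x)"

definition D_var :: "real \<Rightarrow> (nat \<times> int \<Rightarrow> real) \<Rightarrow> real" where
  "D_var eps X = X (0, 0) / sqrt (8 * pi * eps)"

definition chi_const :: real where
  "chi_const = ln 4 - 1"

definition Q_const :: "real \<Rightarrow> real" where
  "Q_const b = b - 1 / b"

definition conf_weight :: "real \<Rightarrow> complex \<Rightarrow> complex" where
  "conf_weight b \<alpha> = \<alpha> * (of_real (Q_const b) - \<alpha>)"

definition w_param :: "nat \<Rightarrow> (nat \<Rightarrow> complex) \<Rightarrow> real \<Rightarrow> complex" where
  "w_param k \<alpha> b = (of_real (Q_const b) - (\<Sum>j=1..k. \<alpha> j)) / of_real b"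

definition V_tilde ::
    "real \<Rightarrow> real \<Rightarrow> nat \<Rightarrow> (nat \<times> int \<Rightarrow> real) \<Rightarrow> complex \<Rightarrow> real^3 \<Rightarrow> complex" where
  "V_tilde b lam L X \<alpha> x =
     exp (of_real chi_const * \<alpha> * (of_real b - \<alpha>))
     * of_real (round_metric (stereo x)) powr (- conf_weight b \<alpha>)
     * exp (2 * \<alpha> * of_real (X_reg lam L X x) + 2 * \<alpha>\<^sup>2 * of_real (G_reg lam L x x))"

definition C_reg ::
    "nat \<Rightarrow> (nat \<Rightarrow> complex) \<Rightarrow> (nat \<Rightarrow> real^3) \<Rightarrow> real \<Rightarrow> real \<Rightarrow> real \<Rightarrow> real \<Rightarrow> nat \<Rightarrow> complex" where
  "C_reg k \<alpha> x b \<mu> eps lam L = wrong_sign_expectation (modes L)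
     (\<lambda>X. (\<Prod>j=1..k. V_tilde b lam L X (\<alpha> j) (x j))
        * exp (- 2 * of_real b * w_param k \<alpha> b * of_real (D_var eps X)
               - of_real (\<mu> * exp (2 * b * D_var eps X)
                   * (LINT y|area. exp (2 * b * X_reg lam L X y + 2 * b\<^sup>2 * G_reg lam L y y)))))"

definition C_tilde ::
    "nat \<Rightarrow> (nat \<Rightarrow> complex) \<Rightarrow> (nat \<Rightarrow> real^3) \<Rightarrow> real \<Rightarrow> real \<Rightarrow> complex" where
  "C_tilde k \<alpha> x b \<mu> =
     Lim (at_left 1) (\<lambda>lam. lim (\<lambda>L. Lim (at_right 0) (\<lambda>eps. C_reg k \<alpha> x b \<mu> eps lam L)))"

text \<open>The branch of the logarithm for numbers of the form \<open>exp (-i \<pi> w) r\<close> with \<open>r > 0\<close>; the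
  inner \<open>ln\<close> is then applied to \<open>r\<close>.\<close>

definition log_branch :: "complex \<Rightarrow> complex \<Rightarrow> complex" where
  "log_branch w c = - \<i> * of_real pi * w + ln (exp (\<i> * of_real pi * w) * c)"

definition log_C_tilde ::
    "nat \<Rightarrow> (nat \<Rightarrow> complex) \<Rightarrow> (nat \<Rightarrow> real^3) \<Rightarrow> real \<Rightarrow> real \<Rightarrow> complex" where
  "log_C_tilde k \<alpha> x b \<mu> = log_branch (w_param k \<alpha> b) (C_tilde k \<alpha> x b \<mu>)"

end

theory Submission
  imports Defs "HOL-Complex_Analysis.Conformal_Mappings"
begin

text \<open>Before its limits are taken, the correlation function is a wrong sign Gaussian expectation of
exponentials of a finite sum of modes. The Gaussians sit on the imaginary axis, where the
integral multiplying \<open>\<mu>\<close> is bounded, so its exponential may be expanded in powers of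
\<open>\<mu>\<close> and integrated term by term (\<open>wrong_sign_expectation_series\<close>).
Completing squares with the characteristic function turns the term of order \<open>m\<close> into an
integral over \<open>m\<close> points of the sphere that repel each other, and are attracted or repelled
by the points \<open>x j\<close>, through the regularised kernel. The zero mode contributes the factor
\<open>exp (- b\<^sup>2 (m - n)\<^sup>2 / (4 \<pi> \<epsilon>))\<close> with \<open>n = w\<close>, hence
for \<open>\<epsilon> \<rightarrow> 0\<close> only the neutral term \<open>m = n\<close> is left
(\<open>C_reg_eps_limit\<close>). Dominated convergence removes the remaining cutoffs, and
\<open>C_tilde\<close> becomes \<open>(-1)^n\<close> times explicit positive factors times
\[
 Z_n = \int \exp\Bigl(- \sum_r V(y_r) - \frac{2\beta}{n-1} \sum_{r \ne s} G(y_r, y_s)\Bigr) dy,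
 \qquad V = \sum_j 4 \tilde\alpha_j G(x_j, \cdot),
\]
the partition function of \<open>n\<close> charges in the mean field scaling. Stirling's formula and the
explicit factors give the elementary terms of the limit; what remains is
\<open>ln (Z n) / n \<rightarrow> - inf S\<close>.

The functional \<open>S\<close> is handled through the identity \<open>S_eq_rel_ent\<close>: for every
\<open>\<sigma>\<close>, up to a constant \<open>S \<rho>\<close> is the relative entropy of
\<open>\<rho>\<close> with respect to the Gibbs density in the field of \<open>\<sigma>\<close> plus the
energy of \<open>\<rho> - \<sigma>\<close>. Both are nonnegative, so a solution \<open>\<sigma>\<close>
of the mean field equation is the unique minimiser. Existence comes from uniform convexity:
a minimising sequence is Cauchy in \<open>L\<^sup>1\<close> (\<open>midpoint_L1\<close>), and Fatou's
lemma applies to its limit. Jensen's inequality for the product of \<open>n\<close> copies of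
\<open>\<sigma>\<close> bounds \<open>Z n\<close> from below (\<open>Z_lower_bound\<close>). For the upper
bound, positive definiteness replaces the pair energy by its linearisation around
\<open>n \<sigma>\<close>, after which the integrand is a product (\<open>Z_upper_bound\<close>). The
diagonal terms force the use of a bounded kernel there, the Abel regularisation \<open>G_abel\<close>,
which is positive definite and lies below the logarithmic kernel up to an error that vanishes with
the regularisation.

Everything needed about the kernel follows from the addition theorem for spherical harmonics. It
turns the regularised kernel into a Legendre series; integrating the generating function of the
Legendre polynomials gives its closed form, hence the limit, and the almost monotonicity in the
regularisation parameter that yields all bounds.\<close>

section \<open>Area and the logarithmic kernel\<close>

lemma borel_measurable_area: "f \<in> borel_measurable borel \<Longrightarrow> f \<in> borel_measurable area"
  for f :: "real^3 \<Rightarrow> 'a::topological_space"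
  unfolding measurable_cong_sets[OF sets_area refl] by (rule measurable_restrict_space1)

lemma measurable_area_ident [measurable]: "(\<lambda>x. x) \<in> area \<rightarrow>\<^sub>M borel"
  by (rule borel_measurable_area) simp

interpretation area: finite_measure area by (rule finite_measure_area)

lemma measurable_Green [measurable]:
  assumes [measurable]: "f \<in> borel_measurable M" "g \<in> borel_measurable M"
  shows "(\<lambda>x. Green (f x) (g x)) \<in> borel_measurable M"
  unfolding Green_def by measurable

lemma Green_commute: "Green x y = Green y x"
  by (simp add: Green_def norm_minus_commute)

lemma dist_sphere_le_2: "x \<in> S2 \<Longrightarrow> y \<in> S2 \<Longrightarrow> norm (x - y) \<le> 2" for x y :: "real^3"
  using norm_triangle_ineq4[of x y] by simp

lemma Green_ge: "x \<in> S2 \<Longrightarrow> y \<in> S2 \<Longrightarrow> - 1 / 2 \<le> Green x y"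
proof (cases "x = y")
  case False
  assume "x \<in> S2" "y \<in> S2"
  then have "ln (norm (x - y)) \<le> ln 2" using dist_sphere_le_2[of x y] False by (subst ln_le_cancel_iff) auto
  then show ?thesis by (simp add: Green_def)
qed (simp add: Green_def)

lemma sets_area_cap: "{y \<in> S2. norm (x - y) < r} \<in> sets area"
proof -
  have "(\<lambda>y. norm (x - y)) \<in> borel_measurable area" by measurable
  then have "{y \<in> space area. norm (x - y) < r} \<in> sets area" by measurable
  then show ?thesis by simp
qed

text \<open>The cone over a cap of radius \<open>r\<close> lies within \<open>2 r\<close> of the points
\<open>j r x\<close> on its axis, so about \<open>1 / r\<close> balls of radius \<open>2 r\<close> cover it.\<close>

lemma emeasure_cap_le:
  assumes x: "x \<in> S2" and r: "0 < r" "r \<le> 1"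
  shows "emeasure area {y \<in> S2. norm (x - y) < r} \<le> ennreal (64 * pi * r\<^sup>2)"
proof -
  define N where "N = nat \<lfloor>1 / r\<rfloor>"
  have N: "real N \<le> 1 / r" using r by (simp add: N_def)
  let ?B = "\<lambda>j. cball ((real j * r) *\<^sub>R x) (2 * r)"
  have sub: "{z. z \<noteq> 0 \<and> norm z \<le> 1 \<and> z /\<^sub>R norm z \<in> {y \<in> S2. norm (x - y) < r}} \<subseteq> (\<Union>j\<in>{..N}. ?B j)"
  proof
    fix z :: "real^3" assume "z \<in> {z. z \<noteq> 0 \<and> norm z \<le> 1 \<and> z /\<^sub>R norm z \<in> {y \<in> S2. norm (x - y) < r}}"
    then have z: "z \<noteq> 0" "norm z \<le> 1" "norm (x - z /\<^sub>R norm z) < r" by auto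
    define j where "j = nat \<lfloor>norm z / r\<rfloor>"
    have j: "real j \<le> norm z / r" "norm z / r < real j + 1"
      using r z by (auto simp: j_def)
    have "norm z / r \<le> 1 / r" using z r by (intro divide_right_mono) auto
    then have "j \<le> N" unfolding j_def N_def by (intro nat_mono floor_mono)
    moreover have "z \<in> ?B j"
    proof -
      have "(real j * r) *\<^sub>R x - z = norm z *\<^sub>R (x - z /\<^sub>R norm z) - (norm z - real j * r) *\<^sub>R x"
        using z by (simp add: algebra_simps)
      then have "norm ((real j * r) *\<^sub>R x - z) \<le> norm z * norm (x - z /\<^sub>R norm z) + \<bar>norm z - real j * r\<bar> * norm x"
        by (metis norm_triangle_ineq4 norm_scaleR abs_norm_cancel)
      also have "norm z * norm (x - z /\<^sub>R norm z) \<le> 1 * r" using z r by (intro mult_mono) auto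
      also have "\<bar>norm z - real j * r\<bar> * norm x \<le> r" using j r x by (auto simp: field_simps)
      finally show ?thesis by (simp add: dist_norm)
    qed
    ultimately show "z \<in> (\<Union>j\<in>{..N}. ?B j)" by blast
  qed
  have ball: "emeasure lborel (?B j) = ennreal (32 / 3 * pi * r ^ 3)" for j
    using r by (subst emeasure_cball) (auto simp: unit_ball_vol_numeral fact_numeral power_mult_distrib)
  have "emeasure area {y \<in> S2. norm (x - y) < r} =
      3 * emeasure lborel {z. z \<noteq> 0 \<and> norm z \<le> 1 \<and> z /\<^sub>R norm z \<in> {y \<in> S2. norm (x - y) < r}}"
    by (rule emeasure_area[OF sets_area_cap])
  also have "\<dots> \<le> 3 * emeasure lborel (\<Union>j\<in>{..N}. ?B j)"
    by (intro mult_left_mono emeasure_mono sub) auto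
  also have "\<dots> \<le> 3 * (\<Sum>j\<in>{..N}. emeasure lborel (?B j))"
    by (intro mult_left_mono emeasure_subadditive_finite) auto
  also have "\<dots> = ennreal (32 * pi * r ^ 3 * (real N + 1))"
    unfolding ball using r by (simp add: ennreal_of_nat_eq_real_of_nat flip: ennreal_numeral ennreal_mult' ennreal_plus ennreal_1)
  also have "\<dots> \<le> ennreal (64 * pi * r\<^sup>2)"
  proof (rule ennreal_leI)
    have "real N + 1 \<le> 2 / r" using N r by (simp add: field_simps)
    then have "32 * pi * r ^ 3 * (real N + 1) \<le> 32 * pi * r ^ 3 * (2 / r)" using r by (intro mult_left_mono) auto
    also have "\<dots> = 64 * pi * r\<^sup>2" using r by (simp add: power3_eq_cube power2_eq_square)
    finally show "32 * pi * r ^ 3 * (real N + 1) \<le> 64 * pi * r\<^sup>2" .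
  qed
  finally show ?thesis .
qed

lemma AE_area_neq:
  assumes x: "x \<in> S2" shows "AE y in area. y \<noteq> x"
proof -
  have sx: "{x} = {y \<in> S2. norm (x - y) < 0 \<or> norm (x - y) = 0}" using x by auto
  have s: "{x} \<in> sets area"
  proof -
    have "(\<lambda>y. norm (x - y)) \<in> borel_measurable area" by measurable
    then have "{y \<in> space area. norm (x - y) = 0} \<in> sets area" by measurable
    also have "{y \<in> space area. norm (x - y) = 0} = {x}" using x by auto
    finally show ?thesis .
  qed
  have "emeasure area {x} \<le> ennreal (64 * pi * r\<^sup>2)" if "0 < r" "r \<le> 1" for r
    using x that by (intro order_trans[OF emeasure_mono[OF _ sets_area_cap] emeasure_cap_le[OF x that]]) auto
  then have "\<forall>\<^sub>F r in at_right 0. emeasure area {x} \<le> ennreal (64 * pi * r\<^sup>2)"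
    using eventually_at_right_real[of 0 "1::real"] by (auto elim!: eventually_mono)
  moreover have "((\<lambda>r. ennreal (64 * pi * r\<^sup>2)) \<longlongrightarrow> ennreal (64 * pi * 0\<^sup>2)) (at_right 0)"
    by (intro tendsto_intros)
  ultimately have "emeasure area {x} \<le> ennreal (64 * pi * 0\<^sup>2)"
    by (intro tendsto_lowerbound) auto
  then have "emeasure area {x} = 0" by simp
  then have "{x} \<in> null_sets area" using s by auto
  then show ?thesis by (rule AE_I') auto
qed

lemma ennreal_le_suminf: "f k \<le> (\<Sum>k. f k)" for f :: "nat \<Rightarrow> ennreal"
  using sum_le_suminf[of f "{k}"] by simp

text \<open>Dyadic decomposition around \<open>x\<close>: at distance about \<open>2^(-k)\<close> the integrand is at
most \<open>2 powr (p (k + 1))\<close>, while the cap of that radius has area of order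
\<open>4^(-k)\<close>. For \<open>p < 2\<close> the resulting geometric series converges.\<close>

lemma nn_integral_dist_power_bounded:
  assumes p: "0 \<le> p" "p < 2"
  obtains C where "0 \<le> C" "\<And>x. x \<in> S2 \<Longrightarrow> (\<integral>\<^sup>+y. ennreal (norm (x - y) powr - p) \<partial>area) \<le> ennreal C"
proof -
  define q where "q = 2 powr p / 4"
  have q: "0 \<le> q" "q < 1"
    using p powr_less_mono[of p 2 "2::real"] by (auto simp: q_def)
  define C where "C = 4 * pi + 2 powr p * 64 * pi * (1 / (1 - q))"
  show ?thesis
  proof
    show "0 \<le> C" using q by (simp add: C_def)
    fix x :: "real^3" assume x: "x \<in> S2"
    let ?cap = "\<lambda>k::nat. {y \<in> S2. norm (x - y) < (1/2) ^ k}"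
    let ?a = "\<lambda>k::nat. 2 powr (p * (real k + 1))"
    have "(\<integral>\<^sup>+y. ennreal (norm (x - y) powr - p) \<partial>area)
      \<le> (\<integral>\<^sup>+y. 1 + (\<Sum>k. ennreal (?a k) * indicator (?cap k) y) \<partial>area)"
    proof (rule nn_integral_mono)
      fix y assume "y \<in> space area"
      then have y: "y \<in> S2" by simp
      let ?d = "norm (x - y)"
      show "ennreal (?d powr - p) \<le> 1 + (\<Sum>k. ennreal (?a k) * indicator (?cap k) y)"
      proof (cases "?d = 0 \<or> 1 \<le> ?d")
        case True
        then have "?d powr - p \<le> 1" using p by (auto simp: powr_minus intro!: inverse_le_1_iff[THEN iffD2] ge_one_powr_ge_zero)
        then have "ennreal (?d powr - p) \<le> 1" using ennreal_leI[of _ 1] by simp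
        also have "\<dots> \<le> 1 + (\<Sum>k. ennreal (?a k) * indicator (?cap k) y)" by simp
        finally show ?thesis .
      next
        case False
        then have d: "0 < ?d" "?d < 1" by auto
        define k where "k = nat \<lfloor>log (1/2) ?d\<rfloor>"
        have "0 \<le> log (1/2) ?d" using d by (simp add: log_def divide_nonpos_neg)
        then have k: "real k \<le> log (1/2) ?d" "log (1/2) ?d < real k + 1" by (auto simp: k_def)
        have dd: "?d = (1/2) powr (log (1/2) ?d)" using d by simp
        have "?d \<le> (1/2) ^ k"
          using powr_mono'[OF k(1), of "1/2"] dd by (simp add: powr_realpow)
        moreover have "(1/2) powr (real k + 1) \<le> ?d"
          using powr_mono'[of "log (1/2) ?d" "real k + 1" "1/2"] k(2) dd by simp
        then have le: "?d powr - p \<le> ((1/2) powr (real k + 1)) powr - p"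
          using p by (intro powr_mono2') auto
        have e: "((1/2) powr (real k + 1)) powr - p = ?a k"
        proof -
          have "(1/2::real) powr (real k + 1) = 2 powr - (real k + 1)"
            unfolding powr_minus_divide by (simp add: powr_divide)
          then show ?thesis by (simp add: powr_powr algebra_simps)
        qed
        show ?thesis
        proof (cases "?d < (1/2) ^ k")
          case True
          have "ennreal (?d powr - p) \<le> ennreal (?a k) * indicator (?cap k) y"
            using le e True y by (simp add: ennreal_leI)
          also have "\<dots> \<le> (\<Sum>k. ennreal (?a k) * indicator (?cap k) y)"
            by (rule ennreal_le_suminf)
          finally show ?thesis by (simp add: add_increasing)
        next
          case False
          (* the open cap misses a point at distance exactly 2^(-k); the next larger cap contains it *)
          with calculation have dk: "?d = (1/2) ^ k" by simp
          with d have "k \<noteq> 0" by (cases k) auto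
          then obtain j where j: "k = Suc j" by (cases k) auto
          have "?d < (1/2) ^ j" unfolding dk j by simp
          moreover have "?d powr - p \<le> ?a j"
          proof -
            have "2 powr - real (Suc j) = inverse (2 ^ Suc j :: real)"
              by (simp only: powr_minus powr_realpow zero_less_numeral)
            also have "\<dots> = ?d" unfolding dk j by (metis power_inverse inverse_eq_divide)
            finally have "?d = 2 powr - real (Suc j)" by simp
            then show ?thesis by (simp add: powr_powr algebra_simps)
          qed
          ultimately have "ennreal (?d powr - p) \<le> ennreal (?a j) * indicator (?cap j) y"
            using y by (simp add: ennreal_leI)
          also have "\<dots> \<le> (\<Sum>k. ennreal (?a k) * indicator (?cap k) y)"
            by (rule ennreal_le_suminf)
          finally show ?thesis by (simp add: add_increasing)
        qed
      qed
    qed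
    also have "\<dots> = (\<integral>\<^sup>+y. 1 \<partial>area) + (\<Sum>k. ennreal (?a k) * emeasure area (?cap k))"
    proof -
      have cap: "?cap k \<in> sets area" for k by (rule sets_area_cap)
      have m: "(\<lambda>y. ennreal (?a k) * indicator (?cap k) y) \<in> borel_measurable area" for k
        by (intro borel_measurable_times_ennreal borel_measurable_const borel_measurable_indicator cap)
      have "(\<integral>\<^sup>+y. 1 + (\<Sum>k. ennreal (?a k) * indicator (?cap k) y) \<partial>area)
        = (\<integral>\<^sup>+y. 1 \<partial>area) + (\<integral>\<^sup>+y. (\<Sum>k. ennreal (?a k) * indicator (?cap k) y) \<partial>area)"
        by (rule nn_integral_add) (intro borel_measurable_const borel_measurable_suminf_order m)+
      also have "(\<integral>\<^sup>+y. (\<Sum>k. ennreal (?a k) * indicator (?cap k) y) \<partial>area)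
        = (\<Sum>k. \<integral>\<^sup>+y. ennreal (?a k) * indicator (?cap k) y \<partial>area)"
        by (rule nn_integral_suminf[OF m])
      finally show ?thesis by (simp only: nn_integral_cmult_indicator[OF cap])
    qed
    also have "\<dots> \<le> ennreal (4 * pi) + (\<Sum>k. ennreal (2 powr p * 64 * pi * q ^ k))"
    proof (intro add_mono suminf_le)
      show "(\<integral>\<^sup>+y. 1 \<partial>area) \<le> ennreal (4 * pi)" by (simp add: emeasure_area_S2)
      fix k
      have "ennreal (?a k) * emeasure area (?cap k) \<le> ennreal (?a k) * ennreal (64 * pi * ((1/2) ^ k)\<^sup>2)"
        by (intro mult_left_mono emeasure_cap_le[OF x]) (auto simp: power_le_one)
      also have "\<dots> = ennreal (2 powr p * 64 * pi * q ^ k)"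
      proof -
        have "?a k = 2 powr p * (2 powr p) ^ k"
        proof -
          have "(2 powr p) ^ k = 2 powr (p * real k)"
            using powr_realpow[of "2 powr p" k] by (simp add: powr_powr)
          then show ?thesis by (simp add: distrib_left powr_add)
        qed
        moreover have "((1/2::real) ^ k)\<^sup>2 = (1/4) ^ k" by (simp add: power2_eq_square flip: power_mult_distrib)
        ultimately have ee: "?a k * (64 * pi * ((1/2) ^ k)\<^sup>2) = 2 powr p * 64 * pi * q ^ k"
          by (simp add: q_def power_divide)
        show ?thesis unfolding ee[symmetric] by (rule ennreal_mult[symmetric]) auto
      qed
      finally show "ennreal (?a k) * emeasure area (?cap k) \<le> ennreal (2 powr p * 64 * pi * q ^ k)" .
    qed auto
    also have "(\<Sum>k. ennreal (2 powr p * 64 * pi * q ^ k)) = ennreal (2 powr p * 64 * pi * (1 / (1 - q)))"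
    proof -
      have "(\<lambda>k. 2 powr p * 64 * pi * q ^ k) sums (2 powr p * 64 * pi * (1 / (1 - q)))"
        using q by (intro sums_mult geometric_sums) auto
      then show ?thesis using q by (intro suminf_ennreal_eq) auto
    qed
    also have "ennreal (4 * pi) + ennreal (2 powr p * 64 * pi * (1 / (1 - q))) = ennreal C"
      unfolding C_def using q by (subst ennreal_plus[symmetric]) auto
    finally show "(\<integral>\<^sup>+y. ennreal (norm (x - y) powr - p) \<partial>area) \<le> ennreal C" .
  qed
qed

lemma exp_Green_le:
  assumes "0 \<le> p" shows "exp (p * Green x y) \<le> 2 powr p * (1 + norm (x - y) powr - p)"
proof (cases "x = y")
  case True
  have "p * (ln 2 - 1/2) \<le> p * ln 2" using assms by (intro mult_left_mono) auto
  then show ?thesis using True by (simp add: Green_def powr_def)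
next
  case False
  have "p * (- ln (norm (x - y)) - 1/2 + ln 2) \<le> p * ln 2 + - p * ln (norm (x - y))"
    using assms by (simp add: algebra_simps)
  then have "exp (p * Green x y) \<le> exp (p * ln 2 + - p * ln (norm (x - y)))" by (simp add: Green_def)
  also have "\<dots> = 2 powr p * norm (x - y) powr - p" using False by (simp add: powr_def exp_add[symmetric])
  finally show ?thesis by (simp add: distrib_left add_increasing)
qed

lemma nn_integral_exp_Green_bounded:
  assumes p: "0 \<le> p" "p < 2"
  obtains C where "0 \<le> C" "\<And>x. x \<in> S2 \<Longrightarrow> (\<integral>\<^sup>+y. ennreal (exp (p * Green x y)) \<partial>area) \<le> ennreal C"
proof -
  obtain C where C: "0 \<le> C" "\<And>x. x \<in> S2 \<Longrightarrow> (\<integral>\<^sup>+y. ennreal (norm (x - y) powr - p) \<partial>area) \<le> ennreal C"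
    using nn_integral_dist_power_bounded[OF p] by blast
  show ?thesis
  proof
    show "0 \<le> 2 powr p * (4 * pi + C)" using C by simp
    fix x :: "real^3" assume x: "x \<in> S2"
    have "(\<integral>\<^sup>+y. ennreal (exp (p * Green x y)) \<partial>area)
      \<le> (\<integral>\<^sup>+y. ennreal (2 powr p) * (1 + ennreal (norm (x - y) powr - p)) \<partial>area)"
      using exp_Green_le[OF p(1)]
      by (intro nn_integral_mono) (simp add: ennreal_leI flip: ennreal_mult ennreal_plus ennreal_1)
    also have "\<dots> = ennreal (2 powr p) * (ennreal (4 * pi) + (\<integral>\<^sup>+y. ennreal (norm (x - y) powr - p) \<partial>area))"
      by (subst nn_integral_cmult, measurable, subst nn_integral_add) (auto simp: emeasure_area_S2)
    also have "\<dots> \<le> ennreal (2 powr p) * (ennreal (4 * pi) + ennreal C)"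
      by (intro mult_left_mono add_left_mono C x) auto
    also have "\<dots> = ennreal (2 powr p * (4 * pi + C))"
      using C by (subst ennreal_plus[symmetric], simp, simp, subst ennreal_mult) auto
    finally show "(\<integral>\<^sup>+y. ennreal (exp (p * Green x y)) \<partial>area) \<le> ennreal (2 powr p * (4 * pi + C))" .
  qed
qed

section \<open>Legendre polynomials\<close>

abbreviation legD :: "nat \<Rightarrow> nat \<Rightarrow> real \<Rightarrow> real" where
  "legD l M z \<equiv> poly ((pderiv ^^ M) (legendre_poly l)) z"

abbreviation legP :: "nat \<Rightarrow> real \<Rightarrow> real" where
  "legP l z \<equiv> poly (legendre_poly l) z"

text \<open>The polynomial \<open>(z\<^sup>2 - 1)^l\<close> of Rodrigues' formula, kept folded so that iterated
derivatives are not computed symbolically.\<close>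

definition base_pow :: "nat \<Rightarrow> real poly" where
  "base_pow l = [:- 1, 0, 1:] ^ l"

lemma legendre_poly_base: "legendre_poly l = smult (1 / (2 ^ l * fact l)) ((pderiv ^^ l) (base_pow l))"
  by (simp add: legendre_poly_def base_pow_def)

lemma pderiv_base_pow: "pderiv (base_pow (Suc l)) = smult (2 * (real l + 1)) ([:0, 1:] * base_pow l)"
  unfolding base_pow_def pderiv_power_Suc by (simp add: pderiv_pCons algebra_simps)

lemma base_pow_first_order: "[:- 1, 0, 1:] * pderiv (base_pow l) = smult (2 * real l) ([:0, 1:] * base_pow l)"
proof (cases l)
  case (Suc m)
  show ?thesis unfolding Suc pderiv_base_pow
    by (simp add: base_pow_def algebra_simps)
qed (simp add: base_pow_def)

lemma poly_ext_zero: "(\<And>z. poly p z = 0) \<Longrightarrow> p = 0" for p :: "real poly"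
  using poly_all_0_iff_0 by blast

lemma poly_ext: "(\<And>z. poly p z = poly q z) \<Longrightarrow> p = q" for p q :: "real poly"
  by (simp add: poly_eq_poly_eq_iff[symmetric] fun_eq_iff)

text \<open>Differentiating \<open>(z\<^sup>2 - 1) p' = 2 l z p\<close> repeatedly; for \<open>k \<ge> l\<close> this is
the associated Legendre equation \<open>legD_ode\<close>.\<close>

lemma base_pow_ode:
  "[:- 1, 0, 1:] * (pderiv ^^ (k + 2)) (base_pow l)
    + smult (2 * (real k + 1 - real l)) ([:0, 1:] * (pderiv ^^ (k + 1)) (base_pow l))
    + smult ((real k + 1) * (real k - 2 * real l)) ((pderiv ^^ k) (base_pow l)) = 0"
proof (induction k)
  case 0
  have "pderiv ([:- 1, 0, 1:] * pderiv (base_pow l) - smult (2 * real l) ([:0, 1:] * base_pow l)) = 0"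
    by (subst base_pow_first_order) simp
  then have "poly (pderiv ([:- 1, 0, 1:] * pderiv (base_pow l) - smult (2 * real l) ([:0, 1:] * base_pow l))) z = 0" for z
    by simp
  then show ?case
    by (intro poly_ext_zero) (simp add: pderiv_diff pderiv_mult pderiv_smult pderiv_pCons numeral_2_eq_2 algebra_simps del: mult_pCons_left mult_pCons_right)
next
  case (Suc k)
  let ?D = "\<lambda>k. (pderiv ^^ k) (base_pow l)"
  have "pderiv ([:- 1, 0, 1:] * ?D (k + 2)
    + smult (2 * (real k + 1 - real l)) ([:0, 1:] * ?D (k + 1))
    + smult ((real k + 1) * (real k - 2 * real l)) (?D k)) = 0"
    by (subst Suc.IH) simp
  then have "poly (pderiv ([:- 1, 0, 1:] * ?D (k + 2)
    + smult (2 * (real k + 1 - real l)) ([:0, 1:] * ?D (k + 1))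
    + smult ((real k + 1) * (real k - 2 * real l)) (?D k))) z = 0" for z
    by simp
  then show ?case
    by (intro poly_ext_zero) (simp add: pderiv_add pderiv_mult pderiv_smult pderiv_pCons numeral_2_eq_2 algebra_simps del: mult_pCons_left mult_pCons_right)
qed

lemma legD_base: "legD l M z = poly ((pderiv ^^ (l + M)) (base_pow l)) z / (2 ^ l * fact l)"
  unfolding legendre_poly_base higher_pderiv_smult
  by (simp add: add.commute[of l M] funpow_add)

lemma legD_ode:
  "(1 - z\<^sup>2) * legD l (M + 2) z - 2 * (real M + 1) * z * legD l (M + 1) z
    + (real l + real M + 1) * (real l - real M) * legD l M z = 0"
proof -
  have "poly ([:- 1, 0, 1:] * (pderiv ^^ (l + M + 2)) (base_pow l)
    + smult (2 * (real (l + M) + 1 - real l)) ([:0, 1:] * (pderiv ^^ (l + M + 1)) (base_pow l))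
    + smult ((real (l + M) + 1) * (real (l + M) - 2 * real l)) ((pderiv ^^ (l + M)) (base_pow l))) z = 0"
    by (subst base_pow_ode) simp
  then have "((z\<^sup>2 - 1) * poly ((pderiv ^^ (l + M + 2)) (base_pow l)) z
    + 2 * (real M + 1) * (z * poly ((pderiv ^^ (l + M + 1)) (base_pow l)) z)
    + (real l + real M + 1) * (real M - real l) * poly ((pderiv ^^ (l + M)) (base_pow l)) z) / (2 ^ l * fact l) = 0"
    by (simp add: power2_eq_square algebra_simps del: mult_pCons_left mult_pCons_right funpow.simps)
  then show ?thesis
    unfolding legD_base
    by (simp add: add_divide_distrib diff_divide_distrib algebra_simps del: funpow.simps)
qed

lemma higher_pderiv_X_mult:
  fixes p :: "real poly"
  shows "(pderiv ^^ Suc n) ([:0, 1:] * p) = [:0, 1:] * (pderiv ^^ Suc n) p + smult (real (Suc n)) ((pderiv ^^ n) p)"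
proof (induction n)
  case (Suc n)
  have "(pderiv ^^ Suc (Suc n)) ([:0, 1:] * p) = pderiv ((pderiv ^^ Suc n) ([:0, 1:] * p))"
    by simp
  also have "\<dots> = [:0, 1:] * (pderiv ^^ Suc (Suc n)) p + smult (real (Suc (Suc n))) ((pderiv ^^ Suc n) p)"
    unfolding Suc.IH
    by (rule poly_ext) (simp add: pderiv_add pderiv_mult pderiv_smult pderiv_pCons algebra_simps
        del: mult_pCons_left mult_pCons_right)
  finally show ?case .
qed (simp add: pderiv_mult pderiv_pCons del: mult_pCons_left mult_pCons_right)

lemma higher_pderiv_X2_mult:
  fixes p :: "real poly"
  shows "(pderiv ^^ (n + 2)) ([:- 1, 0, 1:] * p) = [:- 1, 0, 1:] * (pderiv ^^ (n + 2)) p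
     + smult (2 * real (n + 2)) ([:0, 1:] * (pderiv ^^ (n + 1)) p) + smult (real (n + 2) * real (n + 1)) ((pderiv ^^ n) p)"
proof -
  have e: "[:- 1, 0, 1:] * q = [:0, 1:] * ([:0, 1:] * q) - q" for q :: "real poly"
    by (simp add: algebra_simps)
  have d: "(pderiv ^^ k) (a - b) = (pderiv ^^ k) a - (pderiv ^^ k) b" for k and a b :: "real poly"
    by (induction k) (simp_all add: pderiv_diff)
  have "(pderiv ^^ Suc (Suc n)) ([:- 1, 0, 1:] * p) = [:- 1, 0, 1:] * (pderiv ^^ Suc (Suc n)) p
     + smult (2 * real (n + 2)) ([:0, 1:] * (pderiv ^^ Suc n) p) + smult (real (n + 2) * real (n + 1)) ((pderiv ^^ n) p)"
    unfolding e d higher_pderiv_X_mult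
    by (rule poly_ext) (simp add: algebra_simps del: mult_pCons_left mult_pCons_right funpow.simps)
  then show ?thesis by simp
qed

lemma legD_Suc_1: "legD (Suc l) 1 z = z * legD l 1 z + (real l + 1) * legP l z"
proof -
  have "(pderiv ^^ (Suc l + 1)) (base_pow (Suc l)) = (pderiv ^^ Suc l) (pderiv (base_pow (Suc l)))"
    by (simp add: funpow_swap1)
  also have "\<dots> = smult (2 * (real l + 1)) ([:0, 1:] * (pderiv ^^ Suc l) (base_pow l)
      + smult (real (Suc l)) ((pderiv ^^ l) (base_pow l)))"
    unfolding pderiv_base_pow higher_pderiv_smult higher_pderiv_X_mult ..
  finally have 1: "(pderiv ^^ (Suc l + 1)) (base_pow (Suc l)) = smult (2 * (real l + 1)) ([:0, 1:] * (pderiv ^^ Suc l) (base_pow l)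
      + smult (real (Suc l)) ((pderiv ^^ l) (base_pow l)))" .
  have 2: "legP l z = poly ((pderiv ^^ l) (base_pow l)) z / (2 ^ l * fact l)"
    using legD_base[of 0 l z] by simp
  have 3: "legD l 1 z = poly ((pderiv ^^ Suc l) (base_pow l)) z / (2 ^ l * fact l)"
    using legD_base[of 1 l z] by simp
  have "legD (Suc l) 1 z = 2 * (real l + 1) * (z * poly ((pderiv ^^ Suc l) (base_pow l)) z
      + (real l + 1) * poly ((pderiv ^^ l) (base_pow l)) z) / (2 * (real l + 1) * (2 ^ l * fact l))"
    unfolding legD_base[of 1 "Suc l" z] 1
    by (simp add: algebra_simps del: mult_pCons_left mult_pCons_right funpow.simps)
  also have "\<dots> = (z * poly ((pderiv ^^ Suc l) (base_pow l)) z
      + (real l + 1) * poly ((pderiv ^^ l) (base_pow l)) z) / (2 ^ l * fact l)"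
    by (subst mult_divide_mult_cancel_left) auto
  finally show ?thesis
    unfolding 2 3 by (simp add: add_divide_distrib)
qed

text \<open>Together with \<open>legD_Suc_1\<close> this gives the three term recurrence. It comes from the Leibniz
rule for \<open>base_pow (Suc l) = (z\<^sup>2 - 1) base_pow l\<close>, where \<open>base_pow_ode\<close>
of order one less than \<open>l\<close> eliminates the lowest derivative.\<close>

lemma legP_Suc: "(real l + 1) * legP (Suc l) z = (z\<^sup>2 - 1) * legD l 1 z + (real l + 1) * z * legP l z"
proof (cases l)
  case 0
  then show ?thesis by (simp add: legendre_poly_def pderiv_pCons)
next
  case (Suc n)
  have b: "base_pow (Suc l) = [:- 1, 0, 1:] * base_pow l"
    by (simp add: base_pow_def)
  have 1: "[:- 1, 0, 1:] * (pderiv ^^ (n + 2)) (base_pow l)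
    + smult (2 * (real n + 1 - real l)) ([:0, 1:] * (pderiv ^^ (n + 1)) (base_pow l))
    + smult ((real n + 1) * (real n - 2 * real l)) ((pderiv ^^ n) (base_pow l)) = 0"
    by (rule base_pow_ode)
  have 2: "smult ((real n + 1) * (real n + 2)) ((pderiv ^^ n) (base_pow l)) = [:- 1, 0, 1:] * (pderiv ^^ (n + 2)) (base_pow l)"
  proof (rule poly_ext)
    fix z show "poly (smult ((real n + 1) * (real n + 2)) ((pderiv ^^ n) (base_pow l))) z
      = poly ([:- 1, 0, 1:] * (pderiv ^^ (n + 2)) (base_pow l)) z"
      using arg_cong[OF 1, of "\<lambda>p. poly p z"] Suc
      by (simp add: algebra_simps del: mult_pCons_left mult_pCons_right funpow.simps)
  qed
  have 3: "(pderiv ^^ (n + 2)) (base_pow (Suc l)) = smult 2 ([:- 1, 0, 1:] * (pderiv ^^ (n + 2)) (base_pow l)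
     + smult (real l + 1) ([:0, 1:] * (pderiv ^^ (n + 1)) (base_pow l)))"
  proof -
    have "smult (real (n + 2) * real (n + 1)) ((pderiv ^^ n) (base_pow l)) = [:- 1, 0, 1:] * (pderiv ^^ (n + 2)) (base_pow l)"
      using 2 by (simp add: mult.commute add.commute del: funpow.simps)
    then show ?thesis
      unfolding b higher_pderiv_X2_mult using Suc
      by (intro poly_ext) (simp add: algebra_simps del: mult_pCons_left mult_pCons_right funpow.simps)
  qed
  define A B F where "A = poly ((pderiv ^^ (n + 2)) (base_pow l)) z"
    and "B = poly ((pderiv ^^ (n + 1)) (base_pow l)) z" and "F = (2 ^ l * fact l :: real)"
  have F: "F \<noteq> 0" by (simp add: F_def)
  have "legP (Suc l) z = 2 * ((z\<^sup>2 - 1) * A + (real l + 1) * (z * B)) / (2 * (real l + 1) * F)"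
    using legD_base[of 0 "Suc l" z] Suc 3 unfolding A_def B_def F_def
    by (simp add: algebra_simps power2_eq_square del: mult_pCons_left mult_pCons_right funpow.simps)
  also have "\<dots> = ((z\<^sup>2 - 1) * A + (real l + 1) * (z * B)) / ((real l + 1) * F)"
    by (subst mult.assoc, subst mult_divide_mult_cancel_left) auto
  finally have P: "legP (Suc l) z = ((z\<^sup>2 - 1) * A + (real l + 1) * (z * B)) / ((real l + 1) * F)" .
  have D: "legD l 1 z = A / F"
    using legD_base[of 1 l z] Suc by (simp add: A_def F_def)
  have Q: "legP l z = B / F"
    using legD_base[of 0 l z] Suc by (simp add: B_def F_def)
  have "p * (((z\<^sup>2 - 1) * A + p * (z * B)) / (p * F)) = (z\<^sup>2 - 1) * (A / F) + p * z * (B / F)"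
    if "p \<noteq> 0" for p
    using that F by (simp add: distrib_left add_divide_distrib)
  moreover have "real l + 1 \<noteq> 0" by linarith
  ultimately show ?thesis unfolding P D Q by blast
qed

lemma legP_0 [simp]: "legP 0 z = 1" and legP_1 [simp]: "legP (Suc 0) z = z"
  by (simp_all add: legendre_poly_def pderiv_pCons)

lemma legP_at_1 [simp]: "legP l 1 = 1"
proof (induction l)
  case (Suc l)
  then show ?case using legP_Suc[of l 1] by simp
qed simp

lemma legP_recurrence:
  "(real l + 2) * legP (l + 2) z = (2 * real l + 3) * z * legP (l + 1) z - (real l + 1) * legP l z"
proof -
  have "(real l + 2) * legP (l + 2) z = (z\<^sup>2 - 1) * legD (Suc l) 1 z + (real l + 2) * z * legP (Suc l) z"
    using legP_Suc[of "Suc l" z] by (simp add: add_ac)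
  also have "\<dots> = z * ((z\<^sup>2 - 1) * legD l 1 z) + (z\<^sup>2 - 1) * (real l + 1) * legP l z + (real l + 2) * z * legP (Suc l) z"
    unfolding legD_Suc_1 by (simp add: algebra_simps)
  also have "(z\<^sup>2 - 1) * legD l 1 z = (real l + 1) * legP (Suc l) z - (real l + 1) * z * legP l z"
    using legP_Suc[of l z] by simp
  finally show ?thesis by (simp add: algebra_simps power2_eq_square)
qed

lemma legD_top: "legD l (Suc l) z = 0"
proof -
  have "degree (base_pow l) = 2 * l"
    by (simp add: base_pow_def degree_power_eq)
  then have "degree ((pderiv ^^ l) (legendre_poly l)) = 0"
    unfolding legendre_poly_base by (simp add: degree_higher_pderiv)
  then have "pderiv ((pderiv ^^ l) (legendre_poly l)) = 0" by (simp only: pderiv_eq_0_iff)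
  then show ?thesis by simp
qed

section \<open>Addition theorem\<close>

text \<open>The associated Legendre function of order \<open>M\<close> times its azimuthal factor, at height
\<open>z\<close> and with \<open>u = x + i y\<close>; in this form it is polynomial in the coordinates.\<close>

definition legf :: "nat \<Rightarrow> nat \<Rightarrow> real \<Rightarrow> complex \<Rightarrow> complex" where
  "legf l M z u = of_real (legD l M z) * u ^ M"

text \<open>A point moves under the rotation about the first axis, so \<open>z' = Im u\<close> and
\<open>u' = - i z\<close>. The derivative is a combination of the functions of order one higher and
one lower: these are the ladder operators, and the Legendre equation removes the second derivative.\<close>

lemma legf_derivative:
  assumes Z: "(Z has_real_derivative Im (U t)) (at t)"
    and U: "(U has_vector_derivative - (\<i> * of_real (Z t))) (at t)"
    and unit: "(cmod (U t))\<^sup>2 = 1 - (Z t)\<^sup>2"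
  shows "((\<lambda>t. legf l (Suc M) (Z t) (U t)) has_vector_derivative
     - (\<i> / 2) * (legf l (M + 2) (Z t) (U t)
       + of_real ((real l + real M + 1) * (real l - real M)) * legf l M (Z t) (U t))) (at t)"
proof -
  let ?z = "Z t" and ?u = "U t"
  have 1: "((\<lambda>t. legD l (Suc M) (Z t)) has_real_derivative legD l (M + 2) ?z * Im ?u) (at t)"
    using DERIV_chain'[OF Z poly_DERIV[of "(pderiv ^^ Suc M) (legendre_poly l)"]] 
    by (simp add: mult.commute)
  have 2: "((\<lambda>t. of_real (legD l (Suc M) (Z t)) :: complex) has_vector_derivative
      of_real (legD l (M + 2) ?z * Im ?u)) (at t)"
    using has_vector_derivative_of_real[OF 1] .
  have "((\<lambda>w. w ^ Suc M) has_field_derivative of_nat (Suc M) * ?u ^ M) (at ?u)"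
    using DERIV_power[OF DERIV_ident, of "Suc M" "U t"] by simp
  from field_vector_diff_chain_at[OF U this]
  have 3: "((\<lambda>t. U t ^ Suc M) has_vector_derivative
      - (\<i> * of_real ?z) * (of_nat (Suc M) * ?u ^ M)) (at t)"
    by (simp add: o_def)
  have n: "?u * cnj ?u = of_real (1 - ?z\<^sup>2)"
    using unit by (metis complex_norm_square of_real_power)
  have im: "of_real (Im ?u) = (?u - cnj ?u) / (2 * \<i>)"
    by (simp add: complex_eq_iff)
  have eq: "of_real ((1 - ?z\<^sup>2) * legD l (M + 2) ?z) = (of_real (2 * (real M + 1) * ?z * legD l (M + 1) ?z)
    - of_real ((real l + real M + 1) * (real l - real M) * legD l M ?z) :: complex)"
    unfolding of_real_diff[symmetric] of_real_eq_iff using legD_ode[of ?z M l] by simp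
  have "of_real (legD l (Suc M) ?z) * (- (\<i> * of_real ?z) * (of_nat (Suc M) * ?u ^ M))
      + of_real (legD l (M + 2) ?z * Im ?u) * ?u ^ Suc M
    = - (\<i> / 2) * (legf l (M + 2) ?z ?u
       + of_real ((real l + real M + 1) * (real l - real M)) * legf l M ?z ?u)" (is "?l = ?r")
  proof -
    have "of_real (Im ?u) * ?u ^ Suc M = (?u ^ (M + 2) - of_real (1 - ?z\<^sup>2) * ?u ^ M) / (2 * \<i>)"
      unfolding im n[symmetric] by (simp add: algebra_simps)
    then have "?l = of_real (legD l (Suc M) ?z) * (- (\<i> * of_real ?z) * (of_nat (Suc M) * ?u ^ M))
       + of_real (legD l (M + 2) ?z) * (?u ^ (M + 2) - of_real (1 - ?z\<^sup>2) * ?u ^ M) / (2 * \<i>)"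
      by (simp add: mult.assoc)
    also have "\<dots> = - (\<i> / 2) * (legf l (M + 2) ?z ?u + (of_real (2 * (real M + 1) * ?z * legD l (M + 1) ?z)
        - of_real ((1 - ?z\<^sup>2) * legD l (M + 2) ?z)) * ?u ^ M)"
      by (simp add: legf_def field_simps del: funpow.simps)
    also have "\<dots> = ?r"
      unfolding eq by (simp add: legf_def algebra_simps del: funpow.simps)
    finally show ?thesis .
  qed
  then show ?thesis
    using has_vector_derivative_mult[OF 2 3] unfolding legf_def by simp
qed

text \<open>The sum over \<open>m\<close> in the addition theorem, with the two signs of \<open>m\<close> combined.\<close>

definition zonal :: "nat \<Rightarrow> real \<Rightarrow> complex \<Rightarrow> real \<Rightarrow> complex \<Rightarrow> real" where
  "zonal l z u s v = legP l z * legP l s + (\<Sum>m<l. 2 * fact (l - Suc m) / fact (l + Suc m)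
      * Re (legf l (Suc m) z u * cnj (legf l (Suc m) s v)))"

text \<open>Rotation invariance. By the ladder relations the derivative of each term is a difference of
neighbouring expressions \<open>T\<close>, and the factorial weights are exactly those for which the sum
telescopes; the upper end vanishes because a polynomial of degree \<open>l\<close> has no derivative of
order \<open>l + 1\<close>.\<close>

lemma zonal_rotation_derivative:
  assumes Z: "(Z has_real_derivative Im (U t)) (at t)"
    and U: "(U has_vector_derivative - (\<i> * of_real (Z t))) (at t)"
    and unit: "(cmod (U t))\<^sup>2 = 1 - (Z t)\<^sup>2"
    and Z': "(Z' has_real_derivative Im (U' t)) (at t)"
    and U': "(U' has_vector_derivative - (\<i> * of_real (Z' t))) (at t)"
    and unit': "(cmod (U' t))\<^sup>2 = 1 - (Z' t)\<^sup>2"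
  shows "((\<lambda>t. zonal l (Z t) (U t) (Z' t) (U' t)) has_real_derivative 0) (at t)"
proof -
  define f where "f M = legf l M (Z t) (U t)" for M
  define g where "g M = legf l M (Z' t) (U' t)" for M
  define T where "T M = (\<i> / 2) * (f M * cnj (g (M + 1)) - f (M + 1) * cnj (g M))" for M
  define d where "d M = (2 * fact (l - M) / fact (l + M) :: real)" for M
  define a where "a M = (real l + real M + 1) * (real l - real M)" for M
  have summand: "((\<lambda>t. Re (legf l (Suc M) (Z t) (U t) * cnj (legf l (Suc M) (Z' t) (U' t))))
      has_real_derivative Re (T (Suc M) - of_real (a M) * T M)) (at t)" for M
  proof -
    have "((\<lambda>t. legf l (Suc M) (Z t) (U t) * cnj (legf l (Suc M) (Z' t) (U' t)))
      has_vector_derivative f (Suc M) * cnj (- (\<i> / 2) * (g (M + 2) + of_real (a M) * g M))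
       + (- (\<i> / 2) * (f (M + 2) + of_real (a M) * f M)) * cnj (g (Suc M))) (at t)"
      unfolding f_def g_def a_def
      by (intro has_vector_derivative_mult has_vector_derivative_cnj legf_derivative assms)
    also have "f (Suc M) * cnj (- (\<i> / 2) * (g (M + 2) + of_real (a M) * g M))
       + (- (\<i> / 2) * (f (M + 2) + of_real (a M) * f M)) * cnj (g (Suc M)) = T (Suc M) - of_real (a M) * T M"
      by (simp add: T_def algebra_simps)
    finally show ?thesis
      unfolding has_real_derivative_iff_has_vector_derivative
      using bounded_linear.has_vector_derivative[OF bounded_linear_Re] by blast
  qed
  have zero: "((\<lambda>t. legP l (Z t) * legP l (Z' t)) has_real_derivative 2 * Re (T 0)) (at t)"
  proof -
    have 1: "((\<lambda>t. legP l (Z t)) has_real_derivative legD l 1 (Z t) * Im (U t)) (at t)"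
      using DERIV_chain'[OF Z poly_DERIV[of "legendre_poly l"]] by (simp add: mult.commute)
    have 2: "((\<lambda>t. legP l (Z' t)) has_real_derivative legD l 1 (Z' t) * Im (U' t)) (at t)"
      using DERIV_chain'[OF Z' poly_DERIV[of "legendre_poly l"]] by (simp add: mult.commute)
    show ?thesis
      by (rule DERIV_cong[OF DERIV_mult[OF 1 2]])
        (simp add: T_def f_def g_def legf_def algebra_simps)
  qed
  have da: "d (Suc m) * a m = d m" if "m < l" for m
  proof -
    have "fact (l - m) = (real l - real m) * fact (l - Suc m)"
      using that by (simp add: Suc_diff_Suc[symmetric] of_nat_diff algebra_simps)
    moreover have "fact (l + Suc m) = (real l + real m + 1) * fact (l + m)"
      by (simp add: algebra_simps)
    moreover have "2 * F1 / (p * F2) * (p * q) = 2 * (q * F1) / F2" if "p \<noteq> 0" for p q F1 F2 :: real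
      using that by (simp add: field_simps)
    moreover have "real l + real m + 1 \<noteq> 0" by linarith
    ultimately show ?thesis
      unfolding d_def a_def by presburger
  qed
  have "((\<lambda>t. zonal l (Z t) (U t) (Z' t) (U' t)) has_real_derivative
     2 * Re (T 0) + (\<Sum>m<l. d (Suc m) * Re (T (Suc m) - of_real (a m) * T m))) (at t)"
    unfolding zonal_def d_def
    by (intro DERIV_add DERIV_sum zero DERIV_cmult summand)
  also have "(\<Sum>m<l. d (Suc m) * Re (T (Suc m) - of_real (a m) * T m))
     = (\<Sum>m<l. d (Suc m) * Re (T (Suc m)) - d m * Re (T m))"
    by (intro sum.cong refl) (simp add: da[symmetric] algebra_simps)
  also have "\<dots> = d l * Re (T l) - d 0 * Re (T 0)"
    by (rule sum_lessThan_telescope)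
  also have "T l = 0"
    by (simp add: T_def f_def g_def legf_def legD_top del: funpow.simps)
  finally show ?thesis by (simp add: d_def)
qed

text \<open>Both sides are invariant under rotations, and when the second point is the pole only the term
\<open>m = 0\<close> is left.\<close>

lemma zonal_eq_legP:
  assumes u: "(cmod u)\<^sup>2 = 1 - z\<^sup>2" and v: "(cmod v)\<^sup>2 = 1 - s\<^sup>2"
  shows "zonal l z u s v = legP l (z * s + Re (u * cnj v))"
proof -
  (* the phase w turns v to the positive imaginary axis; the rotation by \<theta> about the first axis then takes the second point to the pole *)
  define w where "w = (if v = 0 then 1 else \<i> * cnj v / of_real (cmod v))"
  have w: "w * cnj w = 1" "w * v = \<i> * of_real (cmod v)"
    using complex_norm_square[of v] by (auto simp: w_def field_simps power2_eq_square)
  have cw: "cmod w = 1"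
    using w(1) by (metis complex_mod_cnj norm_mult norm_one power2_eq_1_iff power2_eq_square norm_ge_zero
        abs_of_nonneg abs_1 abs_square_eq_1)
  obtain \<theta> where \<theta>: "s = cos \<theta>" "cmod v = sin \<theta>"
  proof -
    have "s\<^sup>2 + (cmod v)\<^sup>2 = 1" using v by simp
    then show ?thesis using sincos_total_2pi[of s "cmod v"] that by metis
  qed
  define rotZ where "rotZ c q t = Im q * sin t + c * cos t" for c q t
  define rotU where "rotU c q t = Complex (Re q) (Im q * cos t - c * sin t)" for c q t
  have inv: "zonal l z (w * u) s (w * v) = zonal l z u s v"
  proof -
    have "legf l m z (w * u) * cnj (legf l m s (w * v)) = legf l m z u * cnj (legf l m s v)" for m
    proof -
      have "legf l m z (w * u) * cnj (legf l m s (w * v)) = (w * cnj w) ^ m * (legf l m z u * cnj (legf l m s v))"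
        by (simp add: legf_def power_mult_distrib)
      then show ?thesis using w by simp
    qed
    then show ?thesis by (simp add: zonal_def)
  qed
  have rot0: "rotZ c q 0 = c" "rotU c q 0 = q" for c q
    by (simp_all add: rotZ_def rotU_def)
  have dZ: "(rotZ c q has_real_derivative Im (rotU c q t)) (at t)" for c q t
    unfolding rotZ_def rotU_def by (auto intro!: derivative_eq_intros)
  have dU: "(rotU c q has_vector_derivative - (\<i> * of_real (rotZ c q t))) (at t)" for c q t
  proof -
    have "((\<lambda>t. of_real (Re q) + \<i> * of_real (Im q * cos t - c * sin t)) has_vector_derivative
       0 + \<i> * of_real (- Im q * sin t - c * cos t)) (at t)"
      by (intro has_vector_derivative_add has_vector_derivative_const has_vector_derivative_mult_right
          has_vector_derivative_of_real)
        (auto simp: has_real_derivative_iff_has_vector_derivative[symmetric] intro!: derivative_eq_intros)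
    moreover have "(\<lambda>t. of_real (Re q) + \<i> * of_real (Im q * cos t - c * sin t)) = rotU c q"
      by (simp add: rotU_def fun_eq_iff complex_eq_iff)
    moreover have "0 + \<i> * of_real (- Im q * sin t - c * cos t) = - (\<i> * of_real (rotZ c q t))"
      by (simp add: rotZ_def algebra_simps)
    ultimately show ?thesis by metis
  qed
  have unit: "(cmod (rotU c q t))\<^sup>2 = 1 - (rotZ c q t)\<^sup>2" if "(cmod q)\<^sup>2 = 1 - c\<^sup>2" for c q t
  proof -
    have "(Re q)\<^sup>2 + (Im q)\<^sup>2 + c\<^sup>2 = 1" using that by (simp add: cmod_power2)
    moreover have ring: "(a * C - b * S)\<^sup>2 + (a * S + b * C)\<^sup>2 = (a\<^sup>2 + b\<^sup>2) * (S\<^sup>2 + C\<^sup>2)" for a b C S :: real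
      by algebra
    moreover have "(cmod (rotU c q t))\<^sup>2 + (rotZ c q t)\<^sup>2 = (Re q)\<^sup>2 + ((Im q)\<^sup>2 + c\<^sup>2) * ((sin t)\<^sup>2 + (cos t)\<^sup>2)"
      unfolding rotU_def rotZ_def cmod_power2 using ring[of "Im q" "cos t" c "sin t"] by simp
    ultimately show ?thesis by simp
  qed
  let ?u = "w * u" and ?v = "w * v"
  have uu: "(cmod ?u)\<^sup>2 = 1 - z\<^sup>2" "(cmod ?v)\<^sup>2 = 1 - s\<^sup>2"
    using u v cw by (simp_all add: norm_mult)
  have const: "zonal l (rotZ z ?u \<theta>) (rotU z ?u \<theta>) (rotZ s ?v \<theta>) (rotU s ?v \<theta>)
      = zonal l (rotZ z ?u 0) (rotU z ?u 0) (rotZ s ?v 0) (rotU s ?v 0)"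
    by (rule DERIV_isconst_all) (intro allI zonal_rotation_derivative dZ dU unit uu)
  have "zonal l z u s v = zonal l (rotZ z ?u \<theta>) (rotU z ?u \<theta>) (rotZ s ?v \<theta>) (rotU s ?v \<theta>)"
    using inv const rot0 by simp
  also have "rotZ s ?v \<theta> = 1"
    unfolding w(2) rotZ_def using \<theta> by (simp add: power2_eq_square[symmetric])
  also have "rotU s ?v \<theta> = 0"
    unfolding w(2) rotU_def using \<theta> by (simp add: complex_eq_iff)
  also have "zonal l (rotZ z ?u \<theta>) (rotU z ?u \<theta>) 1 0 = legP l (rotZ z ?u \<theta>)"
    by (simp add: zonal_def legf_def)
  also have "rotZ z ?u \<theta> = z * s + Re (u * cnj v)"
  proof -
    have "u * cnj v = ?u * cnj ?v" using w(1) by (simp add: algebra_simps)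
    also have "\<dots> = ?u * (- \<i> * of_real (cmod v))" unfolding w(2) by simp
    finally have "Re (u * cnj v) = Im ?u * sin \<theta>" using \<theta> by simp
    then show ?thesis unfolding rotZ_def using \<theta> by simp
  qed
  finally show ?thesis .
qed

lemma sum_symmetric_int_interval:
  fixes h :: "int \<Rightarrow> 'a :: comm_monoid_add"
  shows "(\<Sum>m=- int l..int l. h m) = h 0 + (\<Sum>m<l. h (int (Suc m)) + h (- int (Suc m)))"
proof (induction l)
  case (Suc l)
  have "{- int (Suc l)..int (Suc l)} = insert (- int (Suc l)) (insert (int (Suc l)) {- int l..int l})"
    by auto
  then show ?case using Suc by (simp add: add_ac)
qed simp

lemma inner_real3: "x \<bullet> y = x$1 * y$1 + x$2 * y$2 + x$3 * y$3" for x y :: "real^3"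
  by (simp add: inner_vec_def sum_3)

lemma sphere_coords:
  fixes x :: "real^3"
  assumes "x \<in> S2" shows "(cmod (Complex (x$1) (x$2)))\<^sup>2 = 1 - (x$3)\<^sup>2"
proof -
  have "x \<bullet> x = 1" using assms by (simp add: dot_square_norm)
  then show ?thesis unfolding inner_real3 cmod_power2 by (simp add: power2_eq_square)
qed

theorem addition_theorem:
  assumes "x \<in> S2" "y \<in> S2"
  shows "(\<Sum>m=- int l..int l. Ylm l m x * Ylm l m y) = (2 * real l + 1) / (4 * pi) * legP l (x \<bullet> y)"
proof -
  let ?u = "Complex (x$1) (x$2)" and ?v = "Complex (y$1) (y$2)"
  let ?c = "(2 * real l + 1) / (4 * pi)"
  have pair: "Ylm l (int (Suc m)) x * Ylm l (int (Suc m)) y + Ylm l (- int (Suc m)) x * Ylm l (- int (Suc m)) y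
     = ?c * (2 * fact (l - Suc m) / fact (l + Suc m) * Re (legf l (Suc m) (x$3) ?u * cnj (legf l (Suc m) (y$3) ?v)))" for m
  proof -
    define s where "s = sqrt (2 * (2 * real l + 1) / (4 * pi) * fact (l - Suc m) / fact (l + Suc m))"
    define M where "M = Suc m"
    have M: "nat \<bar>int M\<bar> = M" "nat \<bar>- int M\<bar> = M" "int M \<noteq> 0" "\<not> - int M \<ge> 0" by (auto simp: M_def)
    have s2: "s * s = ?c * (2 * fact (l - Suc m) / fact (l + Suc m))"
      unfolding s_def by (simp add: field_simps)
    have Y: "Ylm l (int M) x = s * legD l M (x$3) * Re (Complex (x$1) (x$2) ^ M)"
        "Ylm l (- int M) x = s * legD l M (x$3) * Im (Complex (x$1) (x$2) ^ M)"
      for x :: "real^3" unfolding Ylm_def Let_def M using M by (simp_all add: s_def M_def del: funpow.simps)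
    have "Ylm l (int M) x * Ylm l (int M) y + Ylm l (- int M) x * Ylm l (- int M) y
       = s * s * Re (legf l M (x$3) ?u * cnj (legf l M (y$3) ?v))"
      unfolding Y legf_def by (simp add: algebra_simps del: funpow.simps complex_cnj_power)
    then show ?thesis unfolding s2 M_def by (simp only: mult.assoc)
  qed
  have "Ylm l 0 x * Ylm l 0 y = ?c * (legP l (x$3) * legP l (y$3))"
  proof -
    have Y: "Ylm l 0 x = sqrt ?c * legP l (x$3)" for x :: "real^3" by (simp add: Ylm_def Let_def)
    have "0 \<le> ?c" by simp
    then have c: "sqrt ?c * sqrt ?c = ?c" by (rule real_sqrt_mult_self[THEN trans, OF abs_of_nonneg])
    have "r * p * (r * q) = c * (p * q)" if "r * r = c" for r p q c :: real
      unfolding that[symmetric] by (simp only: mult_ac)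
    from this[OF c] show ?thesis unfolding Y .
  qed
  then have "(\<Sum>m=- int l..int l. Ylm l m x * Ylm l m y) = ?c * zonal l (x$3) ?u (y$3) ?v"
    unfolding sum_symmetric_int_interval pair zonal_def
    by (simp add: sum_distrib_left distrib_left)
  also have "zonal l (x$3) ?u (y$3) ?v = legP l (x \<bullet> y)"
    unfolding zonal_eq_legP[OF sphere_coords[OF assms(1)] sphere_coords[OF assms(2)]]
    by (simp add: inner_real3 algebra_simps)
  finally show ?thesis .
qed

text \<open>The addition theorem at coinciding points evaluates the sum of squares of the harmonics, so this is
the Cauchy-Schwarz inequality.\<close>

lemma abs_legP_le_1:
  assumes "\<bar>t\<bar> \<le> 1" shows "\<bar>legP l t\<bar> \<le> 1"
proof -
  (* two points of the sphere with inner product t *)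
  define x :: "real^3" where "x = vector [sqrt (1 - t\<^sup>2), 0, t]"
  define y :: "real^3" where "y = vector [0, 0, 1]"
  have t2: "t\<^sup>2 \<le> 1" using assms abs_square_le_1 by blast
  have "x \<bullet> x = 1" "y \<bullet> y = 1" and xy: "x \<bullet> y = t"
    unfolding inner_real3 using t2 by (simp_all add: x_def y_def vector_3 power2_eq_square)
  then have xS: "x \<in> S2" "y \<in> S2" by (simp_all add: norm_eq_1)
  let ?c = "(2 * real l + 1) / (4 * pi)"
  have c: "?c > 0" by (simp add: add_pos_pos)
  have "\<bar>?c * legP l t\<bar> \<le> (\<Sum>m=- int l..int l. \<bar>Ylm l m x * Ylm l m y\<bar>)"
    unfolding xy[symmetric] addition_theorem[OF xS, symmetric] by (rule sum_abs)
  also have "\<dots> \<le> (\<Sum>m=- int l..int l. (Ylm l m x * Ylm l m x + Ylm l m y * Ylm l m y) / 2)"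
  proof (intro sum_mono)
    fix m
    have "2 * \<bar>Ylm l m x\<bar> * \<bar>Ylm l m y\<bar> \<le> \<bar>Ylm l m x\<bar>\<^sup>2 + \<bar>Ylm l m y\<bar>\<^sup>2" by (rule sum_squares_bound)
    then show "\<bar>Ylm l m x * Ylm l m y\<bar> \<le> (Ylm l m x * Ylm l m x + Ylm l m y * Ylm l m y) / 2"
      by (simp add: abs_mult power2_eq_square)
  qed
  also have "\<dots> = ?c"
    unfolding sum_divide_distrib[symmetric] sum.distrib addition_theorem[OF xS(1) xS(1)] addition_theorem[OF xS(2) xS(2)]
    using \<open>x \<bullet> x = 1\<close> \<open>y \<bullet> y = 1\<close> by simp
  finally have "?c * \<bar>legP l t\<bar> \<le> ?c * 1" using c by (simp add: abs_mult)
  then show ?thesis using c by (simp only: mult_le_cancel_left_pos)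
qed

section \<open>Abel summation of Legendre series\<close>

lemma legendre_radicand_pos:
  fixes t s :: real
  assumes "\<bar>t\<bar> \<le> 1" "\<bar>s\<bar> < 1" shows "0 < 1 - 2 * t * s + s\<^sup>2"
proof -
  have "t * s \<le> \<bar>s\<bar>"
    using assms mult_mono[of "\<bar>t\<bar>" 1 "\<bar>s\<bar>" "\<bar>s\<bar>"] abs_le_D1[of "t * s"] by (simp add: abs_mult)
  then have "(1 - \<bar>s\<bar>)\<^sup>2 \<le> 1 - 2 * t * s + s\<^sup>2"
    by (simp add: power2_eq_square algebra_simps)
  moreover have "0 < (1 - \<bar>s\<bar>)\<^sup>2" using assms by simp
  ultimately show ?thesis by linarith
qed

lemma summable_legendre_series:
  assumes t: "\<bar>t\<bar> \<le> 1" and c: "\<And>l. \<bar>c l\<bar> \<le> (1::real)" and s: "norm s < 1"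
  shows "summable (\<lambda>l. c l * legP l t * s ^ l)"
proof (rule summable_comparison_test'[where N=0])
  show "summable (\<lambda>l. \<bar>s\<bar> ^ l)" using s by (simp add: summable_geometric)
  show "norm (c l * legP l t * s ^ l) \<le> \<bar>s\<bar> ^ l" if "l \<ge> 0" for l
  proof -
    have "\<bar>c l\<bar> * \<bar>legP l t\<bar> \<le> 1 * 1" by (intro mult_mono c abs_legP_le_1 t) auto
    then show ?thesis
      by (simp add: abs_mult power_abs mult_left_le_one_le)
  qed
qed

definition leg_gen :: "real \<Rightarrow> real \<Rightarrow> real" where
  "leg_gen t s = (\<Sum>l. legP l t * s ^ l)"

text \<open>The recurrence of the Legendre polynomials is the differential equation
\<open>(1 - 2 t r + r\<^sup>2) D = (t - r) leg_gen\<close> for the derivative \<open>D\<close>, which the right-hand side solves too.\<close>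

lemma leg_gen_eq:
  assumes t: "\<bar>t\<bar> \<le> 1" and s: "\<bar>s\<bar> < 1"
  shows "leg_gen t s = 1 / sqrt (1 - 2 * t * s + s\<^sup>2)"
proof -
  let ?c = "\<lambda>l. legP l t"
  have sm: "summable (\<lambda>l. ?c l * r ^ l)" if "norm r < 1" for r
    using summable_legendre_series[OF t, of "\<lambda>_. 1" r] that by simp
  define D where "D r = (\<Sum>l. diffs ?c l * r ^ l)" for r
  have der: "(leg_gen t has_real_derivative D r) (at r)" if "norm r < 1" for r
    unfolding leg_gen_def D_def by (rule termdiffs_strong'[of 1, OF sm that])
  have ode: "(1 - 2 * t * r + r\<^sup>2) * D r = (t - r) * leg_gen t r" if r: "norm r < 1" for r
  proof -
    let ?d = "\<lambda>l. (real l + 1) * legP (Suc l) t * r ^ l"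
    have "summable (\<lambda>l. diffs ?c l * r ^ l)"
      by (rule termdiff_converges[OF r sm])
    then have d: "?d sums D r"
      unfolding D_def by (simp add: diffs_def summable_sums add.commute)
    have g: "(\<lambda>l. ?c l * r ^ l) sums leg_gen t r"
      unfolding leg_gen_def by (rule summable_sums[OF sm[OF r]])
    have d1: "(\<lambda>l. ?d (Suc l)) sums (D r - t)"
      using sums_split_initial_segment[OF d, of 1] by simp
    have g1: "(\<lambda>l. ?c (Suc l) * r ^ Suc l) sums (leg_gen t r - 1)"
      using sums_split_initial_segment[OF g, of 1] by simp
    have e: "(\<lambda>l. real l * legP l t * r ^ (l + 1)) sums (r\<^sup>2 * D r)"
      by (rule sums_Suc_imp) (use sums_mult[OF d, of "r\<^sup>2"] in \<open>simp_all add: power2_eq_square algebra_simps\<close>)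
    have "(\<lambda>l. 2 * t * r * ?d l + t * (?c (Suc l) * r ^ Suc l) - real l * legP l t * r ^ (l + 1) - r * (?c l * r ^ l))
       sums (2 * t * r * D r + t * (leg_gen t r - 1) - r\<^sup>2 * D r - r * leg_gen t r)"
      by (intro sums_add sums_diff sums_mult d g1 e g)
    also have "(\<lambda>l. 2 * t * r * ?d l + t * (?c (Suc l) * r ^ Suc l) - real l * legP l t * r ^ (l + 1) - r * (?c l * r ^ l))
       = (\<lambda>l. ?d (Suc l))"
    proof
      fix l
      have "?d (Suc l) = ((real l + 2) * legP (l + 2) t) * r ^ Suc l" by (simp add: algebra_simps)
      then show "2 * t * r * ?d l + t * (?c (Suc l) * r ^ Suc l) - real l * legP l t * r ^ (l + 1) - r * (?c l * r ^ l) = ?d (Suc l)"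
        unfolding legP_recurrence by (simp add: algebra_simps)
    qed
    finally have "D r - t = 2 * t * r * D r + t * (leg_gen t r - 1) - r\<^sup>2 * D r - r * leg_gen t r"
      using d1 sums_unique2 by blast
    then show ?thesis by (simp add: algebra_simps)
  qed
  let ?R = "\<lambda>r. sqrt (1 - 2 * t * r + r\<^sup>2)"
  have "leg_gen t s * ?R s = leg_gen t 0 * ?R 0"
  proof (rule DERIV_isconst3[where a="-1" and b=1 and f="\<lambda>r. leg_gen t r * ?R r"])
    fix r :: real assume "r \<in> {-1<..<1}"
    then have r: "norm r < 1" by auto
    then have pos: "0 < 1 - 2 * t * r + r\<^sup>2" using legendre_radicand_pos[OF t] by simp
    have "((\<lambda>r. leg_gen t r * ?R r) has_real_derivative
       leg_gen t r * ((r - t) / ?R r) + D r * ?R r) (at r)"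
      using pos by (auto intro!: derivative_eq_intros der r simp: divide_simps)
    also have "leg_gen t r * ((r - t) / ?R r) + D r * ?R r = ((1 - 2 * t * r + r\<^sup>2) * D r - (t - r) * leg_gen t r) / ?R r"
      using pos by (simp add: field_simps)
    finally show "((\<lambda>r. leg_gen t r * ?R r) has_real_derivative 0) (at r)"
      using ode[OF r] by simp
  qed (use s in auto)
  also have "leg_gen t 0 = 1" unfolding leg_gen_def using powser_zero[of ?c] by simp
  finally show ?thesis
    using legendre_radicand_pos[OF t s] by (simp add: field_simps)
qed

text \<open>The eigenvalue \<open>2 \<pi> / (l (l + 1))\<close> times the factor
\<open>(2 l + 1) / (4 \<pi>)\<close> of the addition theorem; division by zero makes the coefficient of
\<open>l = 0\<close> vanish, as required for mean zero.\<close>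

definition abel_coeff :: "nat \<Rightarrow> real" where
  "abel_coeff l = (2 * real l + 1) / (2 * real l * (real l + 1))"

definition abel_sum :: "real \<Rightarrow> real \<Rightarrow> real" where
  "abel_sum t s = (\<Sum>l. abel_coeff l * legP l t * s ^ l)"

text \<open>The average of the generating function over \<open>{0..s}\<close>, see \<open>leg_mean_derivative\<close>.\<close>

definition leg_mean :: "real \<Rightarrow> real \<Rightarrow> real" where
  "leg_mean t s = (\<Sum>l. 1 / (real l + 1) * legP l t * s ^ l)"

lemma abel_coeff_0 [simp]: "abel_coeff 0 = 0" by (simp add: abel_coeff_def)

lemma abel_coeff_bounds: "0 \<le> abel_coeff l" "abel_coeff l \<le> 1"
proof -
  show "0 \<le> abel_coeff l" by (simp add: abel_coeff_def)
  show "abel_coeff l \<le> 1"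
  proof (cases "l = 0")
    case False
    then have "1 \<le> real l" by simp
    then have "1 * 1 \<le> real l * real l" by (intro mult_mono) auto
    then show ?thesis using \<open>1 \<le> real l\<close> by (simp add: abel_coeff_def divide_le_eq algebra_simps)
  qed simp
qed

context
  fixes t :: real
  assumes t: "\<bar>t\<bar> \<le> 1"
begin

lemma summable_abel: "norm s < 1 \<Longrightarrow> summable (\<lambda>l. abel_coeff l * legP l t * s ^ l)"
  using abel_coeff_bounds by (intro summable_legendre_series[OF t]) auto

lemma summable_gen: "norm s < 1 \<Longrightarrow> summable (\<lambda>l. legP l t * s ^ l)"
  using summable_legendre_series[OF t, of "\<lambda>_. 1" s] by simp

lemma summable_mean: "norm s < 1 \<Longrightarrow> summable (\<lambda>l. 1 / (real l + 1) * legP l t * s ^ l)"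
  by (rule summable_legendre_series[OF t]) (auto simp: divide_le_eq)

lemma leg_mean_derivative:
  assumes s: "norm s < 1"
  shows "((\<lambda>s. s * leg_mean t s) has_real_derivative leg_gen t s) (at s)"
proof -
  define c where "c n = (case n of 0 \<Rightarrow> 0 | Suc l \<Rightarrow> 1 / (real l + 1) * legP l t)" for n
  have c: "(\<lambda>n. c n * r ^ n) sums (r * leg_mean t r)" if r: "norm r < 1" for r
    by (rule sums_Suc_imp)
      (use sums_mult[OF summable_sums[OF summable_mean[OF r]], of r] in
       \<open>simp_all add: c_def leg_mean_def algebra_simps\<close>)
  have "((\<lambda>r. \<Sum>n. c n * r ^ n) has_real_derivative (\<Sum>n. diffs c n * s ^ n)) (at s)"
    by (rule termdiffs_strong'[of 1]) (use c s in \<open>auto intro: sums_summable\<close>)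
  also have "diffs c = (\<lambda>l. legP l t)"
    by (auto simp: diffs_def c_def fun_eq_iff add.commute)
  finally have "((\<lambda>r. \<Sum>n. c n * r ^ n) has_real_derivative leg_gen t s) (at s)"
    by (simp add: leg_gen_def)
  then show ?thesis
  proof (rule has_field_derivative_transform_within_open[where S="ball 0 1"])
    fix r :: real assume "r \<in> ball 0 1"
    then show "(\<Sum>n. c n * r ^ n) = r * leg_mean t r" using c[of r] sums_unique by force
  qed (use s in auto)
qed

text \<open>From \<open>l * abel_coeff l = 1 - 1 / (2 (l + 1))\<close> for \<open>l \<ge> 1\<close>. The derivative is
given only through its product with \<open>s\<close>, which avoids a case distinction at
\<open>s = 0\<close>.\<close>

lemma abel_sum_derivative:
  assumes s: "norm s < 1"
  obtains d where "(abel_sum t has_real_derivative d) (at s)"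
    and "s * d = leg_gen t s - leg_mean t s / 2 - 1 / 2"
proof
  let ?c = "\<lambda>l. abel_coeff l * legP l t"
  let ?d = "\<Sum>l. diffs ?c l * s ^ l"
  show "(abel_sum t has_real_derivative ?d) (at s)"
    unfolding abel_sum_def by (rule termdiffs_strong'[of 1]) (use summable_abel s in auto)
  have "(\<lambda>l. diffs ?c l * s ^ l) sums ?d"
    by (rule summable_sums, rule termdiff_converges[OF s summable_abel])
  then have "(\<lambda>l. s * (diffs ?c l * s ^ l)) sums (s * ?d)" by (rule sums_mult)
  then have 1: "(\<lambda>l. real l * (?c l * s ^ l)) sums (s * ?d)"
    by - (rule sums_Suc_imp, simp_all add: diffs_def algebra_simps)
  have "(\<lambda>l. legP l t * s ^ l - 1 / (real l + 1) * legP l t * s ^ l / 2 - (if l = 0 then 1 / 2 else 0))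
     sums (leg_gen t s - leg_mean t s / 2 - 1 / 2)"
    unfolding leg_gen_def leg_mean_def
    by (intro sums_diff sums_divide summable_sums summable_gen summable_mean s) (rule sums_single[of 0 "\<lambda>_. 1/2", simplified])
  also have "(\<lambda>l. legP l t * s ^ l - 1 / (real l + 1) * legP l t * s ^ l / 2 - (if l = 0 then 1 / 2 else 0))
     = (\<lambda>l. real l * (?c l * s ^ l))"
  proof
    fix l
    have "r * ((2 * r + 1) / (2 * r * (r + 1))) = 1 - 1 / (r + 1) / 2" if "r > 0" for r :: real
    proof -
      have "r + 1 \<noteq> 0" "r \<noteq> 0" using that by auto
      then show ?thesis by (simp add: divide_simps) (simp add: algebra_simps)
    qed
    then have "real l * abel_coeff l = 1 - 1 / (real l + 1) / 2" if "l \<noteq> 0"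
      using that by (simp add: abel_coeff_def)
    then have "real l * abel_coeff l * (legP l t * s ^ l) = (1 - 1 / (real l + 1) / 2) * (legP l t * s ^ l)" if "l \<noteq> 0"
      using that by simp
    then show "legP l t * s ^ l - 1 / (real l + 1) * legP l t * s ^ l / 2 - (if l = 0 then 1 / 2 else 0)
      = real l * (?c l * s ^ l)"
      by (cases "l = 0") (simp_all add: algebra_simps)
  qed
  finally show "s * ?d = leg_gen t s - leg_mean t s / 2 - 1 / 2"
    using 1 sums_unique2 by blast
qed

text \<open>On \<open>{1/2..s}\<close> the generating function is at most twice its value at \<open>s\<close>, since the
radicand at \<open>s\<close> is at most four times that at \<open>r\<close>; integrate this from
\<open>1/2\<close>.\<close>

lemma leg_mean_le:
  assumes s: "1 / 2 \<le> s" "s < 1"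
  shows "leg_mean t s \<le> 2 + leg_gen t s"
proof -
  have gs: "leg_gen t s > 0" using leg_gen_eq[OF t, of s] legendre_radicand_pos[OF t, of s] s by simp
  have g: "leg_gen t r \<le> 2 * leg_gen t s" if r: "1 / 2 \<le> r" "r \<le> s" for r
  proof -
    have "(1 - s)\<^sup>2 \<le> (1 - r)\<^sup>2" using r s by (intro power_mono) auto
    moreover have "s * (1 - t) \<le> 1 * (1 - t)" "1 / 2 * (1 - t) \<le> r * (1 - t)"
      using r s t by (intro mult_right_mono; auto)+
    moreover have "0 \<le> (1 - s)\<^sup>2" "0 \<le> 1 - t" using t by auto
    moreover have "A + 2 * a \<le> 4 * (B + 2 * b)"
      if "A \<le> B" "a \<le> 1 * c" "1 / 2 * c \<le> b" "0 \<le> A" "0 \<le> c" for A B a b c :: real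
    proof -
      have "A \<le> 4 * B" "2 * a \<le> 8 * b" using that by auto
      then show ?thesis by simp
    qed
    ultimately have "(1 - s)\<^sup>2 + 2 * (s * (1 - t)) \<le> 4 * ((1 - r)\<^sup>2 + 2 * (r * (1 - t)))"
      by blast
    then have "1 - 2 * t * s + s\<^sup>2 \<le> 4 * (1 - 2 * t * r + r\<^sup>2)"
      by (simp add: power2_eq_square algebra_simps)
    then have "sqrt (1 - 2 * t * s + s\<^sup>2) \<le> sqrt (4 * (1 - 2 * t * r + r\<^sup>2))" by (rule real_sqrt_le_mono)
    then have "sqrt (1 - 2 * t * s + s\<^sup>2) \<le> 2 * sqrt (1 - 2 * t * r + r\<^sup>2)"
      by (simp only: real_sqrt_mult real_sqrt_four)
    moreover have "1 / b \<le> 2 * (1 / a)" if "a \<le> 2 * b" "0 < a" "0 < b" for a b :: real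
      using that by (simp add: field_simps)
    ultimately show ?thesis
      using leg_gen_eq[OF t, of s] leg_gen_eq[OF t, of r] legendre_radicand_pos[OF t, of s] legendre_radicand_pos[OF t, of r] s r
      by simp
  qed
  have half: "leg_mean t (1/2) \<le> 2"
  proof -
    have "leg_mean t (1/2) \<le> (\<Sum>l. (1/2) ^ l)"
      unfolding leg_mean_def
    proof (rule suminf_le)
      fix l
      have "\<bar>1 / (real l + 1)\<bar> * \<bar>legP l t\<bar> \<le> 1 * 1" by (intro mult_mono abs_legP_le_1 t) (auto simp: divide_le_eq)
      then have "1 / (real l + 1) * legP l t \<le> 1" unfolding abs_mult[symmetric] by linarith
      then show "1 / (real l + 1) * legP l t * (1/2) ^ l \<le> (1/2) ^ l"
        using mult_right_mono[of "1 / (real l + 1) * legP l t" 1 "(1/2) ^ l"] by simp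
    qed (use summable_mean[of "1/2"] in \<open>auto simp: summable_geometric\<close>)
    also have "\<dots> = 2" by (simp add: suminf_geometric)
    finally show ?thesis .
  qed
  have "2 * leg_gen t s * (1/2) - 1/2 * leg_mean t (1/2) \<le> 2 * leg_gen t s * s - s * leg_mean t s"
  proof (rule DERIV_nonneg_imp_nondecreasing[OF s(1)])
    fix r assume r: "1/2 \<le> r" "r \<le> s"
    have "((\<lambda>r. 2 * leg_gen t s * r - r * leg_mean t r) has_real_derivative 2 * leg_gen t s - leg_gen t r) (at r)"
      by (rule DERIV_diff, rule DERIV_cong[OF DERIV_cmult[OF DERIV_ident]], simp, rule leg_mean_derivative) (use r s in auto)
    then show "\<exists>y. ((\<lambda>r. 2 * leg_gen t s * r - r * leg_mean t r) has_real_derivative y) (at r) \<and> 0 \<le> y"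
      using g[OF r] by auto
  qed
  then have "s * leg_mean t s \<le> 1 + leg_gen t s * (2 * s - 1)"
    using half by (simp add: algebra_simps)
  also have "\<dots> \<le> 2 * s + leg_gen t s * s"
    using s gs by (intro add_mono mult_left_mono) auto
  finally have "s * leg_mean t s \<le> s * (2 + leg_gen t s)" by (simp add: algebra_simps)
  then show ?thesis using s by (simp only: mult_le_cancel_left_pos)
qed

text \<open>The derivative of \<open>abel_sum t\<close> is at least \<open>-3\<close> on \<open>{1/2..<1}\<close>. This almost
monotonicity, uniform in \<open>t\<close>, is the source of the uniform lower bound
\<open>abel_sum_ge\<close> and of the one-sided comparison \<open>abel_sum_le_limit\<close>.\<close>

lemma abel_sum_mono:
  assumes "1 / 2 \<le> r" "r \<le> s" "s < 1"
  shows "abel_sum t r + 3 * r \<le> abel_sum t s + 3 * s"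
proof (rule DERIV_nonneg_imp_nondecreasing[OF assms(2)])
  fix q assume q: "r \<le> q" "q \<le> s"
  then have q': "norm q < 1" "1/2 \<le> q" "q < 1" using assms by auto
  obtain d where d: "(abel_sum t has_real_derivative d) (at q)" "q * d = leg_gen t q - leg_mean t q / 2 - 1 / 2"
    using abel_sum_derivative[OF q'(1)] by blast
  have "leg_gen t q > 0" using leg_gen_eq[OF t, of q] legendre_radicand_pos[OF t, of q] q' by simp
  then have "q * d \<ge> - 3 / 2" using d(2) leg_mean_le[OF q'(2,3)] by linarith
  moreover have "q * (- 3) \<le> - 3 / 2" using q' by simp
  ultimately have "q * (- 3) \<le> q * d" by linarith
  then have "- 3 \<le> d" using q' by (simp only: mult_le_cancel_left_pos)
  then show "\<exists>y. ((\<lambda>q. abel_sum t q + 3 * q) has_real_derivative y) (at q) \<and> 0 \<le> y"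
    by (intro exI[of _ "d + 3"]) (auto intro!: derivative_eq_intros d(1))
qed

lemma abs_abel_partial_le:
  assumes "0 \<le> s" "s < 1"
  shows "\<bar>\<Sum>l\<le>L. abel_coeff l * legP l t * s ^ l\<bar> \<le> 1 / (1 - s)"
proof -
  have "\<bar>\<Sum>l\<le>L. abel_coeff l * legP l t * s ^ l\<bar> \<le> (\<Sum>l\<le>L. s ^ l)"
  proof (rule order_trans[OF sum_abs], rule sum_mono)
    fix l
    have "\<bar>abel_coeff l\<bar> * \<bar>legP l t\<bar> \<le> 1 * 1" using abel_coeff_bounds[of l] by (intro mult_mono abs_legP_le_1 t) auto
    then show "\<bar>abel_coeff l * legP l t * s ^ l\<bar> \<le> s ^ l"
      using assms mult_right_mono[of "\<bar>abel_coeff l\<bar> * \<bar>legP l t\<bar>" 1 "s ^ l"] by (simp add: abs_mult)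
  qed
  also have "\<dots> \<le> (\<Sum>l. s ^ l)"
    using assms by (intro sum_le_suminf summable_geometric) auto
  also have "\<dots> = 1 / (1 - s)" using assms by (simp add: suminf_geometric)
  finally show ?thesis .
qed

lemma abel_partial_tendsto:
  assumes "0 \<le> s" "s < 1"
  shows "(\<lambda>L. \<Sum>l\<le>L. abel_coeff l * legP l t * s ^ l) \<longlonglongrightarrow> abel_sum t s"
  unfolding abel_sum_def by (rule summable_LIMSEQ', rule summable_abel) (use assms in auto)

lemma abs_abel_sum_le:
  assumes "0 \<le> s" "s < 1" shows "\<bar>abel_sum t s\<bar> \<le> 1 / (1 - s)"
  by (rule tendsto_upperbound[OF tendsto_rabs[OF abel_partial_tendsto[OF assms]]])
    (use abs_abel_partial_le[OF assms] in auto)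

lemma abel_sum_ge:
  assumes "1 / 2 \<le> s" "s < 1" shows "- 4 \<le> abel_sum t s"
  using abel_sum_mono[OF order_refl assms] abs_abel_sum_le[of "1/2"] assms by auto

text \<open>Split \<open>2 * abel_coeff l = 1 / l + 1 / (l + 1)\<close>. Both series arise from the generating
function by integration, and the primitives are logarithms.\<close>

lemma abel_sum_closed_form:
  assumes t1: "t < 1" and s: "0 < s" "s < 1"
  defines "R \<equiv> \<lambda>s. sqrt (1 - 2 * t * s + s\<^sup>2)"
  shows "abel_sum t s = (ln 2 - ln (1 - t * s + R s) + (ln (s - t + R s) - ln (1 - t)) / s - 1) / 2"
proof -
  have s': "norm s < 1" using s by auto
  have rad: "0 < 1 - 2 * t * r + r\<^sup>2" and Rpos: "R r > 0" and dR: "(R has_real_derivative (r - t) / R r) (at r)"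
    and Rsq: "R r * R r = 1 - 2 * t * r + r\<^sup>2"
    if "norm r < 1" for r
  proof -
    show p: "0 < 1 - 2 * t * r + r\<^sup>2" using legendre_radicand_pos[OF t] that by simp
    then show "R r > 0" "R r * R r = 1 - 2 * t * r + r\<^sup>2" by (simp_all add: R_def)
    show "(R has_real_derivative (r - t) / R r) (at r)"
      unfolding R_def using p by (auto intro!: derivative_eq_intros simp: divide_simps)
  qed
  have pos1: "r - t + R r > 0" if "norm r < 1" for r
  proof (cases "t = - 1")
    case False
    then have "\<bar>t\<bar> < 1" using t t1 by auto
    then have "t\<^sup>2 < 1" by (simp add: abs_square_less_1)
    then have "(r - t)\<^sup>2 < 1 - 2 * t * r + r\<^sup>2" by (simp add: power2_eq_square algebra_simps)
    then have "sqrt ((r - t)\<^sup>2) < R r" unfolding R_def by (rule real_sqrt_less_mono)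
    then show ?thesis by simp
  qed (use Rpos[OF that] that in auto)
  have pos2: "1 - t * r + R r > 0" if "norm r < 1" for r
  proof -
    have "t * r \<le> 1"
      using that t mult_mono[of "\<bar>t\<bar>" 1 "\<bar>r\<bar>" 1] abs_le_D1[of "t * r"] by (simp add: abs_mult)
    then show ?thesis using Rpos[OF that] by simp
  qed
  have B: "s * leg_mean t s = ln (s - t + R s) - ln (1 - t)"
  proof -
    have "s * leg_mean t s - ln (s - t + R s) = 0 * leg_mean t 0 - ln (0 - t + R 0)"
    proof (rule DERIV_isconst3[where a="-1" and b=1 and f="\<lambda>r. r * leg_mean t r - ln (r - t + R r)"])
      fix r :: real assume "r \<in> {-1<..<1}"
      then have r: "norm r < 1" by auto
      have "((\<lambda>r. r * leg_mean t r - ln (r - t + R r)) has_real_derivative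
         leg_gen t r - (1 + (r - t) / R r) / (r - t + R r)) (at r)"
        using pos1[OF r]
        by (intro DERIV_diff leg_mean_derivative r) (auto intro!: derivative_eq_intros dR r)
      also have "(1 + (r - t) / R r) / (r - t + R r) = 1 / R r"
      proof -
        have "1 + (r - t) / R r = (r - t + R r) / R r" using Rpos[OF r] by (simp add: field_simps)
        then show ?thesis using pos1[OF r] by simp
      qed
      also have "leg_gen t r - 1 / R r = 0" using leg_gen_eq[OF t, of r] r by (simp add: R_def)
      finally show "((\<lambda>r. r * leg_mean t r - ln (r - t + R r)) has_real_derivative 0) (at r)" .
    qed (use s in auto)
    then show ?thesis by (simp add: R_def)
  qed
  define ac where "ac l = 1 / real l * legP l t" for l
  have ac: "summable (\<lambda>l. ac l * r ^ l)" if "norm r < 1" for r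
    unfolding ac_def by (rule summable_legendre_series[OF t]) (use that in \<open>auto simp: divide_le_eq\<close>)
  define A where "A r = (\<Sum>l. ac l * r ^ l)" for r
  have A: "A s = ln 2 - ln (1 - t * s + R s)"
  proof -
    have "A s + ln (1 - t * s + R s) = A 0 + ln (1 - t * 0 + R 0)"
    proof (rule DERIV_isconst3[where a="-1" and b=1 and f="\<lambda>r. A r + ln (1 - t * r + R r)"])
      fix r :: real assume "r \<in> {-1<..<1}"
      then have r: "norm r < 1" by auto
      define E where "E = (\<Sum>l. legP (Suc l) t * r ^ l)"
      have "(A has_real_derivative (\<Sum>l. diffs ac l * r ^ l)) (at r)"
        unfolding A_def by (rule termdiffs_strong'[of 1]) (use ac r in auto)
      moreover have "diffs ac = (\<lambda>l. legP (Suc l) t)" by (simp add: diffs_def ac_def fun_eq_iff)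
      ultimately have dA: "(A has_real_derivative E) (at r)" by (simp add: E_def)
      have "E = - (- t + (r - t) / R r) / (1 - t * r + R r)"
      proof (cases "r = 0")
        case True
        then show ?thesis using powser_zero[of "\<lambda>l. legP (Suc l) t"] by (simp add: E_def R_def)
      next
        case False
        have smE: "summable (\<lambda>l. diffs ac l * r ^ l)" by (rule termdiff_converges[OF r ac])
        have "(\<lambda>l. legP (Suc l) t * r ^ Suc l) sums (leg_gen t r - 1)"
          using sums_split_initial_segment[OF summable_sums[OF summable_gen[OF r]], of 1] by (simp add: leg_gen_def)
        moreover have "(\<lambda>l. r * (legP (Suc l) t * r ^ l)) sums (r * E)"
          using smE \<open>diffs ac = _\<close> unfolding E_def by (intro sums_mult summable_sums) simp
        ultimately have rE: "r * E = 1 / R r - 1"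
          using leg_gen_eq[OF t, of r] r sums_unique2 by (fastforce simp: R_def algebra_simps)
        have "r * (E * (R r * (1 - t * r + R r))) = (r * E) * R r * (1 - t * r + R r)" by simp
        also have "\<dots> = (1 - R r) * (1 - t * r + R r)"
          unfolding rE using Rpos[OF r] by (simp add: field_simps)
        also have "\<dots> = r * (t * R r - r + t)"
          using Rsq[OF r] by (simp add: algebra_simps power2_eq_square)
        finally have "E * (R r * (1 - t * r + R r)) = t * R r - r + t" using False by simp
        moreover have "- (- t + (r - t) / R r) = (t * R r - r + t) / R r"
          using Rpos[OF r] by (simp add: field_simps)
        ultimately show ?thesis using Rpos[OF r] pos2[OF r] by (simp only:) (simp add: eq_divide_eq)
      qed
      then have "E + (- t + (r - t) / R r) / (1 - t * r + R r) = 0"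
        by (simp only: minus_divide_left[symmetric] left_minus)
      moreover have "((\<lambda>r. A r + ln (1 - t * r + R r)) has_real_derivative
          E + (- t + (r - t) / R r) / (1 - t * r + R r)) (at r)"
        using pos2[OF r] by (auto intro!: derivative_eq_intros dA dR r)
      ultimately show "((\<lambda>r. A r + ln (1 - t * r + R r)) has_real_derivative 0) (at r)"
        by (rule DERIV_cong[rotated])
    qed (use s in auto)
    moreover have "A 0 = 0" unfolding A_def using powser_zero[of ac] by (simp add: ac_def)
    ultimately show ?thesis by (simp add: R_def)
  qed
  have "(\<lambda>l. (ac l * s ^ l + 1 / (real l + 1) * legP l t * s ^ l - (if l = 0 then 1 else 0)) / 2)
     sums ((A s + leg_mean t s - 1) / 2)"
    unfolding A_def leg_mean_def
    by (intro sums_divide sums_diff sums_add summable_sums ac summable_mean s') (rule sums_single[of 0 "\<lambda>_. 1", simplified])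
  also have "(\<lambda>l. (ac l * s ^ l + 1 / (real l + 1) * legP l t * s ^ l - (if l = 0 then 1 else 0)) / 2)
     = (\<lambda>l. abel_coeff l * legP l t * s ^ l)"
  proof
    fix l
    have "1 / r + 1 / (r + 1) = 2 * ((2 * r + 1) / (2 * r * (r + 1)))" if "r > 0" for r :: real
    proof -
      have "r + 1 \<noteq> 0" "r \<noteq> 0" using that by auto
      then show ?thesis by (simp add: divide_simps) (simp add: algebra_simps)
    qed
    then have "1 / real l + 1 / (real l + 1) = 2 * abel_coeff l" if "l \<noteq> 0"
      using that by (simp add: abel_coeff_def)
    then have "(1 / real l + 1 / (real l + 1)) * (legP l t * s ^ l) = 2 * abel_coeff l * (legP l t * s ^ l)" if "l \<noteq> 0"
      using that by simp
    then show "(ac l * s ^ l + 1 / (real l + 1) * legP l t * s ^ l - (if l = 0 then 1 else 0)) / 2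
      = abel_coeff l * legP l t * s ^ l"
      by (cases "l = 0") (simp_all add: ac_def algebra_simps)
  qed
  finally have "abel_sum t s = (A s + leg_mean t s - 1) / 2"
    unfolding abel_sum_def by (simp add: sums_iff)
  moreover have "leg_mean t s = (ln (s - t + R s) - ln (1 - t)) / s" using B s by (simp add: field_simps)
  ultimately show ?thesis using A by simp
qed

lemma abel_sum_tendsto:
  assumes t1: "t < 1"
  shows "(abel_sum t \<longlongrightarrow> (ln 2 - ln (1 - t) - 1) / 2) (at_left 1)"
proof -
  let ?R = "\<lambda>s. sqrt (1 - 2 * t * s + s\<^sup>2)"
  have R1: "?R 1 > 0" using t1 by simp
  have "((\<lambda>s. (ln 2 - ln (1 - t * s + ?R s) + (ln (s - t + ?R s) - ln (1 - t)) / s - 1) / 2) \<longlongrightarrow>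
     (ln 2 - ln (1 - t * 1 + ?R 1) + (ln (1 - t + ?R 1) - ln (1 - t)) / 1 - 1) / 2) (at_left 1)"
    by (intro tendsto_intros) (use R1 t1 in \<open>simp_all add: add_pos_pos less_imp_neq[symmetric]\<close>)
  moreover have "\<forall>\<^sub>F s in at_left 1. (ln 2 - ln (1 - t * s + ?R s) + (ln (s - t + ?R s) - ln (1 - t)) / s - 1) / 2 = abel_sum t s"
    using eventually_at_left_real[of 0 "1::real"]
    by (rule eventually_mono) (use abel_sum_closed_form[OF t1] in auto)
  ultimately have "(abel_sum t \<longlongrightarrow>
     (ln 2 - ln (1 - t * 1 + ?R 1) + (ln (1 - t + ?R 1) - ln (1 - t)) / 1 - 1) / 2) (at_left 1)"
    by (rule Lim_transform_eventually)
  then show ?thesis by (simp add: algebra_simps)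
qed

lemma abel_sum_le_limit:
  assumes t1: "t < 1" and s: "1 / 2 \<le> s" "s < 1"
  shows "abel_sum t s \<le> (ln 2 - ln (1 - t) - 1) / 2 + 3 * (1 - s)"
proof -
  have "((\<lambda>r. abel_sum t r + 3 * r) \<longlongrightarrow> (ln 2 - ln (1 - t) - 1) / 2 + 3 * 1) (at_left 1)"
    by (intro tendsto_intros abel_sum_tendsto t1)
  moreover have "\<forall>\<^sub>F r in at_left 1. abel_sum t s + 3 * s \<le> abel_sum t r + 3 * r"
    using eventually_at_left_real[OF s(2)] by (rule eventually_mono) (use abel_sum_mono s in auto)
  ultimately have "abel_sum t s + 3 * s \<le> (ln 2 - ln (1 - t) - 1) / 2 + 3 * 1"
    by (intro tendsto_lowerbound) auto
  then show ?thesis by simp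
qed

end

section \<open>The regularised Green's function\<close>

text \<open>The limit of \<open>G_reg lam L\<close> for \<open>L \<rightarrow> \<infinity>\<close>.\<close>

definition G_abel :: "real \<Rightarrow> real^3 \<Rightarrow> real^3 \<Rightarrow> real" where
  "G_abel lam x y = abel_sum (x \<bullet> y) lam"

lemma inner_sphere_le_1: "x \<in> S2 \<Longrightarrow> y \<in> S2 \<Longrightarrow> \<bar>x \<bullet> y\<bar> \<le> 1" for x y :: "real^3"
  using Cauchy_Schwarz_ineq2[of x y] by simp

lemma inner_sphere_less_1:
  fixes x y :: "real^3"
  assumes "x \<in> S2" "y \<in> S2" "x \<noteq> y" shows "x \<bullet> y < 1"
proof -
  have "0 < (x - y) \<bullet> (x - y)" using assms by simp
  also have "\<dots> = 2 - 2 * (x \<bullet> y)"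
    unfolding inner_diff_left inner_diff_right using assms by (simp add: inner_commute dot_square_norm)
  finally show ?thesis by simp
qed

text \<open>On the sphere \<open>(norm (x - y))\<^sup>2 = 2 (1 - x \<bullet> y)\<close>; this is the limit found in
\<open>abel_sum_tendsto\<close>.\<close>

lemma Green_eq_inner:
  assumes "x \<in> S2" "y \<in> S2" "x \<noteq> y"
  shows "Green x y = (ln 2 - ln (1 - x \<bullet> y) - 1) / 2"
proof -
  have pos: "1 - x \<bullet> y > 0" using inner_sphere_less_1[OF assms] by simp
  have "norm (x - y) = sqrt (2 * (1 - x \<bullet> y))"
    unfolding norm_eq_sqrt_inner inner_diff_left inner_diff_right
    using assms by (simp add: inner_commute dot_square_norm)
  then have "ln (norm (x - y)) = ln (2 * (1 - x \<bullet> y)) / 2"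
    using pos by (simp add: ln_sqrt)
  also have "ln (2 * (1 - x \<bullet> y)) = ln 2 + ln (1 - x \<bullet> y)"
    using pos ln_mult[of 2 "1 - x \<bullet> y"] by simp
  finally show ?thesis by (simp add: Green_def field_simps)
qed

lemma G_reg_eq_partial:
  assumes "x \<in> S2" "y \<in> S2"
  shows "G_reg lam L x y = (\<Sum>l\<le>L. abel_coeff l * legP l (x \<bullet> y) * lam ^ l)"
proof -
  have "G_reg lam L x y = (\<Sum>l=1..L. lam ^ l * (2 * pi / (real l * (real l + 1))) * (\<Sum>m=-int l..int l. Ylm l m x * Ylm l m y))"
    unfolding G_reg_def by (simp add: sum_distrib_left mult.assoc)
  also have "\<dots> = (\<Sum>l=1..L. abel_coeff l * legP l (x \<bullet> y) * lam ^ l)"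
    unfolding addition_theorem[OF assms]
  proof (intro sum.cong refl)
    fix l
    have "2 * pi / q * (a / (4 * pi) * p) = a / (2 * q) * p" for q a p :: real by simp
    then have e: "2 * pi / (real l * (real l + 1)) * ((2 * real l + 1) / (4 * pi) * p)
        = (2 * real l + 1) / (2 * (real l * (real l + 1))) * p" for p by blast
    show "lam ^ l * (2 * pi / (real l * (real l + 1))) * ((2 * real l + 1) / (4 * pi) * legP l (x \<bullet> y))
      = abel_coeff l * legP l (x \<bullet> y) * lam ^ l"
      (is "?l = ?r")
    proof -
      have "?l = lam ^ l * (2 * pi / (real l * (real l + 1)) * ((2 * real l + 1) / (4 * pi) * legP l (x \<bullet> y)))"
        by (simp only: mult.assoc)
      also have "\<dots> = ?r"
        unfolding e by (simp only: abel_coeff_def mult_ac)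
      finally show ?thesis .
    qed
  qed
  also have "\<dots> = (\<Sum>l\<le>L. abel_coeff l * legP l (x \<bullet> y) * lam ^ l)"
    by (rule sum.mono_neutral_left) (auto simp: Suc_le_eq)
  finally show ?thesis .
qed

context
  fixes x y :: "real^3"
  assumes xy: "x \<in> S2" "y \<in> S2"
begin

lemma abs_G_reg_le: "0 \<le> lam \<Longrightarrow> lam < 1 \<Longrightarrow> \<bar>G_reg lam L x y\<bar> \<le> 1 / (1 - lam)"
  unfolding G_reg_eq_partial[OF xy] by (rule abs_abel_partial_le[OF inner_sphere_le_1[OF xy]])

lemma G_reg_tendsto: "0 \<le> lam \<Longrightarrow> lam < 1 \<Longrightarrow> (\<lambda>L. G_reg lam L x y) \<longlonglongrightarrow> G_abel lam x y"
  unfolding G_reg_eq_partial[OF xy] G_abel_def by (rule abel_partial_tendsto[OF inner_sphere_le_1[OF xy]])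

lemma abs_G_abel_le: "0 \<le> lam \<Longrightarrow> lam < 1 \<Longrightarrow> \<bar>G_abel lam x y\<bar> \<le> 1 / (1 - lam)"
  unfolding G_abel_def by (rule abs_abel_sum_le[OF inner_sphere_le_1[OF xy]])

lemma G_abel_ge: "1 / 2 \<le> lam \<Longrightarrow> lam < 1 \<Longrightarrow> - 4 \<le> G_abel lam x y"
  unfolding G_abel_def by (rule abel_sum_ge[OF inner_sphere_le_1[OF xy]])

lemma G_abel_le_Green: "x \<noteq> y \<Longrightarrow> 1 / 2 \<le> lam \<Longrightarrow> lam < 1 \<Longrightarrow> G_abel lam x y \<le> Green x y + 3 * (1 - lam)"
  unfolding G_abel_def Green_eq_inner[OF xy]
  using abel_sum_le_limit[OF inner_sphere_le_1[OF xy] inner_sphere_less_1[OF xy]] by (simp add: Green_eq_inner[OF xy])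

lemma G_abel_tendsto: "x \<noteq> y \<Longrightarrow> ((\<lambda>lam. G_abel lam x y) \<longlongrightarrow> Green x y) (at_left 1)"
  unfolding G_abel_def
  using abel_sum_tendsto[OF inner_sphere_le_1[OF xy] inner_sphere_less_1[OF xy]] by (simp add: Green_eq_inner[OF xy])

end

section \<open>Positive definiteness of the regularised kernel\<close>

interpretation area2: pair_sigma_finite area area ..

interpretation area_pair: finite_measure "area \<Otimes>\<^sub>M area"
  by (rule finite_measure_pair_measure) (rule finite_measure_area)+

lemma area_imp_borel_measurable: "f \<in> M \<rightarrow>\<^sub>M area \<Longrightarrow> f \<in> borel_measurable M"
  using measurable_compose[OF _ measurable_area_ident] by simp

lemma measurable_Green_area:
  assumes "f \<in> M \<rightarrow>\<^sub>M area" "g \<in> M \<rightarrow>\<^sub>M area"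
  shows "(\<lambda>p. Green (f p) (g p)) \<in> borel_measurable M"
  by (intro measurable_Green area_imp_borel_measurable assms)

lemma measurable_Green_pair [measurable]: "(\<lambda>p. Green (fst p) (snd p)) \<in> borel_measurable (area \<Otimes>\<^sub>M area)"
  by (rule measurable_Green_area) measurable

lemma measurable_Green_left [measurable]: "(\<lambda>y. Green x y) \<in> borel_measurable area"
  by (intro measurable_Green measurable_area_ident) simp

lemma continuous_Ylm: "continuous_on UNIV (Ylm l m)"
  unfolding Ylm_def[abs_def] Let_def
  by (cases "0 \<le> m") (auto intro!: continuous_intros)

lemma measurable_Ylm [measurable]: "Ylm l m \<in> borel_measurable area"
  by (intro borel_measurable_area borel_measurable_continuous_onI continuous_Ylm)

lemma Ylm_bounded:
  obtains B where "\<And>y. y \<in> S2 \<Longrightarrow> \<bar>Ylm l m y\<bar> \<le> B"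
proof -
  have "compact (Ylm l m ` S2)"
    by (intro compact_continuous_image continuous_on_subset[OF continuous_Ylm]) auto
  then have "bounded (Ylm l m ` S2)" by (rule compact_imp_bounded)
  then obtain a where "\<forall>x\<in>S2. \<bar>Ylm l m x\<bar> \<le> a" unfolding bounded_iff by auto
  then show ?thesis by (intro that[of a]) blast
qed

lemma measurable_G_reg:
  assumes [measurable]: "f \<in> M \<rightarrow>\<^sub>M area" "g \<in> M \<rightarrow>\<^sub>M area"
  shows "(\<lambda>p. G_reg lam L (f p) (g p)) \<in> borel_measurable M"
  unfolding G_reg_def by measurable

lemma measurable_G_abel:
  assumes f: "f \<in> M \<rightarrow>\<^sub>M area" and g: "g \<in> M \<rightarrow>\<^sub>M area" and lam: "0 \<le> lam" "lam < 1"
  shows "(\<lambda>p. G_abel lam (f p) (g p)) \<in> borel_measurable M"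
proof (rule borel_measurable_LIMSEQ_real)
  fix p assume "p \<in> space M"
  then show "(\<lambda>L. G_reg lam L (f p) (g p)) \<longlonglongrightarrow> G_abel lam (f p) (g p)"
    using measurable_space[OF f] measurable_space[OF g] by (intro G_reg_tendsto lam) auto
qed (rule measurable_G_reg[OF f g])

lemma G_reg_commute: "G_reg lam L x y = G_reg lam L y x"
  unfolding G_reg_def by (simp add: mult_ac)

definition pot :: "(real^3 \<Rightarrow> real^3 \<Rightarrow> real) \<Rightarrow> (real^3 \<Rightarrow> real) \<Rightarrow> real^3 \<Rightarrow> real" where
  "pot K f y = (LINT x|area. K y x * f x)"

lemma integrable_bounded_mult:
  fixes f g :: "'a \<Rightarrow> real"
  assumes f: "integrable M f" and g: "g \<in> borel_measurable M" and B: "\<And>x. x \<in> space M \<Longrightarrow> \<bar>g x\<bar> \<le> B"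
  shows "integrable M (\<lambda>x. g x * f x)"
proof (rule Bochner_Integration.integrable_bound)
  show "integrable M (\<lambda>x. B * \<bar>f x\<bar>)" using f by auto
  show "(\<lambda>x. g x * f x) \<in> borel_measurable M" using f g by measurable
  show "AE x in M. norm (g x * f x) \<le> norm (B * \<bar>f x\<bar>)"
    using B by (intro AE_I2) (force simp: abs_mult intro!: mult_mono)
qed

lemma integrable_pair_product:
  fixes a b :: "real^3 \<Rightarrow> real"
  assumes "integrable area a" "integrable area b"
  shows "integrable (area \<Otimes>\<^sub>M area) (\<lambda>p. a (fst p) * b (snd p))"
    and "(LINT p|(area \<Otimes>\<^sub>M area). a (fst p) * b (snd p)) = (LINT x|area. a x) * (LINT x|area. b x)"
proof -
  have [measurable]: "a \<in> borel_measurable area" "b \<in> borel_measurable area" using assms by auto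
  show i: "integrable (area \<Otimes>\<^sub>M area) (\<lambda>p. a (fst p) * b (snd p))"
    by (rule area2.Fubini_integrable) (use assms in \<open>simp_all add: abs_mult\<close>)
  show "(LINT p|(area \<Otimes>\<^sub>M area). a (fst p) * b (snd p)) = (LINT x|area. a x) * (LINT x|area. b x)"
    using area2.integral_fst'[OF i] by simp
qed

text \<open>In the basis of spherical harmonics the expression is a sum of squares with nonnegative weights:
the energy of the difference between unit point charges at \<open>y r\<close> and the density
\<open>f\<close>. Unlike for the logarithmic kernel, the self-energies of the point charges are finite.\<close>

lemma G_reg_square_expansion:
  assumes f: "integrable area f" and lam: "0 \<le> lam"
  shows "0 \<le> (\<Sum>r\<in>I. \<Sum>s\<in>I. G_reg lam L (y r) (y s)) - 2 * (\<Sum>r\<in>I. pot (G_reg lam L) f (y r))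
      + (LINT z|area. f z * pot (G_reg lam L) f z)"
proof -
  define w where "w l = lam ^ l * (2 * pi / (real l * (real l + 1)))" for l
  define F where "F l m = (LINT z|area. Ylm l m z * f z)" for l m
  define P where "P l m = (\<Sum>r\<in>I. Ylm l m (y r))" for l m
  have G: "G_reg lam L x z = (\<Sum>l=1..L. \<Sum>m=-int l..int l. w l * (Ylm l m x * Ylm l m z))" for x z
    unfolding G_reg_def w_def by (simp add: mult.assoc)
  have int: "integrable area (\<lambda>z. Ylm l m z * f z)" for l m
    using Ylm_bounded[of l m] by (metis integrable_bounded_mult[OF f measurable_Ylm] space_area)
  have pt: "pot (G_reg lam L) f x = (\<Sum>l=1..L. \<Sum>m=-int l..int l. w l * (Ylm l m x * F l m))" for x
  proof -
    have "pot (G_reg lam L) f x = (LINT z|area. (\<Sum>l=1..L. \<Sum>m=-int l..int l. w l * Ylm l m x * (Ylm l m z * f z)))"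
      unfolding pot_def G by (simp add: sum_distrib_right mult.assoc)
    also have "\<dots> = (\<Sum>l=1..L. \<Sum>m=-int l..int l. w l * Ylm l m x * F l m)"
      unfolding F_def using int by (subst Bochner_Integration.integral_sum, simp)
        (subst Bochner_Integration.integral_sum, simp_all)
    finally show ?thesis by (simp add: mult.assoc)
  qed
  have collect: "(\<Sum>r\<in>I. \<Sum>l=1..L. \<Sum>m=-int l..int l. w l * (Ylm l m (y r) * c l m))
      = (\<Sum>l=1..L. \<Sum>m=-int l..int l. w l * (P l m * c l m))" for c
  proof -
    have "(\<Sum>r\<in>I. \<Sum>l=1..L. \<Sum>m=-int l..int l. w l * (Ylm l m (y r) * c l m))
      = (\<Sum>l=1..L. \<Sum>r\<in>I. \<Sum>m=-int l..int l. w l * (Ylm l m (y r) * c l m))"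
      by (rule sum.swap)
    also have "\<dots> = (\<Sum>l=1..L. \<Sum>m=-int l..int l. \<Sum>r\<in>I. w l * (Ylm l m (y r) * c l m))"
      by (intro sum.cong refl sum.swap)
    finally show ?thesis by (simp add: P_def sum_distrib_left sum_distrib_right)
  qed
  have 1: "(\<Sum>r\<in>I. \<Sum>s\<in>I. G_reg lam L (y r) (y s)) = (\<Sum>l=1..L. \<Sum>m=-int l..int l. w l * (P l m * P l m))"
  proof -
    have "(\<Sum>s\<in>I. G_reg lam L (y r) (y s)) = (\<Sum>l=1..L. \<Sum>m=-int l..int l. w l * (Ylm l m (y r) * P l m))" for r
    proof -
      have "(\<Sum>s\<in>I. G_reg lam L (y r) (y s)) = (\<Sum>s\<in>I. G_reg lam L (y s) (y r))"
        by (intro sum.cong refl G_reg_commute)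
      also have "\<dots> = (\<Sum>l=1..L. \<Sum>m=-int l..int l. w l * (P l m * Ylm l m (y r)))"
        unfolding G by (rule collect)
      finally show ?thesis by (simp only: mult.commute[of "P _ _"])
    qed
    then show ?thesis by (simp only: collect)
  qed
  have 2: "(\<Sum>r\<in>I. pot (G_reg lam L) f (y r)) = (\<Sum>l=1..L. \<Sum>m=-int l..int l. w l * (P l m * F l m))"
    unfolding pt by (rule collect)
  have 3: "(LINT z|area. f z * pot (G_reg lam L) f z) = (\<Sum>l=1..L. \<Sum>m=-int l..int l. w l * (F l m * F l m))"
  proof -
    have "(LINT z|area. f z * pot (G_reg lam L) f z)
        = (LINT z|area. (\<Sum>l=1..L. \<Sum>m=-int l..int l. w l * F l m * (Ylm l m z * f z)))"
      unfolding pt by (simp add: sum_distrib_left sum_distrib_right mult_ac)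
    also have "\<dots> = (\<Sum>l=1..L. \<Sum>m=-int l..int l. w l * F l m * F l m)"
      unfolding F_def[symmetric] using int by (subst Bochner_Integration.integral_sum, simp)
        (subst Bochner_Integration.integral_sum, simp_all add: F_def)
    finally show ?thesis by (simp add: mult.assoc)
  qed
  have "(\<Sum>l=1..L. \<Sum>m=-int l..int l. w l * (P l m * P l m)) - 2 * (\<Sum>l=1..L. \<Sum>m=-int l..int l. w l * (P l m * F l m))
     + (\<Sum>l=1..L. \<Sum>m=-int l..int l. w l * (F l m * F l m))
     = (\<Sum>l=1..L. \<Sum>m=-int l..int l. w l * (P l m - F l m)\<^sup>2)"
    unfolding sum_distrib_left sum.distrib[symmetric] sum_subtractf[symmetric]
    by (intro sum.cong refl) (simp add: power2_eq_square algebra_simps)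
  also have "0 \<le> \<dots>"
    using lam by (intro sum_nonneg mult_nonneg_nonneg) (auto simp: w_def)
  finally show ?thesis unfolding 1 2 3 .
qed

lemma G_abel_square_expansion:
  assumes f: "integrable area f" and y: "\<And>r. r \<in> I \<Longrightarrow> y r \<in> S2" and lam: "0 \<le> lam" "lam < 1"
  shows "0 \<le> (\<Sum>r\<in>I. \<Sum>s\<in>I. G_abel lam (y r) (y s)) - 2 * (\<Sum>r\<in>I. pot (G_abel lam) f (y r))
      + (LINT z|area. f z * pot (G_abel lam) f z)"
proof -
  have mf [measurable]: "f \<in> borel_measurable area" using f by auto
  let ?B = "1 / (1 - lam)"
  have pt: "(\<lambda>L. pot (G_reg lam L) f x) \<longlonglongrightarrow> pot (G_abel lam) f x" if x: "x \<in> S2" for x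
    unfolding pot_def
  proof (rule integral_dominated_convergence[where w="\<lambda>z. ?B * \<bar>f z\<bar>"])
    have c: "(\<lambda>_. x) \<in> area \<rightarrow>\<^sub>M area" using x by (intro measurable_const) simp
    show "(\<lambda>z. G_abel lam x z * f z) \<in> borel_measurable area"
      by (intro borel_measurable_times mf measurable_G_abel[OF c] lam) simp
    show "(\<lambda>z. G_reg lam L x z * f z) \<in> borel_measurable area" for L
      by (intro borel_measurable_times mf measurable_G_reg[OF c]) simp
    show "AE z in area. norm (G_reg lam L x z * f z) \<le> ?B * \<bar>f z\<bar>" for L
      using abs_G_reg_le[OF x _ lam] by (intro AE_I2) (simp only: space_area real_norm_def abs_mult mult_right_mono abs_ge_zero)
    show "AE z in area. (\<lambda>L. G_reg lam L x z * f z) \<longlonglongrightarrow> G_abel lam x z * f z"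
      using G_reg_tendsto[OF x _ lam] by (intro AE_I2 tendsto_mult tendsto_const) auto
  qed (use f in auto)
  have bd: "\<bar>pot (G_reg lam L) f x\<bar> \<le> ?B * (LINT z|area. \<bar>f z\<bar>)" if x: "x \<in> S2" for x L
  proof -
    have "\<bar>pot (G_reg lam L) f x\<bar> \<le> (LINT z|area. \<bar>G_reg lam L x z * f z\<bar>)"
      unfolding pot_def by (rule integral_abs_bound)
    also have "\<dots> \<le> (LINT z|area. ?B * \<bar>f z\<bar>)"
    proof (rule integral_mono')
      show "integrable area (\<lambda>z. ?B * \<bar>f z\<bar>)" using f by auto
      show "0 \<le> ?B * \<bar>f z\<bar>" for z using lam by simp
    qed (use abs_G_reg_le[OF x _ lam] in \<open>simp only: space_area abs_mult mult_right_mono abs_ge_zero\<close>)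
    finally show ?thesis by simp
  qed
  have mp [measurable]: "pot (G_reg lam L) f \<in> borel_measurable area" for L
  proof -
    have [measurable]: "(\<lambda>p. G_reg lam L (fst p) (snd p)) \<in> borel_measurable (area \<Otimes>\<^sub>M area)"
      by (rule measurable_G_reg) measurable
    have "(\<lambda>x. LINT z|area. (\<lambda>(x, z). G_reg lam L x z * f z) (x, z)) \<in> borel_measurable area"
      by (rule area.borel_measurable_lebesgue_integral) (simp add: case_prod_unfold)
    then show ?thesis unfolding pot_def by simp
  qed
  have mpa [measurable]: "pot (G_abel lam) f \<in> borel_measurable area"
    by (rule borel_measurable_LIMSEQ_real[OF _ mp]) (use pt in auto)
  have "(\<lambda>L. LINT z|area. f z * pot (G_reg lam L) f z) \<longlonglongrightarrow> (LINT z|area. f z * pot (G_abel lam) f z)"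
  proof (rule integral_dominated_convergence[where w="\<lambda>z. \<bar>f z\<bar> * (?B * (LINT z|area. \<bar>f z\<bar>))"])
    show "AE z in area. norm (f z * pot (G_reg lam L) f z) \<le> \<bar>f z\<bar> * (?B * (LINT z|area. \<bar>f z\<bar>))" for L
      using bd by (intro AE_I2) (simp only: space_area real_norm_def abs_mult mult_left_mono abs_ge_zero)
    show "AE z in area. (\<lambda>L. f z * pot (G_reg lam L) f z) \<longlonglongrightarrow> f z * pot (G_abel lam) f z"
      using pt by (intro AE_I2 tendsto_mult tendsto_const) auto
  qed (use f in auto)
  then have "(\<lambda>L. (\<Sum>r\<in>I. \<Sum>s\<in>I. G_reg lam L (y r) (y s)) - 2 * (\<Sum>r\<in>I. pot (G_reg lam L) f (y r))
      + (LINT z|area. f z * pot (G_reg lam L) f z)) \<longlonglongrightarrow> (\<Sum>r\<in>I. \<Sum>s\<in>I. G_abel lam (y r) (y s))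
      - 2 * (\<Sum>r\<in>I. pot (G_abel lam) f (y r)) + (LINT z|area. f z * pot (G_abel lam) f z)"
    by (intro tendsto_intros G_reg_tendsto pt y lam)
  then show ?thesis
    by (rule tendsto_lowerbound) (intro always_eventually allI G_reg_square_expansion f lam(1), simp)
qed

section \<open>Convexity of the entropy integrand\<close>

text \<open>Young's inequality for the conjugate pair \<open>r ln r - r\<close> and \<open>exp t\<close>: it makes
potentials with exponential moments integrable against densities of finite entropy.\<close>

lemma young_exp: "0 \<le> r \<Longrightarrow> r * t \<le> r * ln r - r + exp t" for r t :: real
proof (cases "r = 0")
  case False
  assume "0 \<le> r"
  with False have r: "0 < r" by simp
  have "1 + (t - ln r) \<le> exp (t - ln r)" by (rule exp_ge_add_one_self)
  then have "r * (1 + (t - ln r)) \<le> r * exp (t - ln r)" using r by (intro mult_left_mono) auto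
  also have "r * exp (t - ln r) = exp t" using r by (simp add: exp_diff)
  finally show ?thesis by (simp add: algebra_simps)
qed simp

text \<open>This pointwise bound by the squared Hellinger distance yields convexity, its quantitative form
\<open>mult_ln_midpoint\<close>, and the case of equality in Gibbs' inequality.\<close>

lemma relative_entropy_hellinger:
  fixes r m :: real
  assumes "0 \<le> r" "0 < m"
  shows "(sqrt r - sqrt m)\<^sup>2 \<le> r * ln r - r * ln m - r + m"
proof (cases "r = 0")
  case False
  with assms have r: "0 < r" by simp
  have "ln (sqrt (m / r)) \<le> sqrt (m / r) - 1" using r assms by (intro ln_le_minus_one) auto
  then have "ln m - ln r \<le> 2 * sqrt (m / r) - 2" using r assms by (simp add: ln_sqrt ln_div)
  then have "r * (ln m - ln r) \<le> r * (2 * sqrt (m / r) - 2)" using r by (intro mult_left_mono) auto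
  moreover have "r * sqrt (m / r) = sqrt r * sqrt m"
    using r assms by (simp add: real_sqrt_divide field_simps)
  ultimately have "2 * r - 2 * (sqrt r * sqrt m) \<le> r * ln r - r * ln m"
    by (simp add: algebra_simps)
  moreover have "(sqrt r - sqrt m)\<^sup>2 = r + m - 2 * (sqrt r * sqrt m)"
    using r assms by (simp add: power2_diff)
  ultimately show ?thesis by simp
qed (use assms in simp)

lemma mult_ln_tangent:
  fixes r m :: real
  assumes "0 \<le> r" "0 < m" shows "m * ln m + (1 + ln m) * (r - m) \<le> r * ln r"
proof -
  have "0 \<le> r * ln r - r * ln m - r + m"
    using relative_entropy_hellinger[OF assms] by (meson order_trans zero_le_power2)
  then show ?thesis by (simp add: algebra_simps)
qed

lemma mult_ln_convex:
  fixes a b t :: real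
  assumes a: "0 \<le> a" and b: "0 \<le> b" and t: "0 < t" "t < 1"
  defines "m \<equiv> (1 - t) * a + t * b"
  shows "m * ln m \<le> (1 - t) * (a * ln a) + t * (b * ln b)"
proof (cases "m = 0")
  case True
  have "0 \<le> (1 - t) * a" "0 \<le> t * b" using a b t by auto
  with True have "(1 - t) * a = 0" "t * b = 0" unfolding m_def by linarith+
  then show ?thesis using True t by auto
next
  case False
  have "0 \<le> m" unfolding m_def using a b t by auto
  with False have m: "0 < m" by simp
  have "(1 - t) * (m * ln m + (1 + ln m) * (a - m)) + t * (m * ln m + (1 + ln m) * (b - m))
     \<le> (1 - t) * (a * ln a) + t * (b * ln b)"
    using t by (intro add_mono mult_left_mono mult_ln_tangent a b m) auto
  also have "(1 - t) * (m * ln m + (1 + ln m) * (a - m)) + t * (m * ln m + (1 + ln m) * (b - m))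
     = m * ln m + (1 + ln m) * ((1 - t) * a + t * b - m)"
    by (simp add: algebra_simps)
  finally show ?thesis by (simp add: m_def)
qed

text \<open>The midpoint defect of \<open>r ln r\<close> controls \<open>(sqrt a - sqrt b)\<^sup>2\<close>, and
\<open>\<bar>a - b\<bar> = \<bar>sqrt a - sqrt b\<bar> * (sqrt a + sqrt b)\<close> is split by the weighted
arithmetic-geometric inequality with a free weight \<open>d\<close>.\<close>

lemma mult_ln_midpoint:
  fixes a b d :: real
  assumes a: "0 \<le> a" and b: "0 \<le> b" and d: "0 < d"
  defines "m \<equiv> (a + b) / 2"
  shows "\<bar>a - b\<bar> \<le> (a * ln a + b * ln b - 2 * (m * ln m)) / d + d * (a + b)"
proof (cases "m = 0")
  case True
  then have "a = 0" "b = 0" using a b by (auto simp: m_def)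
  then show ?thesis by (simp add: m_def)
next
  case False
  then have m: "0 < m" using a b by (auto simp: m_def)
  let ?h = "a * ln a + b * ln b - 2 * (m * ln m)"
  define x y z where "x = sqrt a" and "y = sqrt b" and "z = sqrt m"
  have sq: "x\<^sup>2 = a" "y\<^sup>2 = b" "0 \<le> x" "0 \<le> y" using a b by (auto simp: x_def y_def)
  have "(x - z)\<^sup>2 + (y - z)\<^sup>2 \<le> (a * ln a - a * ln m - a + m) + (b * ln b - b * ln m - b + m)"
    unfolding x_def y_def z_def by (intro add_mono relative_entropy_hellinger a b m)
  also have "\<dots> = ?h - (a + b - 2 * m) * (1 + ln m)"
    by (simp add: algebra_simps)
  also have "\<dots> = ?h" by (simp add: m_def)
  finally have h: "(x - z)\<^sup>2 + (y - z)\<^sup>2 \<le> ?h" .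
  have "(x - y)\<^sup>2 \<le> 2 * ((x - z)\<^sup>2 + (y - z)\<^sup>2)"
  proof -
    have "0 \<le> (x + y - 2 * z)\<^sup>2" by simp
    then show ?thesis by (simp add: power2_eq_square algebra_simps)
  qed
  then have h': "(x - y)\<^sup>2 \<le> 2 * ?h" by (rule order_trans[OF _ mult_left_mono[OF h]]) simp
  have "\<bar>a - b\<bar> = \<bar>x - y\<bar> * (x + y)"
  proof -
    have "a - b = (x - y) * (x + y)" unfolding sq(1,2)[symmetric] by (simp add: power2_eq_square algebra_simps)
    then show ?thesis using sq by (simp add: abs_mult)
  qed
  also have "\<dots> \<le> (x - y)\<^sup>2 / (2 * d) + d * (x + y)\<^sup>2 / 2"
  proof -
    have "2 * d * (p * q) = 2 * p * (d * q)" for p q :: real by simp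
    then have "2 * d * (\<bar>x - y\<bar> * (x + y)) \<le> (x - y)\<^sup>2 + d * d * (x + y)\<^sup>2"
      using sum_squares_bound[of "\<bar>x - y\<bar>" "d * (x + y)"]
      by (simp only: power2_abs power_mult_distrib power2_eq_square[of d])
    then have "\<bar>x - y\<bar> * (x + y) \<le> ((x - y)\<^sup>2 + d * d * (x + y)\<^sup>2) / (2 * d)"
      using d by (simp add: pos_le_divide_eq mult.commute)
    also have "\<dots> = (x - y)\<^sup>2 / (2 * d) + d * (x + y)\<^sup>2 / 2" using d by (simp add: add_divide_distrib)
    finally show ?thesis .
  qed
  also have "(x - y)\<^sup>2 / (2 * d) \<le> ?h / d"
  proof -
    have "2 * ?h / (2 * d) = ?h / d" by (rule mult_divide_mult_cancel_left) simp
    then show ?thesis using divide_right_mono[OF h', of "2 * d"] d by (simp only: mult_pos_pos zero_less_numeral less_imp_le)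
  qed
  also have "d * (x + y)\<^sup>2 / 2 \<le> d * (a + b)"
  proof -
    have "0 \<le> (x - y)\<^sup>2" by simp
    then have "(x + y)\<^sup>2 \<le> 2 * (a + b)" unfolding sq(1,2)[symmetric] by (simp add: power2_eq_square algebra_simps)
    then show ?thesis using d mult_left_mono[of "(x + y)\<^sup>2" "2 * (a + b)" d] by simp
  qed
  finally show ?thesis by simp
qed

lemma tendsto_mult_ln:
  fixes f :: "'a \<Rightarrow> real"
  assumes f: "(f \<longlongrightarrow> x) F" and pos: "\<forall>\<^sub>F n in F. 0 \<le> f n"
  shows "((\<lambda>n. f n * ln (f n)) \<longlongrightarrow> x * ln x) F"
proof (cases "x = 0")
  case False
  then show ?thesis using f by (intro tendsto_intros)
next
  case True
  have "((\<lambda>n. 2 * sqrt (f n)) \<longlongrightarrow> 2 * sqrt 0) F" using f True by (intro tendsto_intros) simp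
  then have lim: "((\<lambda>n. 2 * sqrt (f n)) \<longlongrightarrow> 0) F" by simp
  have "\<forall>\<^sub>F n in F. f n < 1" using f True order_tendstoD(2)[of f 0 F 1] by simp
  then have "\<forall>\<^sub>F n in F. norm (f n * ln (f n)) \<le> 2 * sqrt (f n)"
    using pos
  proof eventually_elim
    case (elim n)
    show ?case
    proof (cases "f n = 0")
      case False
      with elim have p: "0 < f n" "f n < 1" by auto
      have "ln (1 / sqrt (f n)) \<le> 1 / sqrt (f n) - 1" using p by (intro ln_le_minus_one) auto
      then have "- ln (f n) \<le> 2 / sqrt (f n)" using p by (simp add: ln_div ln_sqrt)
      then have "f n * (- ln (f n)) \<le> f n * (2 / sqrt (f n))" using p by (intro mult_left_mono) auto
      also have "\<dots> = 2 * sqrt (f n)" using p real_sqrt_mult_self[of "f n"] by (simp add: field_simps)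
      finally show ?thesis using p by (simp add: abs_mult)
    qed simp
  qed
  then show ?thesis using lim True by (simp add: Lim_null_comparison)
qed

text \<open>Lower semicontinuity along a sequence, in the form used for minimising sequences: the upper bound on
the integrals also gives the integrability of the limit.\<close>

lemma fatou_integral:
  fixes f :: "nat \<Rightarrow> 'a \<Rightarrow> real"
  assumes lim: "AE x in M. (\<lambda>n. f n x) \<longlonglongrightarrow> g x"
    and f: "\<And>n. integrable M (f n)" and nonneg: "\<And>n. AE x in M. 0 \<le> f n x"
    and bound: "\<And>n. (LINT x|M. f n x) \<le> C" and g [measurable]: "g \<in> borel_measurable M"
  shows "integrable M g" and "\<And>e. 0 < e \<Longrightarrow> \<forall>\<^sub>F n in sequentially. (LINT x|M. g x) - e < (LINT x|M. f n x)"
proof -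
  have [measurable]: "f n \<in> borel_measurable M" for n using f by auto
  have g0: "AE x in M. 0 \<le> g x"
  proof -
    have "AE x in M. \<forall>n. 0 \<le> f n x" using nonneg by (simp add: AE_all_countable)
    with lim show ?thesis by eventually_elim (auto intro: LIMSEQ_le_const)
  qed
  have fI: "(\<integral>\<^sup>+x. ennreal (f n x) \<partial>M) = ennreal (LINT x|M. f n x)" for n
    by (rule nn_integral_eq_integral[OF f nonneg])
  have "(\<integral>\<^sup>+x. ennreal (g x) \<partial>M) = (\<integral>\<^sup>+x. liminf (\<lambda>n. ennreal (f n x)) \<partial>M)"
  proof (rule nn_integral_cong_AE)
    show "AE x in M. ennreal (g x) = liminf (\<lambda>n. ennreal (f n x))"
      using lim by eventually_elim (rule lim_imp_Liminf[symmetric], simp, rule tendsto_ennrealI)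
  qed
  also have "\<dots> \<le> liminf (\<lambda>n. \<integral>\<^sup>+x. ennreal (f n x) \<partial>M)"
    by (rule nn_integral_liminf) simp
  finally have le: "(\<integral>\<^sup>+x. ennreal (g x) \<partial>M) \<le> liminf (\<lambda>n. ennreal (LINT x|M. f n x))"
    unfolding fI .
  also have "\<dots> \<le> liminf (\<lambda>n. ennreal C)"
    by (intro Liminf_mono always_eventually allI ennreal_leI bound)
  also have "\<dots> = ennreal C" by (simp add: Liminf_const)
  also have "\<dots> < \<infinity>" by simp
  finally have fin: "(\<integral>\<^sup>+x. ennreal (g x) \<partial>M) < \<infinity>" .
  show int: "integrable M g"
    by (rule integrableI_nonneg[OF g g0 fin])
  fix e :: real assume e: "0 < e"
  have gI: "(\<integral>\<^sup>+x. ennreal (g x) \<partial>M) = ennreal (LINT x|M. g x)"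
    by (rule nn_integral_eq_integral[OF int g0])
  show "\<forall>\<^sub>F n in sequentially. (LINT x|M. g x) - e < (LINT x|M. f n x)"
  proof (cases "(LINT x|M. g x) - e < 0")
    case True
    have "0 \<le> (LINT x|M. f n x)" for n by (rule integral_nonneg_AE[OF nonneg])
    then have "(LINT x|M. g x) - e < (LINT x|M. f n x)" for n using True by (rule less_le_trans[rotated])
    then show ?thesis by (intro always_eventually allI)
  next
    case False
    have "ennreal ((LINT x|M. g x) - e) < ennreal (LINT x|M. g x)"
      using False e by (simp add: ennreal_less_iff)
    also have "\<dots> \<le> liminf (\<lambda>n. ennreal (LINT x|M. f n x))" using le gI by simp
    finally have "\<forall>\<^sub>F n in sequentially. ennreal ((LINT x|M. g x) - e) < ennreal (LINT x|M. f n x)"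
      by (rule less_LiminfD)
    then show ?thesis
      by (rule eventually_mono) (use False in \<open>simp add: ennreal_less_iff\<close>)
  qed
qed

section \<open>Densities of finite entropy\<close>

lemma finite_entropy_densities_iff:
  "\<rho> \<in> finite_entropy_densities \<longleftrightarrow> (\<rho> \<in> borel_measurable area \<and> (\<forall>x\<in>S2. 0 \<le> \<rho> x)
     \<and> integrable area \<rho> \<and> (LINT x|area. \<rho> x) = 1 \<and> integrable area (\<lambda>x. \<rho> x * ln (\<rho> x)))" (is "?l \<longleftrightarrow> ?r")
proof
  assume l: ?l
  then have m: "\<rho> \<in> borel_measurable area" and pos: "\<forall>x\<in>S2. 0 \<le> \<rho> x"
    and one: "(\<integral>\<^sup>+x. ennreal (\<rho> x) \<partial>area) = 1"
    by (auto simp: finite_entropy_densities_def densities_def)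
  have "integrable area \<rho>"
    by (rule integrableI_nonneg) (use m pos one in auto)
  moreover have "(LINT x|area. \<rho> x) = 1"
    by (subst integral_eq_nn_integral) (use m pos one in auto)
  ultimately show ?r using m pos entropy_fun_eq_integral(1)[OF l] by blast
next
  assume r: ?r
  then have [measurable]: "\<rho> \<in> borel_measurable area" and pos: "\<forall>x\<in>S2. 0 \<le> \<rho> x" by auto
  have "(\<integral>\<^sup>+x. ennreal (\<rho> x) \<partial>area) = ennreal (LINT x|area. \<rho> x)"
    by (rule nn_integral_eq_integral) (use r pos in auto)
  then have d: "\<rho> \<in> densities" using r by (simp add: densities_def)
  let ?f = "\<lambda>x. \<rho> x * ln (\<rho> x)"
  have "(\<integral>\<^sup>+x. ennreal (?f x) \<partial>area) < \<infinity>"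
    using r unfolding real_integrable_def by (auto simp: less_top)
  then obtain q where q: "0 \<le> q" "(\<integral>\<^sup>+x. ennreal (?f x) \<partial>area) = ennreal q"
    by (cases "\<integral>\<^sup>+x. ennreal (?f x) \<partial>area" rule: ennreal_cases) auto
  have "entropy_fun \<rho> \<le> enn2ereal (\<integral>\<^sup>+x. ennreal (?f x) \<partial>area)"
    unfolding entropy_fun_def by (simp add: ereal_diff_le_self)
  also have "\<dots> < \<infinity>" unfolding q using q(1) by (simp add: enn2ereal_ennreal)
  finally show ?l using d by (simp add: finite_entropy_densities_def)
qed

lemma finite_entropyD:
  assumes "\<rho> \<in> finite_entropy_densities"
  shows "\<rho> \<in> borel_measurable area" "\<And>x. x \<in> S2 \<Longrightarrow> 0 \<le> \<rho> x" "integrable area \<rho>"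
    "(LINT x|area. \<rho> x) = 1" "integrable area (\<lambda>x. \<rho> x * ln (\<rho> x))"
    "real_of_ereal (entropy_fun \<rho>) = (LINT x|area. \<rho> x * ln (\<rho> x))"
  using assms entropy_fun_eq_integral(2)[OF assms] unfolding finite_entropy_densities_iff by auto

lemma convex_finite_entropy:
  assumes a: "a \<in> finite_entropy_densities" and b: "b \<in> finite_entropy_densities" and t: "0 < t" "t < 1"
  shows "(\<lambda>x. (1 - t) * a x + t * b x) \<in> finite_entropy_densities"
    and "(LINT x|area. ((1 - t) * a x + t * b x) * ln (((1 - t) * a x + t * b x))) \<le> (1 - t) * (LINT x|area. a x * ln (a x)) + t * (LINT x|area. b x * ln (b x))"
proof -
  let ?m = "\<lambda>x. (1 - t) * a x + t * b x"
  note A = finite_entropyD[OF a] and B = finite_entropyD[OF b]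
  note [measurable] = A(1) B(1)
  have conv: "?m x * ln (?m x) \<le> (1 - t) * (a x * ln (a x)) + t * (b x * ln (b x))" if "x \<in> S2" for x
    by (rule mult_ln_convex[OF A(2)[OF that] B(2)[OF that] t])
  have m0: "0 \<le> ?m x" if "x \<in> S2" for x using A(2)[OF that] B(2)[OF that] t by simp
  have i: "integrable area (\<lambda>x. (1 - t) * (a x * ln (a x)) + t * (b x * ln (b x)))" using A B by simp
  have int: "integrable area (\<lambda>x. ?m x * ln (?m x))"
  proof (rule Bochner_Integration.integrable_bound)
    show "integrable area (\<lambda>x. \<bar>(1 - t) * (a x * ln (a x)) + t * (b x * ln (b x))\<bar> + 1)"
      using i by auto
    show "AE x in area. norm (?m x * ln (?m x)) \<le> norm (\<bar>(1 - t) * (a x * ln (a x)) + t * (b x * ln (b x))\<bar> + 1)"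
    proof (rule AE_I2)
      fix x assume "x \<in> space area"
      then have x: "x \<in> S2" by simp
      show "norm (?m x * ln (?m x)) \<le> norm (\<bar>(1 - t) * (a x * ln (a x)) + t * (b x * ln (b x))\<bar> + 1)"
        using mult_ln_ge[OF m0[OF x]] conv[OF x] by (simp only: real_norm_def)
    qed
  qed simp
  show "?m \<in> finite_entropy_densities"
    unfolding finite_entropy_densities_iff using A B int m0 by simp
  have "(LINT x|area. ?m x * ln (?m x)) \<le> (LINT x|area. (1 - t) * (a x * ln (a x)) + t * (b x * ln (b x)))"
    by (rule integral_mono[OF int i]) (use conv in auto)
  then show "(LINT x|area. ?m x * ln (?m x)) \<le> (1 - t) * (LINT x|area. a x * ln (a x)) + t * (LINT x|area. b x * ln (b x))"
    using A B by simp
qed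

lemma uniform_density: "(\<lambda>_. 1 / (4 * pi)) \<in> finite_entropy_densities"
proof -
  have "measure area S2 = 4 * pi" by (simp add: measure_def emeasure_area_S2)
  then show ?thesis unfolding finite_entropy_densities_iff by simp
qed

lemma entropy_ge:
  assumes "\<rho> \<in> finite_entropy_densities" shows "- (4 * pi) \<le> (LINT x|area. \<rho> x * ln (\<rho> x))"
proof -
  have "(LINT x|area. - 1) \<le> (LINT x|area. \<rho> x * ln (\<rho> x))"
    by (rule integral_mono) (use finite_entropyD[OF assms] mult_ln_ge in auto)
  then show ?thesis by (simp add: measure_def emeasure_area_S2)
qed

section \<open>The logarithmic energy\<close>

lemma abs_Green_le: "x \<in> S2 \<Longrightarrow> y \<in> S2 \<Longrightarrow> \<bar>Green x y\<bar> \<le> Green x y + 1"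
  using Green_ge[of x y] by auto

text \<open>By \<open>young_exp\<close> with \<open>t = \<bar>Green y x\<bar>\<close>; the exponential of the kernel is
integrable uniformly in \<open>y\<close>.\<close>

lemma nn_integral_potential_bounded:
  assumes \<rho>: "\<rho> \<in> finite_entropy_densities"
  obtains C where "0 \<le> C" "\<And>y. y \<in> S2 \<Longrightarrow> (\<integral>\<^sup>+x. ennreal (\<bar>Green y x\<bar> * \<rho> x) \<partial>area) \<le> ennreal C"
proof -
  note R = finite_entropyD[OF \<rho>]
  note [measurable] = R(1)
  obtain K where K: "0 \<le> K" "\<And>x. x \<in> S2 \<Longrightarrow> (\<integral>\<^sup>+y. ennreal (exp (1 * Green x y)) \<partial>area) \<le> ennreal K"
    using nn_integral_exp_Green_bounded[of 1] by auto
  define H where "H = (LINT x|area. \<rho> x * ln (\<rho> x) + 1)"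
  have H0: "0 \<le> \<rho> x * ln (\<rho> x) + 1" if "x \<in> S2" for x using mult_ln_ge[OF R(2)[OF that]] by simp
  have HI: "(\<integral>\<^sup>+x. ennreal (\<rho> x * ln (\<rho> x) + 1) \<partial>area) = ennreal H"
    unfolding H_def by (rule nn_integral_eq_integral) (use R H0 in auto)
  have Hnn: "0 \<le> H" unfolding H_def by (rule integral_nonneg_AE, rule AE_I2) (use H0 in auto)
  show ?thesis
  proof
    show "0 \<le> H + exp 1 * K" using Hnn K by simp
    fix y :: "real^3" assume y: "y \<in> S2"
    have "(\<integral>\<^sup>+x. ennreal (\<bar>Green y x\<bar> * \<rho> x) \<partial>area)
      \<le> (\<integral>\<^sup>+x. ennreal (\<rho> x * ln (\<rho> x) + 1) + ennreal (exp 1) * ennreal (exp (1 * Green y x)) \<partial>area)"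
    proof (rule nn_integral_mono)
      fix x assume "x \<in> space area"
      then have x: "x \<in> S2" by simp
      have "\<bar>Green y x\<bar> * \<rho> x \<le> \<rho> x * ln (\<rho> x) - \<rho> x + exp \<bar>Green y x\<bar>"
        using young_exp[OF R(2)[OF x], of "\<bar>Green y x\<bar>"] by (simp add: mult.commute)
      also have "\<dots> \<le> (\<rho> x * ln (\<rho> x) + 1) + exp (Green y x + 1)"
        using R(2)[OF x] abs_Green_le[OF y x] by (intro add_mono) auto
      finally have "\<bar>Green y x\<bar> * \<rho> x \<le> (\<rho> x * ln (\<rho> x) + 1) + exp 1 * exp (1 * Green y x)"
        by (simp add: exp_add mult.commute)
      then show "ennreal (\<bar>Green y x\<bar> * \<rho> x) \<le> ennreal (\<rho> x * ln (\<rho> x) + 1) + ennreal (exp 1) * ennreal (exp (1 * Green y x))"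
        using H0[OF x] by (simp add: ennreal_leI flip: ennreal_mult ennreal_plus)
    qed
    also have "\<dots> = ennreal H + ennreal (exp 1) * (\<integral>\<^sup>+x. ennreal (exp (1 * Green y x)) \<partial>area)"
      by (subst nn_integral_add) (simp_all add: HI nn_integral_cmult)
    also have "\<dots> \<le> ennreal H + ennreal (exp 1) * ennreal K"
      by (intro add_left_mono mult_left_mono K y) auto
    also have "\<dots> = ennreal (H + exp 1 * K)" using Hnn K by (simp add: ennreal_mult)
    finally show "(\<integral>\<^sup>+x. ennreal (\<bar>Green y x\<bar> * \<rho> x) \<partial>area) \<le> ennreal (H + exp 1 * K)" .
  qed
qed

lemma integrable_Green_density:
  assumes \<rho>: "\<rho> \<in> finite_entropy_densities" and y: "y \<in> S2"
  shows "integrable area (\<lambda>x. Green y x * \<rho> x)"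
proof -
  obtain C where C: "0 \<le> C" "\<And>y. y \<in> S2 \<Longrightarrow> (\<integral>\<^sup>+x. ennreal (\<bar>Green y x\<bar> * \<rho> x) \<partial>area) \<le> ennreal C"
    using nn_integral_potential_bounded[OF \<rho>] by blast
  note [measurable] = finite_entropyD(1)[OF \<rho>]
  show ?thesis
  proof (rule integrableI_bounded)
    have "(\<integral>\<^sup>+x. ennreal (norm (Green y x * \<rho> x)) \<partial>area) = (\<integral>\<^sup>+x. ennreal (\<bar>Green y x\<bar> * \<rho> x) \<partial>area)"
      by (rule nn_integral_cong) (use finite_entropyD(2)[OF \<rho>] in \<open>simp add: abs_mult\<close>)
    also have "\<dots> < \<infinity>" using C(2)[OF y] by (simp add: le_less_trans)
    finally show "(\<integral>\<^sup>+x. ennreal (norm (Green y x * \<rho> x)) \<partial>area) < \<infinity>" .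
  qed simp
qed

lemma potential_bounded:
  assumes \<rho>: "\<rho> \<in> finite_entropy_densities"
  obtains C where "\<And>y. y \<in> S2 \<Longrightarrow> \<bar>pot Green \<rho> y\<bar> \<le> C"
proof -
  obtain C where C: "0 \<le> C" "\<And>y. y \<in> S2 \<Longrightarrow> (\<integral>\<^sup>+x. ennreal (\<bar>Green y x\<bar> * \<rho> x) \<partial>area) \<le> ennreal C"
    using nn_integral_potential_bounded[OF \<rho>] by blast
  show ?thesis
  proof
    fix y :: "real^3" assume y: "y \<in> S2"
    have "ennreal (norm (pot Green \<rho> y)) \<le> (\<integral>\<^sup>+x. ennreal (norm (Green y x * \<rho> x)) \<partial>area)"
      unfolding pot_def by (rule integral_norm_bound_ennreal[OF integrable_Green_density[OF \<rho> y]])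
    also have "\<dots> = (\<integral>\<^sup>+x. ennreal (\<bar>Green y x\<bar> * \<rho> x) \<partial>area)"
      by (rule nn_integral_cong) (use finite_entropyD(2)[OF \<rho>] in \<open>simp add: abs_mult\<close>)
    also have "\<dots> \<le> ennreal C" by (rule C(2)[OF y])
    finally show "\<bar>pot Green \<rho> y\<bar> \<le> C" using C(1) by simp
  qed
qed

lemma measurable_potential [measurable]:
  assumes [measurable]: "\<rho> \<in> borel_measurable area"
  shows "pot Green \<rho> \<in> borel_measurable area"
proof -
  have "(\<lambda>y. LINT x|area. (\<lambda>(y, x). Green y x * \<rho> x) (y, x)) \<in> borel_measurable area"
    by (rule area.borel_measurable_lebesgue_integral) (simp add: case_prod_unfold)
  then show ?thesis unfolding pot_def by simp
qed

definition energy :: "(real^3 \<Rightarrow> real) \<Rightarrow> (real^3 \<Rightarrow> real) \<Rightarrow> real" where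
  "energy f g = (LINT y|area. f y * pot Green g y)"

lemma integrable_energy:
  assumes \<rho>: "\<rho> \<in> finite_entropy_densities" and \<sigma>: "\<sigma> \<in> finite_entropy_densities"
  shows "integrable (area \<Otimes>\<^sub>M area) (\<lambda>p. \<rho> (fst p) * \<sigma> (snd p) * Green (fst p) (snd p))"
    and "integrable area (\<lambda>y. \<rho> y * pot Green \<sigma> y)"
    and "(LINT p|(area \<Otimes>\<^sub>M area). \<rho> (fst p) * \<sigma> (snd p) * Green (fst p) (snd p)) = energy \<rho> \<sigma>"
proof -
  note R = finite_entropyD[OF \<rho>] and S = finite_entropyD[OF \<sigma>]
  note [measurable] = R(1) S(1)
  obtain C where C: "0 \<le> C" "\<And>y. y \<in> S2 \<Longrightarrow> (\<integral>\<^sup>+x. ennreal (\<bar>Green y x\<bar> * \<sigma> x) \<partial>area) \<le> ennreal C"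
    using nn_integral_potential_bounded[OF \<sigma>] by blast
  let ?f = "\<lambda>p. \<rho> (fst p) * \<sigma> (snd p) * Green (fst p) (snd p)"
  show int: "integrable (area \<Otimes>\<^sub>M area) ?f"
  proof (rule integrableI_bounded)
    have "(\<integral>\<^sup>+p. ennreal (norm (?f p)) \<partial>(area \<Otimes>\<^sub>M area)) = (\<integral>\<^sup>+x. \<integral>\<^sup>+y. ennreal (norm (?f (x, y))) \<partial>area \<partial>area)"
      by (rule area.nn_integral_fst[symmetric]) simp
    also have "\<dots> = (\<integral>\<^sup>+x. ennreal (\<rho> x) * (\<integral>\<^sup>+y. ennreal (\<bar>Green x y\<bar> * \<sigma> y) \<partial>area) \<partial>area)"
    proof (rule nn_integral_cong)
      fix x assume x: "x \<in> space area"
      have "(\<integral>\<^sup>+y. ennreal (norm (?f (x, y))) \<partial>area) = (\<integral>\<^sup>+y. ennreal (\<rho> x) * ennreal (\<bar>Green x y\<bar> * \<sigma> y) \<partial>area)"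
        using x R(2) S(2) by (intro nn_integral_cong) (simp add: abs_mult ennreal_mult[symmetric] mult_ac)
      also have "\<dots> = ennreal (\<rho> x) * (\<integral>\<^sup>+y. ennreal (\<bar>Green x y\<bar> * \<sigma> y) \<partial>area)"
        by (rule nn_integral_cmult) simp
      finally show "(\<integral>\<^sup>+y. ennreal (norm (?f (x, y))) \<partial>area) = ennreal (\<rho> x) * (\<integral>\<^sup>+y. ennreal (\<bar>Green x y\<bar> * \<sigma> y) \<partial>area)" .
    qed
    also have "\<dots> \<le> (\<integral>\<^sup>+x. ennreal (\<rho> x) * ennreal C \<partial>area)"
      by (intro nn_integral_mono mult_left_mono C) auto
    also have "\<dots> = (\<integral>\<^sup>+x. ennreal (\<rho> x) \<partial>area) * ennreal C"
      by (rule nn_integral_multc) simp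
    also have "\<dots> < \<infinity>"
      using assms by (simp add: finite_entropy_densities_def densities_def)
    finally show "(\<integral>\<^sup>+p. ennreal (norm (?f p)) \<partial>(area \<Otimes>\<^sub>M area)) < \<infinity>" .
  qed simp
  have inner: "(LINT y|area. ?f (x, y)) = \<rho> x * pot Green \<sigma> x" for x
    unfolding pot_def by (simp add: mult_ac flip: integral_mult_right_zero)
  show "integrable area (\<lambda>y. \<rho> y * pot Green \<sigma> y)"
    using area2.integrable_fst'[OF int] unfolding inner .
  show "(LINT p|(area \<Otimes>\<^sub>M area). ?f p) = energy \<rho> \<sigma>"
    using area2.integral_fst'[OF int] unfolding inner energy_def by simp
qed

lemma energy_commute:
  assumes "\<rho> \<in> finite_entropy_densities" "\<sigma> \<in> finite_entropy_densities"
  shows "energy \<rho> \<sigma> = energy \<sigma> \<rho>"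
proof -
  have "energy \<rho> \<sigma> = (LINT p|(area \<Otimes>\<^sub>M area). \<rho> (fst p) * \<sigma> (snd p) * Green (fst p) (snd p))"
    by (rule integrable_energy(3)[OF assms, symmetric])
  also have "\<dots> = (LINT p|(area \<Otimes>\<^sub>M area). (case p of (x, y) \<Rightarrow> \<rho> y * \<sigma> x * Green y x))"
    using area2.integral_product_swap[of "\<lambda>p. \<rho> (fst p) * \<sigma> (snd p) * Green (fst p) (snd p)"]
      integrable_energy(1)[OF assms] by (simp add: case_prod_unfold borel_measurable_integrable)
  also have "\<dots> = (LINT p|(area \<Otimes>\<^sub>M area). \<sigma> (fst p) * \<rho> (snd p) * Green (fst p) (snd p))"
    by (simp add: case_prod_unfold mult_ac Green_commute[of "snd _"])
  also have "\<dots> = energy \<sigma> \<rho>"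
    using assms by (intro integrable_energy(3))
  finally show ?thesis .
qed

lemma R_fun_eq_energy: "\<rho> \<in> finite_entropy_densities \<Longrightarrow> R_fun \<rho> = energy \<rho> \<rho>"
  unfolding R_fun_def by (rule integrable_energy(3))

lemma energy_ge:
  assumes \<rho>: "\<rho> \<in> finite_entropy_densities" shows "- 1 / 2 \<le> energy \<rho> \<rho>"
proof -
  note R = finite_entropyD[OF \<rho>]
  have pg: "- 1 / 2 \<le> pot Green \<rho> y" if y: "y \<in> S2" for y
  proof -
    have "(LINT x|area. - 1 / 2 * \<rho> x) \<le> pot Green \<rho> y"
      unfolding pot_def
      by (rule integral_mono[OF _ integrable_Green_density[OF \<rho> y]])
        (use R(3) in simp, rule mult_right_mono, use Green_ge y R(2) in auto)
    then show ?thesis using R(4) by simp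
  qed
  have "(LINT y|area. - 1 / 2 * \<rho> y) \<le> energy \<rho> \<rho>"
    unfolding energy_def
  proof (rule integral_mono[OF _ integrable_energy(2)[OF \<rho> \<rho>]])
    show "integrable area (\<lambda>y. - 1 / 2 * \<rho> y)" using R(3) by simp
    show "- 1 / 2 * \<rho> y \<le> \<rho> y * pot Green \<rho> y" if "y \<in> space area" for y
      using mult_left_mono[OF pg R(2)] that by (simp add: mult.commute)
  qed
  then show ?thesis using R(4) by simp
qed

text \<open>The energy of the signed density \<open>\<rho> - \<sigma>\<close>, expanded because \<open>energy\<close> is
used for densities only.\<close>

definition energy_dist :: "(real^3 \<Rightarrow> real) \<Rightarrow> (real^3 \<Rightarrow> real) \<Rightarrow> real" where
  "energy_dist \<rho> \<sigma> = energy \<rho> \<rho> - 2 * energy \<rho> \<sigma> + energy \<sigma> \<sigma>"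

lemma pot_combination:
  assumes "\<rho> \<in> finite_entropy_densities" "\<sigma> \<in> finite_entropy_densities" "y \<in> S2"
  shows "pot Green (\<lambda>x. s * \<rho> x + t * \<sigma> x) y = s * pot Green \<rho> y + t * pot Green \<sigma> y"
proof -
  have "pot Green (\<lambda>x. s * \<rho> x + t * \<sigma> x) y = (LINT x|area. s * (Green y x * \<rho> x) + t * (Green y x * \<sigma> x))"
    unfolding pot_def by (simp add: algebra_simps)
  also have "\<dots> = s * pot Green \<rho> y + t * pot Green \<sigma> y"
    unfolding pot_def using integrable_Green_density assms by simp
  finally show ?thesis .
qed

lemma energy_combination:
  assumes r: "\<rho> \<in> finite_entropy_densities" and s: "\<sigma> \<in> finite_entropy_densities"
  shows "energy (\<lambda>x. a * \<rho> x + b * \<sigma> x) (\<lambda>x. a * \<rho> x + b * \<sigma> x)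
     = a * a * energy \<rho> \<rho> + 2 * a * b * energy \<rho> \<sigma> + b * b * energy \<sigma> \<sigma>"
proof -
  have "energy (\<lambda>x. a * \<rho> x + b * \<sigma> x) (\<lambda>x. a * \<rho> x + b * \<sigma> x)
     = (LINT y|area. a * a * (\<rho> y * pot Green \<rho> y) + a * b * (\<rho> y * pot Green \<sigma> y)
        + a * b * (\<sigma> y * pot Green \<rho> y) + b * b * (\<sigma> y * pot Green \<sigma> y))"
    unfolding energy_def using pot_combination[OF r s, of _ a b]
    by (intro Bochner_Integration.integral_cong) (simp_all add: algebra_simps)
  also have "\<dots> = a * a * energy \<rho> \<rho> + a * b * energy \<rho> \<sigma> + a * b * energy \<sigma> \<rho> + b * b * energy \<sigma> \<sigma>"
    unfolding energy_def using integrable_energy(2) r s by simp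
  finally show ?thesis using energy_commute[OF r s] by simp
qed

text \<open>For the Abel kernel this is \<open>G_abel_square_expansion\<close> without point charges. The kernels are
dominated by a shift of the logarithmic kernel, so the sign survives the limit
\<open>lam \<rightarrow> 1\<close>.\<close>

lemma energy_dist_nonneg:
  assumes r: "\<rho> \<in> finite_entropy_densities" and s: "\<sigma> \<in> finite_entropy_densities"
  shows "0 \<le> energy_dist \<rho> \<sigma>"
proof -
  note R = finite_entropyD[OF r] and S = finite_entropyD[OF s]
  note [measurable] = R(1) S(1)
  define f where "f x = 1 * \<rho> x + (-1) * \<sigma> x" for x
  have [measurable]: "f \<in> borel_measurable area" unfolding f_def by measurable
  have fi: "integrable area f" unfolding f_def using R S by simp
  define F where "F lam p = f (fst p) * f (snd p) * G_abel lam (fst p) (snd p)" for lam p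
  (* 10 is a convenient shift: the Abel kernel lies between -4 and Green + 3/2, and Green is at least -1/2 *)
  define w where "w p = (\<rho> (fst p) + \<sigma> (fst p)) * (\<rho> (snd p) + \<sigma> (snd p)) * (Green (fst p) (snd p) + 10)" for p
  let ?G = "\<lambda>p. f (fst p) * f (snd p) * Green (fst p) (snd p)"
  have mG: "(\<lambda>p. G_abel lam (fst p) (snd p)) \<in> borel_measurable (area \<Otimes>\<^sub>M area)" if "0 \<le> lam" "lam < 1" for lam
    using that by (intro measurable_G_abel) measurable
  have wi: "integrable (area \<Otimes>\<^sub>M area) w"
  proof -
    have eq: "w = (\<lambda>p. \<rho> (fst p) * \<rho> (snd p) * Green (fst p) (snd p) + \<rho> (fst p) * \<sigma> (snd p) * Green (fst p) (snd p)
       + \<sigma> (fst p) * \<rho> (snd p) * Green (fst p) (snd p) + \<sigma> (fst p) * \<sigma> (snd p) * Green (fst p) (snd p)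
       + 10 * (\<rho> (fst p) * \<rho> (snd p)) + 10 * (\<rho> (fst p) * \<sigma> (snd p))
       + 10 * (\<sigma> (fst p) * \<rho> (snd p)) + 10 * (\<sigma> (fst p) * \<sigma> (snd p)))"
      by (simp add: w_def fun_eq_iff algebra_simps)
    show ?thesis
      unfolding eq
      by (intro Bochner_Integration.integrable_add integrable_mult_right integrable_energy(1) r s integrable_pair_product R S)
  qed
  have offdiag: "AE p in area \<Otimes>\<^sub>M area. snd p \<noteq> fst p"
  proof -
    have m: "fst \<in> borel_measurable (area \<Otimes>\<^sub>M area)" "snd \<in> borel_measurable (area \<Otimes>\<^sub>M area)"
      by (rule area_imp_borel_measurable, rule measurable_fst measurable_snd)+
    have "AE x in area. AE y in area. snd (x, y) \<noteq> fst (x, y)"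
    proof (rule AE_I2)
      fix x assume "x \<in> space area"
      then show "AE y in area. snd (x, y) \<noteq> fst (x, y)" using AE_area_neq[of x] by simp
    qed
    moreover have "{p \<in> space (area \<Otimes>\<^sub>M area). norm (snd p - fst p) \<noteq> 0} \<in> sets (area \<Otimes>\<^sub>M area)"
      by (intro borel_measurable_neq borel_measurable_const measurable_compose[OF borel_measurable_diff[OF m(2) m(1)] borel_measurable_norm])
    then have "{p \<in> space (area \<Otimes>\<^sub>M area). snd p \<noteq> fst p} \<in> sets (area \<Otimes>\<^sub>M area)" by simp
    ultimately show ?thesis by (intro area2.AE_pair_measure)
  qed
  have Fint: "integrable (area \<Otimes>\<^sub>M area) (F lam)" and Fnn: "0 \<le> (LINT p|(area \<Otimes>\<^sub>M area). F lam p)"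
    if lam: "0 \<le> lam" "lam < 1" for lam
  proof -
    have "integrable (area \<Otimes>\<^sub>M area) (\<lambda>p. G_abel lam (fst p) (snd p) * (f (fst p) * f (snd p)))"
    proof (rule integrable_bounded_mult[OF integrable_pair_product(1)[OF fi fi] mG[OF lam]])
      show "\<bar>G_abel lam (fst p) (snd p)\<bar> \<le> 1 / (1 - lam)" if "p \<in> space (area \<Otimes>\<^sub>M area)" for p
        using that lam by (intro abs_G_abel_le) (auto simp: space_pair_measure)
    qed
    then show i: "integrable (area \<Otimes>\<^sub>M area) (F lam)" by (simp add: F_def[abs_def] mult_ac)
    have inner: "(LINT y|area. F lam (x, y)) = f x * pot (G_abel lam) f x" for x
      unfolding pot_def F_def by (simp add: mult_ac flip: integral_mult_right_zero)
    have "0 \<le> (LINT z|area. f z * pot (G_abel lam) f z)"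
      using G_abel_square_expansion[OF fi, of "{}" _ lam] lam by simp
    then show "0 \<le> (LINT p|(area \<Otimes>\<^sub>M area). F lam p)"
      using area2.integral_fst'[OF i] unfolding inner by simp
  qed
  define u where "u n = 1 - 1 / (real n + 2)" for n
  have u: "1 / 2 \<le> u n" "u n < 1" for n by (auto simp: u_def field_simps)
  have ulim: "filterlim u (at_left 1) sequentially"
  proof (rule tendsto_imp_filterlim_at_left)
    have "(\<lambda>n. 1 - 1 / real (n + 2)) \<longlonglongrightarrow> 1 - 0"
      by (intro tendsto_diff tendsto_const LIMSEQ_ignore_initial_segment lim_const_over_n)
    then show "u \<longlonglongrightarrow> 1" by (simp add: u_def[abs_def] add.commute)
  qed (use u in auto)
  have "(\<lambda>n. LINT p|(area \<Otimes>\<^sub>M area). F (u n) p) \<longlonglongrightarrow> (LINT p|(area \<Otimes>\<^sub>M area). ?G p)"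
  proof (rule integral_dominated_convergence[OF _ _ wi])
    show "F (u n) \<in> borel_measurable (area \<Otimes>\<^sub>M area)" for n using Fint[of "u n"] u[of n] by simp
    show "AE p in area \<Otimes>\<^sub>M area. (\<lambda>n. F (u n) p) \<longlonglongrightarrow> ?G p"
      using offdiag AE_space
    proof eventually_elim
      case (elim p)
      then have "((\<lambda>lam. G_abel lam (fst p) (snd p)) \<longlongrightarrow> Green (fst p) (snd p)) (at_left 1)"
        by (intro G_abel_tendsto) (auto simp: space_pair_measure)
      then show ?case unfolding F_def by (intro tendsto_mult tendsto_const filterlim_compose[OF _ ulim])
    qed
    show "AE p in area \<Otimes>\<^sub>M area. norm (F (u n) p) \<le> w p" for n
      using offdiag AE_space
    proof eventually_elim
      case (elim p)
      then have p: "fst p \<in> S2" "snd p \<in> S2" "fst p \<noteq> snd p" by (auto simp: space_pair_measure)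
      have "- 4 \<le> G_abel (u n) (fst p) (snd p)" "G_abel (u n) (fst p) (snd p) \<le> Green (fst p) (snd p) + 3 * (1 - u n)"
        using G_abel_ge[OF p(1,2)] G_abel_le_Green[OF p] u[of n] by auto
      then have G: "\<bar>G_abel (u n) (fst p) (snd p)\<bar> \<le> Green (fst p) (snd p) + 10"
        using u[of n] Green_ge[OF p(1,2)] by (simp add: abs_le_iff)
      have fb: "\<bar>f x\<bar> \<le> \<rho> x + \<sigma> x" if "x \<in> S2" for x unfolding f_def using R(2)[OF that] S(2)[OF that] by simp
      have "\<bar>f (fst p)\<bar> * \<bar>f (snd p)\<bar> * \<bar>G_abel (u n) (fst p) (snd p)\<bar> \<le> w p"
        unfolding w_def using fb[OF p(1)] fb[OF p(2)] G R(2)[OF p(1)] S(2)[OF p(1)] by (intro mult_mono) auto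
      then show ?case by (simp add: F_def abs_mult)
    qed
  qed simp
  then have "0 \<le> (LINT p|(area \<Otimes>\<^sub>M area). ?G p)"
  proof (rule LIMSEQ_le_const)
    have "0 \<le> (LINT p|(area \<Otimes>\<^sub>M area). F (u n) p)" for n using Fnn[of "u n"] u[of n] by simp
    then show "\<exists>N. \<forall>n\<ge>N. 0 \<le> (LINT p|(area \<Otimes>\<^sub>M area). F (u n) p)" by blast
  qed
  also have "(LINT p|(area \<Otimes>\<^sub>M area). ?G p) = energy_dist \<rho> \<sigma>"
  proof -
    have "?G = (\<lambda>p. \<rho> (fst p) * \<rho> (snd p) * Green (fst p) (snd p) - \<rho> (fst p) * \<sigma> (snd p) * Green (fst p) (snd p)
       - \<sigma> (fst p) * \<rho> (snd p) * Green (fst p) (snd p) + \<sigma> (fst p) * \<sigma> (snd p) * Green (fst p) (snd p))"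
      by (simp add: f_def fun_eq_iff algebra_simps)
    then have "(LINT p|(area \<Otimes>\<^sub>M area). ?G p) = energy \<rho> \<rho> - energy \<rho> \<sigma> - energy \<sigma> \<rho> + energy \<sigma> \<sigma>"
      using integrable_energy(1,3) r s by simp
    then show ?thesis using energy_commute[OF r s] by (simp add: energy_dist_def)
  qed
  finally show ?thesis .
qed

section \<open>The mean field functional\<close>

lemma energy_combination_left:
  assumes r: "\<rho> \<in> finite_entropy_densities" and s: "\<sigma> \<in> finite_entropy_densities" and t: "\<tau> \<in> finite_entropy_densities"
  shows "energy (\<lambda>x. a * \<rho> x + b * \<sigma> x) \<tau> = a * energy \<rho> \<tau> + b * energy \<sigma> \<tau>"
proof -
  have "energy (\<lambda>x. a * \<rho> x + b * \<sigma> x) \<tau> = (LINT y|area. a * (\<rho> y * pot Green \<tau> y) + b * (\<sigma> y * pot Green \<tau> y))"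
    unfolding energy_def by (simp add: algebra_simps)
  also have "\<dots> = a * energy \<rho> \<tau> + b * energy \<sigma> \<tau>"
    unfolding energy_def using integrable_energy(2) r s t by simp
  finally show ?thesis .
qed

lemma norm_le_normI: "\<bar>a\<bar> \<le> b \<Longrightarrow> norm a \<le> norm b" for a b :: real
  by simp

abbreviation ent :: "(real^3 \<Rightarrow> real) \<Rightarrow> real" where
  "ent \<rho> \<equiv> LINT x|area. \<rho> x * ln (\<rho> x)"

text \<open>The two exponential moments have different purposes: small moments of \<open>\<bar>V\<bar>\<close> make
\<open>V\<close> integrable against every density of finite entropy, and a moment of \<open>- V\<close> of
order above one leaves part of the entropy to spare when \<open>V\<close> is absorbed.\<close>

locale mean_field =
  fixes V :: "real^3 \<Rightarrow> real" and \<beta> c q :: real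
  assumes V_measurable [measurable]: "V \<in> borel_measurable area"
    and beta_pos: "0 < \<beta>"
    and c_pos: "0 < c" and integrable_exp_abs: "integrable area (\<lambda>y. exp (c * \<bar>V y\<bar>))"
    and q_gt_1: "1 < q" and integrable_exp_q: "integrable area (\<lambda>y. exp (- q * V y))"
begin

definition S :: "(real^3 \<Rightarrow> real) \<Rightarrow> real" where
  "S \<rho> = (LINT y|area. V y * \<rho> y) + 2 * \<beta> * energy \<rho> \<rho> + ent \<rho>"

lemma integrable_V_density:
  assumes "\<rho> \<in> finite_entropy_densities" shows "integrable area (\<lambda>y. V y * \<rho> y)"
proof -
  note R = finite_entropyD[OF assms]
  note [measurable] = R(1)
  show ?thesis
  proof (rule Bochner_Integration.integrable_bound)
    show "integrable area (\<lambda>y. 1 / c * ((\<rho> y * ln (\<rho> y) + 1) + exp (c * \<bar>V y\<bar>)))"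
      using R(5) integrable_exp_abs by (intro integrable_mult_right Bochner_Integration.integrable_add) auto
    show "AE y in area. norm (V y * \<rho> y) \<le> norm (1 / c * ((\<rho> y * ln (\<rho> y) + 1) + exp (c * \<bar>V y\<bar>)))"
    proof (rule AE_I2)
      fix y assume "y \<in> space area"
      then have y: "0 \<le> \<rho> y" using R(2) by simp
      have "c * (\<bar>V y\<bar> * \<rho> y) = \<rho> y * (c * \<bar>V y\<bar>)" by simp
      also have "\<dots> \<le> \<rho> y * ln (\<rho> y) - \<rho> y + exp (c * \<bar>V y\<bar>)" by (rule young_exp[OF y])
      also have "\<dots> \<le> (\<rho> y * ln (\<rho> y) + 1) + exp (c * \<bar>V y\<bar>)" using y by simp
      finally have "\<bar>V y\<bar> * \<rho> y \<le> 1 / c * ((\<rho> y * ln (\<rho> y) + 1) + exp (c * \<bar>V y\<bar>))"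
        using c_pos by (simp add: field_simps)
      then show "norm (V y * \<rho> y) \<le> norm (1 / c * ((\<rho> y * ln (\<rho> y) + 1) + exp (c * \<bar>V y\<bar>)))"
        by (intro norm_le_normI) (simp only: abs_mult abs_of_nonneg[OF y])
    qed
  qed simp
qed

lemma exp_neg_le: "exp (- V y) \<le> 1 + exp (- q * V y)"
proof (cases "0 \<le> V y")
  case True
  then have "exp (- V y) \<le> 1" by simp
  then show ?thesis using exp_gt_zero[of "- q * V y"] by linarith
next
  case False
  then have "q * V y \<le> 1 * V y" using q_gt_1 by (intro mult_right_mono_neg) auto
  then have "exp (- V y) \<le> exp (- q * V y)" by simp
  then show ?thesis by linarith
qed

lemma integrable_exp_neg: "integrable area (\<lambda>y. exp (- V y))"
  by (rule Bochner_Integration.integrable_bound[of _ "\<lambda>y. 1 + exp (- q * V y)"])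
    (use integrable_exp_q exp_neg_le in auto)

lemma integrable_exp_neg_V: "integrable area (\<lambda>y. exp (- V y) * \<bar>V y\<bar>)"
proof (rule Bochner_Integration.integrable_bound[of _ "\<lambda>y. 1 + exp (- q * V y) / (q - 1)"])
  show "AE y in area. norm (exp (- V y) * \<bar>V y\<bar>) \<le> norm (1 + exp (- q * V y) / (q - 1))"
  proof (rule AE_I2)
    fix y
    have "exp (- V y) * \<bar>V y\<bar> \<le> 1 + exp (- q * V y) / (q - 1)"
    proof (cases "0 \<le> V y")
      case True
      have "V y \<le> exp (V y)" using exp_ge_add_one_self[of "V y"] by linarith
      then have "exp (- V y) * V y \<le> exp (- V y) * exp (V y)" by (intro mult_left_mono) auto
      also have "\<dots> = 1" by (simp add: exp_add[symmetric])
      finally have "exp (- V y) * \<bar>V y\<bar> \<le> 1" using True by simp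
      moreover have "0 \<le> exp (- q * V y) / (q - 1)" using q_gt_1 by simp
      ultimately show ?thesis by linarith
    next
      case False
      have "(q - 1) * (- V y) \<le> exp ((q - 1) * (- V y))"
        using exp_ge_add_one_self[of "(q - 1) * (- V y)"] by linarith
      then have "- V y \<le> exp ((q - 1) * (- V y)) / (q - 1)"
        using q_gt_1 by (simp add: pos_le_divide_eq mult.commute)
      then have "exp (- V y) * (- V y) \<le> exp (- V y) * (exp ((q - 1) * (- V y)) / (q - 1))"
        by (intro mult_left_mono) auto
      also have "\<dots> = exp (- q * V y) / (q - 1)" by (simp add: exp_add[symmetric] algebra_simps)
      finally have "exp (- V y) * \<bar>V y\<bar> \<le> exp (- q * V y) / (q - 1)" using False by simp
      then show ?thesis by simp
    qed
    then show "norm (exp (- V y) * \<bar>V y\<bar>) \<le> norm (1 + exp (- q * V y) / (q - 1))"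
      by (intro norm_le_normI) (simp only: abs_mult abs_exp_cancel abs_idempotent)
  qed
qed (use integrable_exp_q in auto)

text \<open>\<open>young_exp\<close> with \<open>t = - q * V y\<close> absorbs the potential at the cost of the fraction
\<open>1 / q\<close> of the entropy.\<close>

lemma entropy_le_S:
  assumes "\<rho> \<in> finite_entropy_densities"
  shows "(1 - 1 / q) * ent \<rho> \<le> S \<rho> + (LINT y|area. exp (- q * V y)) / q + \<beta>"
proof -
  note R = finite_entropyD[OF assms]
  have "(LINT y|area. - (1 / q) * (\<rho> y * ln (\<rho> y) - \<rho> y + exp (- q * V y))) \<le> (LINT y|area. V y * \<rho> y)"
  proof (rule integral_mono[OF _ integrable_V_density[OF assms]])
    show "integrable area (\<lambda>y. - (1 / q) * (\<rho> y * ln (\<rho> y) - \<rho> y + exp (- q * V y)))"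
      by (intro integrable_mult_right Bochner_Integration.integrable_add Bochner_Integration.integrable_diff R(3,5) integrable_exp_q)
    fix y assume "y \<in> space area"
    then have "\<rho> y * (- q * V y) \<le> \<rho> y * ln (\<rho> y) - \<rho> y + exp (- q * V y)"
      using R(2) by (intro young_exp) auto
    then show "- (1 / q) * (\<rho> y * ln (\<rho> y) - \<rho> y + exp (- q * V y)) \<le> V y * \<rho> y"
      using q_gt_1 by (simp add: field_simps)
  qed
  also have "(LINT y|area. - (1 / q) * (\<rho> y * ln (\<rho> y) - \<rho> y + exp (- q * V y)))
     = - (1 / q) * (ent \<rho> - 1 + (LINT y|area. exp (- q * V y)))"
    using R integrable_exp_q by simp
  finally have "- (1 / q) * (ent \<rho> - 1 + (LINT y|area. exp (- q * V y))) \<le> (LINT y|area. V y * \<rho> y)" .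
  moreover have "- (1 / q) * (ent \<rho> - 1 + (LINT y|area. exp (- q * V y)))
     = - ent \<rho> / q + 1 / q - (LINT y|area. exp (- q * V y)) / q" using q_gt_1 by (simp add: field_simps)
  moreover have "0 < 1 / q" using q_gt_1 by simp
  moreover have "\<beta> * (- 1) \<le> \<beta> * (2 * energy \<rho> \<rho>)"
    using energy_ge[OF assms] beta_pos by (intro mult_left_mono) auto
  moreover have "(1 - 1 / q) * ent \<rho> = ent \<rho> - ent \<rho> / q" by (simp add: left_diff_distrib)
  moreover have "\<beta> * (2 * energy \<rho> \<rho>) = 2 * \<beta> * energy \<rho> \<rho>" by simp
  ultimately show ?thesis unfolding S_def by linarith
qed

lemma bdd_below_S: "bdd_below (S ` finite_entropy_densities)"
proof (rule bdd_belowI2)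
  fix \<rho> assume r: "\<rho> \<in> finite_entropy_densities"
  have "(1 - 1 / q) * - (4 * pi) \<le> (1 - 1 / q) * ent \<rho>"
    using entropy_ge[OF r] q_gt_1 by (intro mult_left_mono) auto
  then show "(1 - 1 / q) * - (4 * pi) - (LINT y|area. exp (- q * V y)) / q - \<beta> \<le> S \<rho>"
    using entropy_le_S[OF r] by linarith
qed

section \<open>Gibbs densities and relative entropy\<close>

definition partition :: "(real^3 \<Rightarrow> real) \<Rightarrow> real" where
  "partition U = (LINT y|area. exp (- (V y + U y)))"

definition gibbs :: "(real^3 \<Rightarrow> real) \<Rightarrow> real^3 \<Rightarrow> real" where
  "gibbs U y = exp (- (V y + U y)) / partition U"

text \<open>The relative entropy of \<open>\<rho>\<close> with respect to \<open>gibbs U\<close>, see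
\<open>rel_ent_eq_integral\<close>.\<close>

definition rel_ent :: "(real^3 \<Rightarrow> real) \<Rightarrow> (real^3 \<Rightarrow> real) \<Rightarrow> real" where
  "rel_ent \<rho> U = ent \<rho> + (LINT y|area. V y * \<rho> y) + (LINT y|area. U y * \<rho> y) + ln (partition U)"

context
  fixes U :: "real^3 \<Rightarrow> real" and B :: real
  assumes U_measurable [measurable]: "U \<in> borel_measurable area"
    and U_bounded: "\<And>y. y \<in> S2 \<Longrightarrow> \<bar>U y\<bar> \<le> B"
begin

lemma integrable_gibbs_weight: "integrable area (\<lambda>y. exp (- (V y + U y)))"
proof -
  have "integrable area (\<lambda>y. exp (- U y) * exp (- V y))"
  proof (rule integrable_bounded_mult[OF integrable_exp_neg])
    show "\<bar>exp (- U y)\<bar> \<le> exp B" if "y \<in> space area" for y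
      using U_bounded[of y] that by simp
  qed simp
  then show ?thesis by (simp add: exp_add[symmetric] algebra_simps)
qed

lemma partition_pos: "0 < partition U"
proof -
  have "partition U \<noteq> 0"
  proof
    assume "partition U = 0"
    then have "AE y in area. exp (- (V y + U y)) = 0"
      unfolding partition_def
      using integral_nonneg_eq_0_iff_AE[OF integrable_gibbs_weight] by simp
    then have "AE y in area. False" by simp
    then have "emeasure area (space area) = 0"
      using AE_iff_measurable[of "space area" area "\<lambda>_. False", OF sets.top] by blast
    then show False by (simp add: emeasure_area_S2)
  qed
  moreover have "0 \<le> partition U" unfolding partition_def by (rule integral_nonneg_AE) simp
  ultimately show ?thesis by simp
qed

lemma gibbs_pos: "0 < gibbs U y" unfolding gibbs_def using partition_pos by simp

lemma ln_gibbs: "ln (gibbs U y) = - (V y + U y) - ln (partition U)"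
  unfolding gibbs_def using partition_pos by (simp add: ln_div)

lemma gibbs_measurable: "gibbs U \<in> borel_measurable area"
  unfolding gibbs_def[abs_def] by measurable

lemma gibbs_finite_entropy: "gibbs U \<in> finite_entropy_densities"
  unfolding finite_entropy_densities_iff
proof (intro conjI ballI)
  show "gibbs U \<in> borel_measurable area" by (rule gibbs_measurable)
  show "0 \<le> gibbs U x" for x using gibbs_pos by (rule less_imp_le)
  show i: "integrable area (gibbs U)" unfolding gibbs_def[abs_def] using integrable_gibbs_weight by simp
  show "(LINT x|area. gibbs U x) = 1"
    unfolding gibbs_def using integrable_gibbs_weight partition_pos by (simp add: partition_def)
  have "integrable area (\<lambda>y. (exp (- U y) / partition U) * (exp (- V y) * \<bar>V y\<bar>))"
  proof (rule integrable_bounded_mult[OF integrable_exp_neg_V])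
    show "\<bar>exp (- U y) / partition U\<bar> \<le> exp B / partition U" if "y \<in> space area" for y
      using U_bounded[of y] that partition_pos by (simp add: divide_right_mono)
  qed simp
  then have iV: "integrable area (\<lambda>y. \<bar>gibbs U y * V y\<bar>)"
    using partition_pos by (simp add: gibbs_def abs_mult exp_add[symmetric] algebra_simps exp_diff exp_minus divide_simps)
  have iU: "integrable area (\<lambda>y. (U y + ln (partition U)) * gibbs U y)"
    by (rule integrable_bounded_mult[OF i, of _ "B + \<bar>ln (partition U)\<bar>"]) (use U_bounded in \<open>force intro: order_trans[OF abs_triangle_ineq]\<close>)+
  have "integrable area (\<lambda>y. - (gibbs U y * V y) - (U y + ln (partition U)) * gibbs U y)"
    using iV iU integrable_abs_cancel[of area "\<lambda>y. gibbs U y * V y"] gibbs_measurable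
    by (intro Bochner_Integration.integrable_diff Bochner_Integration.integrable_minus) auto
  moreover have "- (gibbs U y * V y) - (U y + ln (partition U)) * gibbs U y = gibbs U y * ln (gibbs U y)" for y
    unfolding ln_gibbs by (simp add: algebra_simps)
  ultimately show "integrable area (\<lambda>y. gibbs U y * ln (gibbs U y))" by (simp only:)
qed

lemma integrable_U_density:
  assumes "\<rho> \<in> finite_entropy_densities" shows "integrable area (\<lambda>y. U y * \<rho> y)"
  by (rule integrable_bounded_mult[OF finite_entropyD(3)[OF assms] U_measurable]) (use U_bounded in auto)

lemma rel_ent_eq_integral:
  assumes "\<rho> \<in> finite_entropy_densities"
  shows "integrable area (\<lambda>y. \<rho> y * ln (\<rho> y) - \<rho> y * ln (gibbs U y) - \<rho> y + gibbs U y)"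
    and "(LINT y|area. \<rho> y * ln (\<rho> y) - \<rho> y * ln (gibbs U y) - \<rho> y + gibbs U y) = rel_ent \<rho> U"
proof -
  note R = finite_entropyD[OF assms] and G = finite_entropyD[OF gibbs_finite_entropy]
  note i = integrable_V_density[OF assms] integrable_U_density[OF assms]
  have e: "\<rho> y * ln (\<rho> y) - \<rho> y * ln (gibbs U y) - \<rho> y + gibbs U y
     = \<rho> y * ln (\<rho> y) + V y * \<rho> y + U y * \<rho> y + ln (partition U) * \<rho> y - \<rho> y + gibbs U y" for y
    unfolding ln_gibbs by (simp add: algebra_simps)
  show "integrable area (\<lambda>y. \<rho> y * ln (\<rho> y) - \<rho> y * ln (gibbs U y) - \<rho> y + gibbs U y)"
    unfolding e using R i G by simp
  show "(LINT y|area. \<rho> y * ln (\<rho> y) - \<rho> y * ln (gibbs U y) - \<rho> y + gibbs U y) = rel_ent \<rho> U"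
    unfolding e rel_ent_def using R i G by simp
qed

lemma rel_ent_nonneg:
  assumes "\<rho> \<in> finite_entropy_densities" shows "0 \<le> rel_ent \<rho> U"
  unfolding rel_ent_eq_integral(2)[OF assms, symmetric]
proof (rule integral_nonneg_AE, rule AE_I2)
  fix y assume "y \<in> space area"
  then show "0 \<le> \<rho> y * ln (\<rho> y) - \<rho> y * ln (gibbs U y) - \<rho> y + gibbs U y"
    using relative_entropy_hellinger[OF finite_entropyD(2)[OF assms] gibbs_pos, of y y]
    by (simp add: order_trans[OF zero_le_power2])
qed

lemma rel_ent_zero_imp:
  assumes r: "\<rho> \<in> finite_entropy_densities" and z: "rel_ent \<rho> U \<le> 0"
  shows "AE y in area. \<rho> y = gibbs U y"
proof -
  let ?k = "\<lambda>y. \<rho> y * ln (\<rho> y) - \<rho> y * ln (gibbs U y) - \<rho> y + gibbs U y"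
  have h: "(sqrt (\<rho> y) - sqrt (gibbs U y))\<^sup>2 \<le> ?k y" if "y \<in> S2" for y
    by (rule relative_entropy_hellinger[OF finite_entropyD(2)[OF r that] gibbs_pos])
  have "AE y in area. 0 \<le> ?k y"
    using h by (intro AE_I2) (auto intro: order_trans[OF zero_le_power2])
  moreover have "(LINT y|area. ?k y) = 0"
    using rel_ent_eq_integral(2)[OF r] z rel_ent_nonneg[OF r] by simp
  ultimately have "AE y in area. ?k y = 0"
    using integral_nonneg_eq_0_iff_AE[OF rel_ent_eq_integral(1)[OF r]] by blast
  then show ?thesis
    using AE_space
  proof eventually_elim
    case (elim y)
    then have "(sqrt (\<rho> y) - sqrt (gibbs U y))\<^sup>2 \<le> 0" using h[of y] by simp
    then show ?case by simp
  qed
qed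

lemma rel_ent_gibbs: "rel_ent (gibbs U) U = 0"
  unfolding rel_ent_eq_integral(2)[OF gibbs_finite_entropy, symmetric] by simp

lemma rel_ent_convex:
  assumes a: "a \<in> finite_entropy_densities" and b: "b \<in> finite_entropy_densities" and t: "0 < t" "t < 1"
  shows "rel_ent (\<lambda>x. (1 - t) * a x + t * b x) U \<le> (1 - t) * rel_ent a U + t * rel_ent b U"
proof -
  have lin: "(LINT y|area. W y * ((1 - t) * a y + t * b y)) = (1 - t) * (LINT y|area. W y * a y) + t * (LINT y|area. W y * b y)"
    if "integrable area (\<lambda>y. W y * a y)" "integrable area (\<lambda>y. W y * b y)" for W :: "real^3 \<Rightarrow> real"
  proof -
    have "(LINT y|area. W y * ((1 - t) * a y + t * b y)) = (LINT y|area. (1 - t) * (W y * a y) + t * (W y * b y))"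
      by (simp add: algebra_simps)
    then show ?thesis using that by simp
  qed
  show ?thesis
    unfolding rel_ent_def lin[OF integrable_V_density[OF a] integrable_V_density[OF b]]
      lin[OF integrable_U_density[OF a] integrable_U_density[OF b]]
    using convex_finite_entropy(2)[OF a b t] by (simp add: algebra_simps)
qed

end

text \<open>The first variation of the interaction term \<open>2 * \<beta> * energy \<rho> \<rho>\<close>.\<close>

abbreviation mf_pot :: "(real^3 \<Rightarrow> real) \<Rightarrow> real^3 \<Rightarrow> real" where
  "mf_pot \<rho> y \<equiv> 4 * \<beta> * pot Green \<rho> y"

lemma mf_pot_measurable: "\<rho> \<in> finite_entropy_densities \<Longrightarrow> mf_pot \<rho> \<in> borel_measurable area"
  using measurable_potential[OF finite_entropyD(1)] by simp

lemma mf_pot_bounded: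
  assumes "\<rho> \<in> finite_entropy_densities"
  obtains B where "\<And>y. y \<in> S2 \<Longrightarrow> \<bar>mf_pot \<rho> y\<bar> \<le> B"
proof -
  obtain C where C: "\<And>y. y \<in> S2 \<Longrightarrow> \<bar>pot Green \<rho> y\<bar> \<le> C" using potential_bounded[OF assms] by blast
  show ?thesis
    by (rule that[of "4 * \<beta> * C"]) (use C beta_pos in \<open>simp add: abs_mult\<close>)
qed

text \<open>The interaction energy is expanded around \<open>\<sigma>\<close>: the linear part joins the external
potential, the quadratic part is \<open>energy_dist\<close>.\<close>

lemma S_eq_rel_ent:
  assumes r: "\<rho> \<in> finite_entropy_densities" and s: "\<sigma> \<in> finite_entropy_densities"
  shows "S \<rho> = rel_ent \<rho> (mf_pot \<sigma>) + 2 * \<beta> * energy_dist \<rho> \<sigma> - 2 * \<beta> * energy \<sigma> \<sigma> - ln (partition (mf_pot \<sigma>))"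
proof -
  have lin: "(LINT y|area. mf_pot \<sigma> y * \<rho> y) = 4 * \<beta> * energy \<rho> \<sigma>"
  proof -
    have "(LINT y|area. mf_pot \<sigma> y * \<rho> y) = (LINT y|area. 4 * \<beta> * (\<rho> y * pot Green \<sigma> y))"
      by (simp add: mult_ac)
    also have "\<dots> = 4 * \<beta> * energy \<rho> \<sigma>" unfolding energy_def by (rule integral_mult_right_zero)
    finally show ?thesis .
  qed
  show ?thesis unfolding S_def rel_ent_def energy_dist_def lin by (simp add: algebra_simps)
qed

section \<open>Existence of a minimiser\<close>

text \<open>The linear terms of \<open>S\<close> have no midpoint defect and the energy has a nonnegative one, so the
defect of the entropy is at most that of \<open>S\<close>; \<open>mult_ln_midpoint\<close> is then
integrated.\<close>

lemma midpoint_L1: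
  assumes a: "a \<in> finite_entropy_densities" and b: "b \<in> finite_entropy_densities" and d: "0 < d"
  shows "(LINT x|area. \<bar>a x - b x\<bar>) \<le> (S a + S b - 2 * S (\<lambda>x. (1 - 1/2) * a x + 1/2 * b x)) / d + 2 * d"
proof -
  define m where "m x = (1 - 1/2) * a x + 1/2 * b x" for x
  have m: "m \<in> finite_entropy_densities"
    using convex_finite_entropy(1)[OF a b, of "1/2"] by (simp add: m_def[abs_def])
  note A = finite_entropyD[OF a] and B = finite_entropyD[OF b] and M = finite_entropyD[OF m]
  have i: "integrable area (\<lambda>x. (a x * ln (a x) + b x * ln (b x) - 2 * (m x * ln (m x))) / d + d * (a x + b x))"
    using A B M by simp
  have "(LINT x|area. \<bar>a x - b x\<bar>) \<le> (LINT x|area. (a x * ln (a x) + b x * ln (b x) - 2 * (m x * ln (m x))) / d + d * (a x + b x))"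
  proof (rule integral_mono[OF _ i])
    show "integrable area (\<lambda>x. \<bar>a x - b x\<bar>)" using A B by auto
    fix x assume "x \<in> space area"
    then have x: "x \<in> S2" by simp
    have mx: "m x = (a x + b x) / 2" by (simp add: m_def field_simps)
    show "\<bar>a x - b x\<bar> \<le> (a x * ln (a x) + b x * ln (b x) - 2 * (m x * ln (m x))) / d + d * (a x + b x)"
      unfolding mx by (rule mult_ln_midpoint[OF A(2)[OF x] B(2)[OF x] d])
  qed
  also have "\<dots> = (ent a + ent b - 2 * ent m) / d + 2 * d"
    using A B M by simp
  also have "\<dots> \<le> (S a + S b - 2 * S m) / d + 2 * d"
  proof -
    have V: "(LINT y|area. V y * m y) = 1/2 * (LINT y|area. V y * a y) + 1/2 * (LINT y|area. V y * b y)"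
    proof -
      have "(LINT y|area. V y * m y) = (LINT y|area. 1/2 * (V y * a y) + 1/2 * (V y * b y))"
        by (simp add: m_def algebra_simps)
      then show ?thesis using integrable_V_density[OF a] integrable_V_density[OF b] by simp
    qed
    have "energy m m = (1 - 1/2) * (1 - 1/2) * energy a a + 2 * (1 - 1/2) * (1/2) * energy a b + 1/2 * (1/2) * energy b b"
      unfolding m_def by (rule energy_combination[OF a b])
    then have "energy a a + energy b b - 2 * energy m m = energy_dist a b / 2"
      unfolding energy_dist_def by simp
    then have "0 \<le> energy a a + energy b b - 2 * energy m m" using energy_dist_nonneg[OF a b] by simp
    then have "0 \<le> 2 * \<beta> * (energy a a + energy b b - 2 * energy m m)" using beta_pos by simp
    then have "ent a + ent b - 2 * ent m \<le> S a + S b - 2 * S m"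
      unfolding S_def V by (simp add: algebra_simps)
    then show ?thesis using d by (simp add: divide_right_mono)
  qed
  finally show ?thesis unfolding m_def .
qed

lemma AE_pair_of_AE:
  assumes "AE x in area. P x"
  shows "AE p in area \<Otimes>\<^sub>M area. P (fst p) \<and> P (snd p)"
proof -
  obtain N where N: "N \<in> null_sets area" "{x \<in> space area. \<not> P x} \<subseteq> N"
    using assms by (auto simp: eventually_ae_filter)
  have "N \<times> space area \<in> null_sets (area \<Otimes>\<^sub>M area)" "space area \<times> N \<in> null_sets (area \<Otimes>\<^sub>M area)"
    by (rule area.times_in_null_sets1[OF N(1) sets.top], rule area.times_in_null_sets2[OF sets.top N(1)])
  then have "N \<times> space area \<union> space area \<times> N \<in> null_sets (area \<Otimes>\<^sub>M area)" by blast
  then show ?thesis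
    by (rule AE_I') (use N(2) in \<open>auto simp: space_pair_measure\<close>)
qed

text \<open>Midpoints cannot go below the infimum, so \<open>midpoint_L1\<close> makes a minimising sequence Cauchy
in \<open>L\<^sup>1\<close>. Its limit is almost everywhere a pointwise limit, and \<open>S\<close> is lower
semicontinuous there: the entropy with the potential, and the energy, are integrals of functions
bounded below by integrable ones.\<close>

lemma minimiser_exists:
  obtains \<rho> where "\<rho> \<in> finite_entropy_densities" "\<And>\<sigma>. \<sigma> \<in> finite_entropy_densities \<Longrightarrow> S \<rho> \<le> S \<sigma>"
proof -
  let ?P = finite_entropy_densities
  define I where "I = Inf (S ` ?P)"
  have I_le: "I \<le> S \<sigma>" if "\<sigma> \<in> ?P" for \<sigma> unfolding I_def by (rule cINF_lower[OF bdd_below_S that])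
  (* precision 4^(-k), so that midpoint_L1 with d = 2^(-k) makes the distance of successive members of order 2^(-k) *)
  have "\<exists>\<rho>\<in>?P. S \<rho> < I + (1/4) ^ k" for k :: nat
  proof -
    have "Inf (S ` ?P) < I + (1/4) ^ k" unfolding I_def by simp
    then show ?thesis using uniform_density by (subst (asm) cInf_less_iff) (use bdd_below_S in auto)
  qed
  then obtain r where r: "\<And>k. r k \<in> ?P" "\<And>k. S (r k) < I + (1/4) ^ k" by metis
  note R = finite_entropyD[OF r(1)]
  note [measurable] = R(1)
  have pk: "(1/4) ^ k \<le> (1::real)" for k :: nat by (simp add: power_le_one)
  define f where "f k x = r (Suc k) x - r k x" for k x
  have fi: "integrable area (f k)" for k unfolding f_def[abs_def] using R by simp
  have fL1: "(LINT x|area. norm (f k x)) \<le> 4 * (1/2) ^ k" for k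
  proof -
    let ?d = "(1/2) ^ k :: real"
    let ?m = "\<lambda>x. (1 - 1/2) * r (Suc k) x + 1/2 * r k x"
    have d: "0 < ?d" by simp
    have "S (r (Suc k)) + S (r k) - 2 * S ?m \<le> 2 * (1/4) ^ k"
    proof -
      have "I \<le> S ?m" using convex_finite_entropy(1)[OF r(1) r(1), of "1/2"] by (intro I_le) auto
      moreover have "(1/4) ^ Suc k \<le> (1/4::real) ^ k" by simp
      ultimately show ?thesis using r(2)[of k] r(2)[of "Suc k"] by linarith
    qed
    also have "(1/4) ^ k = ?d * ?d" by (simp flip: power_mult_distrib)
    finally have "(S (r (Suc k)) + S (r k) - 2 * S ?m) / ?d \<le> 2 * ?d"
      using d by (simp add: pos_divide_le_eq)
    moreover have "(LINT x|area. \<bar>r (Suc k) x - r k x\<bar>) \<le> (S (r (Suc k)) + S (r k) - 2 * S ?m) / ?d + 2 * ?d"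
      by (rule midpoint_L1[OF r(1) r(1) d])
    ultimately show ?thesis unfolding f_def real_norm_def by linarith
  qed
  have sum4: "summable (\<lambda>k. 4 * (1/2) ^ k :: real)" by (intro summable_mult summable_geometric) simp
  have fsum: "summable (\<lambda>k. LINT x|area. norm (f k x))"
    by (rule summable_comparison_test'[OF sum4, where N=0]) (use fL1 in auto)
  have fAE: "AE x in area. summable (\<lambda>k. norm (f k x))"
  proof -
    have [measurable]: "f k \<in> borel_measurable area" for k using fi by auto
    have "(\<integral>\<^sup>+x. (\<Sum>k. ennreal (norm (f k x))) \<partial>area) = (\<Sum>k. \<integral>\<^sup>+x. ennreal (norm (f k x)) \<partial>area)"
      by (rule nn_integral_suminf) simp
    also have "\<dots> = (\<Sum>k. ennreal (LINT x|area. norm (f k x)))"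
      by (intro suminf_cong nn_integral_eq_integral integrable_norm fi) simp
    also have "\<dots> = ennreal (\<Sum>k. LINT x|area. norm (f k x))"
      by (rule suminf_ennreal2[OF _ fsum]) (simp add: integral_nonneg_AE)
    finally have "(\<integral>\<^sup>+x. (\<Sum>k. ennreal (norm (f k x))) \<partial>area) \<noteq> \<infinity>" by simp
    then have "AE x in area. (\<Sum>k. ennreal (norm (f k x))) \<noteq> \<infinity>"
      by (intro nn_integral_PInf_AE) auto
    then show ?thesis by eventually_elim (rule summable_suminf_not_top, auto)
  qed
  define g where "g x = r 0 x + (\<Sum>k. f k x)" for x
  (* a version of the limit that is nonnegative at every point *)
  define \<rho> where "\<rho> x = max 0 (g x)" for x
  have gi: "integrable area g"
    unfolding g_def[abs_def] using R(3) integrable_suminf[OF fi fAE fsum] by simp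
  have gint: "(LINT x|area. g x) = 1"
  proof -
    have "(LINT x|area. f k x) = 0" for k unfolding f_def using R(3,4) by simp
    then have "(LINT x|area. (\<Sum>k. f k x)) = 0" using integral_suminf[OF fi fAE fsum] by simp
    then show ?thesis unfolding g_def using R(3,4) integrable_suminf[OF fi fAE fsum] by simp
  qed
  have lim_g: "AE x in area. (\<lambda>n. r n x) \<longlonglongrightarrow> g x"
    using fAE
  proof eventually_elim
    case (elim x)
    then have "(\<lambda>n. \<Sum>k<n. f k x) \<longlonglongrightarrow> (\<Sum>k. f k x)"
      by (rule summable_LIMSEQ[OF summable_norm_cancel])
    moreover have "(\<Sum>k<n. f k x) = r n x - r 0 x" for n unfolding f_def by (rule sum_lessThan_telescope)
    ultimately have "(\<lambda>n. r 0 x + (r n x - r 0 x)) \<longlonglongrightarrow> r 0 x + (\<Sum>k. f k x)"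
      by (intro tendsto_add tendsto_const) simp
    then show ?case by (simp add: g_def)
  qed
  have "0 \<le> \<rho> x" for x by (simp add: \<rho>_def)
  have g_nonneg: "AE x in area. \<rho> x = g x"
    using lim_g AE_space
  proof eventually_elim
    case (elim x)
    then have "0 \<le> g x" using R(2) by (intro LIMSEQ_le_const[OF elim(1)]) auto
    then show ?case by (simp add: \<rho>_def)
  qed
  have lim: "AE x in area. (\<lambda>n. r n x) \<longlonglongrightarrow> \<rho> x"
    using lim_g g_nonneg by eventually_elim simp
  have [measurable]: "g \<in> borel_measurable area" using gi by auto
  have m [measurable]: "\<rho> \<in> borel_measurable area" unfolding \<rho>_def[abs_def] by measurable
  have \<rho>i: "integrable area \<rho>" using gi g_nonneg m by (subst integrable_cong_AE[of _ _ g]) auto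
  have \<rho>1: "(LINT x|area. \<rho> x) = 1" using gint g_nonneg by (subst integral_cong_AE[of _ _ g]) auto
  define E where "E = (LINT y|area. exp (- V y))"
  define C where "C = (I + 1 + (LINT y|area. exp (- q * V y)) / q + \<beta>) / (1 - 1 / q)"
  have entC: "ent (r n) \<le> C" for n
  proof -
    have "(1 - 1 / q) * ent (r n) \<le> I + 1 + (LINT y|area. exp (- q * V y)) / q + \<beta>"
      using entropy_le_S[OF r(1)[of n]] r(2)[of n] pk[of n] by linarith
    moreover have "0 < 1 - 1 / q" using q_gt_1 by simp
    ultimately show ?thesis unfolding C_def by (simp add: pos_le_divide_eq mult.commute)
  qed
  have lim_ent: "AE x in area. (\<lambda>n. r n x * ln (r n x)) \<longlonglongrightarrow> \<rho> x * ln (\<rho> x)"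
    using lim AE_space
  proof eventually_elim
    case (elim x)
    then show ?case using R(2) by (intro tendsto_mult_ln always_eventually) auto
  qed
  have "integrable area (\<lambda>x. \<rho> x * ln (\<rho> x) + 1)"
  proof (rule fatou_integral(1)[where f="\<lambda>n x. r n x * ln (r n x) + 1" and C="C + 4 * pi"])
    show "AE x in area. (\<lambda>n. r n x * ln (r n x) + 1) \<longlonglongrightarrow> \<rho> x * ln (\<rho> x) + 1"
      using lim_ent by eventually_elim (intro tendsto_add tendsto_const)
    show "AE x in area. 0 \<le> r n x * ln (r n x) + 1" for n
    proof (rule AE_I2)
      fix x assume "x \<in> space area"
      then have "0 \<le> r n x" using R(2) by simp
      then show "0 \<le> r n x * ln (r n x) + 1" using mult_ln_ge[of "r n x"] by linarith
    qed
    show "(LINT x|area. r n x * ln (r n x) + 1) \<le> C + 4 * pi" for n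
      using R(5) entC[of n] by (simp add: measure_def emeasure_area_S2)
  qed (use R in auto)
  then have "integrable area (\<lambda>x. \<rho> x * ln (\<rho> x) + 1 - 1)" by (intro Bochner_Integration.integrable_diff) auto
  then have \<rho>: "\<rho> \<in> ?P"
    unfolding finite_entropy_densities_iff using m \<rho>i \<rho>1 \<open>\<And>x. 0 \<le> \<rho> x\<close> by simp
  note D = finite_entropyD[OF \<rho>]
  (* by young_exp the added exponential makes the integrand nonnegative; the shift by 1/2 in T below does the same for the energy *)
  define A where "A s = (LINT x|area. s x * ln (s x) + V x * s x + exp (- V x))" for s
  have A: "A s = ent s + (LINT x|area. V x * s x) + E" if "s \<in> ?P" for s
    unfolding A_def E_def using finite_entropyD[OF that] integrable_V_density[OF that] integrable_exp_neg by simp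
  have A_pt: "0 \<le> s x * ln (s x) + V x * s x + exp (- V x)" if "s \<in> ?P" "x \<in> S2" for s x
    using young_exp[OF finite_entropyD(2)[OF that], of "- V x"] finite_entropyD(2)[OF that] by (simp add: mult.commute)
  have A0: "0 \<le> A s" if "s \<in> ?P" for s
    unfolding A_def using A_pt[OF that] by (intro integral_nonneg_AE AE_I2) auto
  have SA: "S s = A s - E + 2 * \<beta> * energy s s" if "s \<in> ?P" for s
    unfolding S_def A[OF that] by simp
  have e_low: "- \<beta> \<le> 2 * \<beta> * energy s s" if "s \<in> ?P" for s
    using mult_left_mono[OF energy_ge[OF that], of "2 * \<beta>"] beta_pos by simp
  have Alow: "\<forall>\<^sub>F n in sequentially. A \<rho> - e < A (r n)" if e: "0 < e" for e
    unfolding A_def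
  proof (rule fatou_integral(2)[OF _ _ _ _ _ e, where C="I + 1 + \<beta> + E"])
    show "AE x in area. (\<lambda>n. r n x * ln (r n x) + V x * r n x + exp (- V x)) \<longlonglongrightarrow> \<rho> x * ln (\<rho> x) + V x * \<rho> x + exp (- V x)"
      using lim_ent lim by eventually_elim (rule tendsto_add[OF tendsto_add[OF _ tendsto_mult[OF tendsto_const]] tendsto_const])
    show "integrable area (\<lambda>x. r n x * ln (r n x) + V x * r n x + exp (- V x))" for n
      using R integrable_V_density[OF r(1)] integrable_exp_neg by simp
    show "AE x in area. 0 \<le> r n x * ln (r n x) + V x * r n x + exp (- V x)" for n
      using A_pt[OF r(1)] by (intro AE_I2) auto
    show "(LINT x|area. r n x * ln (r n x) + V x * r n x + exp (- V x)) \<le> I + 1 + \<beta> + E" for n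
      using SA[OF r(1)[of n]] e_low[OF r(1)[of n]] r(2)[of n] pk[of n] unfolding A_def[symmetric] by linarith
  qed simp
  define T where "T s = (LINT p|(area \<Otimes>\<^sub>M area). s (fst p) * s (snd p) * (Green (fst p) (snd p) + 1/2))" for s
  have Ti: "integrable (area \<Otimes>\<^sub>M area) (\<lambda>p. s (fst p) * s (snd p) * (Green (fst p) (snd p) + 1/2))"
    and T: "T s = energy s s + 1/2" if s: "s \<in> ?P" for s
  proof -
    have e: "s (fst p) * s (snd p) * (Green (fst p) (snd p) + 1/2)
       = s (fst p) * s (snd p) * Green (fst p) (snd p) + 1/2 * (s (fst p) * s (snd p))" for p by (simp add: algebra_simps)
    note si = finite_entropyD(3)[OF s]
    show "integrable (area \<Otimes>\<^sub>M area) (\<lambda>p. s (fst p) * s (snd p) * (Green (fst p) (snd p) + 1/2))"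
      unfolding e using integrable_energy(1)[OF s s] integrable_pair_product(1)[OF si si] by simp
    show "T s = energy s s + 1/2"
      unfolding T_def e using integrable_energy(1,3)[OF s s] integrable_pair_product[OF si si] finite_entropyD(4)[OF s] by simp
  qed
  have Tlow: "\<forall>\<^sub>F n in sequentially. T \<rho> - e < T (r n)" if e: "0 < e" for e
    unfolding T_def
  proof (rule fatou_integral(2)[OF _ _ _ _ _ e, where C="(I + 1 + E) / (2 * \<beta>) + 1/2"])
    show "AE p in area \<Otimes>\<^sub>M area. (\<lambda>n. r n (fst p) * r n (snd p) * (Green (fst p) (snd p) + 1/2))
       \<longlonglongrightarrow> \<rho> (fst p) * \<rho> (snd p) * (Green (fst p) (snd p) + 1/2)"
      using AE_pair_of_AE[OF lim] by eventually_elim (intro tendsto_mult tendsto_const, auto)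
    show "integrable (area \<Otimes>\<^sub>M area) (\<lambda>p. r n (fst p) * r n (snd p) * (Green (fst p) (snd p) + 1/2))" for n
      by (rule Ti[OF r(1)])
    show "AE p in area \<Otimes>\<^sub>M area. 0 \<le> r n (fst p) * r n (snd p) * (Green (fst p) (snd p) + 1/2)" for n
    proof (rule AE_I2)
      fix p assume "p \<in> space (area \<Otimes>\<^sub>M area)"
      then have p: "fst p \<in> S2" "snd p \<in> S2" by (auto simp: space_pair_measure)
      show "0 \<le> r n (fst p) * r n (snd p) * (Green (fst p) (snd p) + 1/2)"
        using R(2)[OF p(1)] R(2)[OF p(2)] Green_ge[OF p] by (intro mult_nonneg_nonneg) auto
    qed
    show "(LINT p|(area \<Otimes>\<^sub>M area). r n (fst p) * r n (snd p) * (Green (fst p) (snd p) + 1/2)) \<le> (I + 1 + E) / (2 * \<beta>) + 1/2" for n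
    proof -
      have "2 * \<beta> * energy (r n) (r n) \<le> I + 1 + E"
        using SA[OF r(1)[of n]] A0[OF r(1)[of n]] r(2)[of n] pk[of n] by linarith
      then have "energy (r n) (r n) \<le> (I + 1 + E) / (2 * \<beta>)"
        using beta_pos by (simp add: pos_le_divide_eq mult.commute)
      then show ?thesis using T[OF r(1)[of n]] unfolding T_def by simp
    qed
    show "(\<lambda>p. \<rho> (fst p) * \<rho> (snd p) * (Green (fst p) (snd p) + 1/2)) \<in> borel_measurable (area \<Otimes>\<^sub>M area)"
      using Ti[OF \<rho>] by auto
  qed
  have "S \<rho> \<le> I"
  proof (rule field_le_epsilon)
    fix e :: real assume e: "0 < e"
    define d where "d = e / (2 * (1 + 2 * \<beta>))"
    have d: "0 < d" "d * (1 + 2 * \<beta>) = e / 2" using e beta_pos by (simp_all add: d_def field_simps)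
    have "(\<lambda>n. (1/4::real) ^ n) \<longlonglongrightarrow> 0" by (rule LIMSEQ_power_zero) simp
    then have "\<forall>\<^sub>F n in sequentially. (1/4::real) ^ n < e / 2" using e by (intro order_tendstoD) auto
    with Alow[OF d(1)] Tlow[OF d(1)] have "\<forall>\<^sub>F n in sequentially. S \<rho> \<le> I + e"
    proof eventually_elim
      case (elim n)
      have "2 * \<beta> * (energy \<rho> \<rho> - d) < 2 * \<beta> * energy (r n) (r n)"
        using elim(2) beta_pos unfolding T[OF \<rho>] T[OF r(1)] by (intro mult_strict_left_mono) auto
      then have "S \<rho> - d * (1 + 2 * \<beta>) < S (r n)"
        using elim(1) unfolding SA[OF \<rho>] SA[OF r(1)] by (simp add: algebra_simps)
      then show ?case using r(2)[of n] elim(3) d(2) by linarith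
    qed
    then show "S \<rho> \<le> I + e" by (simp add: eventually_const)
  qed
  then show ?thesis using that[OF \<rho>] I_le by (meson order_trans)
qed

section \<open>The mean field equation\<close>

text \<open>A minimiser \<open>r\<close> has to coincide with the Gibbs density in its own field: moving the fraction
\<open>t\<close> towards that density lowers the relative entropy in proportion to \<open>t\<close> but costs
energy only of order \<open>t\<^sup>2\<close>. The Gibbs density itself serves as \<open>\<sigma>\<close>, so that
the equation holds at every point; minimality and uniqueness follow from \<open>S_eq_rel_ent\<close>.\<close>

theorem mean_field_equilibrium:
  obtains \<sigma> where "\<sigma> \<in> finite_entropy_densities" "\<And>y. \<sigma> y = gibbs (mf_pot \<sigma>) y"
    and "S \<sigma> = - 2 * \<beta> * energy \<sigma> \<sigma> - ln (partition (mf_pot \<sigma>))"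
    and "\<And>\<rho>. \<rho> \<in> finite_entropy_densities \<Longrightarrow> S \<sigma> \<le> S \<rho>"
    and "\<And>\<rho>. \<rho> \<in> finite_entropy_densities \<Longrightarrow> S \<rho> = S \<sigma> \<Longrightarrow> AE y in area. \<rho> y = \<sigma> y"
proof -
  let ?P = finite_entropy_densities
  obtain r where r: "r \<in> ?P" and min: "\<And>\<sigma>. \<sigma> \<in> ?P \<Longrightarrow> S r \<le> S \<sigma>"
    using minimiser_exists by blast
  obtain B where B: "\<And>y. y \<in> S2 \<Longrightarrow> \<bar>mf_pot r y\<bar> \<le> B" using mf_pot_bounded[OF r] by blast
  note ctx = mf_pot_measurable[OF r] B
  define \<sigma> where "\<sigma> = gibbs (mf_pot r)"
  have \<sigma>: "\<sigma> \<in> ?P" unfolding \<sigma>_def by (rule gibbs_finite_entropy[OF ctx])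
  have "rel_ent r (mf_pot r) \<le> 0"
  proof (rule ccontr)
    let ?k = "rel_ent r (mf_pot r)" and ?D = "2 * \<beta> * energy_dist \<sigma> r"
    assume "\<not> ?k \<le> 0"
    then have k: "0 < ?k" by simp
    have D: "0 \<le> ?D" using energy_dist_nonneg[OF \<sigma> r] beta_pos by simp
    (* small enough that the gain t * ?k exceeds the cost t\<^sup>2 * ?D *)
    define t where "t = ?k / (2 * (?D + ?k))"
    have t: "0 < t" "t < 1" using k D by (auto simp: t_def field_simps)
    have td: "t * ?D < ?k"
    proof -
      have "t * ?D \<le> t * (?D + ?k)" using t k by (intro mult_left_mono) auto
      also have "\<dots> = ?k / 2"
      proof -
        have "p / (2 * s) * s = p / 2" if "s \<noteq> 0" for p s :: real using that by simp
        from this[of "?D + ?k" ?k] show ?thesis unfolding t_def using k D by linarith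
      qed
      also have "\<dots> < ?k" using k by simp
      finally show ?thesis .
    qed
    define m where "m x = (1 - t) * r x + t * \<sigma> x" for x
    have m: "m \<in> ?P" unfolding m_def[abs_def] by (rule convex_finite_entropy(1)[OF r \<sigma> t])
    have "energy_dist m r = t * t * energy_dist \<sigma> r"
    proof -
      have "energy m m = (1 - t) * (1 - t) * energy r r + 2 * (1 - t) * t * energy r \<sigma> + t * t * energy \<sigma> \<sigma>"
        unfolding m_def[abs_def] by (rule energy_combination[OF r \<sigma>])
      moreover have "energy m r = (1 - t) * energy r r + t * energy \<sigma> r"
        unfolding m_def[abs_def] by (rule energy_combination_left[OF r \<sigma> r])
      ultimately show ?thesis
        using energy_commute[OF r \<sigma>] unfolding energy_dist_def by (simp add: algebra_simps)
    qed
    moreover have "rel_ent m (mf_pot r) \<le> (1 - t) * ?k + t * 0"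
      using rel_ent_convex[OF ctx r \<sigma> t] rel_ent_gibbs[OF ctx] unfolding m_def[abs_def] \<sigma>_def by simp
    moreover have "energy_dist r r = 0" by (simp add: energy_dist_def)
    ultimately have "?k \<le> (1 - t) * ?k + 2 * \<beta> * (t * t * energy_dist \<sigma> r)"
      using min[OF m] S_eq_rel_ent[OF m r] S_eq_rel_ent[OF r r] by simp
    then have "t * ?k \<le> t * (t * ?D)" by (simp add: algebra_simps)
    then show False using t td by (simp add: mult_le_cancel_left_pos)
  qed
  then have r\<sigma>: "AE y in area. r y = \<sigma> y" unfolding \<sigma>_def using rel_ent_zero_imp[OF ctx r] by simp
  have pot_eq: "pot Green \<sigma> y = pot Green r y" for y
    unfolding pot_def
    by (rule integral_cong_AE) (use r\<sigma> finite_entropyD(1)[OF r] finite_entropyD(1)[OF \<sigma>] in \<open>auto elim: eventually_mono\<close>)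
  have mf: "mf_pot \<sigma> = mf_pot r" using pot_eq by auto
  have eq: "\<sigma> y = gibbs (mf_pot \<sigma>) y" for y unfolding mf by (simp add: \<sigma>_def)
  have "rel_ent \<sigma> (mf_pot r) = 0" unfolding \<sigma>_def by (rule rel_ent_gibbs[OF ctx])
  then have rel0: "rel_ent \<sigma> (mf_pot \<sigma>) = 0" unfolding mf .
  obtain B' where B': "\<And>y. y \<in> S2 \<Longrightarrow> \<bar>mf_pot \<sigma> y\<bar> \<le> B'" using mf_pot_bounded[OF \<sigma>] by blast
  note ctx' = mf_pot_measurable[OF \<sigma>] B'
  show ?thesis
  proof (rule that[OF \<sigma> eq])
    show S\<sigma>: "S \<sigma> = - 2 * \<beta> * energy \<sigma> \<sigma> - ln (partition (mf_pot \<sigma>))"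
      using S_eq_rel_ent[OF \<sigma> \<sigma>] rel0 by (simp add: energy_dist_def)
    fix \<rho> assume \<rho>: "\<rho> \<in> ?P"
    have k: "0 \<le> rel_ent \<rho> (mf_pot \<sigma>)" by (rule rel_ent_nonneg[OF ctx' \<rho>])
    have D: "0 \<le> 2 * \<beta> * energy_dist \<rho> \<sigma>" using energy_dist_nonneg[OF \<rho> \<sigma>] beta_pos by simp
    show "S \<sigma> \<le> S \<rho>" using S_eq_rel_ent[OF \<rho> \<sigma>] S\<sigma> k D by simp
    assume "S \<rho> = S \<sigma>"
    then have "rel_ent \<rho> (mf_pot \<sigma>) \<le> 0" using S_eq_rel_ent[OF \<rho> \<sigma>] S\<sigma> D by simp
    then have "AE y in area. \<rho> y = gibbs (mf_pot \<sigma>) y" using rel_ent_zero_imp[OF ctx' \<rho>] by simp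
    then show "AE y in area. \<rho> y = \<sigma> y" using eq by simp
  qed
qed

end

section \<open>Uniqueness of the wrong sign expectation\<close>

lemma continuous_map_fun_upd:
  assumes z: "z \<in> extensional I" and j: "j \<in> I"
  shows "continuous_map euclidean (product_topology (\<lambda>_. euclidean) I) (\<lambda>\<zeta>::complex. z(j := \<zeta>))"
  unfolding continuous_map_componentwise
proof (intro conjI ballI)
  show "(\<lambda>\<zeta>. z(j := \<zeta>)) ` topspace euclidean \<subseteq> extensional I"
    using z j by (auto simp: extensional_def)
  fix i assume "i \<in> I"
  show "continuous_map euclidean euclidean (\<lambda>\<zeta>. (z(j := \<zeta>)) i)"
    by (cases "i = j") auto
qed

text \<open>The coordinates are moved off the real axis one at a time. In the moving coordinate the domain
contains the connected cross \<open>\<real> \<union> \<i> \<real>\<close>, and the identity theorem applies on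
the component of the slice around it because the extensions agree on \<open>\<real>\<close>.\<close>

lemma holomorphic_extension_unique:
  fixes h1 h2 :: "('i \<Rightarrow> complex) \<Rightarrow> complex"
  assumes fin: "finite I" and e1: "holomorphic_extension I h h1" and e2: "holomorphic_extension I h h2"
    and z: "z \<in> (\<Pi>\<^sub>E i\<in>I. \<real> \<union> (*) \<i> ` \<real>)"
  shows "h1 z = h2 z"
proof -
  let ?X = "product_topology (\<lambda>_. euclidean) I :: ('i \<Rightarrow> complex) topology"
  let ?A = "\<Pi>\<^sub>E i\<in>I. (\<real> \<union> (*) \<i> ` \<real> :: complex set)"
  obtain U1 where U1: "openin ?X U1" "?A \<subseteq> U1" "holomorphic_several I U1 h1"
    using e1 unfolding holomorphic_extension_def by blast
  obtain U2 where U2: "openin ?X U2" "?A \<subseteq> U2" "holomorphic_several I U2 h2"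
    using e2 unfolding holomorphic_extension_def by blast
  have base: "h1 z = h2 z" if "z \<in> ?A" "\<forall>i\<in>I. z i \<in> \<real>" for z
  proof -
    define x where "x = (\<lambda>i\<in>I. Re (z i))"
    have xz: "(\<lambda>i\<in>I. complex_of_real (x i)) = z"
      using that by (auto simp: x_def fun_eq_iff PiE_def extensional_def restrict_def)
    have x: "x \<in> (\<Pi>\<^sub>E i\<in>I. UNIV)" by (simp add: x_def)
    have "h1 (\<lambda>i\<in>I. complex_of_real (x i)) = h x" "h2 (\<lambda>i\<in>I. complex_of_real (x i)) = h x"
      using e1 e2 x unfolding holomorphic_extension_def by blast+
    then show ?thesis unfolding xz by simp
  qed
  have "\<forall>z\<in>?A. (\<forall>i\<in>I - J. z i \<in> \<real>) \<longrightarrow> h1 z = h2 z" if "J \<subseteq> I" for J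
    using finite_subset[OF that fin] that
  proof (induction J rule: finite_induct)
    case empty
    then show ?case using base by auto
  next
    case (insert j J)
    then have j: "j \<in> I" and IH: "\<And>z. z \<in> ?A \<Longrightarrow> \<forall>i\<in>I - J. z i \<in> \<real> \<Longrightarrow> h1 z = h2 z" by auto
    show ?case
    proof (intro ballI impI)
      fix z assume z: "z \<in> ?A" and zr: "\<forall>i\<in>I - insert j J. z i \<in> \<real>"
      have ext: "z \<in> extensional I" using z by (simp add: PiE_def)
      define T where "T = {\<zeta>. z(j := \<zeta>) \<in> U1 \<inter> U2}"
      let ?ax = "\<real> \<union> (*) \<i> ` \<real> :: complex set"
      have zj: "z(j := \<zeta>) \<in> ?A" if "\<zeta> \<in> ?ax" for \<zeta>
        using z that j by (auto simp: PiE_def Pi_def extensional_def)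
      have axT: "?ax \<subseteq> T"
      proof
        fix \<zeta> :: complex assume "\<zeta> \<in> ?ax"
        then have "z(j := \<zeta>) \<in> ?A" by (rule zj)
        then show "\<zeta> \<in> T" unfolding T_def using subsetD[OF U1(2)] subsetD[OF U2(2)] by simp
      qed
      have openT: "open T"
      proof -
        have "openin ?X (U1 \<inter> U2)" using U1(1) U2(1) by (rule openin_Int)
        then have "openin euclidean {\<zeta> \<in> topspace euclidean. z(j := \<zeta>) \<in> U1 \<inter> U2}"
          by (rule openin_continuous_map_preimage[OF continuous_map_fun_upd[OF ext j]])
        then show ?thesis by (simp add: T_def)
      qed
      define f where "f \<zeta> = h1 (z(j := \<zeta>)) - h2 (z(j := \<zeta>))" for \<zeta>
      have diff: "f field_differentiable (at \<zeta>)" if \<zeta>: "\<zeta> \<in> T" for \<zeta>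
      proof -
        have "(\<lambda>w. h1 ((z(j := \<zeta>))(j := w))) field_differentiable (at ((z(j := \<zeta>)) j))"
          using U1(3) \<zeta> j unfolding holomorphic_several_def T_def by blast
        moreover have "(\<lambda>w. h2 ((z(j := \<zeta>))(j := w))) field_differentiable (at ((z(j := \<zeta>)) j))"
          using U2(3) \<zeta> j unfolding holomorphic_several_def T_def by blast
        ultimately show ?thesis
          unfolding f_def[abs_def] by (intro field_differentiable_diff) simp_all
      qed
      define C where "C = connected_component_set T 0"
      have T0: "0 \<in> T" using axT by auto
      have conn: "connected ?ax"
      proof (rule connected_Un)
        have "connected (range complex_of_real)"
          by (intro connected_continuous_image continuous_intros connected_UNIV)
        then show "connected (\<real> :: complex set)" by (simp add: Reals_def)
        then show "connected ((*) \<i> ` (\<real> :: complex set))"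
          by (intro connected_continuous_image continuous_intros)
        have "0 \<in> (\<real> :: complex set) \<inter> (*) \<i> ` \<real>" by (auto simp: image_iff intro!: bexI[of _ 0])
        then show "(\<real> :: complex set) \<inter> (*) \<i> ` \<real> \<noteq> {}" by blast
      qed
      have axC: "?ax \<subseteq> C" unfolding C_def
        by (rule connected_component_maximal[OF _ conn axT]) simp
      have CT: "C \<subseteq> T" unfolding C_def by (rule connected_component_subset)
      have "f (z j) = 0"
      proof (rule analytic_continuation[of f C \<real> 0])
        show "f holomorphic_on C"
          unfolding holomorphic_on_def using diff CT by (blast intro: field_differentiable_at_within)
        show "open C" unfolding C_def by (rule open_connected_component[OF openT])
        show "connected C" unfolding C_def by simp
        show "\<real> \<subseteq> C" "0 \<in> C" using axC by auto
        show "(0::complex) islimpt \<real>"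
          unfolding islimpt_approachable
        proof (intro allI impI)
          fix e :: real assume "0 < e"
          then show "\<exists>x'\<in>\<real>. x' \<noteq> (0::complex) \<and> dist x' 0 < e"
            by (intro bexI[of _ "complex_of_real (e / 2)"]) auto
        qed
        show "f \<zeta> = 0" if "\<zeta> \<in> \<real>" for \<zeta>
        proof -
          have "h1 (z(j := \<zeta>)) = h2 (z(j := \<zeta>))"
            using that zr by (intro IH zj) auto
          then show ?thesis by (simp add: f_def)
        qed
        have "z j \<in> ?ax" using z j by auto
        then show "z j \<in> C" using axC by blast
      qed
      then show "h1 z = h2 z" by (simp add: f_def)
    qed
  qed
  from this[of I] z show ?thesis by auto
qed

lemma wrong_sign_expectation_eqI:
  assumes fin: "finite I" and ext: "holomorphic_extension I h H"
    and int: "integrable (std_gaussian I) (\<lambda>W. H (\<lambda>i\<in>I. \<i> * complex_of_real (W i)))"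
  shows "wrong_sign_expectation I h = (LINT W|std_gaussian I. H (\<lambda>i\<in>I. \<i> * complex_of_real (W i)))"
  unfolding wrong_sign_expectation_def
proof (rule the_equality)
  show "\<exists>h'. holomorphic_extension I h h' \<and>
        integrable (std_gaussian I) (\<lambda>W. h' (\<lambda>i\<in>I. \<i> * complex_of_real (W i))) \<and>
        (LINT W|std_gaussian I. H (\<lambda>i\<in>I. \<i> * complex_of_real (W i)))
        = (LINT W|std_gaussian I. h' (\<lambda>i\<in>I. \<i> * complex_of_real (W i)))"
    using ext int by blast
  fix v assume "\<exists>h'. holomorphic_extension I h h' \<and>
        integrable (std_gaussian I) (\<lambda>W. h' (\<lambda>i\<in>I. \<i> * complex_of_real (W i))) \<and>
        v = (LINT W|std_gaussian I. h' (\<lambda>i\<in>I. \<i> * complex_of_real (W i)))"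
  then obtain h' where h': "holomorphic_extension I h h'"
    and v: "v = (LINT W|std_gaussian I. h' (\<lambda>i\<in>I. \<i> * complex_of_real (W i)))" by blast
  have "h' (\<lambda>i\<in>I. \<i> * complex_of_real (W i)) = H (\<lambda>i\<in>I. \<i> * complex_of_real (W i))" for W
    by (rule holomorphic_extension_unique[OF fin h' ext]) auto
  then show "v = (LINT W|std_gaussian I. H (\<lambda>i\<in>I. \<i> * complex_of_real (W i)))"
    unfolding v by simp
qed

section \<open>Entire exponential integrals\<close>

lemma norm_exp_minus_1_le: "norm (exp w - 1) \<le> norm w * exp (norm w)" for w :: complex
proof -
  have "norm (exp w - exp 0) \<le> exp (norm w) * norm (w - 0)"
  proof (rule field_differentiable_bound[of "cball 0 (norm w)"])
    fix z :: complex assume "z \<in> cball 0 (norm w)"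
    then show "norm (exp z) \<le> exp (norm w)"
      using norm_exp[of z] by (auto intro: order_trans)
  qed (auto intro!: DERIV_subset[OF DERIV_exp])
  then show ?thesis by (simp add: mult.commute)
qed

definition expo :: "'i set \<Rightarrow> ('i \<Rightarrow> 'b \<Rightarrow> real) \<Rightarrow> ('b \<Rightarrow> real) \<Rightarrow> ('i \<Rightarrow> complex) \<Rightarrow> 'b \<Rightarrow> complex" where
  "expo I c d z y = (\<Sum>i\<in>I. of_real (c i y) * z i) + of_real (d y)"

definition exp_int ::
    "'b measure \<Rightarrow> 'i set \<Rightarrow> ('i \<Rightarrow> 'b \<Rightarrow> real) \<Rightarrow> ('b \<Rightarrow> real) \<Rightarrow> ('i \<Rightarrow> complex) \<Rightarrow> complex" where
  "exp_int M I c d z = (LINT y|M. exp (expo I c d z y))"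

text \<open>The entire function whose values on the imaginary axes define the wrong sign expectation, see
\<open>exp_fun_extension\<close>.\<close>

definition exp_fun ::
    "'b measure \<Rightarrow> 'i set \<Rightarrow> ('i \<Rightarrow> 'b \<Rightarrow> real) \<Rightarrow> ('b \<Rightarrow> real) \<Rightarrow> complex \<Rightarrow> ('i \<Rightarrow> real) \<Rightarrow> real
      \<Rightarrow> ('i \<Rightarrow> complex) \<Rightarrow> complex" where
  "exp_fun M I c d K a \<mu> z = K * exp ((\<Sum>i\<in>I. of_real (a i) * z i) - of_real \<mu> * exp_int M I c d z)"

context
  fixes M :: "'b measure" and I :: "'i set" and c :: "'i \<Rightarrow> 'b \<Rightarrow> real" and d :: "'b \<Rightarrow> real" and B :: real
  assumes fm: "finite_measure M" and fin: "finite I"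
    and c_meas [measurable]: "\<And>i. c i \<in> borel_measurable M" and d_meas [measurable]: "d \<in> borel_measurable M"
    and c_bd: "\<And>i y. y \<in> space M \<Longrightarrow> \<bar>c i y\<bar> \<le> B" and d_bd: "\<And>y. y \<in> space M \<Longrightarrow> \<bar>d y\<bar> \<le> B"
begin

interpretation M: finite_measure M by (rule fm)

lemma expo_measurable [measurable]: "expo I c d z \<in> borel_measurable M"
  unfolding expo_def[abs_def] by measurable

lemma norm_expo_le:
  assumes "y \<in> space M" shows "norm (expo I c d z y) \<le> B * (\<Sum>i\<in>I. norm (z i)) + B"
proof -
  have "norm (expo I c d z y) \<le> (\<Sum>i\<in>I. norm (of_real (c i y) * z i)) + norm (of_real (d y) :: complex)"
    unfolding expo_def by (intro order_trans[OF norm_triangle_ineq] add_mono norm_sum order_refl)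
  also have "\<dots> \<le> (\<Sum>i\<in>I. B * norm (z i)) + B"
    using c_bd[OF assms] d_bd[OF assms] by (intro add_mono sum_mono) (auto simp: norm_mult intro!: mult_right_mono)
  finally show ?thesis by (simp add: sum_distrib_left)
qed

lemma norm_exp_expo_le: "y \<in> space M \<Longrightarrow> norm (exp (expo I c d z y)) \<le> exp (B * (\<Sum>i\<in>I. norm (z i)) + B)"
  using norm_expo_le[of y z] norm_exp[of "expo I c d z y"] by (meson exp_le_cancel_iff order_trans)

lemma exp_expo_integrable: "integrable M (\<lambda>y. exp (expo I c d z y))"
  by (rule M.integrable_const_bound[OF AE_I2[OF norm_exp_expo_le]]) simp_all

lemma exp_int_tendsto:
  assumes Z: "\<And>i. i \<in> I \<Longrightarrow> ((\<lambda>t. Z t i) \<longlongrightarrow> z i) F"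
  shows "((\<lambda>t. exp_int M I c d (Z t)) \<longlongrightarrow> exp_int M I c d z) F"
proof -
  define N where "N t = B * (\<Sum>i\<in>I. norm (Z t i - z i))" for t
  let ?K = "exp (B * (\<Sum>i\<in>I. norm (z i)) + B)"
  have "((\<lambda>t. N t) \<longlongrightarrow> B * (\<Sum>i\<in>I. norm (z i - z i))) F"
    unfolding N_def by (intro tendsto_intros Z)
  then have N0: "(N \<longlongrightarrow> 0) F" by simp
  have bound: "norm (exp_int M I c d (Z t) - exp_int M I c d z) \<le> measure M (space M) * (?K * (N t * exp (N t)))" for t
  proof -
    have pt: "norm (exp (expo I c d (Z t) y) - exp (expo I c d z y)) \<le> ?K * (N t * exp (N t))" if y: "y \<in> space M" for y
    proof -
      define w where "w = expo I c d (Z t) y - expo I c d z y"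
      have w: "w = (\<Sum>i\<in>I. of_real (c i y) * (Z t i - z i))"
        unfolding w_def expo_def by (simp add: sum_subtractf algebra_simps)
      have "norm w \<le> (\<Sum>i\<in>I. norm (of_real (c i y) * (Z t i - z i)))" unfolding w by (rule norm_sum)
      also have "\<dots> \<le> (\<Sum>i\<in>I. B * norm (Z t i - z i))"
        using c_bd[OF y] by (intro sum_mono) (auto simp: norm_mult intro!: mult_right_mono)
      finally have wN: "norm w \<le> N t" by (simp add: N_def sum_distrib_left)
      have "exp (expo I c d (Z t) y) - exp (expo I c d z y) = exp (expo I c d z y) * (exp w - 1)"
        by (simp add: w_def algebra_simps exp_add[symmetric])
      then have "norm (exp (expo I c d (Z t) y) - exp (expo I c d z y)) = norm (exp (expo I c d z y)) * norm (exp w - 1)"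
        by (simp add: norm_mult)
      also have "\<dots> \<le> ?K * (norm w * exp (norm w))"
        by (intro mult_mono norm_exp_expo_le y norm_exp_minus_1_le) auto
      also have "\<dots> \<le> ?K * (N t * exp (N t))"
        using wN by (intro mult_left_mono mult_mono) (auto intro: order_trans[OF norm_ge_zero])
      finally show ?thesis .
    qed
    have "norm (exp_int M I c d (Z t) - exp_int M I c d z) = norm (LINT y|M. exp (expo I c d (Z t) y) - exp (expo I c d z y))"
      unfolding exp_int_def using exp_expo_integrable by simp
    also have "\<dots> \<le> (LINT y|M. norm (exp (expo I c d (Z t) y) - exp (expo I c d z y)))"
      by (rule integral_norm_bound)
    also have "\<dots> \<le> (LINT y|M. ?K * (N t * exp (N t)))"
      by (rule integral_mono) (use exp_expo_integrable pt in auto)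
    finally show ?thesis by simp
  qed
  have "((\<lambda>t. measure M (space M) * (?K * (N t * exp (N t)))) \<longlongrightarrow> measure M (space M) * (?K * (0 * exp 0))) F"
    by (intro tendsto_intros N0)
  then have "((\<lambda>t. exp_int M I c d (Z t) - exp_int M I c d z) \<longlongrightarrow> 0) F"
    by (intro Lim_null_comparison[OF always_eventually[OF allI[OF bound]]]) simp
  then show ?thesis by (simp add: Lim_null[of _ "exp_int M I c d z"])
qed

lemma exp_int_differentiable:
  assumes j: "j \<in> I"
  shows "(\<lambda>\<zeta>. exp_int M I c d (z(j := \<zeta>))) field_differentiable (at w)"
proof -
  define D where "D = (LINT y|M. of_real (c j y) * exp (expo I c d (z(j := w)) y))"
  let ?K = "exp (B * (\<Sum>i\<in>I. norm ((z(j := w)) i)) + B)"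
  have ex: "expo I c d (z(j := w + h)) y = expo I c d (z(j := w)) y + of_real (c j y) * h" for h y
  proof -
    have "(\<Sum>i\<in>I. of_real (c i y) * (z(j := w + h)) i) = (\<Sum>i\<in>I. of_real (c i y) * (z(j := w)) i + (if i = j then of_real (c j y) * h else 0))"
      by (intro sum.cong refl) (auto simp: algebra_simps)
    also have "\<dots> = (\<Sum>i\<in>I. of_real (c i y) * (z(j := w)) i) + of_real (c j y) * h"
      using fin j by (simp add: sum.distrib)
    finally show ?thesis unfolding expo_def by simp
  qed
  have "((\<lambda>h. (exp_int M I c d (z(j := w + h)) - exp_int M I c d (z(j := w))) / h) \<longlongrightarrow> D) (at 0)"
    unfolding tendsto_at_iff_sequentially o_def
  proof (intro allI impI)
    fix X :: "nat \<Rightarrow> complex" assume X: "\<forall>i. X i \<in> UNIV - {0}" and X0: "X \<longlonglongrightarrow> 0"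
    have "bounded (range X)" using X0 convergent_imp_bounded by blast
    then obtain R where R: "\<And>n. norm (X n) \<le> R" unfolding bounded_iff by auto
    let ?q = "\<lambda>n y. exp (expo I c d (z(j := w)) y) * ((exp (of_real (c j y) * X n) - 1) / X n)"
    have "(\<lambda>n. LINT y|M. ?q n y) \<longlonglongrightarrow> (LINT y|M. of_real (c j y) * exp (expo I c d (z(j := w)) y))"
    proof (rule integral_dominated_convergence[where w="\<lambda>_. ?K * (\<bar>B\<bar> * exp (\<bar>B\<bar> * R))"])
      show "AE y in M. (\<lambda>n. ?q n y) \<longlonglongrightarrow> of_real (c j y) * exp (expo I c d (z(j := w)) y)"
      proof (rule AE_I2)
        fix y
        have "((\<lambda>h. exp (of_real (c j y) * h)) has_field_derivative of_real (c j y)) (at 0)"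
          by (auto intro!: derivative_eq_intros)
        then have "((\<lambda>h. (exp (of_real (c j y) * h) - 1) / h) \<longlongrightarrow> of_real (c j y)) (at (0::complex))"
          by (simp add: DERIV_def)
        then have "(\<lambda>n. (exp (of_real (c j y) * X n) - 1) / X n) \<longlonglongrightarrow> of_real (c j y)"
          using X X0 unfolding tendsto_at_iff_sequentially o_def by blast
        then have "(\<lambda>n. ?q n y) \<longlonglongrightarrow> exp (expo I c d (z(j := w)) y) * of_real (c j y)"
          by (intro tendsto_mult tendsto_const)
        then show "(\<lambda>n. ?q n y) \<longlonglongrightarrow> of_real (c j y) * exp (expo I c d (z(j := w)) y)"
          by (simp add: mult.commute)
      qed
      show "AE y in M. norm (?q n y) \<le> ?K * (\<bar>B\<bar> * exp (\<bar>B\<bar> * R))" for n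
      proof (rule AE_I2)
        fix y assume y: "y \<in> space M"
        have Xn: "X n \<noteq> 0" using X by auto
        have cB: "\<bar>c j y\<bar> \<le> \<bar>B\<bar>" using c_bd[OF y, of j] by linarith
        have "norm (exp (of_real (c j y) * X n) - 1) \<le> norm (of_real (c j y) * X n) * exp (norm (of_real (c j y) * X n))"
          by (rule norm_exp_minus_1_le)
        also have "\<dots> \<le> (\<bar>B\<bar> * norm (X n)) * exp (\<bar>B\<bar> * R)"
          using cB R[of n] by (intro mult_mono) (auto simp: norm_mult intro!: mult_mono)
        finally have "norm ((exp (of_real (c j y) * X n) - 1) / X n) \<le> \<bar>B\<bar> * exp (\<bar>B\<bar> * R)"
          using Xn by (simp add: norm_divide divide_le_eq mult_ac)
        then show "norm (?q n y) \<le> ?K * (\<bar>B\<bar> * exp (\<bar>B\<bar> * R))"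
          unfolding norm_mult by (intro mult_mono norm_exp_expo_le y) auto
      qed
    qed auto
    moreover have "(LINT y|M. ?q n y) = (exp_int M I c d (z(j := w + X n)) - exp_int M I c d (z(j := w))) / X n" for n
    proof -
      have "(exp_int M I c d (z(j := w + X n)) - exp_int M I c d (z(j := w))) / X n
        = (LINT y|M. (exp (expo I c d (z(j := w + X n)) y) - exp (expo I c d (z(j := w)) y)) / X n)"
        unfolding exp_int_def using exp_expo_integrable by simp
      also have "(\<lambda>y. (exp (expo I c d (z(j := w + X n)) y) - exp (expo I c d (z(j := w)) y)) / X n) = ?q n"
        unfolding ex exp_add by (simp add: fun_eq_iff algebra_simps diff_divide_distrib)
      finally show ?thesis by (rule sym)
    qed
    ultimately show "(\<lambda>n. (exp_int M I c d (z(j := w + X n)) - exp_int M I c d (z(j := w))) / X n) \<longlonglongrightarrow> D"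
      unfolding D_def by (simp only:)
  qed
  then have "((\<lambda>\<zeta>. exp_int M I c d (z(j := \<zeta>))) has_field_derivative D) (at w)"
    unfolding DERIV_def by simp
  then show ?thesis unfolding field_differentiable_def by blast
qed

lemma exp_fun_holomorphic: "holomorphic_several I (\<Pi>\<^sub>E i\<in>I. UNIV) (exp_fun M I c d K a \<mu>)"
  unfolding holomorphic_several_def
proof (intro conjI ballI)
  let ?X = "product_topology (\<lambda>_. euclidean) I :: ('i \<Rightarrow> complex) topology"
  have top: "topspace ?X = (\<Pi>\<^sub>E i\<in>I. UNIV)" by simp
  have "continuous_map ?X euclidean (exp_fun M I c d K a \<mu>)"
    unfolding continuous_map_atin
  proof
    fix z assume z: "z \<in> topspace ?X"
    have lim: "((\<lambda>x. x i) \<longlongrightarrow> z i) (atin ?X z)" if "i \<in> I" for i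
      using continuous_map_product_projection[OF that, of "\<lambda>_. euclidean :: complex topology"] z
      unfolding continuous_map_atin by simp
    have "((\<lambda>x. exp_fun M I c d K a \<mu> x) \<longlongrightarrow> exp_fun M I c d K a \<mu> z) (atin ?X z)"
      unfolding exp_fun_def by (intro tendsto_intros exp_int_tendsto lim)
    then show "limitin euclidean (exp_fun M I c d K a \<mu>) (exp_fun M I c d K a \<mu> z) (atin ?X z)" by simp
  qed
  then show "continuous_map (subtopology ?X (\<Pi>\<^sub>E i\<in>I. UNIV)) euclidean (exp_fun M I c d K a \<mu>)"
    by (rule continuous_map_from_subtopology)
  fix z i assume z: "z \<in> (\<Pi>\<^sub>E i\<in>I. UNIV :: complex set)" and i: "i \<in> I"
  have "(\<lambda>\<zeta>. \<Sum>k\<in>I. of_real (a k) * (z(i := \<zeta>)) k) field_differentiable at (z i)"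
  proof (rule field_differentiable_sum)
    fix k
    show "(\<lambda>\<zeta>. of_real (a k) * (z(i := \<zeta>)) k) field_differentiable at (z i)"
      by (cases "k = i") (auto intro!: derivative_intros)
  qed
  then have "(\<lambda>\<zeta>. (\<Sum>k\<in>I. of_real (a k) * (z(i := \<zeta>)) k) - of_real \<mu> * exp_int M I c d (z(i := \<zeta>))) field_differentiable at (z i)"
    by (intro field_differentiable_diff field_differentiable_mult field_differentiable_const exp_int_differentiable i)
  then have "(exp \<circ> (\<lambda>\<zeta>. (\<Sum>k\<in>I. of_real (a k) * (z(i := \<zeta>)) k) - of_real \<mu> * exp_int M I c d (z(i := \<zeta>)))) field_differentiable at (z i)"
    by (rule field_differentiable_compose) (rule field_differentiable_within_exp)
  then show "(\<lambda>\<zeta>. exp_fun M I c d K a \<mu> (z(i := \<zeta>))) field_differentiable at (z i)"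
    unfolding exp_fun_def o_def by (intro field_differentiable_mult field_differentiable_const)
qed

lemma exp_fun_extension:
  "holomorphic_extension I (\<lambda>X. K * exp (of_real ((\<Sum>i\<in>I. a i * X i) - \<mu> * (LINT y|M. exp ((\<Sum>i\<in>I. c i y * X i) + d y))))) (exp_fun M I c d K a \<mu>)"
  unfolding holomorphic_extension_def
proof (intro conjI exI ballI)
  let ?X = "product_topology (\<lambda>_. euclidean) I :: ('i \<Rightarrow> complex) topology"
  have "openin ?X (topspace ?X)" by (rule openin_topspace)
  then show "openin ?X (\<Pi>\<^sub>E i\<in>I. UNIV)" by simp
  show "(\<Pi>\<^sub>E i\<in>I. \<real> \<union> (*) \<i> ` \<real>) \<subseteq> (\<Pi>\<^sub>E i\<in>I. UNIV)" by (intro PiE_mono) auto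
  show "holomorphic_several I (\<Pi>\<^sub>E i\<in>I. UNIV) (exp_fun M I c d K a \<mu>)" by (rule exp_fun_holomorphic)
  fix x :: "'i \<Rightarrow> real" assume "x \<in> (\<Pi>\<^sub>E i\<in>I. UNIV)"
  have "exp_int M I c d (\<lambda>i\<in>I. complex_of_real (x i)) = of_real (LINT y|M. exp ((\<Sum>i\<in>I. c i y * x i) + d y))"
    unfolding exp_int_def expo_def
    by (simp flip: of_real_mult of_real_sum of_real_add exp_of_real integral_complex_of_real)
  then show "exp_fun M I c d K a \<mu> (\<lambda>i\<in>I. complex_of_real (x i))
     = K * exp (of_real ((\<Sum>i\<in>I. a i * x i) - \<mu> * (LINT y|M. exp ((\<Sum>i\<in>I. c i y * x i) + d y))))"
    unfolding exp_fun_def by simp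
qed

end

declare expo_measurable [measurable del]

section \<open>Gaussian moments of exponential integrals\<close>

lemma finite_measure_PiM:
  assumes fin: "finite J" and fm: "finite_measure M"
  shows "finite_measure (\<Pi>\<^sub>M r\<in>J. M)"
    and "measure (\<Pi>\<^sub>M r\<in>J. M) (space (\<Pi>\<^sub>M r\<in>J. M)) = measure M (space M) ^ card J"
proof -
  interpret M: finite_measure M by (rule fm)
  interpret P: product_sigma_finite "\<lambda>_. M" by (standard) 
  have e: "emeasure (\<Pi>\<^sub>M r\<in>J. M) (space (\<Pi>\<^sub>M r\<in>J. M)) = emeasure M (space M) ^ card J"
    unfolding space_PiM by (subst P.emeasure_PiM[OF fin]) auto
  then show "finite_measure (\<Pi>\<^sub>M r\<in>J. M)"
    by (intro finite_measureI) (simp add: M.emeasure_eq_measure ennreal_power)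
  show "measure (\<Pi>\<^sub>M r\<in>J. M) (space (\<Pi>\<^sub>M r\<in>J. M)) = measure M (space M) ^ card J"
  proof (rule measure_eq_emeasure_eq_ennreal)
    show "emeasure (\<Pi>\<^sub>M r\<in>J. M) (space (\<Pi>\<^sub>M r\<in>J. M)) = ennreal (measure M (space M) ^ card J)"
      using e by (simp add: M.emeasure_eq_measure ennreal_power)
  qed simp
qed

lemma prob_space_std_gaussian: "prob_space (std_gaussian I)"
  unfolding std_gaussian_def
  by (intro prob_space_PiM prob_space_normal_density) simp

lemma std_gaussian_characteristic:
  assumes fin: "finite I"
  shows "(LINT W|std_gaussian I. exp (\<i> * of_real (\<Sum>i\<in>I. \<xi> i * W i))) = of_real (exp (- (\<Sum>i\<in>I. (\<xi> i)\<^sup>2) / 2))"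
proof -
  interpret N: prob_space std_normal_distribution by (rule prob_space_normal_density) simp
  interpret P: product_sigma_finite "\<lambda>_. std_normal_distribution" by standard
  have "(LINT W|std_gaussian I. exp (\<i> * of_real (\<Sum>i\<in>I. \<xi> i * W i)))
    = (LINT W|(\<Pi>\<^sub>M i\<in>I. std_normal_distribution). (\<Prod>i\<in>I. iexp (\<xi> i * W i)))"
    unfolding std_gaussian_def using fin by (simp add: of_real_sum sum_distrib_left exp_sum)
  also have "\<dots> = (\<Prod>i\<in>I. LINT x|std_normal_distribution. iexp (\<xi> i * x))"
    by (rule P.product_integral_prod[OF fin]) (intro N.integrable_const_bound[of _ 1], auto)
  also have "\<dots> = (\<Prod>i\<in>I. of_real (exp (- (\<xi> i)\<^sup>2 / 2)))"
    using char_std_normal_distribution by (simp add: char_def fun_eq_iff)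
  also have "\<dots> = of_real (exp (- (\<Sum>i\<in>I. (\<xi> i)\<^sup>2) / 2))"
    using fin by (simp flip: of_real_prod exp_sum add: sum_negf sum_divide_distrib)
  finally show ?thesis .
qed

text \<open>The Gaussian average of the \<open>m\<close>-th power of the exponential integral at imaginary modes,
times the linear exponential, see \<open>gaussian_power_expectation\<close>. The square carries a minus
sign because of the wrong sign of the variance.\<close>

definition gauss_moment ::
    "'b measure \<Rightarrow> 'i set \<Rightarrow> ('i \<Rightarrow> 'b \<Rightarrow> real) \<Rightarrow> ('b \<Rightarrow> real) \<Rightarrow> ('i \<Rightarrow> real) \<Rightarrow> nat \<Rightarrow> real" where
  "gauss_moment M I c d a m = (LINT y|(\<Pi>\<^sub>M r\<in>{..<m}. M).
     exp ((\<Sum>r<m. d (y r)) - (\<Sum>i\<in>I. (a i + (\<Sum>r<m. c i (y r)))\<^sup>2) / 2))"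

context
  fixes M :: "'b measure" and I :: "'i set" and c :: "'i \<Rightarrow> 'b \<Rightarrow> real" and d :: "'b \<Rightarrow> real" and B :: real
  assumes fm: "finite_measure M" and fin: "finite I"
    and c_meas [measurable]: "\<And>i. c i \<in> borel_measurable M" and d_meas [measurable]: "d \<in> borel_measurable M"
    and c_bd: "\<And>i y. y \<in> space M \<Longrightarrow> \<bar>c i y\<bar> \<le> B" and d_bd: "\<And>y. y \<in> space M \<Longrightarrow> \<bar>d y\<bar> \<le> B"
begin

interpretation M: finite_measure M by (rule fm)
interpretation P: product_sigma_finite "\<lambda>_::nat. M" by standard
interpretation W: prob_space "std_gaussian I" by (rule prob_space_std_gaussian)

lemma component_measurable [measurable]: "i \<in> I \<Longrightarrow> (\<lambda>W. W i) \<in> borel_measurable (std_gaussian I)"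
  unfolding std_gaussian_def using measurable_component_singleton[of i I "\<lambda>_. std_normal_distribution"] by simp

lemma abs_gauss_moment_le: "\<bar>gauss_moment M I c d a m\<bar> \<le> (exp B * measure M (space M)) ^ m"
proof -
  interpret Q: finite_measure "\<Pi>\<^sub>M r\<in>{..<m}. M" by (rule finite_measure_PiM[OF _ fm]) simp
  have pt: "exp ((\<Sum>r<m. d (y r)) - (\<Sum>i\<in>I. (a i + (\<Sum>r<m. c i (y r)))\<^sup>2) / 2) \<le> exp B ^ m"
    if "y \<in> space (\<Pi>\<^sub>M r\<in>{..<m}. M)" for y
  proof -
    have "(\<Sum>r<m. d (y r)) \<le> (\<Sum>r<m. B)"
      using that by (intro sum_mono) (auto simp: space_PiM intro!: order_trans[OF abs_ge_self d_bd])
    moreover have "0 \<le> (\<Sum>i\<in>I. (a i + (\<Sum>r<m. c i (y r)))\<^sup>2)" by (intro sum_nonneg) simp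
    ultimately show ?thesis by (simp add: exp_of_nat_mult[symmetric])
  qed
  have "\<bar>gauss_moment M I c d a m\<bar> \<le> (LINT y|(\<Pi>\<^sub>M r\<in>{..<m}. M). \<bar>exp ((\<Sum>r<m. d (y r)) - (\<Sum>i\<in>I. (a i + (\<Sum>r<m. c i (y r)))\<^sup>2) / 2)\<bar>)"
    unfolding gauss_moment_def by (rule integral_abs_bound)
  also have "\<dots> \<le> (LINT y|(\<Pi>\<^sub>M r\<in>{..<m}. M). exp B ^ m)"
    by (rule integral_mono') (use pt in auto)
  also have "\<dots> = (exp B * measure M (space M)) ^ m"
    using finite_measure_PiM(2)[OF finite_lessThan fm, of m] by (simp add: power_mult_distrib)
  finally show ?thesis .
qed

text \<open>The power is an integral over \<open>m\<close> points; after exchanging the integrals, the Gaussian one is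
a characteristic function.\<close>

lemma gaussian_power_expectation:
  "(LINT W|std_gaussian I. exp (\<i> * of_real (\<Sum>i\<in>I. a i * W i))
      * exp_int M I c d (\<lambda>i\<in>I. \<i> * complex_of_real (W i)) ^ m) = of_real (gauss_moment M I c d a m)"
proof -
  interpret Q: finite_measure "\<Pi>\<^sub>M r\<in>{..<m}. M" by (rule finite_measure_PiM[OF _ fm]) simp
  interpret WQ: pair_sigma_finite "std_gaussian I" "\<Pi>\<^sub>M r\<in>{..<m}. M"
    by (rule pair_sigma_finite.intro[OF W.sigma_finite_measure_axioms Q.sigma_finite_measure_axioms])
  interpret WQf: finite_measure "std_gaussian I \<Otimes>\<^sub>M (\<Pi>\<^sub>M r\<in>{..<m}. M)"
    by (rule finite_measure_pair_measure[OF Q.finite_measure_axioms W.finite_measure_axioms])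
  define f where "f W y = exp (\<i> * of_real (\<Sum>i\<in>I. (a i + (\<Sum>r<m. c i (y r))) * W i) + of_real (\<Sum>r<m. d (y r)))"
    for W :: "'i \<Rightarrow> real" and y :: "nat \<Rightarrow> 'b"
  have f_int: "integrable (std_gaussian I \<Otimes>\<^sub>M (\<Pi>\<^sub>M r\<in>{..<m}. M)) (\<lambda>(W, y). f W y)"
  proof (rule WQf.integrable_const_bound[of _ "exp (real m * B)"])
    show "AE p in std_gaussian I \<Otimes>\<^sub>M (\<Pi>\<^sub>M r\<in>{..<m}. M). norm (case p of (W, y) \<Rightarrow> f W y) \<le> exp (real m * B)"
    proof (rule AE_I2)
      fix p assume "p \<in> space (std_gaussian I \<Otimes>\<^sub>M (\<Pi>\<^sub>M r\<in>{..<m}. M))"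
      then obtain W y where p: "p = (W, y)" and y: "y \<in> space (\<Pi>\<^sub>M r\<in>{..<m}. M)"
        by (auto simp: space_pair_measure)
      have "(\<Sum>r<m. d (y r)) \<le> (\<Sum>r<m. B)"
        using y by (intro sum_mono abs_le_D1[OF d_bd]) (auto simp: space_PiM)
      then show "norm (case p of (W, y) \<Rightarrow> f W y) \<le> exp (real m * B)"
        by (simp add: p f_def exp_add norm_mult)
    qed
    have m1: "(\<lambda>p. fst p i) \<in> borel_measurable (std_gaussian I \<Otimes>\<^sub>M (\<Pi>\<^sub>M r\<in>{..<m}. M))" if "i \<in> I" for i
      using measurable_compose[OF measurable_fst component_measurable[OF that]] .
    have m2: "(\<lambda>p. snd p r) \<in> (std_gaussian I \<Otimes>\<^sub>M (\<Pi>\<^sub>M r\<in>{..<m}. M)) \<rightarrow>\<^sub>M M" if "r \<in> {..<m}" for r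
      using measurable_compose[OF measurable_snd measurable_component_singleton[OF that]] .
    have m3: "(\<lambda>p. \<Sum>r<m. c i (snd p r)) \<in> borel_measurable (std_gaussian I \<Otimes>\<^sub>M (\<Pi>\<^sub>M r\<in>{..<m}. M))" for i
      by (intro borel_measurable_sum measurable_compose[OF m2 c_meas])
    have m4: "(\<lambda>p. \<Sum>r<m. d (snd p r)) \<in> borel_measurable (std_gaussian I \<Otimes>\<^sub>M (\<Pi>\<^sub>M r\<in>{..<m}. M))"
      by (intro borel_measurable_sum measurable_compose[OF m2 d_meas])
    have m5: "(\<lambda>p. \<Sum>i\<in>I. (a i + (\<Sum>r<m. c i (snd p r))) * fst p i) \<in> borel_measurable (std_gaussian I \<Otimes>\<^sub>M (\<Pi>\<^sub>M r\<in>{..<m}. M))"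
      by (intro borel_measurable_sum borel_measurable_times borel_measurable_add borel_measurable_const m1 m3)
    show "(\<lambda>(W, y). f W y) \<in> borel_measurable (std_gaussian I \<Otimes>\<^sub>M (\<Pi>\<^sub>M r\<in>{..<m}. M))"
      unfolding f_def case_prod_unfold using m4 m5 by measurable
  qed
  have "exp (\<i> * of_real (\<Sum>i\<in>I. a i * W i)) * exp_int M I c d (\<lambda>i\<in>I. \<i> * complex_of_real (W i)) ^ m
     = (LINT y|(\<Pi>\<^sub>M r\<in>{..<m}. M). f W y)" for W
  proof -
    let ?g = "\<lambda>y. exp (expo I c d (\<lambda>i\<in>I. \<i> * complex_of_real (W i)) y)"
    have "exp_int M I c d (\<lambda>i\<in>I. \<i> * complex_of_real (W i)) ^ m = (\<Prod>r\<in>{..<m}. LINT y|M. ?g y)"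
      by (simp add: exp_int_def)
    also have "\<dots> = (LINT y|(\<Pi>\<^sub>M r\<in>{..<m}. M). (\<Prod>r\<in>{..<m}. ?g (y r)))"
      by (rule P.product_integral_prod[symmetric])
        (use exp_expo_integrable[OF fm fin c_meas d_meas c_bd d_bd] in auto)
    finally have "exp (\<i> * of_real (\<Sum>i\<in>I. a i * W i)) * exp_int M I c d (\<lambda>i\<in>I. \<i> * complex_of_real (W i)) ^ m
       = (LINT y|(\<Pi>\<^sub>M r\<in>{..<m}. M). exp (\<i> * of_real (\<Sum>i\<in>I. a i * W i)) * (\<Prod>r\<in>{..<m}. ?g (y r)))"
      by simp
    also have "(\<lambda>y. exp (\<i> * of_real (\<Sum>i\<in>I. a i * W i)) * (\<Prod>r\<in>{..<m}. ?g (y r))) = f W"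
    proof
      fix y :: "nat \<Rightarrow> 'b"
      have "(\<Sum>r<m. \<Sum>i\<in>I. c i (y r) * W i) = (\<Sum>i\<in>I. (\<Sum>r<m. c i (y r)) * W i)"
        by (subst sum.swap) (simp add: sum_distrib_right)
      then have e: "(\<Sum>r<m. \<Sum>i\<in>I. of_real (c i (y r)) * of_real (W i) :: complex) = of_real (\<Sum>i\<in>I. (\<Sum>r<m. c i (y r)) * W i)"
        by (simp flip: of_real_mult of_real_sum)
      have "(\<Prod>r\<in>{..<m}. ?g (y r)) = exp (\<Sum>r<m. expo I c d (\<lambda>i\<in>I. \<i> * complex_of_real (W i)) (y r))"
        by (simp add: exp_sum)
      also have "(\<Sum>r<m. expo I c d (\<lambda>i\<in>I. \<i> * complex_of_real (W i)) (y r))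
         = \<i> * (\<Sum>r<m. \<Sum>i\<in>I. of_real (c i (y r)) * of_real (W i)) + of_real (\<Sum>r<m. d (y r))"
        unfolding expo_def
        by (simp add: sum.distrib sum_distrib_left mult_ac)
      finally have pe: "(\<Prod>r\<in>{..<m}. ?g (y r)) = exp (\<i> * (\<Sum>r<m. \<Sum>i\<in>I. of_real (c i (y r)) * of_real (W i))
          + of_real (\<Sum>r<m. d (y r)))" .
      show "exp (\<i> * of_real (\<Sum>i\<in>I. a i * W i)) * (\<Prod>r\<in>{..<m}. ?g (y r)) = f W y"
        unfolding pe e f_def by (simp add: exp_add[symmetric] distrib_left distrib_right sum.distrib add.assoc)
    qed
    finally show ?thesis .
  qed
  then have "(LINT W|std_gaussian I. exp (\<i> * of_real (\<Sum>i\<in>I. a i * W i))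
      * exp_int M I c d (\<lambda>i\<in>I. \<i> * complex_of_real (W i)) ^ m)
    = (LINT W|std_gaussian I. LINT y|(\<Pi>\<^sub>M r\<in>{..<m}. M). f W y)" by simp
  also have "\<dots> = (LINT y|(\<Pi>\<^sub>M r\<in>{..<m}. M). LINT W|std_gaussian I. f W y)"
    by (rule WQ.Fubini_integral[symmetric, OF f_int])
  also have "(\<lambda>y. LINT W|std_gaussian I. f W y)
     = (\<lambda>y. of_real (exp ((\<Sum>r<m. d (y r)) - (\<Sum>i\<in>I. (a i + (\<Sum>r<m. c i (y r)))\<^sup>2) / 2)))"
  proof
    fix y :: "nat \<Rightarrow> 'b"
    have "(LINT W|std_gaussian I. f W y)
      = of_real (exp (- (\<Sum>i\<in>I. (a i + (\<Sum>r<m. c i (y r)))\<^sup>2) / 2)) * exp (of_real (\<Sum>r<m. d (y r)))"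
      unfolding f_def exp_add by (simp only: integral_mult_left_zero std_gaussian_characteristic[OF fin])
    also have "\<dots> = of_real (exp (- (\<Sum>i\<in>I. (a i + (\<Sum>r<m. c i (y r)))\<^sup>2) / 2 + (\<Sum>r<m. d (y r))))"
      by (simp only: exp_of_real of_real_mult[symmetric] exp_add[symmetric])
    finally show "(LINT W|std_gaussian I. f W y)
      = of_real (exp ((\<Sum>r<m. d (y r)) - (\<Sum>i\<in>I. (a i + (\<Sum>r<m. c i (y r)))\<^sup>2) / 2))"
      by simp
  qed
  finally show ?thesis by (simp only: gauss_moment_def integral_complex_of_real)
qed

lemma norm_exp_int_imaginary_le: "norm (exp_int M I c d (\<lambda>i\<in>I. \<i> * complex_of_real (W i))) \<le> exp B * measure M (space M)"
proof -
  have "norm (exp_int M I c d (\<lambda>i\<in>I. \<i> * complex_of_real (W i)))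
    \<le> (LINT y|M. norm (exp (expo I c d (\<lambda>i\<in>I. \<i> * complex_of_real (W i)) y)))"
    unfolding exp_int_def by (rule integral_norm_bound)
  also have "\<dots> \<le> (LINT y|M. exp B)"
  proof (rule integral_mono')
    fix y assume y: "y \<in> space M"
    have "Re (\<Sum>i\<in>I. of_real (c i y) * (\<i> * complex_of_real (W i))) = 0" by (simp add: Re_sum)
    then show "norm (exp (expo I c d (\<lambda>i\<in>I. \<i> * complex_of_real (W i)) y)) \<le> exp B"
      using d_bd[OF y] by (simp add: expo_def)
  qed auto
  finally show ?thesis by (simp add: mult.commute)
qed

lemma exp_int_imaginary_measurable [measurable]:
  "(\<lambda>W. exp_int M I c d (\<lambda>i\<in>I. \<i> * complex_of_real (W i))) \<in> borel_measurable (std_gaussian I)"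
proof -
  have "(\<lambda>W. LINT y|M. (\<lambda>(W, y). exp ((\<Sum>i\<in>I. of_real (c i y) * (\<i> * complex_of_real (W i))) + of_real (d y))) (W, y))
    \<in> borel_measurable (std_gaussian I)"
    by (rule M.borel_measurable_lebesgue_integral) measurable
  then show ?thesis by (simp add: exp_int_def expo_def)
qed

text \<open>At purely imaginary modes the exponential integral is bounded by a constant that does not depend on
the modes, so the exponential series may be integrated term by term.\<close>

lemma wrong_sign_expectation_series:
  "wrong_sign_expectation I (\<lambda>X. K * exp (of_real ((\<Sum>i\<in>I. a i * X i) - \<mu> * (LINT y|M. exp ((\<Sum>i\<in>I. c i y * X i) + d y)))))
    = K * of_real (\<Sum>m. (- \<mu>) ^ m / fact m * gauss_moment M I c d a m)"
proof -
  let ?z = "\<lambda>W. \<lambda>i\<in>I. \<i> * complex_of_real (W i)"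
  let ?A = "\<lambda>W. exp_int M I c d (?z W)"
  let ?e = "\<lambda>W. exp (\<i> * of_real (\<Sum>i\<in>I. a i * W i))"
  define C where "C = exp B * measure M (space M)"
  define f where "f m W = K * (of_real ((- \<mu>) ^ m / fact m) * (?e W * ?A W ^ m))" for m W
  have C: "norm (?A W) \<le> C" for W unfolding C_def by (rule norm_exp_int_imaginary_le)
  have C0: "0 \<le> C" by (simp add: C_def)
  have norm_f: "norm (f m W) \<le> norm K * ((\<bar>\<mu>\<bar> * C) ^ m / fact m)" for m W
  proof -
    have "norm (f m W) = norm K * (\<bar>\<mu>\<bar> ^ m / fact m * norm (?A W) ^ m)"
      by (simp add: f_def norm_mult norm_power norm_divide power_abs)
    also have "\<dots> \<le> norm K * (\<bar>\<mu>\<bar> ^ m / fact m * C ^ m)"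
      by (intro mult_left_mono power_mono C) auto
    finally show ?thesis by (simp add: power_mult_distrib)
  qed
  have smb: "summable (\<lambda>m. norm K * ((\<bar>\<mu>\<bar> * C) ^ m / fact m))"
    using summable_exp_generic[of "\<bar>\<mu>\<bar> * C"] by (intro summable_mult) (simp add: field_simps)
  have f_sum: "(\<lambda>m. f m W) sums exp_fun M I c d K a \<mu> (?z W)" for W
  proof -
    have "(\<lambda>m. (- of_real \<mu> * ?A W) ^ m /\<^sub>R fact m) sums exp (- of_real \<mu> * ?A W)"
      by (rule exp_converges)
    then have "(\<lambda>m. K * (?e W * ((- of_real \<mu> * ?A W) ^ m /\<^sub>R fact m))) sums (K * (?e W * exp (- of_real \<mu> * ?A W)))"
      by (intro sums_mult)
    moreover have "K * (?e W * exp (- of_real \<mu> * ?A W)) = exp_fun M I c d K a \<mu> (?z W)"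
      unfolding exp_fun_def by (simp add: exp_add[symmetric] sum_distrib_left mult_ac)
    moreover have "K * (?e W * ((- of_real \<mu> * ?A W) ^ m /\<^sub>R fact m)) = f m W" for m
      unfolding f_def power_mult_distrib by (simp add: scaleR_conv_of_real field_simps)
    ultimately show ?thesis by simp
  qed
  have fi: "integrable (std_gaussian I) (f m)" for m
  proof (rule W.integrable_const_bound[OF AE_I2[OF norm_f]])
    show "f m \<in> borel_measurable (std_gaussian I)" unfolding f_def[abs_def] by measurable
  qed
  have smf: "summable (\<lambda>m. norm (f m W))" for W
    by (rule summable_comparison_test'[OF smb, where N=0]) (use norm_f in auto)
  have smi: "summable (\<lambda>m. LINT W|std_gaussian I. norm (f m W))"
  proof (rule summable_comparison_test'[OF smb, where N=0])
    fix m
    have "(LINT W|std_gaussian I. norm (f m W)) \<le> (LINT W|std_gaussian I. norm K * ((\<bar>\<mu>\<bar> * C) ^ m / fact m))"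
      by (rule integral_mono) (use fi norm_f in auto)
    then show "norm (LINT W|std_gaussian I. norm (f m W)) \<le> norm K * ((\<bar>\<mu>\<bar> * C) ^ m / fact m)"
      by (simp add: W.prob_space integral_nonneg_AE)
  qed
  have eq: "exp_fun M I c d K a \<mu> (?z W) = (\<Sum>m. f m W)" for W using f_sum sums_unique by blast
  have int: "integrable (std_gaussian I) (\<lambda>W. exp_fun M I c d K a \<mu> (?z W))"
    unfolding eq by (rule integrable_suminf[OF fi _ smi]) (use smf in auto)
  have "wrong_sign_expectation I (\<lambda>X. K * exp (of_real ((\<Sum>i\<in>I. a i * X i) - \<mu> * (LINT y|M. exp ((\<Sum>i\<in>I. c i y * X i) + d y)))))
    = (LINT W|std_gaussian I. exp_fun M I c d K a \<mu> (?z W))"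
    by (rule wrong_sign_expectation_eqI[OF fin exp_fun_extension[OF fm fin c_meas d_meas c_bd d_bd] int])
  also have "\<dots> = (\<Sum>m. LINT W|std_gaussian I. f m W)"
    unfolding eq by (rule integral_suminf[OF fi _ smi]) (use smf in auto)
  also have "(\<lambda>m. LINT W|std_gaussian I. f m W) = (\<lambda>m. K * of_real ((- \<mu>) ^ m / fact m * gauss_moment M I c d a m))"
  proof
    fix m
    have "(LINT W|std_gaussian I. f m W) = K * (of_real ((- \<mu>) ^ m / fact m) * (LINT W|std_gaussian I. ?e W * ?A W ^ m))"
      unfolding f_def by (simp only: integral_mult_right_zero)
    then show "(LINT W|std_gaussian I. f m W) = K * of_real ((- \<mu>) ^ m / fact m * gauss_moment M I c d a m)"
      unfolding gaussian_power_expectation by (simp only: of_real_mult)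
  qed
  also have "(\<Sum>m. K * of_real ((- \<mu>) ^ m / fact m * gauss_moment M I c d a m)) = K * of_real (\<Sum>m. (- \<mu>) ^ m / fact m * gauss_moment M I c d a m)"
  proof -
    have sm: "summable (\<lambda>m. (- \<mu>) ^ m / fact m * gauss_moment M I c d a m)"
    proof (rule summable_comparison_test'[where N=0])
      show "summable (\<lambda>m. (\<bar>\<mu>\<bar> * C) ^ m / fact m)"
        using summable_exp_generic[of "\<bar>\<mu>\<bar> * C"] by (simp add: field_simps)
      show "norm ((- \<mu>) ^ m / fact m * gauss_moment M I c d a m) \<le> (\<bar>\<mu>\<bar> * C) ^ m / fact m" for m
        using abs_gauss_moment_le[of a m] unfolding C_def[symmetric]
        by (simp add: abs_mult power_abs power_mult_distrib divide_right_mono mult_left_mono)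
    qed
    show ?thesis
      unfolding suminf_of_real[OF sm] by (rule suminf_mult[OF summable_of_real[OF sm]])
  qed
  finally show ?thesis .
qed

end

declare component_measurable [measurable del] exp_int_imaginary_measurable [measurable del]

section \<open>Products of the area measure\<close>

interpretation area_prod: product_sigma_finite "\<lambda>_::nat. area" by standard

lemma finite_measure_area_PiM: "finite J \<Longrightarrow> finite_measure (\<Pi>\<^sub>M r\<in>J. area)"
  by (rule finite_measure_PiM(1)[OF _ finite_measure_area])

lemma measurable_PiM_pair:
  assumes "s \<in> J" "t \<in> J"
  shows "(\<lambda>y. (y s, y t)) \<in> (\<Pi>\<^sub>M r\<in>J. area) \<rightarrow>\<^sub>M area \<Otimes>\<^sub>M area"
  by (intro measurable_Pair measurable_component_singleton assms)

lemma measurable_PiM_comp: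
  assumes "r \<in> J" "f \<in> area \<rightarrow>\<^sub>M N" shows "(\<lambda>y. f (y r)) \<in> (\<Pi>\<^sub>M r\<in>J. area) \<rightarrow>\<^sub>M N"
  by (rule measurable_compose[OF measurable_component_singleton[OF assms(1)] assms(2)])

text \<open>The coordinates other than \<open>s\<close> and \<open>t\<close> integrate to one.\<close>

lemma nn_integral_PiM_pair:
  fixes \<sigma> :: "real^3 \<Rightarrow> ennreal" and K :: "(real^3) \<times> (real^3) \<Rightarrow> ennreal" and J :: "nat set"
  assumes fin: "finite J" and s: "s \<in> J" and t: "t \<in> J" and st: "s \<noteq> t"
    and \<sigma> [measurable]: "\<sigma> \<in> borel_measurable area" and one: "(\<integral>\<^sup>+x. \<sigma> x \<partial>area) = 1"
    and K [measurable]: "K \<in> borel_measurable (area \<Otimes>\<^sub>M area)"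
  shows "(\<integral>\<^sup>+y. (\<Prod>r\<in>J. \<sigma> (y r)) * K (y s, y t) \<partial>(\<Pi>\<^sub>M r\<in>J. area))
     = (\<integral>\<^sup>+b. \<sigma> b * (\<integral>\<^sup>+a. \<sigma> a * K (a, b) \<partial>area) \<partial>area)"
proof -
  define J' where "J' = J - {s, t}"
  have J: "J = insert s (insert t J')" "s \<notin> insert t J'" "t \<notin> J'" "finite J'" "finite (insert t J')"
    using s t st fin by (auto simp: J'_def)
  have mp: "(\<lambda>y. \<Prod>r\<in>A. \<sigma> (y r)) \<in> borel_measurable (\<Pi>\<^sub>M r\<in>B. area)" if "A \<subseteq> B" for A B :: "nat set"
    using that by (intro borel_measurable_prod_ennreal measurable_PiM_comp[OF _ \<sigma>]) auto
  define h where "h b = (\<integral>\<^sup>+a. \<sigma> a * K (a, b) \<partial>area)" for b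
  have h [measurable]: "h \<in> borel_measurable area"
  proof -
    have "(\<lambda>b. \<integral>\<^sup>+a. (\<lambda>(b, a). \<sigma> a * K (a, b)) (b, a) \<partial>area) \<in> borel_measurable area"
      by (rule area.borel_measurable_nn_integral) measurable
    then show ?thesis by (simp add: h_def[abs_def])
  qed
  have "(\<integral>\<^sup>+y. (\<Prod>r\<in>J. \<sigma> (y r)) * K (y s, y t) \<partial>(\<Pi>\<^sub>M r\<in>J. area))
     = (\<integral>\<^sup>+x. (\<integral>\<^sup>+a. (\<Prod>r\<in>J. \<sigma> ((x(s := a)) r)) * K ((x(s := a)) s, (x(s := a)) t) \<partial>area) \<partial>(\<Pi>\<^sub>M r\<in>insert t J'. area))"
    unfolding J(1)
  proof (rule area_prod.product_nn_integral_insert[OF J(5) J(2)])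
    show "(\<lambda>y. (\<Prod>r\<in>insert s (insert t J'). \<sigma> (y r)) * K (y s, y t)) \<in> borel_measurable (\<Pi>\<^sub>M r\<in>insert s (insert t J'). area)"
      by (intro borel_measurable_times_ennreal mp measurable_compose[OF measurable_PiM_pair K]) auto
  qed
  also have "\<dots> = (\<integral>\<^sup>+x. (\<Prod>r\<in>insert t J'. \<sigma> (x r)) * h (x t) \<partial>(\<Pi>\<^sub>M r\<in>insert t J'. area))"
  proof (rule nn_integral_cong)
    fix x :: "nat \<Rightarrow> real^3"
    have "(\<Prod>r\<in>J. \<sigma> ((x(s := a)) r)) * K ((x(s := a)) s, (x(s := a)) t)
       = (\<Prod>r\<in>insert t J'. \<sigma> (x r)) * (\<sigma> a * K (a, x t))" for a
    proof -
      have "(\<Prod>r\<in>J. \<sigma> ((x(s := a)) r)) = \<sigma> a * (\<Prod>r\<in>insert t J'. \<sigma> ((x(s := a)) r))"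
        unfolding J(1) using J(2,5) by (subst prod.insert) auto
      also have "(\<Prod>r\<in>insert t J'. \<sigma> ((x(s := a)) r)) = (\<Prod>r\<in>insert t J'. \<sigma> (x r))"
        using J(2) by (intro prod.cong) auto
      finally show ?thesis using st by (simp add: mult_ac)
    qed
    moreover have "(\<lambda>a. \<sigma> a * K (a, x t)) \<in> borel_measurable area" if "x t \<in> space area"
    proof -
      have "(\<lambda>a. (a, x t)) \<in> area \<rightarrow>\<^sub>M area \<Otimes>\<^sub>M area" using that by (intro measurable_Pair measurable_const) auto
      then show ?thesis by (intro borel_measurable_times_ennreal \<sigma> measurable_compose[OF _ K])
    qed
    moreover assume "x \<in> space (\<Pi>\<^sub>M r\<in>insert t J'. area)"
    then have "x t \<in> space area" by (auto simp: space_PiM)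
    ultimately show "(\<integral>\<^sup>+a. (\<Prod>r\<in>J. \<sigma> ((x(s := a)) r)) * K ((x(s := a)) s, (x(s := a)) t) \<partial>area)
       = (\<Prod>r\<in>insert t J'. \<sigma> (x r)) * h (x t)"
      unfolding h_def by (simp only: nn_integral_cmult)
  qed
  also have "\<dots> = (\<integral>\<^sup>+x. (\<integral>\<^sup>+b. (\<Prod>r\<in>insert t J'. \<sigma> ((x(t := b)) r)) * h ((x(t := b)) t) \<partial>area) \<partial>(\<Pi>\<^sub>M r\<in>J'. area))"
  proof (rule area_prod.product_nn_integral_insert[OF J(4) J(3)])
    show "(\<lambda>y. (\<Prod>r\<in>insert t J'. \<sigma> (y r)) * h (y t)) \<in> borel_measurable (\<Pi>\<^sub>M r\<in>insert t J'. area)"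
      by (intro borel_measurable_times_ennreal mp measurable_PiM_comp[OF _ h]) auto
  qed
  also have "\<dots> = (\<integral>\<^sup>+x. (\<Prod>r\<in>J'. \<sigma> (x r)) * (\<integral>\<^sup>+b. \<sigma> b * h b \<partial>area) \<partial>(\<Pi>\<^sub>M r\<in>J'. area))"
  proof (rule nn_integral_cong)
    fix x :: "nat \<Rightarrow> real^3"
    have "(\<Prod>r\<in>insert t J'. \<sigma> ((x(t := b)) r)) * h ((x(t := b)) t) = (\<Prod>r\<in>J'. \<sigma> (x r)) * (\<sigma> b * h b)" for b
    proof -
      have "(\<Prod>r\<in>insert t J'. \<sigma> ((x(t := b)) r)) = \<sigma> b * (\<Prod>r\<in>J'. \<sigma> ((x(t := b)) r))"
        using J(3,4) by (subst prod.insert) auto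
      also have "(\<Prod>r\<in>J'. \<sigma> ((x(t := b)) r)) = (\<Prod>r\<in>J'. \<sigma> (x r))"
        using J(3) by (intro prod.cong) auto
      finally show ?thesis by (simp add: mult_ac)
    qed
    then show "(\<integral>\<^sup>+b. (\<Prod>r\<in>insert t J'. \<sigma> ((x(t := b)) r)) * h ((x(t := b)) t) \<partial>area)
       = (\<Prod>r\<in>J'. \<sigma> (x r)) * (\<integral>\<^sup>+b. \<sigma> b * h b \<partial>area)"
      by (simp only: nn_integral_cmult borel_measurable_times_ennreal \<sigma> h)
  qed
  also have "\<dots> = (\<integral>\<^sup>+x. (\<Prod>r\<in>J'. \<sigma> (x r)) \<partial>(\<Pi>\<^sub>M r\<in>J'. area)) * (\<integral>\<^sup>+b. \<sigma> b * h b \<partial>area)"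
    by (rule nn_integral_multc) (rule mp, simp)
  also have "(\<integral>\<^sup>+x. (\<Prod>r\<in>J'. \<sigma> (x r)) \<partial>(\<Pi>\<^sub>M r\<in>J'. area)) = 1"
    using area_prod.product_nn_integral_prod[OF J(4), of "\<lambda>_. \<sigma>"] one by simp
  finally show ?thesis by (simp add: h_def)
qed

text \<open>Points have area zero, so this is \<open>nn_integral_PiM_pair\<close> for the uniform density and the
indicator function of the diagonal.\<close>

lemma AE_PiM_area_distinct:
  fixes J :: "nat set"
  assumes fin: "finite J"
  shows "AE y in \<Pi>\<^sub>M r\<in>J. area. \<forall>s\<in>J. \<forall>t\<in>J. s \<noteq> t \<longrightarrow> y s \<noteq> y t"
proof -
  have m: "fst \<in> borel_measurable (area \<Otimes>\<^sub>M area)" "snd \<in> borel_measurable (area \<Otimes>\<^sub>M area)"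
    by (rule area_imp_borel_measurable, rule measurable_fst measurable_snd)+
  have set: "{p \<in> space (area \<Otimes>\<^sub>M area). fst p = snd p} \<in> sets (area \<Otimes>\<^sub>M area)"
  proof -
    have "{p \<in> space (area \<Otimes>\<^sub>M area). norm (snd p - fst p) = 0} \<in> sets (area \<Otimes>\<^sub>M area)"
      by (intro borel_measurable_eq borel_measurable_const measurable_compose[OF borel_measurable_diff[OF m(2) m(1)] borel_measurable_norm])
    also have "{p \<in> space (area \<Otimes>\<^sub>M area). norm (snd p - fst p) = 0} = {p \<in> space (area \<Otimes>\<^sub>M area). fst p = snd p}"
      by auto
    finally show ?thesis .
  qed
  let ?D = "{p \<in> space (area \<Otimes>\<^sub>M area). fst p = snd p}"
  have "AE y in \<Pi>\<^sub>M r\<in>J. area. y s \<noteq> y t" if st: "s \<in> J" "t \<in> J" "s \<noteq> t" for s t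
  proof -
    let ?u = "\<lambda>_::real^3. ennreal (1 / (4 * pi))"
    have inner: "(\<integral>\<^sup>+a. ?u a * indicator ?D (a, b) \<partial>area) = 0" if b: "b \<in> S2" for b
    proof -
      have "AE a in area. ?u a * indicator ?D (a, b) = 0"
        using AE_area_neq[OF b] by eventually_elim (simp add: indicator_def)
      from nn_integral_cong_AE[OF this] show ?thesis by simp
    qed
    have "(\<integral>\<^sup>+y. (\<Prod>r\<in>J. ?u (y r)) * indicator ?D (y s, y t) \<partial>(\<Pi>\<^sub>M r\<in>J. area))
      = (\<integral>\<^sup>+b. ?u b * (\<integral>\<^sup>+a. ?u a * indicator ?D (a, b) \<partial>area) \<partial>area)"
    proof (rule nn_integral_PiM_pair[OF fin st])
      show "(\<integral>\<^sup>+x. ?u x \<partial>area) = 1"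
        by (simp add: emeasure_area_S2 flip: ennreal_mult)
    qed (use set in auto)
    also have "\<dots> = (\<integral>\<^sup>+b. 0 \<partial>area)"
      by (rule nn_integral_cong) (use inner in simp)
    finally have z: "(\<integral>\<^sup>+y. (\<Prod>r\<in>J. ?u (y r)) * indicator ?D (y s, y t) \<partial>(\<Pi>\<^sub>M r\<in>J. area)) = 0" by simp
    have "AE y in \<Pi>\<^sub>M r\<in>J. area. (\<Prod>r\<in>J. ?u (y r)) * indicator ?D (y s, y t) = 0"
    proof (rule nn_integral_0_iff_AE[THEN iffD1, OF _ z])
      show "(\<lambda>y. (\<Prod>r\<in>J. ?u (y r)) * indicator ?D (y s, y t)) \<in> borel_measurable (\<Pi>\<^sub>M r\<in>J. area)"
        by (intro borel_measurable_times_ennreal borel_measurable_const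
            measurable_compose[OF measurable_PiM_pair[OF st(1,2)] borel_measurable_indicator[OF set]])
    qed
    then show ?thesis
      using AE_space
    proof eventually_elim
      case (elim y)
      have "(\<Prod>r\<in>J. ?u (y r)) \<noteq> 0" by simp
      then have "indicator ?D (y s, y t) = (0::ennreal)" using elim(1) by (simp only: mult_eq_0_iff simp_thms)
      moreover have "(y s, y t) \<in> space (area \<Otimes>\<^sub>M area)"
        using elim(2) st by (auto simp: space_PiM space_pair_measure)
      ultimately show ?case by (simp add: indicator_def split: if_splits)
    qed
  qed
  then have "AE y in \<Pi>\<^sub>M r\<in>J. area. \<forall>p\<in>J \<times> J. fst p \<noteq> snd p \<longrightarrow> y (fst p) \<noteq> y (snd p)"
    using fin by (subst AE_ball_countable) (auto intro: countable_finite)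
  then show ?thesis by eventually_elim auto
qed

text \<open>Under the product density two particles are independent. The proof shifts the kernel by
\<open>1/2\<close>, which makes it nonnegative by \<open>Green_ge\<close>, and applies
\<open>nn_integral_PiM_pair\<close>.\<close>

lemma integral_PiM_Green_pair:
  fixes J :: "nat set"
  assumes fin: "finite J" and st: "s \<in> J" "t \<in> J" "s \<noteq> t" and \<sigma>: "\<sigma> \<in> finite_entropy_densities"
  shows "integrable (\<Pi>\<^sub>M r\<in>J. area) (\<lambda>y. (\<Prod>r\<in>J. \<sigma> (y r)) * Green (y s) (y t))"
    and "(LINT y|(\<Pi>\<^sub>M r\<in>J. area). (\<Prod>r\<in>J. \<sigma> (y r)) * Green (y s) (y t)) = energy \<sigma> \<sigma>"
proof -
  note D = finite_entropyD[OF \<sigma>]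
  let ?P = "\<Pi>\<^sub>M r\<in>J. area"
  let ?K = "\<lambda>p. Green (fst p) (snd p) + 1/2"
  have sp: "y r \<in> S2" if "y \<in> space ?P" "r \<in> J" for y r using that by (auto simp: space_PiM)
  have s1: "(\<integral>\<^sup>+x. ennreal (\<sigma> x) \<partial>area) = 1"
    using \<sigma> by (simp add: finite_entropy_densities_def densities_def)
  have prod0: "0 \<le> (\<Prod>r\<in>J. \<sigma> (y r))" if "y \<in> space ?P" for y
    using sp[OF that] D(2) by (intro prod_nonneg) auto
  have mprod: "(\<lambda>y. \<Prod>r\<in>J. \<sigma> (y r)) \<in> borel_measurable ?P"
    by (intro borel_measurable_prod measurable_PiM_comp[OF _ D(1)])
  have mG: "(\<lambda>y. Green (y s) (y t)) \<in> borel_measurable ?P"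
    by (rule measurable_Green_area) (intro measurable_component_singleton st)+
  have K0: "0 \<le> ?K p" if "p \<in> space (area \<Otimes>\<^sub>M area)" for p
    using that Green_ge[of "fst p" "snd p"] by (auto simp: space_pair_measure)
  have iT: "integrable (area \<Otimes>\<^sub>M area) (\<lambda>p. \<sigma> (fst p) * \<sigma> (snd p) * ?K p)"
    and T: "(LINT p|(area \<Otimes>\<^sub>M area). \<sigma> (fst p) * \<sigma> (snd p) * ?K p) = energy \<sigma> \<sigma> + 1/2"
  proof -
    have e: "\<sigma> (fst p) * \<sigma> (snd p) * ?K p
       = \<sigma> (fst p) * \<sigma> (snd p) * Green (fst p) (snd p) + 1/2 * (\<sigma> (fst p) * \<sigma> (snd p))" for p by (simp add: algebra_simps)
    show "integrable (area \<Otimes>\<^sub>M area) (\<lambda>p. \<sigma> (fst p) * \<sigma> (snd p) * ?K p)"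
      unfolding e using integrable_energy(1)[OF \<sigma> \<sigma>] integrable_pair_product(1)[OF D(3) D(3)] by simp
    show "(LINT p|(area \<Otimes>\<^sub>M area). \<sigma> (fst p) * \<sigma> (snd p) * ?K p) = energy \<sigma> \<sigma> + 1/2"
      unfolding e using integrable_energy(1,3)[OF \<sigma> \<sigma>] integrable_pair_product[OF D(3) D(3)] D(4) by simp
  qed
  have "(\<integral>\<^sup>+y. ennreal ((\<Prod>r\<in>J. \<sigma> (y r)) * (Green (y s) (y t) + 1/2)) \<partial>?P)
     = (\<integral>\<^sup>+y. (\<Prod>r\<in>J. ennreal (\<sigma> (y r))) * ennreal (?K (y s, y t)) \<partial>?P)"
  proof (rule nn_integral_cong)
    fix y assume y: "y \<in> space ?P"
    have "(\<Prod>r\<in>J. ennreal (\<sigma> (y r))) = ennreal (\<Prod>r\<in>J. \<sigma> (y r))"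
      using sp[OF y] D(2) by (intro prod_ennreal) auto
    then show "ennreal ((\<Prod>r\<in>J. \<sigma> (y r)) * (Green (y s) (y t) + 1/2)) = (\<Prod>r\<in>J. ennreal (\<sigma> (y r))) * ennreal (?K (y s, y t))"
      using prod0[OF y] Green_ge[OF sp[OF y st(1)] sp[OF y st(2)]] by (simp add: ennreal_mult)
  qed
  also have "\<dots> = (\<integral>\<^sup>+b. ennreal (\<sigma> b) * (\<integral>\<^sup>+a. ennreal (\<sigma> a) * ennreal (?K (a, b)) \<partial>area) \<partial>area)"
  proof (rule nn_integral_PiM_pair[OF fin st _ s1])
    show "(\<lambda>x. ennreal (\<sigma> x)) \<in> borel_measurable area" using D(1) by simp
    show "(\<lambda>p. ennreal (?K p)) \<in> borel_measurable (area \<Otimes>\<^sub>M area)" using measurable_Green_pair by simp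
  qed
  also have "\<dots> = (\<integral>\<^sup>+b. (\<integral>\<^sup>+a. ennreal (\<sigma> a * \<sigma> b * ?K (a, b)) \<partial>area) \<partial>area)"
  proof (rule nn_integral_cong)
    fix b assume b: "b \<in> space area"
    have "(\<lambda>a. ennreal (\<sigma> a) * ennreal (?K (a, b))) \<in> borel_measurable area"
    proof -
      have "(\<lambda>a. Green a b) \<in> borel_measurable area"
        by (intro measurable_Green measurable_area_ident) simp
      then show ?thesis using D(1) by simp
    qed
    then have "ennreal (\<sigma> b) * (\<integral>\<^sup>+a. ennreal (\<sigma> a) * ennreal (?K (a, b)) \<partial>area)
      = (\<integral>\<^sup>+a. ennreal (\<sigma> b) * (ennreal (\<sigma> a) * ennreal (?K (a, b))) \<partial>area)"
      by (rule nn_integral_cmult[symmetric])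
    also have "\<dots> = (\<integral>\<^sup>+a. ennreal (\<sigma> a * \<sigma> b * ?K (a, b)) \<partial>area)"
    proof (rule nn_integral_cong)
      fix a assume "a \<in> space area"
      then have "0 \<le> \<sigma> a" "0 \<le> \<sigma> b" "0 \<le> ?K (a, b)"
        using b D(2) K0[of "(a, b)"] by (auto simp: space_pair_measure)
      then show "ennreal (\<sigma> b) * (ennreal (\<sigma> a) * ennreal (?K (a, b))) = ennreal (\<sigma> a * \<sigma> b * ?K (a, b))"
        by (simp only: ennreal_mult mult_nonneg_nonneg mult_ac)
    qed
    finally show "ennreal (\<sigma> b) * (\<integral>\<^sup>+a. ennreal (\<sigma> a) * ennreal (?K (a, b)) \<partial>area)
      = (\<integral>\<^sup>+a. ennreal (\<sigma> a * \<sigma> b * ?K (a, b)) \<partial>area)" .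
  qed
  also have "\<dots> = (\<integral>\<^sup>+p. ennreal (\<sigma> (fst p) * \<sigma> (snd p) * ?K p) \<partial>(area \<Otimes>\<^sub>M area))"
    using area2.nn_integral_snd[of "\<lambda>p. ennreal (\<sigma> (fst p) * \<sigma> (snd p) * ?K p)"] D(1) by simp
  also have "\<dots> = ennreal (energy \<sigma> \<sigma> + 1/2)"
  proof (subst nn_integral_eq_integral[OF iT])
    show "AE p in area \<Otimes>\<^sub>M area. 0 \<le> \<sigma> (fst p) * \<sigma> (snd p) * ?K p"
    proof (rule AE_I2)
      fix p assume p: "p \<in> space (area \<Otimes>\<^sub>M area)"
      then have "0 \<le> \<sigma> (fst p)" "0 \<le> \<sigma> (snd p)" using D(2) by (auto simp: space_pair_measure)
      then show "0 \<le> \<sigma> (fst p) * \<sigma> (snd p) * ?K p" using K0[OF p] by (intro mult_nonneg_nonneg)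
    qed
  qed (simp only: T)
  finally have nn: "(\<integral>\<^sup>+y. ennreal ((\<Prod>r\<in>J. \<sigma> (y r)) * (Green (y s) (y t) + 1/2)) \<partial>?P) = ennreal (energy \<sigma> \<sigma> + 1/2)" .
  have nonneg: "AE y in ?P. 0 \<le> (\<Prod>r\<in>J. \<sigma> (y r)) * (Green (y s) (y t) + 1/2)"
    using prod0 Green_ge[OF sp[OF _ st(1)] sp[OF _ st(2)]] by (intro AE_I2 mult_nonneg_nonneg) force+
  have m: "(\<lambda>y. (\<Prod>r\<in>J. \<sigma> (y r)) * (Green (y s) (y t) + 1/2)) \<in> borel_measurable ?P"
    using mprod mG by simp
  have i: "integrable ?P (\<lambda>y. (\<Prod>r\<in>J. \<sigma> (y r)) * (Green (y s) (y t) + 1/2))"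
    by (rule integrableI_nonneg[OF m nonneg]) (simp add: nn)
  have I: "(LINT y|?P. (\<Prod>r\<in>J. \<sigma> (y r)) * (Green (y s) (y t) + 1/2)) = energy \<sigma> \<sigma> + 1/2"
    using energy_ge[OF \<sigma>] by (subst integral_eq_nn_integral[OF m nonneg]) (simp add: nn)
  have ip: "integrable ?P (\<lambda>y. \<Prod>r\<in>J. \<sigma> (y r))"
    by (rule area_prod.product_integrable_prod[OF fin]) (rule D(3))
  have Ip: "(LINT y|?P. (\<Prod>r\<in>J. \<sigma> (y r))) = 1"
    using area_prod.product_integral_prod[OF fin, of "\<lambda>_. \<sigma>"] D(3,4) by simp
  have e: "(\<Prod>r\<in>J. \<sigma> (y r)) * Green (y s) (y t)
     = (\<Prod>r\<in>J. \<sigma> (y r)) * (Green (y s) (y t) + 1/2) - 1/2 * (\<Prod>r\<in>J. \<sigma> (y r))" for y by (simp add: algebra_simps)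
  show "integrable ?P (\<lambda>y. (\<Prod>r\<in>J. \<sigma> (y r)) * Green (y s) (y t))" unfolding e using i ip by simp
  show "(LINT y|?P. (\<Prod>r\<in>J. \<sigma> (y r)) * Green (y s) (y t)) = energy \<sigma> \<sigma>"
    unfolding e using i ip I Ip by simp
qed

lemma integral_PiM_single:
  fixes J :: "nat set" and f :: "real^3 \<Rightarrow> real"
  assumes fin: "finite J" and s: "s \<in> J" and \<sigma>: "\<sigma> \<in> finite_entropy_densities"
    and f: "integrable area (\<lambda>x. \<sigma> x * f x)"
  shows "integrable (\<Pi>\<^sub>M r\<in>J. area) (\<lambda>y. (\<Prod>r\<in>J. \<sigma> (y r)) * f (y s))"
    and "(LINT y|(\<Pi>\<^sub>M r\<in>J. area). (\<Prod>r\<in>J. \<sigma> (y r)) * f (y s)) = (LINT x|area. \<sigma> x * f x)"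
proof -
  note D = finite_entropyD[OF \<sigma>]
  define g where "g r x = (if r = s then \<sigma> x * f x else \<sigma> x)" for r x
  have gi: "integrable area (g r)" for r unfolding g_def[abs_def] using D(3) f by (cases "r = s") auto
  have e: "(\<Prod>r\<in>J. \<sigma> (y r)) * f (y s) = (\<Prod>r\<in>J. g r (y r))" for y
  proof -
    have "(\<Prod>r\<in>J. g r (y r)) = (\<Prod>r\<in>J. \<sigma> (y r) * (if r = s then f (y s) else 1))"
      by (intro prod.cong) (auto simp: g_def)
    also have "\<dots> = (\<Prod>r\<in>J. \<sigma> (y r)) * f (y s)" using fin s by (simp add: prod.distrib)
    finally show ?thesis by simp
  qed
  show "integrable (\<Pi>\<^sub>M r\<in>J. area) (\<lambda>y. (\<Prod>r\<in>J. \<sigma> (y r)) * f (y s))"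
    unfolding e by (rule area_prod.product_integrable_prod[OF fin gi])
  have "(LINT y|(\<Pi>\<^sub>M r\<in>J. area). (\<Prod>r\<in>J. g r (y r))) = (\<Prod>r\<in>J. LINT x|area. g r x)"
    by (rule area_prod.product_integral_prod[OF fin gi])
  also have "\<dots> = (\<Prod>r\<in>J. if r = s then (LINT x|area. \<sigma> x * f x) else 1)"
    using D(4) by (intro prod.cong) (auto simp: g_def)
  also have "\<dots> = (LINT x|area. \<sigma> x * f x)" using fin s by simp
  finally show "(LINT y|(\<Pi>\<^sub>M r\<in>J. area). (\<Prod>r\<in>J. \<sigma> (y r)) * f (y s)) = (LINT x|area. \<sigma> x * f x)"
    unfolding e .
qed

section \<open>The Coulomb gas in the mean field scaling\<close>

text \<open>The sum runs over ordered pairs, so every pair is counted twice.\<close>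

definition pair_sum :: "(real^3 \<Rightarrow> real^3 \<Rightarrow> real) \<Rightarrow> nat \<Rightarrow> (nat \<Rightarrow> real^3) \<Rightarrow> real" where
  "pair_sum K n y = (\<Sum>s<n. \<Sum>t\<in>{..<n} - {s}. K (y s) (y t))"

lemma pair_sum_const: "(\<Sum>s<n. \<Sum>t\<in>{..<n} - {s}. c) = real n * (real n - 1) * (c::real)"
proof (cases "n = 0")
  case False
  have "(\<Sum>s<n. \<Sum>t\<in>{..<n} - {s}. c) = (\<Sum>s<n. (real n - 1) * c)"
    using False by (intro sum.cong refl) (simp add: card_Diff_singleton of_nat_diff)
  then show ?thesis by simp
qed simp

lemma pair_sum_mono:
  assumes "\<And>s t. s < n \<Longrightarrow> t < n \<Longrightarrow> s \<noteq> t \<Longrightarrow> K (y s) (y t) \<le> K' (y s) (y t)"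
  shows "pair_sum K n y \<le> pair_sum K' n y"
  unfolding pair_sum_def by (intro sum_mono assms) auto

lemma pair_sum_ge:
  assumes "\<And>s t. s < n \<Longrightarrow> t < n \<Longrightarrow> s \<noteq> t \<Longrightarrow> c \<le> K (y s) (y t)"
  shows "real n * (real n - 1) * c \<le> pair_sum K n y"
  unfolding pair_sum_const[symmetric] pair_sum_def by (intro sum_mono assms) auto

lemma pair_sum_full: "pair_sum K n y = (\<Sum>s<n. \<Sum>t<n. K (y s) (y t)) - (\<Sum>s<n. K (y s) (y s))"
  unfolding pair_sum_def sum_subtractf[symmetric]
proof (intro sum.cong refl)
  fix s assume "s \<in> {..<n}"
  then show "(\<Sum>t\<in>{..<n} - {s}. K (y s) (y t)) = (\<Sum>t<n. K (y s) (y t)) - K (y s) (y s)"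
    by (simp add: sum_diff1)
qed

lemma space_PiM_areaD: "y \<in> space (\<Pi>\<^sub>M r\<in>J. area) \<Longrightarrow> r \<in> J \<Longrightarrow> y r \<in> S2"
  by (auto simp: space_PiM)

lemma measurable_pair_sum:
  assumes "\<And>s t. s < n \<Longrightarrow> t < n \<Longrightarrow> (\<lambda>y. K (y s) (y t)) \<in> borel_measurable (\<Pi>\<^sub>M r\<in>{..<n}. area)"
  shows "pair_sum K n \<in> borel_measurable (\<Pi>\<^sub>M r\<in>{..<n}. area)"
  unfolding pair_sum_def[abs_def] by (intro borel_measurable_sum assms) auto

lemma measurable_Green_PiM:
  "s \<in> J \<Longrightarrow> t \<in> J \<Longrightarrow> (\<lambda>y. Green (y s) (y t)) \<in> borel_measurable (\<Pi>\<^sub>M r\<in>J. area)"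
  by (rule measurable_Green_area) (intro measurable_component_singleton; assumption)+

context mean_field
begin

text \<open>The coupling is of order \<open>1 / n\<close>, so potential and interaction energies both are of order
\<open>n\<close>.\<close>

definition weight :: "nat \<Rightarrow> (nat \<Rightarrow> real^3) \<Rightarrow> real" where
  "weight n y = exp (- (\<Sum>r<n. V (y r)) - 2 * \<beta> / (real n - 1) * pair_sum Green n y)"

definition Z :: "nat \<Rightarrow> real" where
  "Z n = (LINT y|(\<Pi>\<^sub>M r\<in>{..<n}. area). weight n y)"

lemma weight_measurable: "weight n \<in> borel_measurable (\<Pi>\<^sub>M r\<in>{..<n}. area)"
proof -
  have 1: "pair_sum Green n \<in> borel_measurable (\<Pi>\<^sub>M r\<in>{..<n}. area)"
    by (rule measurable_pair_sum) (rule measurable_Green_PiM, auto)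
  have 2: "(\<lambda>y. \<Sum>r<n. V (y r)) \<in> borel_measurable (\<Pi>\<^sub>M r\<in>{..<n}. area)"
    by (intro borel_measurable_sum measurable_PiM_comp[OF _ V_measurable])
  show ?thesis unfolding weight_def[abs_def] using 1 2 by measurable
qed

lemma weight_le:
  assumes n: "2 \<le> n" and y: "y \<in> space (\<Pi>\<^sub>M r\<in>{..<n}. area)"
  shows "weight n y \<le> exp (\<beta> * real n) * (\<Prod>r<n. exp (- V (y r)))"
proof -
  have "real n * (real n - 1) * (- 1 / 2) \<le> pair_sum Green n y"
    by (rule pair_sum_ge) (use Green_ge space_PiM_areaD[OF y] in auto)
  then have "2 * \<beta> / (real n - 1) * (real n * (real n - 1) * (- 1 / 2)) \<le> 2 * \<beta> / (real n - 1) * pair_sum Green n y"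
    using n beta_pos by (intro mult_left_mono) auto
  also have "2 * \<beta> / (real n - 1) * (real n * (real n - 1) * (- 1 / 2)) = - (\<beta> * real n)"
    using n by (simp add: field_simps)
  finally have "weight n y \<le> exp (\<beta> * real n + (\<Sum>r<n. - V (y r)))"
    unfolding weight_def by (simp add: sum_negf)
  then show ?thesis by (simp add: exp_add exp_sum)
qed

lemma weight_integrable:
  assumes n: "2 \<le> n" shows "integrable (\<Pi>\<^sub>M r\<in>{..<n}. area) (weight n)"
proof (rule Bochner_Integration.integrable_bound[OF _ weight_measurable])
  show "integrable (\<Pi>\<^sub>M r\<in>{..<n}. area) (\<lambda>y. exp (\<beta> * real n) * (\<Prod>r<n. exp (- V (y r))))"
    by (intro integrable_mult_right area_prod.product_integrable_prod integrable_exp_neg) simp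
  show "AE y in \<Pi>\<^sub>M r\<in>{..<n}. area. norm (weight n y) \<le> norm (exp (\<beta> * real n) * (\<Prod>r<n. exp (- V (y r))))"
    using weight_le[OF n] by (intro AE_I2 norm_le_normI) (simp add: weight_def)
qed

context
  fixes \<sigma> :: "real^3 \<Rightarrow> real"
  assumes \<sigma>: "\<sigma> \<in> finite_entropy_densities" and eq: "\<And>y. \<sigma> y = gibbs (mf_pot \<sigma>) y"
begin

lemma mf_partition_pos: "0 < partition (mf_pot \<sigma>)"
  using mf_pot_bounded[OF \<sigma>] partition_pos[OF mf_pot_measurable[OF \<sigma>]] by metis

lemma exp_V_eq: "exp (- V y) = partition (mf_pot \<sigma>) * (\<sigma> y * exp (mf_pot \<sigma> y))"
proof -
  have "\<sigma> y * exp (mf_pot \<sigma> y) = exp (- V y) / partition (mf_pot \<sigma>)"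
    by (subst eq) (simp add: gibbs_def exp_add[symmetric] algebra_simps exp_diff exp_minus divide_simps)
  then show ?thesis using mf_partition_pos by simp
qed

text \<open>\<open>Z n\<close> is \<open>partition (mf_pot \<sigma>) ^ n\<close> times the expectation of \<open>exp X\<close>
under the product of the densities \<open>\<sigma>\<close>, where \<open>X\<close> has mean
\<open>2 * \<beta> * n * energy \<sigma> \<sigma>\<close>; apply Jensen's inequality. The coupling
\<open>2 * \<beta> / (n - 1)\<close> makes this mean exact for every \<open>n\<close>.\<close>

lemma Z_lower_bound:
  assumes n: "2 \<le> n"
  shows "exp (real n * (ln (partition (mf_pot \<sigma>)) + 2 * \<beta> * energy \<sigma> \<sigma>)) \<le> Z n"
proof -
  let ?P = "\<Pi>\<^sub>M r\<in>{..<n}. area"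
  let ?z = "partition (mf_pot \<sigma>)" and ?E = "energy \<sigma> \<sigma>"
  note D = finite_entropyD[OF \<sigma>]
  define \<pi> where "\<pi> y = (\<Prod>r<n. \<sigma> (y r))" for y :: "nat \<Rightarrow> real^3"
  define X where "X y = (\<Sum>r<n. mf_pot \<sigma> (y r)) - 2 * \<beta> / (real n - 1) * pair_sum Green n y" for y
  define c where "c = 2 * \<beta> * real n * ?E"
  have w: "weight n y = ?z ^ n * (\<pi> y * exp (X y))" for y
  proof -
    have "weight n y = (\<Prod>r<n. exp (- V (y r))) * exp (- 2 * \<beta> / (real n - 1) * pair_sum Green n y)"
      unfolding weight_def by (simp add: exp_sum[symmetric] exp_add[symmetric] sum_negf)
    also have "(\<Prod>r<n. exp (- V (y r))) = ?z ^ n * (\<pi> y * exp (\<Sum>r<n. mf_pot \<sigma> (y r)))"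
      unfolding exp_V_eq \<pi>_def by (simp add: prod.distrib exp_sum)
    finally show ?thesis unfolding X_def by (simp add: exp_add[symmetric] mult.assoc)
  qed
  have i1: "integrable ?P (\<lambda>y. \<pi> y * mf_pot \<sigma> (y r))"
    and I1: "(LINT y|?P. \<pi> y * mf_pot \<sigma> (y r)) = 4 * \<beta> * ?E" if "r < n" for r
  proof -
    have e: "(\<lambda>x. \<sigma> x * mf_pot \<sigma> x) = (\<lambda>x. 4 * \<beta> * (\<sigma> x * pot Green \<sigma> x))" by (simp add: fun_eq_iff)
    have i: "integrable area (\<lambda>x. \<sigma> x * mf_pot \<sigma> x)"
      unfolding e using integrable_energy(2)[OF \<sigma> \<sigma>] by (rule integrable_mult_right)
    have r: "r \<in> {..<n}" using that by simp
    show "integrable ?P (\<lambda>y. \<pi> y * mf_pot \<sigma> (y r))"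
      unfolding \<pi>_def by (rule integral_PiM_single(1)[OF finite_lessThan r \<sigma> i])
    have "(LINT y|?P. \<pi> y * mf_pot \<sigma> (y r)) = (LINT x|area. \<sigma> x * mf_pot \<sigma> x)"
      unfolding \<pi>_def by (rule integral_PiM_single(2)[OF finite_lessThan r \<sigma> i])
    also have "\<dots> = 4 * \<beta> * ?E" unfolding e energy_def by (rule integral_mult_right_zero)
    finally show "(LINT y|?P. \<pi> y * mf_pot \<sigma> (y r)) = 4 * \<beta> * ?E" .
  qed
  have i2: "integrable ?P (\<lambda>y. \<pi> y * Green (y s) (y t))"
    and I2: "(LINT y|?P. \<pi> y * Green (y s) (y t)) = ?E" if "s < n" "t \<in> {..<n} - {s}" for s t
    unfolding \<pi>_def using integral_PiM_Green_pair[OF finite_lessThan _ _ _ \<sigma>, of s n t] that by auto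
  have piX: "\<pi> y * X y = (\<Sum>r<n. \<pi> y * mf_pot \<sigma> (y r))
      - 2 * \<beta> / (real n - 1) * (\<Sum>s<n. \<Sum>t\<in>{..<n} - {s}. \<pi> y * Green (y s) (y t))" for y
    unfolding X_def pair_sum_def by (simp add: right_diff_distrib sum_distrib_left mult.left_commute)
  have iX: "integrable ?P (\<lambda>y. \<pi> y * X y)"
    unfolding piX
    by (intro Bochner_Integration.integrable_diff integrable_mult_right Bochner_Integration.integrable_sum i1 i2) auto
  have IX: "(LINT y|?P. \<pi> y * X y) = c"
  proof -
    have s1: "(LINT y|?P. (\<Sum>r<n. \<pi> y * mf_pot \<sigma> (y r))) = (\<Sum>r<n. 4 * \<beta> * ?E)"
      using i1 I1 by (subst Bochner_Integration.integral_sum) auto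
    have s2: "(LINT y|?P. (\<Sum>s<n. \<Sum>t\<in>{..<n} - {s}. \<pi> y * Green (y s) (y t))) = (\<Sum>s<n. \<Sum>t\<in>{..<n} - {s}. ?E)"
    proof -
      have "(LINT y|?P. (\<Sum>s<n. \<Sum>t\<in>{..<n} - {s}. \<pi> y * Green (y s) (y t)))
        = (\<Sum>s<n. LINT y|?P. (\<Sum>t\<in>{..<n} - {s}. \<pi> y * Green (y s) (y t)))"
        by (rule Bochner_Integration.integral_sum) (intro Bochner_Integration.integrable_sum i2, auto)
      also have "\<dots> = (\<Sum>s<n. \<Sum>t\<in>{..<n} - {s}. LINT y|?P. \<pi> y * Green (y s) (y t))"
        by (intro sum.cong refl Bochner_Integration.integral_sum i2) auto
      also have "\<dots> = (\<Sum>s<n. \<Sum>t\<in>{..<n} - {s}. ?E)"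
        by (intro sum.cong refl I2) auto
      finally show ?thesis .
    qed
    have i1s: "integrable ?P (\<lambda>y. \<Sum>r<n. \<pi> y * mf_pot \<sigma> (y r))"
      by (intro Bochner_Integration.integrable_sum i1) auto
    have i2s: "integrable ?P (\<lambda>y. \<Sum>s<n. \<Sum>t\<in>{..<n} - {s}. \<pi> y * Green (y s) (y t))"
      by (intro Bochner_Integration.integrable_sum i2) auto
    have "(LINT y|?P. \<pi> y * X y) = (\<Sum>r<n. 4 * \<beta> * ?E) - 2 * \<beta> / (real n - 1) * (\<Sum>s<n. \<Sum>t\<in>{..<n} - {s}. ?E)"
      unfolding piX s1[symmetric] s2[symmetric]
      by (subst Bochner_Integration.integral_diff[OF i1s integrable_mult_right[OF i2s]]) (simp only: integral_mult_right_zero)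
    also have "\<dots> = c" unfolding pair_sum_const c_def using n by (simp add: field_simps)
    finally show ?thesis .
  qed
  have ip: "integrable ?P \<pi>"
    unfolding \<pi>_def[abs_def] by (rule area_prod.product_integrable_prod) (use D(3) in auto)
  have Ip: "(LINT y|?P. \<pi> y) = 1"
    unfolding \<pi>_def using area_prod.product_integral_prod[of "{..<n}" "\<lambda>_. \<sigma>"] D(3,4) by simp
  have pi0: "0 \<le> \<pi> y" for y
    unfolding \<pi>_def using eq gibbs_pos[OF mf_pot_measurable[OF \<sigma>]] mf_pot_bounded[OF \<sigma>]
    by (intro prod_nonneg) (metis less_imp_le)
  (* Jensen: exp lies above its tangent at the mean c *)
  have "exp c * (1 - c) + exp c * c \<le> (LINT y|?P. \<pi> y * exp (X y))"
  proof -
    have "(LINT y|?P. exp c * (1 - c) * \<pi> y + exp c * (\<pi> y * X y)) \<le> (LINT y|?P. \<pi> y * exp (X y))"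
    proof (rule integral_mono)
      show "integrable ?P (\<lambda>y. exp c * (1 - c) * \<pi> y + exp c * (\<pi> y * X y))" using ip iX by simp
      have "integrable ?P (\<lambda>y. (1 / ?z ^ n) * weight n y)" using weight_integrable[OF n] by (rule integrable_mult_right)
      then show "integrable ?P (\<lambda>y. \<pi> y * exp (X y))" unfolding w using mf_partition_pos by simp
      fix y
      have "1 + (X y - c) \<le> exp (X y - c)" by (rule exp_ge_add_one_self)
      then have "exp c * (1 + (X y - c)) \<le> exp c * exp (X y - c)" by (intro mult_left_mono) auto
      also have "\<dots> = exp (X y)" by (simp add: exp_add[symmetric])
      finally have "\<pi> y * (exp c * (1 + (X y - c))) \<le> \<pi> y * exp (X y)" by (intro mult_left_mono pi0)
      then show "exp c * (1 - c) * \<pi> y + exp c * (\<pi> y * X y) \<le> \<pi> y * exp (X y)" by (simp add: algebra_simps)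
    qed
    also have "(LINT y|?P. exp c * (1 - c) * \<pi> y + exp c * (\<pi> y * X y)) = exp c * (1 - c) + exp c * c"
      using ip iX Ip IX by simp
    finally show ?thesis .
  qed
  then have "exp c \<le> (LINT y|?P. \<pi> y * exp (X y))" by (simp add: algebra_simps)
  then have "?z ^ n * exp c \<le> ?z ^ n * (LINT y|?P. \<pi> y * exp (X y))"
    using mf_partition_pos by (intro mult_left_mono) auto
  also have "\<dots> = Z n" unfolding Z_def w by (simp only: integral_mult_right_zero)
  also have "?z ^ n * exp c = exp (real n * (ln ?z + 2 * \<beta> * ?E))"
    using mf_partition_pos by (simp add: distrib_left exp_add exp_of_nat_mult c_def mult_ac)
  finally show ?thesis .
qed

definition reg_pot :: "real \<Rightarrow> real^3 \<Rightarrow> real" where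
  "reg_pot lam = pot (G_abel lam) \<sigma>"

definition reg_energy :: "real \<Rightarrow> real" where
  "reg_energy lam = (LINT y|area. \<sigma> y * reg_pot lam y)"

definition reg_partition :: "real \<Rightarrow> real" where
  "reg_partition lam = (LINT y|area. exp (- V y - 4 * \<beta> * reg_pot lam y))"

lemma measurable_G_abel_left:
  assumes "y \<in> S2" "0 \<le> lam" "lam < 1" shows "(\<lambda>x. G_abel lam y x) \<in> borel_measurable area"
  by (rule measurable_G_abel[OF measurable_const]) (use assms in auto)

lemma integrable_G_abel_density:
  assumes "y \<in> S2" "0 \<le> lam" "lam < 1" shows "integrable area (\<lambda>x. G_abel lam y x * \<sigma> x)"
  by (rule integrable_bounded_mult[OF finite_entropyD(3)[OF \<sigma>] measurable_G_abel_left[OF assms]])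
    (use abs_G_abel_le[OF assms(1) _ assms(2,3)] in auto)

text \<open>The bound is uniform in the regularisation; it is what makes \<open>reg_partition\<close> converge by
dominated convergence.\<close>

lemma reg_pot_ge:
  assumes y: "y \<in> S2" and lam: "1 / 2 \<le> lam" "lam < 1" shows "- 4 \<le> reg_pot lam y"
proof -
  note D = finite_entropyD[OF \<sigma>]
  have "(LINT x|area. - 4 * \<sigma> x) \<le> reg_pot lam y"
    unfolding reg_pot_def pot_def
  proof (rule integral_mono)
    show "integrable area (\<lambda>x. G_abel lam y x * \<sigma> x)" using lam by (intro integrable_G_abel_density y) auto
    show "integrable area (\<lambda>x. - 4 * \<sigma> x)" using D(3) by simp
    show "- 4 * \<sigma> x \<le> G_abel lam y x * \<sigma> x" if "x \<in> space area" for x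
      using G_abel_ge[OF y _ lam, of x] D(2)[of x] that by (intro mult_right_mono) auto
  qed
  then show ?thesis using D(4) by simp
qed

lemma reg_pot_le:
  assumes y: "y \<in> S2" and lam: "1 / 2 \<le> lam" "lam < 1"
  shows "reg_pot lam y \<le> pot Green \<sigma> y + 3 * (1 - lam)"
proof -
  note D = finite_entropyD[OF \<sigma>]
  have "reg_pot lam y \<le> (LINT x|area. Green y x * \<sigma> x + 3 * (1 - lam) * \<sigma> x)"
    unfolding reg_pot_def pot_def
  proof (rule integral_mono_AE)
    show "integrable area (\<lambda>x. G_abel lam y x * \<sigma> x)" using lam by (intro integrable_G_abel_density y) auto
    show "integrable area (\<lambda>x. Green y x * \<sigma> x + 3 * (1 - lam) * \<sigma> x)"
      using integrable_Green_density[OF \<sigma> y] D(3) by simp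
    show "AE x in area. G_abel lam y x * \<sigma> x \<le> Green y x * \<sigma> x + 3 * (1 - lam) * \<sigma> x"
      using AE_area_neq[OF y] AE_space
    proof eventually_elim
      case (elim x)
      then have "G_abel lam y x * \<sigma> x \<le> (Green y x + 3 * (1 - lam)) * \<sigma> x"
        using G_abel_le_Green[OF y _ _ lam, of x] D(2)[of x] by (intro mult_right_mono) auto
      then show ?case by (simp add: distrib_right)
    qed
  qed
  also have "\<dots> = pot Green \<sigma> y + 3 * (1 - lam)"
    unfolding pot_def using integrable_Green_density[OF \<sigma> y] D(3,4) by simp
  finally show ?thesis .
qed

lemma reg_pot_measurable:
  assumes lam: "0 \<le> lam" "lam < 1" shows "reg_pot lam \<in> borel_measurable area"
proof -
  have [measurable]: "\<sigma> \<in> borel_measurable area" by (rule finite_entropyD(1)[OF \<sigma>])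
  have [measurable]: "(\<lambda>p. G_abel lam (fst p) (snd p)) \<in> borel_measurable (area \<Otimes>\<^sub>M area)"
    using lam by (intro measurable_G_abel) measurable
  have "(\<lambda>x. LINT z|area. (\<lambda>(x, z). G_abel lam x z * \<sigma> z) (x, z)) \<in> borel_measurable area"
    by (rule area.borel_measurable_lebesgue_integral) (simp add: case_prod_unfold)
  then show ?thesis unfolding reg_pot_def pot_def[abs_def] by simp
qed

lemma reg_weight_le:
  assumes "y \<in> S2" "1 / 2 \<le> lam" "lam < 1"
  shows "exp (- V y - 4 * \<beta> * reg_pot lam y) \<le> exp (16 * \<beta>) * exp (- V y)"
proof -
  have "4 * \<beta> * - 4 \<le> 4 * \<beta> * reg_pot lam y"
    using reg_pot_ge[OF assms] beta_pos by (intro mult_left_mono) auto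
  then show ?thesis by (simp add: exp_add[symmetric])
qed

lemma reg_weight_integrable:
  assumes lam: "1 / 2 \<le> lam" "lam < 1" shows "integrable area (\<lambda>y. exp (- V y - 4 * \<beta> * reg_pot lam y))"
proof (rule Bochner_Integration.integrable_bound)
  show "integrable area (\<lambda>y. exp (16 * \<beta>) * exp (- V y))" using integrable_exp_neg by simp
  have [measurable]: "reg_pot lam \<in> borel_measurable area" using lam by (intro reg_pot_measurable) auto
  show "(\<lambda>y. exp (- V y - 4 * \<beta> * reg_pot lam y)) \<in> borel_measurable area" by measurable
  show "AE y in area. norm (exp (- V y - 4 * \<beta> * reg_pot lam y)) \<le> norm (exp (16 * \<beta>) * exp (- V y))"
    using reg_weight_le[OF _ lam] by (intro AE_I2 norm_le_normI) simp
qed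

lemma reg_energy_le:
  assumes lam: "1 / 2 \<le> lam" "lam < 1" shows "reg_energy lam \<le> energy \<sigma> \<sigma> + 3 * (1 - lam)"
proof -
  note D = finite_entropyD[OF \<sigma>]
  obtain C where C: "\<And>y. y \<in> S2 \<Longrightarrow> \<bar>pot Green \<sigma> y\<bar> \<le> C" using potential_bounded[OF \<sigma>] by blast
  have m: "reg_pot lam \<in> borel_measurable area" using lam by (intro reg_pot_measurable) auto
  have "integrable area (\<lambda>y. reg_pot lam y * \<sigma> y)"
  proof (rule integrable_bounded_mult[OF D(3) m, of "C + 10"])
    fix y assume "y \<in> space area"
    then have y: "y \<in> S2" by simp
    show "\<bar>reg_pot lam y\<bar> \<le> C + 10"
      using C[OF y] reg_pot_ge[OF y lam] reg_pot_le[OF y lam] lam by (simp add: abs_le_iff)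
  qed
  then have i: "integrable area (\<lambda>y. \<sigma> y * reg_pot lam y)" by (simp add: mult.commute)
  have "reg_energy lam \<le> (LINT y|area. \<sigma> y * pot Green \<sigma> y + 3 * (1 - lam) * \<sigma> y)"
    unfolding reg_energy_def
  proof (rule integral_mono[OF i])
    show "integrable area (\<lambda>y. \<sigma> y * pot Green \<sigma> y + 3 * (1 - lam) * \<sigma> y)"
      using integrable_energy(2)[OF \<sigma> \<sigma>] D(3) by simp
    fix y assume "y \<in> space area"
    then have "\<sigma> y * reg_pot lam y \<le> \<sigma> y * (pot Green \<sigma> y + 3 * (1 - lam))"
      using reg_pot_le[OF _ lam, of y] D(2)[of y] by (intro mult_left_mono) auto
    then show "\<sigma> y * reg_pot lam y \<le> \<sigma> y * pot Green \<sigma> y + 3 * (1 - lam) * \<sigma> y" by (simp add: algebra_simps)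
  qed
  also have "\<dots> = energy \<sigma> \<sigma> + 3 * (1 - lam)"
    unfolding energy_def using integrable_energy(2)[OF \<sigma> \<sigma>] D(3,4) by simp
  finally show ?thesis .
qed

lemma reg_pot_tendsto:
  assumes y: "y \<in> S2" and u: "\<And>i. 1 / 2 \<le> u i" "\<And>i. u i < 1" and ulim: "filterlim u (at_left 1) sequentially"
  shows "(\<lambda>i. reg_pot (u i) y) \<longlonglongrightarrow> pot Green \<sigma> y"
  unfolding reg_pot_def pot_def
proof (rule integral_dominated_convergence[where w="\<lambda>x. Green y x * \<sigma> x + 10 * \<sigma> x"])
  note D = finite_entropyD[OF \<sigma>]
  have u0: "0 \<le> u i" for i using u(1)[of i] by linarith
  show "(\<lambda>x. Green y x * \<sigma> x) \<in> borel_measurable area" using D(1) by simp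
  show "(\<lambda>x. G_abel (u i) y x * \<sigma> x) \<in> borel_measurable area" for i
    using measurable_G_abel_left[OF y u0 u(2)] D(1) by simp
  show "integrable area (\<lambda>x. Green y x * \<sigma> x + 10 * \<sigma> x)"
    using integrable_Green_density[OF \<sigma> y] D(3) by simp
  show "AE x in area. (\<lambda>i. G_abel (u i) y x * \<sigma> x) \<longlonglongrightarrow> Green y x * \<sigma> x"
    using AE_area_neq[OF y] AE_space
  proof eventually_elim
    case (elim x)
    then have "((\<lambda>lam. G_abel lam y x) \<longlongrightarrow> Green y x) (at_left 1)" using y by (intro G_abel_tendsto) auto
    then show ?case by (intro tendsto_mult tendsto_const filterlim_compose[OF _ ulim])
  qed
  show "AE x in area. norm (G_abel (u i) y x * \<sigma> x) \<le> Green y x * \<sigma> x + 10 * \<sigma> x" for i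
    using AE_area_neq[OF y] AE_space
  proof eventually_elim
    case (elim x)
    then have x: "x \<in> S2" "y \<noteq> x" by auto
    have "\<bar>G_abel (u i) y x\<bar> \<le> Green y x + 10"
      using G_abel_ge[OF y x(1) u(1)[of i] u(2)[of i]] G_abel_le_Green[OF y x u(1)[of i] u(2)[of i]]
        Green_ge[OF y x(1)] u(1)[of i] by (simp add: abs_le_iff)
    then have "\<bar>G_abel (u i) y x\<bar> * \<sigma> x \<le> (Green y x + 10) * \<sigma> x" using D(2)[OF x(1)] by (intro mult_right_mono)
    then show ?case using D(2)[OF x(1)] by (simp add: abs_mult distrib_right)
  qed
qed

lemma reg_partition_tendsto:
  assumes u: "\<And>i. 1 / 2 \<le> u i" "\<And>i. u i < 1" and ulim: "filterlim u (at_left 1) sequentially"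
  shows "(\<lambda>i. reg_partition (u i)) \<longlonglongrightarrow> partition (mf_pot \<sigma>)"
  unfolding reg_partition_def partition_def
proof (rule integral_dominated_convergence[where w="\<lambda>y. exp (16 * \<beta>) * exp (- V y)"])
  show "(\<lambda>y. exp (- (V y + mf_pot \<sigma> y))) \<in> borel_measurable area"
    using mf_pot_measurable[OF \<sigma>] by simp
  show "(\<lambda>y. exp (- V y - 4 * \<beta> * reg_pot (u i) y)) \<in> borel_measurable area" for i
    using reg_weight_integrable[OF u] by auto
  show "integrable area (\<lambda>y. exp (16 * \<beta>) * exp (- V y))" using integrable_exp_neg by simp
  show "AE y in area. (\<lambda>i. exp (- V y - 4 * \<beta> * reg_pot (u i) y)) \<longlonglongrightarrow> exp (- (V y + mf_pot \<sigma> y))"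
  proof (rule AE_I2)
    fix y assume "y \<in> space area"
    then have "(\<lambda>i. exp (- V y - 4 * \<beta> * reg_pot (u i) y)) \<longlonglongrightarrow> exp (- V y - 4 * \<beta> * pot Green \<sigma> y)"
      by (intro tendsto_intros reg_pot_tendsto u ulim) simp
    then show "(\<lambda>i. exp (- V y - 4 * \<beta> * reg_pot (u i) y)) \<longlonglongrightarrow> exp (- (V y + mf_pot \<sigma> y))" by simp
  qed
  show "AE y in area. norm (exp (- V y - 4 * \<beta> * reg_pot (u i) y)) \<le> exp (16 * \<beta>) * exp (- V y)" for i
    using reg_weight_le[OF _ u] by (intro AE_I2) simp
qed

text \<open>The square expansion of the Abel kernel around \<open>n \<sigma>\<close> bounds the full double sum from
below. The diagonal costs at most \<open>n / (1 - lam)\<close>, and passing to the logarithmic kernel costs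
\<open>3 * (1 - lam)\<close> for each ordered pair.\<close>

lemma pair_sum_Green_ge:
  assumes y: "\<And>r. r < n \<Longrightarrow> y r \<in> S2" and dist: "\<And>s t. s < n \<Longrightarrow> t < n \<Longrightarrow> s \<noteq> t \<Longrightarrow> y s \<noteq> y t"
    and lam: "1 / 2 \<le> lam" "lam < 1"
  shows "2 * real n * (\<Sum>r<n. reg_pot lam (y r)) - (real n)\<^sup>2 * reg_energy lam - real n / (1 - lam)
      - 3 * (1 - lam) * (real n * (real n - 1)) \<le> pair_sum Green n y"
proof -
  let ?f = "\<lambda>x. real n * \<sigma> x"
  have lam0: "0 \<le> lam" using lam by linarith
  have fi: "integrable area ?f" using finite_entropyD(3)[OF \<sigma>] by simp
  have p: "pot (G_abel lam) ?f x = real n * reg_pot lam x" for x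
    unfolding reg_pot_def pot_def by (simp add: mult.left_commute flip: integral_mult_right_zero)
  have "0 \<le> (\<Sum>r<n. \<Sum>s<n. G_abel lam (y r) (y s)) - 2 * (\<Sum>r<n. pot (G_abel lam) ?f (y r))
      + (LINT z|area. ?f z * pot (G_abel lam) ?f z)"
    by (rule G_abel_square_expansion[OF fi _ lam0 lam(2)]) (use y in auto)
  also have "(LINT z|area. ?f z * pot (G_abel lam) ?f z) = (real n)\<^sup>2 * reg_energy lam"
  proof -
    have "(\<lambda>z. ?f z * pot (G_abel lam) ?f z) = (\<lambda>z. (real n)\<^sup>2 * (\<sigma> z * reg_pot lam z))"
      unfolding p by (simp add: fun_eq_iff power2_eq_square mult_ac)
    then show ?thesis unfolding reg_energy_def by (simp only: integral_mult_right_zero)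
  qed
  also have "(\<Sum>r<n. pot (G_abel lam) ?f (y r)) = real n * (\<Sum>r<n. reg_pot lam (y r))"
    unfolding p by (simp add: sum_distrib_left)
  finally have full: "2 * real n * (\<Sum>r<n. reg_pot lam (y r)) - (real n)\<^sup>2 * reg_energy lam \<le> (\<Sum>r<n. \<Sum>s<n. G_abel lam (y r) (y s))"
    by simp
  have diag: "(\<Sum>r<n. G_abel lam (y r) (y r)) \<le> real n / (1 - lam)"
  proof -
    have "(\<Sum>r<n. G_abel lam (y r) (y r)) \<le> (\<Sum>r<n. 1 / (1 - lam))"
      by (intro sum_mono abs_le_D1[OF abs_G_abel_le] lam lam0) (use y in auto)
    then show ?thesis by simp
  qed
  have "pair_sum (G_abel lam) n y - 3 * (1 - lam) * (real n * (real n - 1)) = pair_sum (\<lambda>a b. G_abel lam a b - 3 * (1 - lam)) n y"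
    using pair_sum_const[of "3 * (1 - lam)" n] unfolding pair_sum_def by (simp add: sum_subtractf mult_ac)
  also have "\<dots> \<le> pair_sum Green n y"
  proof (rule pair_sum_mono)
    fix s t assume "s < n" "t < n" "s \<noteq> t"
    then show "G_abel lam (y s) (y t) - 3 * (1 - lam) \<le> Green (y s) (y t)"
      using G_abel_le_Green[OF y y dist lam, of s t] by simp
  qed
  finally show ?thesis using full diag pair_sum_full[of "G_abel lam" n y] by linarith
qed

text \<open>By \<open>pair_sum_Green_ge\<close> the weight is bounded by a product of functions of single points. The
term \<open>16 * \<beta> / N\<close> comes from replacing \<open>n / (n - 1)\<close> by one in front of the
potential, which is at least \<open>- 4\<close>.\<close>

lemma Z_upper_bound:
  assumes n: "2 \<le> n" and lam: "1 / 2 \<le> lam" "lam < 1"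
  defines "N \<equiv> real n - 1"
  shows "Z n \<le> (reg_partition lam * exp (16 * \<beta> / N + 2 * \<beta> * (real n / N) * reg_energy lam
      + 2 * \<beta> / (N * (1 - lam)) + 6 * \<beta> * (1 - lam))) ^ n"
proof -
  let ?P = "\<Pi>\<^sub>M r\<in>{..<n}. area"
  let ?g = "\<lambda>y. exp (- V y - 4 * \<beta> * reg_pot lam y)"
  define B where "B = 16 * \<beta> / N + 2 * \<beta> * (real n / N) * reg_energy lam + 2 * \<beta> / (N * (1 - lam)) + 6 * \<beta> * (1 - lam)"
  have N: "0 < N" "real n = N + 1" using n by (auto simp: N_def)
  have i: "integrable ?P (\<lambda>y. exp (real n * B) * (\<Prod>r<n. ?g (y r)))"
    by (intro integrable_mult_right area_prod.product_integrable_prod reg_weight_integrable lam) simp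
  have "Z n \<le> (LINT y|?P. exp (real n * B) * (\<Prod>r<n. ?g (y r)))"
    unfolding Z_def
  proof (rule integral_mono_AE[OF weight_integrable[OF n] i])
    show "AE y in ?P. weight n y \<le> exp (real n * B) * (\<Prod>r<n. ?g (y r))"
      using AE_PiM_area_distinct[OF finite_lessThan] AE_space
    proof eventually_elim
      case (elim y)
      have y: "y r \<in> S2" if "r < n" for r using space_PiM_areaD[OF elim(2)] that by simp
      let ?U = "\<Sum>r<n. reg_pot lam (y r)"
      have U: "- 4 * real n \<le> ?U"
        using sum_mono[of "{..<n}" "\<lambda>_. - 4" "\<lambda>r. reg_pot lam (y r)"] reg_pot_ge[OF y lam] by simp
      have "2 * real n * ?U - (real n)\<^sup>2 * reg_energy lam - real n / (1 - lam) - 3 * (1 - lam) * (real n * N) \<le> pair_sum Green n y"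
        unfolding N_def by (rule pair_sum_Green_ge[OF y _ lam]) (use elim(1) in auto)
      then have "2 * \<beta> / N * (2 * real n * ?U - (real n)\<^sup>2 * reg_energy lam - real n / (1 - lam) - 3 * (1 - lam) * (real n * N))
         \<le> 2 * \<beta> / N * pair_sum Green n y"
        using N beta_pos by (intro mult_left_mono) auto
      moreover have "2 * \<beta> / N * (2 * real n * ?U - (real n)\<^sup>2 * reg_energy lam - real n / (1 - lam) - 3 * (1 - lam) * (real n * N))
         = 4 * \<beta> * ?U + 4 * \<beta> / N * ?U - real n * (2 * \<beta> * (real n / N) * reg_energy lam) - real n * (2 * \<beta> / (N * (1 - lam)))
            - real n * (6 * \<beta> * (1 - lam))"
      proof -
        have 1: "2 * \<beta> / N * (2 * real n * ?U) = 4 * \<beta> * ?U + 4 * \<beta> / N * ?U"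
          using N by (simp add: field_simps)
        have 2: "2 * \<beta> / N * ((real n)\<^sup>2 * reg_energy lam) = real n * (2 * \<beta> * (real n / N) * reg_energy lam)"
          by (simp add: power2_eq_square)
        have 3: "2 * \<beta> / N * (real n / (1 - lam)) = real n * (2 * \<beta> / (N * (1 - lam)))" by simp
        have 4: "2 * \<beta> / N * (3 * (1 - lam) * (real n * N)) = real n * (6 * \<beta> * (1 - lam))" using N(1) by simp
        show ?thesis unfolding right_diff_distrib[of "2 * \<beta> / N"] 1 2 3 4 ..
      qed
      moreover have "4 * \<beta> / N * (- 4 * real n) \<le> 4 * \<beta> / N * ?U" using U N beta_pos by (intro mult_left_mono) auto
      moreover have "4 * \<beta> / N * (- 4 * real n) = - (real n * (16 * \<beta> / N))" by simp
      ultimately have "- (2 * \<beta> / N * pair_sum Green n y) \<le> real n * B - 4 * \<beta> * ?U"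
        unfolding B_def distrib_left by linarith
      then have "weight n y \<le> exp (real n * B + (\<Sum>r<n. - V (y r) - 4 * \<beta> * reg_pot lam (y r)))"
        unfolding weight_def N_def[symmetric] by (simp add: sum_subtractf sum_negf sum_distrib_left)
      then show ?case by (simp add: exp_add exp_sum)
    qed
  qed
  also have "\<dots> = exp (real n * B) * (LINT y|?P. (\<Prod>r<n. ?g (y r)))" by (rule integral_mult_right_zero)
  also have "(LINT y|?P. (\<Prod>r<n. ?g (y r))) = reg_partition lam ^ n"
    using area_prod.product_integral_prod[of "{..<n}" "\<lambda>_. ?g"] reg_weight_integrable[OF lam]
    by (simp add: reg_partition_def)
  also have "exp (real n * B) * reg_partition lam ^ n = (reg_partition lam * exp B) ^ n"
    by (simp add: power_mult_distrib exp_of_nat_mult)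
  finally show ?thesis unfolding B_def .
qed

text \<open>In the upper bound \<open>n \<rightarrow> \<infinity>\<close> is taken at a fixed regularisation, whose parameter
then tends to one.\<close>

theorem free_energy_limit:
  "(\<lambda>n. ln (Z n) / real n) \<longlonglongrightarrow> ln (partition (mf_pot \<sigma>)) + 2 * \<beta> * energy \<sigma> \<sigma>"
proof -
  let ?F = "ln (partition (mf_pot \<sigma>)) + 2 * \<beta> * energy \<sigma> \<sigma>"
  have Zpos: "0 < Z n" if "2 \<le> n" for n
    using Z_lower_bound[OF that] by (rule less_le_trans[OF exp_gt_zero])
  have lower: "?F \<le> ln (Z n) / real n" if n: "2 \<le> n" for n
  proof -
    have "real n * ?F \<le> ln (Z n)"
      using Z_lower_bound[OF n] Zpos[OF n] by (simp add: ln_ge_iff)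
    then show ?thesis using n by (simp add: pos_le_divide_eq mult.commute)
  qed
  define u where "u i = 1 - 1 / (real i + 2)" for i
  have u: "1 / 2 \<le> u i" "u i < 1" for i by (auto simp: u_def field_simps)
  have u1: "u \<longlonglongrightarrow> 1"
  proof -
    have "(\<lambda>n. 1 - 1 / real (n + 2)) \<longlonglongrightarrow> 1 - 0"
      by (intro tendsto_diff tendsto_const LIMSEQ_ignore_initial_segment lim_const_over_n)
    then show ?thesis by (simp add: u_def[abs_def] add.commute)
  qed
  have ulim: "filterlim u (at_left 1) sequentially"
    by (rule tendsto_imp_filterlim_at_left[OF u1]) (use u in auto)
  define g where "g i = ln (reg_partition (u i)) + 2 * \<beta> * (energy \<sigma> \<sigma> + 3 * (1 - u i)) + 6 * \<beta> * (1 - u i)" for i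
  have "g \<longlonglongrightarrow> ln (partition (mf_pot \<sigma>)) + 2 * \<beta> * (energy \<sigma> \<sigma> + 3 * (1 - 1)) + 6 * \<beta> * (1 - 1)"
    unfolding g_def using mf_partition_pos
    by (intro tendsto_intros reg_partition_tendsto u ulim u1) auto
  then have glim: "g \<longlonglongrightarrow> ?F" by simp
  show ?thesis
  proof (rule order_tendstoI)
    fix a assume "a < ?F"
    then show "\<forall>\<^sub>F n in sequentially. a < ln (Z n) / real n"
      using lower by (intro eventually_sequentiallyI[of 2]) (rule less_le_trans)
  next
    fix a assume a: "?F < a"
    have "\<forall>\<^sub>F i in sequentially. 0 < reg_partition (u i)"
      using reg_partition_tendsto[OF u ulim] mf_partition_pos by (rule order_tendstoD)
    with order_tendstoD(2)[OF glim a] have "\<forall>\<^sub>F i in sequentially. g i < a \<and> 0 < reg_partition (u i)"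
      by eventually_elim simp
    then obtain i where i: "g i < a" "0 < reg_partition (u i)"
      by (auto simp: eventually_sequentially)
    let ?l = "u i"
    define h where "h n = ln (reg_partition ?l) + (16 * \<beta> / (real n - 1) + 2 * \<beta> * (real n / (real n - 1)) * reg_energy ?l
      + 2 * \<beta> / ((real n - 1) * (1 - ?l)) + 6 * \<beta> * (1 - ?l))" for n :: nat
    have inv: "(\<lambda>n. 1 / (real n - 1)) \<longlonglongrightarrow> 0"
    proof -
      have "(\<lambda>n. 1 / (real (n + 1) - 1)) \<longlonglongrightarrow> 0" using lim_const_over_n[of 1] by simp
      then show ?thesis by (rule LIMSEQ_offset)
    qed
    have quot: "(\<lambda>n. real n / (real n - 1)) \<longlonglongrightarrow> 1"
    proof -
      have "(\<lambda>n. 1 + 1 / (real n - 1)) \<longlonglongrightarrow> 1 + 0" by (intro tendsto_add tendsto_const inv)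
      then have "(\<lambda>n. 1 + 1 / (real n - 1)) \<longlonglongrightarrow> 1" by simp
      then show ?thesis
        by (rule Lim_transform_eventually)
          (use eventually_ge_at_top[of 2] in eventually_elim, simp add: field_simps)
    qed
    have "(\<lambda>n. ln (reg_partition ?l) + (16 * \<beta> * (1 / (real n - 1)) + 2 * \<beta> * (real n / (real n - 1)) * reg_energy ?l
      + 2 * \<beta> / (1 - ?l) * (1 / (real n - 1)) + 6 * \<beta> * (1 - ?l)))
      \<longlonglongrightarrow> ln (reg_partition ?l) + (16 * \<beta> * 0 + 2 * \<beta> * 1 * reg_energy ?l + 2 * \<beta> / (1 - ?l) * 0 + 6 * \<beta> * (1 - ?l))"
      by (intro tendsto_intros inv quot)
    then have hlim: "h \<longlonglongrightarrow> ln (reg_partition ?l) + 2 * \<beta> * reg_energy ?l + 6 * \<beta> * (1 - ?l)"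
      by (simp add: h_def[abs_def] mult.commute[of "1 - ?l"] add.assoc)
    have "2 * \<beta> * reg_energy ?l \<le> 2 * \<beta> * (energy \<sigma> \<sigma> + 3 * (1 - ?l))"
      using reg_energy_le[OF u] beta_pos by (intro mult_left_mono) auto
    then have "ln (reg_partition ?l) + 2 * \<beta> * reg_energy ?l + 6 * \<beta> * (1 - ?l) < a"
      using i(1) unfolding g_def by linarith
    from order_tendstoD(2)[OF hlim this] eventually_ge_at_top[of 2]
    show "\<forall>\<^sub>F n in sequentially. ln (Z n) / real n < a"
    proof eventually_elim
      case (elim n)
      have "ln (Z n) \<le> ln ((reg_partition ?l * exp (h n - ln (reg_partition ?l))) ^ n)"
        using Z_upper_bound[OF elim(2) u] Zpos[OF elim(2)] i(2) unfolding h_def by (subst ln_le_cancel_iff) auto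
      also have "\<dots> = real n * h n" using i(2) by (simp add: ln_realpow ln_mult)
      finally have "ln (Z n) / real n \<le> h n" using elim(2) by (simp add: pos_divide_le_eq mult.commute)
      then show ?case using elim(1) by linarith
    qed
  qed
qed

end

end

section \<open>Quadratic forms in the modes\<close>

lemma modes_eq: "modes L = (SIGMA l:{..L}. {- int l..int l})"
  by (auto simp: modes_def)

lemma finite_modes: "finite (modes L)"
  by (simp add: modes_eq)

lemma sum_modes:
  fixes f :: "nat \<times> int \<Rightarrow> 'a :: comm_monoid_add"
  shows "(\<Sum>i\<in>modes L. f i) = f (0, 0) + (\<Sum>l=1..L. \<Sum>m=-int l..int l. f (l, m))"
proof -
  have "(\<Sum>i\<in>modes L. f i) = (\<Sum>l\<le>L. \<Sum>m=-int l..int l. f (l, m))"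
    unfolding modes_eq by (subst sum.Sigma) auto
  also have "{..L} = insert 0 {1..L}" by auto
  finally show ?thesis by simp
qed

text \<open>The coefficient of a mode of \<open>X_reg\<close>; its square is the weight of that mode in \<open>G_reg\<close>.\<close>

definition mode_coeff :: "real \<Rightarrow> nat \<Rightarrow> real" where
  "mode_coeff lam l = lam powr (real l / 2) * sqrt (2 * pi / (real l * (real l + 1)))"

lemma mode_coeff_square:
  assumes "0 < lam" shows "mode_coeff lam l * mode_coeff lam l = lam ^ l * (2 * pi / (real l * (real l + 1)))"
proof -
  have "lam powr (real l / 2) * lam powr (real l / 2) = lam ^ l"
    using assms by (simp add: powr_add[symmetric] powr_realpow)
  moreover have "sqrt (2 * pi / (real l * (real l + 1))) * sqrt (2 * pi / (real l * (real l + 1))) = 2 * pi / (real l * (real l + 1))"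
    by (rule real_sqrt_mult_self[THEN trans, OF abs_of_nonneg]) simp
  moreover have "(p * q) * (p * q) = (p * p) * (q * q)" for p q :: real by simp
  ultimately show ?thesis unfolding mode_coeff_def by presburger
qed

lemma X_reg_eq: "X_reg lam L X y = (\<Sum>l=1..L. \<Sum>m=-int l..int l. mode_coeff lam l * X (l, m) * Ylm l m y)"
  unfolding X_reg_def mode_coeff_def ..

text \<open>The variance of a combination of field values for standard Gaussian modes, computed mode by mode
and from the covariance \<open>G_reg\<close>.\<close>

lemma G_reg_quadratic:
  assumes lam: "0 < lam"
  shows "(\<Sum>l=1..L. \<Sum>m=-int l..int l. (\<Sum>p\<in>A. c p * (mode_coeff lam l * Ylm l m (z p)))\<^sup>2)
    = (\<Sum>p\<in>A. \<Sum>q\<in>A. c p * c q * G_reg lam L (z p) (z q))"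
proof -
  have "(\<Sum>p\<in>A. c p * (mode_coeff lam l * Ylm l m (z p)))\<^sup>2
      = (\<Sum>p\<in>A. \<Sum>q\<in>A. c p * c q * (lam ^ l * (2 * pi / (real l * (real l + 1))) * Ylm l m (z p) * Ylm l m (z q)))" for l m
  proof -
    have "(\<Sum>p\<in>A. c p * (mode_coeff lam l * Ylm l m (z p)))\<^sup>2
      = (\<Sum>p\<in>A. \<Sum>q\<in>A. (c p * (mode_coeff lam l * Ylm l m (z p))) * (c q * (mode_coeff lam l * Ylm l m (z q))))"
      unfolding power2_eq_square sum_product ..
    also have "\<dots> = (\<Sum>p\<in>A. \<Sum>q\<in>A. c p * c q * (mode_coeff lam l * mode_coeff lam l * Ylm l m (z p) * Ylm l m (z q)))"
      by (simp only: mult_ac)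
    finally show ?thesis unfolding mode_coeff_square[OF lam] .
  qed
  then have "(\<Sum>l=1..L. \<Sum>m=-int l..int l. (\<Sum>p\<in>A. c p * (mode_coeff lam l * Ylm l m (z p)))\<^sup>2)
    = (\<Sum>l=1..L. \<Sum>m=-int l..int l. \<Sum>p\<in>A. \<Sum>q\<in>A. c p * c q * (lam ^ l * (2 * pi / (real l * (real l + 1))) * Ylm l m (z p) * Ylm l m (z q)))"
    by simp
  also have "\<dots> = (\<Sum>l=1..L. \<Sum>p\<in>A. \<Sum>m=-int l..int l. \<Sum>q\<in>A. c p * c q * (lam ^ l * (2 * pi / (real l * (real l + 1))) * Ylm l m (z p) * Ylm l m (z q)))"
    by (intro sum.cong refl sum.swap)
  also have "\<dots> = (\<Sum>p\<in>A. \<Sum>l=1..L. \<Sum>m=-int l..int l. \<Sum>q\<in>A. c p * c q * (lam ^ l * (2 * pi / (real l * (real l + 1))) * Ylm l m (z p) * Ylm l m (z q)))"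
    by (rule sum.swap)
  also have "\<dots> = (\<Sum>p\<in>A. \<Sum>l=1..L. \<Sum>q\<in>A. \<Sum>m=-int l..int l. c p * c q * (lam ^ l * (2 * pi / (real l * (real l + 1))) * Ylm l m (z p) * Ylm l m (z q)))"
    by (intro sum.cong refl sum.swap)
  also have "\<dots> = (\<Sum>p\<in>A. \<Sum>q\<in>A. \<Sum>l=1..L. \<Sum>m=-int l..int l. c p * c q * (lam ^ l * (2 * pi / (real l * (real l + 1))) * Ylm l m (z p) * Ylm l m (z q)))"
    by (intro sum.cong refl sum.swap)
  also have "\<dots> = (\<Sum>p\<in>A. \<Sum>q\<in>A. c p * c q * G_reg lam L (z p) (z q))"
    unfolding G_reg_def by (simp add: sum_distrib_left)
  finally show ?thesis .
qed

lemma sum_Plus_square: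
  fixes K :: "'a \<Rightarrow> 'a \<Rightarrow> real"
  assumes fin: "finite A" "finite B" and sym: "\<And>u v. K u v = K v u"
  shows "(\<Sum>p\<in>A <+> B. \<Sum>q\<in>A <+> B. case_sum c d p * case_sum c d q * K (case_sum x y p) (case_sum x y q))
    = (\<Sum>j\<in>A. \<Sum>j'\<in>A. c j * c j' * K (x j) (x j')) + 2 * (\<Sum>r\<in>B. \<Sum>j\<in>A. c j * d r * K (x j) (y r))
      + (\<Sum>r\<in>B. \<Sum>s\<in>B. d r * d s * K (y r) (y s))"
proof -
  have 1: "(\<Sum>j\<in>A. \<Sum>r\<in>B. c j * d r * K (x j) (y r)) = (\<Sum>r\<in>B. \<Sum>j\<in>A. c j * d r * K (x j) (y r))"
    by (rule sum.swap)
  have 2: "(\<Sum>r\<in>B. \<Sum>j\<in>A. d r * c j * K (y r) (x j)) = (\<Sum>r\<in>B. \<Sum>j\<in>A. c j * d r * K (x j) (y r))"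
    by (intro sum.cong refl) (simp add: sym mult.commute)
  show ?thesis
    using fin by (simp add: sum.Plus sum.distrib 1 2)
qed

lemma sum_off_diagonal:
  fixes f :: "'a \<Rightarrow> 'a \<Rightarrow> real"
  assumes "finite A"
  shows "(\<Sum>s\<in>A. \<Sum>t\<in>A. f s t) = (\<Sum>s\<in>A. \<Sum>t\<in>A - {s}. f s t) + (\<Sum>s\<in>A. f s s)"
  unfolding sum.distrib[symmetric] using assms by (intro sum.cong refl) (simp add: sum_diff1)

section \<open>The correlation function for real parameters\<close>

text \<open>For \<open>w = n\<close> the exponent of the zero mode is cancelled by that of \<open>n\<close> insertions of
the interaction. The parameters are scaled as in the semiclassical limit: the charges are
\<open>al j / b\<close>.\<close>

locale correlation =
  fixes k :: nat and x :: "nat \<Rightarrow> real^3" and al :: "nat \<Rightarrow> real" and b \<mu> :: real and n :: nat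
  assumes x: "\<And>j. j \<in> {1..k} \<Longrightarrow> x j \<in> S2"
    and b: "0 < b"
    and w: "w_param k (\<lambda>j. of_real (al j / b)) b = of_nat n"
begin

abbreviation alpha :: "nat \<Rightarrow> real" where "alpha j \<equiv> al j / b"

text \<open>The factor of \<open>V_tilde\<close> that does not contain the field.\<close>

definition vertex_const :: "nat \<Rightarrow> real" where
  "vertex_const j = exp (chi_const * alpha j * (b - alpha j))
     * round_metric (stereo (x j)) powr (- (alpha j * (Q_const b - alpha j)))"

definition prefactor :: real where
  "prefactor = (\<Prod>j=1..k. vertex_const j)"

definition vertex_interaction :: "(real^3 \<Rightarrow> real^3 \<Rightarrow> real) \<Rightarrow> real" where
  "vertex_interaction K = exp (- 2 * (\<Sum>j=1..k. \<Sum>j'\<in>{1..k} - {j}. alpha j * alpha j' * K (x j) (x j')))"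

definition coulomb_weight :: "(real^3 \<Rightarrow> real^3 \<Rightarrow> real) \<Rightarrow> nat \<Rightarrow> (nat \<Rightarrow> real^3) \<Rightarrow> real" where
  "coulomb_weight K m y = exp (- (\<Sum>r<m. \<Sum>j=1..k. 4 * al j * K (x j) (y r)) - 2 * b\<^sup>2 * pair_sum K m y)"

definition coulomb_integral :: "(real^3 \<Rightarrow> real^3 \<Rightarrow> real) \<Rightarrow> nat \<Rightarrow> real" where
  "coulomb_integral K m = (LINT y|(\<Pi>\<^sub>M r\<in>{..<m}. area). coulomb_weight K m y)"

text \<open>The coefficient of the mode \<open>i\<close> in the exponent of the interaction at \<open>y\<close>. Here
\<open>\<kappa>\<close> is the coefficient \<open>2 * b / sqrt (8 * pi * eps)\<close> of the zero mode; the value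
\<open>0\<close> outside \<open>modes L\<close> makes the coefficients uniformly bounded in \<open>i\<close>.\<close>

definition field_coeff :: "real \<Rightarrow> real \<Rightarrow> nat \<Rightarrow> nat \<times> int \<Rightarrow> real^3 \<Rightarrow> real" where
  "field_coeff \<kappa> lam L i y = (if i \<in> modes L then
     if fst i = 0 then \<kappa> else 2 * b * (mode_coeff lam (fst i) * Ylm (fst i) (snd i) y) else 0)"

text \<open>The coefficient of the mode \<open>i\<close> in the linear exponent of the correlation function.\<close>

definition source_coeff :: "real \<Rightarrow> real \<Rightarrow> nat \<Rightarrow> nat \<times> int \<Rightarrow> real" where
  "source_coeff \<kappa> lam L i = (if fst i = 0 then - \<kappa> * real n
     else \<Sum>j=1..k. 2 * alpha j * (mode_coeff lam (fst i) * Ylm (fst i) (snd i) (x j)))"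

definition self_energy :: "real \<Rightarrow> nat \<Rightarrow> real^3 \<Rightarrow> real" where
  "self_energy lam L y = 2 * b\<^sup>2 * G_reg lam L y y"

lemma round_metric_pos: "0 < round_metric z"
  unfolding round_metric_def by (simp add: add_pos_nonneg power2_eq_square[of "1 + _"])

lemma vertex_const_pos: "0 < vertex_const j"
  unfolding vertex_const_def using round_metric_pos[of "stereo (x j)"] by simp

lemma prefactor_pos: "0 < prefactor"
  unfolding prefactor_def by (intro prod_pos) (simp add: vertex_const_pos)

lemma V_tilde_real:
  "V_tilde b lam L X (of_real (alpha j)) (x j)
    = of_real (vertex_const j * exp (2 * alpha j * X_reg lam L X (x j) + 2 * (alpha j)\<^sup>2 * G_reg lam L (x j) (x j)))"
proof -
  let ?g = "round_metric (stereo (x j))"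
  have "- conf_weight b (of_real a) = of_real (- (a * (Q_const b - a)))" for a
    by (simp add: conf_weight_def)
  then have "of_real ?g powr (- conf_weight b (of_real (alpha j))) = (of_real (?g powr (- (alpha j * (Q_const b - alpha j)))) :: complex)"
    using round_metric_pos[of "stereo (x j)"] by (simp only: powr_of_real[OF less_imp_le])
  moreover have "exp (of_real chi_const * of_real (alpha j) * (of_real b - of_real (alpha j)))
     = (of_real (exp (chi_const * alpha j * (b - alpha j))) :: complex)"
    by (simp only: of_real_diff[symmetric] of_real_mult[symmetric] exp_of_real)
  moreover have "exp (2 * of_real (alpha j) * of_real (X_reg lam L X (x j)) + 2 * (of_real (alpha j))\<^sup>2 * of_real (G_reg lam L (x j) (x j)))
     = (of_real (exp (2 * alpha j * X_reg lam L X (x j) + 2 * (alpha j)\<^sup>2 * G_reg lam L (x j) (x j))) :: complex)"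
    by (simp flip: exp_of_real)
  ultimately show ?thesis unfolding V_tilde_def vertex_const_def by (simp only: of_real_mult)
qed

context
  fixes lam :: real and L :: nat
  assumes lam: "0 < lam" "lam < 1"
begin

lemma field_coeff_bounded:
  obtains B where "\<And>i y. y \<in> space area \<Longrightarrow> \<bar>field_coeff \<kappa> lam L i y\<bar> \<le> B"
    and "\<And>y. y \<in> space area \<Longrightarrow> \<bar>self_energy lam L y\<bar> \<le> B"
proof -
  have "\<exists>C. \<forall>y\<in>S2. \<bar>field_coeff \<kappa> lam L i y\<bar> \<le> C" for i
  proof -
    obtain C where C: "\<And>y. y \<in> S2 \<Longrightarrow> \<bar>Ylm (fst i) (snd i) y\<bar> \<le> C" using Ylm_bounded by blast
    have "\<bar>field_coeff \<kappa> lam L i y\<bar> \<le> \<bar>\<kappa>\<bar> + 2 * b * (\<bar>mode_coeff lam (fst i)\<bar> * \<bar>C\<bar>)" if "y \<in> S2" for y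
    proof -
      have "\<bar>2 * b * (mode_coeff lam (fst i) * Ylm (fst i) (snd i) y)\<bar> \<le> 2 * b * (\<bar>mode_coeff lam (fst i)\<bar> * \<bar>C\<bar>)"
        using b C[OF that] unfolding abs_mult by (intro mult_mono) auto
      moreover have "0 \<le> 2 * b * (\<bar>mode_coeff lam (fst i)\<bar> * \<bar>C\<bar>)" using b by simp
      ultimately show ?thesis unfolding field_coeff_def by auto
    qed
    then show ?thesis by blast
  qed
  then obtain C where C: "\<And>i y. y \<in> S2 \<Longrightarrow> \<bar>field_coeff \<kappa> lam L i y\<bar> \<le> C i" by metis
  define B where "B = (\<Sum>i\<in>modes L. \<bar>C i\<bar>) + 2 * b\<^sup>2 * (1 / (1 - lam))"
  have pos: "0 \<le> 2 * b\<^sup>2 * (1 / (1 - lam))" "0 \<le> (\<Sum>i\<in>modes L. \<bar>C i\<bar>)" using lam by (auto intro: sum_nonneg)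
  show ?thesis
  proof
    fix i and y :: "real^3" assume y: "y \<in> space area"
    show "\<bar>field_coeff \<kappa> lam L i y\<bar> \<le> B"
    proof (cases "i \<in> modes L")
      case True
      then have "\<bar>C i\<bar> \<le> (\<Sum>i\<in>modes L. \<bar>C i\<bar>)" by (intro member_le_sum finite_modes) auto
      then show ?thesis using C[of y i] y pos unfolding B_def by auto
    next
      case False
      then have "field_coeff \<kappa> lam L i y = 0" by (simp add: field_coeff_def)
      then show ?thesis using pos unfolding B_def by simp
    qed
  next
    fix y :: "real^3" assume y: "y \<in> space area"
    have "\<bar>self_energy lam L y\<bar> = 2 * b\<^sup>2 * \<bar>G_reg lam L y y\<bar>" by (simp add: self_energy_def abs_mult)
    also have "\<dots> \<le> 2 * b\<^sup>2 * (1 / (1 - lam))" using y lam by (intro mult_left_mono abs_G_reg_le) auto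
    finally show "\<bar>self_energy lam L y\<bar> \<le> B" using pos unfolding B_def by linarith
  qed
qed

lemma field_coeff_measurable: "field_coeff \<kappa> lam L i \<in> borel_measurable area"
  unfolding field_coeff_def[abs_def] by (cases "i \<in> modes L"; cases "fst i = 0") simp_all

lemma self_energy_measurable: "self_energy lam L \<in> borel_measurable area"
  unfolding self_energy_def[abs_def] using measurable_G_reg[of "\<lambda>y. y" area "\<lambda>y. y" lam L] by simp

lemma sum_field_coeff: "(\<Sum>i\<in>modes L. field_coeff \<kappa> lam L i y * X i) = \<kappa> * X (0, 0) + 2 * b * X_reg lam L X y"
proof -
  have m: "(l, m) \<in> modes L" if "l \<in> {1..L}" "m \<in> {-int l..int l}" for l m using that by (auto simp: modes_def)
  have "(0, 0) \<in> modes L" by (simp add: modes_def)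
  moreover have "(\<Sum>l=1..L. \<Sum>m=-int l..int l. field_coeff \<kappa> lam L (l, m) y * X (l, m))
     = (\<Sum>l=1..L. \<Sum>m=-int l..int l. 2 * b * (mode_coeff lam l * X (l, m) * Ylm l m y))"
    using m by (intro sum.cong refl) (simp add: field_coeff_def)
  ultimately show ?thesis
    unfolding sum_modes X_reg_eq by (simp add: field_coeff_def sum_distrib_left)
qed

lemma sum_source_coeff:
  "(\<Sum>i\<in>modes L. source_coeff \<kappa> lam L i * X i) = - \<kappa> * real n * X (0, 0) + (\<Sum>j=1..k. 2 * alpha j * X_reg lam L X (x j))"
proof -
  have "(\<Sum>l=1..L. \<Sum>m=-int l..int l. source_coeff \<kappa> lam L (l, m) * X (l, m))
     = (\<Sum>l=1..L. \<Sum>m=-int l..int l. \<Sum>j=1..k. 2 * alpha j * (mode_coeff lam l * X (l, m) * Ylm l m (x j)))"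
  proof (intro sum.cong refl)
    fix l m assume "l \<in> {1..L}"
    then have "source_coeff \<kappa> lam L (l, m) = (\<Sum>j=1..k. 2 * alpha j * (mode_coeff lam l * Ylm l m (x j)))"
      by (simp add: source_coeff_def)
    moreover have "(\<Sum>j=1..k. 2 * alpha j * (mode_coeff lam l * Ylm l m (x j))) * X (l, m)
      = (\<Sum>j=1..k. 2 * alpha j * (mode_coeff lam l * X (l, m) * Ylm l m (x j)))"
      unfolding sum_distrib_right by (intro sum.cong refl) (simp only: mult_ac)
    ultimately show "source_coeff \<kappa> lam L (l, m) * X (l, m)
      = (\<Sum>j=1..k. 2 * alpha j * (mode_coeff lam l * X (l, m) * Ylm l m (x j)))" by simp
  qed
  also have "\<dots> = (\<Sum>l=1..L. \<Sum>j=1..k. \<Sum>m=-int l..int l. 2 * alpha j * (mode_coeff lam l * X (l, m) * Ylm l m (x j)))"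
    by (intro sum.cong refl sum.swap)
  also have "\<dots> = (\<Sum>j=1..k. \<Sum>l=1..L. \<Sum>m=-int l..int l. 2 * alpha j * (mode_coeff lam l * X (l, m) * Ylm l m (x j)))"
    by (rule sum.swap)
  finally show ?thesis
    unfolding sum_modes X_reg_eq by (simp add: source_coeff_def sum_distrib_left)
qed

text \<open>With \<open>\<kappa> = 0\<close> the zero mode drops out of the moment.\<close>

definition neutral_moment :: "nat \<Rightarrow> real" where
  "neutral_moment m = gauss_moment area (modes L) (field_coeff 0 lam L) (self_energy lam L) (source_coeff 0 lam L) m"

text \<open>The zero mode contributes its total coefficient \<open>\<kappa> * (m - n)\<close>; the others give the energy
of charges \<open>2 * al j / b\<close> at \<open>x j\<close> and \<open>2 * b\<close> at the points
\<open>y r\<close>.\<close>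

lemma mode_square_sum:
  assumes y: "y \<in> space (\<Pi>\<^sub>M r\<in>{..<m}. area)"
  shows "(\<Sum>i\<in>modes L. (source_coeff \<kappa> lam L i + (\<Sum>r<m. field_coeff \<kappa> lam L i (y r)))\<^sup>2)
    = (\<kappa> * (real m - real n))\<^sup>2 + ((\<Sum>j=1..k. \<Sum>j'=1..k. 4 * (alpha j * alpha j' * G_reg lam L (x j) (x j')))
       + 8 * (\<Sum>r<m. \<Sum>j=1..k. al j * G_reg lam L (x j) (y r))
       + 4 * b\<^sup>2 * (\<Sum>r<m. \<Sum>s<m. G_reg lam L (y r) (y s)))"
proof -
  let ?A = "{1..k} <+> {..<m}"
  let ?c = "case_sum (\<lambda>j. 2 * alpha j) (\<lambda>_. 2 * b) :: nat + nat \<Rightarrow> real"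
  let ?z = "case_sum x y"
  have m00: "(0, 0) \<in> modes L" by (simp add: modes_def)
  have term0: "source_coeff \<kappa> lam L (0, 0) + (\<Sum>r<m. field_coeff \<kappa> lam L (0, 0) (y r)) = \<kappa> * (real m - real n)"
    using m00 by (simp add: source_coeff_def field_coeff_def algebra_simps)
  have rest: "(\<Sum>l=1..L. \<Sum>mm=-int l..int l. (source_coeff \<kappa> lam L (l, mm) + (\<Sum>r<m. field_coeff \<kappa> lam L (l, mm) (y r)))\<^sup>2)
     = (\<Sum>l=1..L. \<Sum>mm=-int l..int l. (\<Sum>p\<in>?A. ?c p * (mode_coeff lam l * Ylm l mm (?z p)))\<^sup>2)"
  proof (intro sum.cong refl)
    fix l mm assume "l \<in> {1..L}" "mm \<in> {-int l..int l}"
    then have "(l, mm) \<in> modes L" "l \<noteq> 0" by (auto simp: modes_def)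
    then show "(source_coeff \<kappa> lam L (l, mm) + (\<Sum>r<m. field_coeff \<kappa> lam L (l, mm) (y r)))\<^sup>2
       = (\<Sum>p\<in>?A. ?c p * (mode_coeff lam l * Ylm l mm (?z p)))\<^sup>2"
      by (simp add: source_coeff_def field_coeff_def sum.Plus)
  qed
  have "(\<Sum>l=1..L. \<Sum>mm=-int l..int l. (\<Sum>p\<in>?A. ?c p * (mode_coeff lam l * Ylm l mm (?z p)))\<^sup>2)
     = (\<Sum>j=1..k. \<Sum>j'=1..k. 2 * alpha j * (2 * alpha j') * G_reg lam L (x j) (x j'))
      + 2 * (\<Sum>r<m. \<Sum>j=1..k. 2 * alpha j * (2 * b) * G_reg lam L (x j) (y r))
      + (\<Sum>r<m. \<Sum>s<m. 2 * b * (2 * b) * G_reg lam L (y r) (y s))"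
    unfolding G_reg_quadratic[OF lam(1)] by (rule sum_Plus_square) (auto simp: G_reg_commute)
  also have "\<dots> = (\<Sum>j=1..k. \<Sum>j'=1..k. 4 * (alpha j * alpha j' * G_reg lam L (x j) (x j')))
       + 8 * (\<Sum>r<m. \<Sum>j=1..k. al j * G_reg lam L (x j) (y r))
       + 4 * b\<^sup>2 * (\<Sum>r<m. \<Sum>s<m. G_reg lam L (y r) (y s))"
  proof -
    have 1: "2 * alpha j * (2 * b) * g = 4 * (al j * g)" for j and g :: real using b by simp
    have 2: "2 * (\<Sum>r<m. \<Sum>j=1..k. 4 * (al j * G_reg lam L (x j) (y r))) = 8 * (\<Sum>r<m. \<Sum>j=1..k. al j * G_reg lam L (x j) (y r))"
      by (simp add: sum_distrib_left[symmetric])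
    have 3: "2 * b * (2 * b) * g = 4 * b\<^sup>2 * g" for g :: real by (simp add: power2_eq_square)
    have 4: "2 * alpha j * (2 * alpha j') * g = 4 * (alpha j * alpha j' * g)" for j j' and g :: real by simp
    show ?thesis unfolding 1 2 3 4 by (simp only: sum_distrib_left)
  qed
  finally show ?thesis unfolding sum_modes term0 rest by simp
qed

lemma gauss_moment_eq:
  "gauss_moment area (modes L) (field_coeff \<kappa> lam L) (self_energy lam L) (source_coeff \<kappa> lam L) m
    = exp (- (\<kappa> * (real m - real n))\<^sup>2 / 2) * neutral_moment m"
proof -
  have "gauss_moment area (modes L) (field_coeff \<kappa> lam L) (self_energy lam L) (source_coeff \<kappa> lam L) m
    = (LINT y|(\<Pi>\<^sub>M r\<in>{..<m}. area). exp (- (\<kappa> * (real m - real n))\<^sup>2 / 2) *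
        exp ((\<Sum>r<m. self_energy lam L (y r)) - (\<Sum>i\<in>modes L. (source_coeff 0 lam L i + (\<Sum>r<m. field_coeff 0 lam L i (y r)))\<^sup>2) / 2))"
    unfolding gauss_moment_def
  proof (rule Bochner_Integration.integral_cong[OF refl])
    fix y assume y: "y \<in> space (\<Pi>\<^sub>M r\<in>{..<m}. area)"
    show "exp ((\<Sum>r<m. self_energy lam L (y r)) - (\<Sum>i\<in>modes L. (source_coeff \<kappa> lam L i + (\<Sum>r<m. field_coeff \<kappa> lam L i (y r)))\<^sup>2) / 2)
      = exp (- (\<kappa> * (real m - real n))\<^sup>2 / 2) *
        exp ((\<Sum>r<m. self_energy lam L (y r)) - (\<Sum>i\<in>modes L. (source_coeff 0 lam L i + (\<Sum>r<m. field_coeff 0 lam L i (y r)))\<^sup>2) / 2)"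
      unfolding mode_square_sum[OF y] by (simp add: exp_add[symmetric] add_divide_distrib)
  qed
  then show ?thesis by (simp add: neutral_moment_def gauss_moment_def)
qed

text \<open>The normal ordering factors, \<open>self_energy\<close> and the diagonal factor on the left, cancel exactly
the self-energies in \<open>mode_square_sum\<close>.\<close>

lemma neutral_moment_eq:
  "(\<Prod>j=1..k. exp (2 * (alpha j)\<^sup>2 * G_reg lam L (x j) (x j))) * neutral_moment m
    = vertex_interaction (G_reg lam L) * coulomb_integral (G_reg lam L) m"
proof -
  let ?G = "G_reg lam L"
  have "(\<Prod>j=1..k. exp (2 * (alpha j)\<^sup>2 * ?G (x j) (x j))) * neutral_moment m
    = (LINT y|(\<Pi>\<^sub>M r\<in>{..<m}. area). exp (\<Sum>j=1..k. 2 * (alpha j)\<^sup>2 * ?G (x j) (x j)) *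
        exp ((\<Sum>r<m. self_energy lam L (y r)) - (\<Sum>i\<in>modes L. (source_coeff 0 lam L i + (\<Sum>r<m. field_coeff 0 lam L i (y r)))\<^sup>2) / 2))"
    unfolding neutral_moment_def gauss_moment_def by (simp add: exp_sum)
  also have "\<dots> = (LINT y|(\<Pi>\<^sub>M r\<in>{..<m}. area). vertex_interaction ?G * coulomb_weight ?G m y)"
  proof (rule Bochner_Integration.integral_cong[OF refl])
    fix y assume y: "y \<in> space (\<Pi>\<^sub>M r\<in>{..<m}. area)"
    let ?vv = "\<Sum>j=1..k. \<Sum>j'\<in>{1..k} - {j}. alpha j * alpha j' * ?G (x j) (x j')"
    let ?vs = "\<Sum>j=1..k. (alpha j)\<^sup>2 * ?G (x j) (x j)"
    let ?vy = "\<Sum>r<m. \<Sum>j=1..k. al j * ?G (x j) (y r)"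
    let ?ys = "\<Sum>r<m. ?G (y r) (y r)"
    have 1: "(\<Sum>j=1..k. \<Sum>j'=1..k. 4 * (alpha j * alpha j' * ?G (x j) (x j'))) = 4 * ?vv + 4 * ?vs"
      by (subst sum_off_diagonal) (simp_all add: sum_distrib_left power2_eq_square)
    have 2: "(\<Sum>r<m. \<Sum>s<m. ?G (y r) (y s)) = pair_sum ?G m y + ?ys"
      unfolding pair_sum_full by simp
    have 3: "(\<Sum>r<m. self_energy lam L (y r)) = 2 * b\<^sup>2 * ?ys"
      unfolding self_energy_def by (simp add: sum_distrib_left)
    have 4: "(\<Sum>j=1..k. 2 * (alpha j)\<^sup>2 * ?G (x j) (x j)) = 2 * ?vs"
      by (simp add: sum_distrib_left mult.assoc)
    have 5: "(\<Sum>r<m. \<Sum>j=1..k. 4 * al j * ?G (x j) (y r)) = 4 * ?vy"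
      by (simp add: sum_distrib_left mult.assoc)
    have "2 * ?vs + (2 * b\<^sup>2 * ?ys - ((0 * (real m - real n))\<^sup>2 + ((4 * ?vv + 4 * ?vs) + 8 * ?vy + 4 * b\<^sup>2 * (pair_sum ?G m y + ?ys))) / 2)
       = - 2 * ?vv + (- (4 * ?vy) - 2 * b\<^sup>2 * pair_sum ?G m y)"
      by (simp add: field_simps)
    then show "exp (\<Sum>j=1..k. 2 * (alpha j)\<^sup>2 * ?G (x j) (x j)) *
        exp ((\<Sum>r<m. self_energy lam L (y r)) - (\<Sum>i\<in>modes L. (source_coeff 0 lam L i + (\<Sum>r<m. field_coeff 0 lam L i (y r)))\<^sup>2) / 2)
      = vertex_interaction ?G * coulomb_weight ?G m y"
      unfolding mode_square_sum[OF y] vertex_interaction_def coulomb_weight_def 1 2 3 4 5 exp_add[symmetric] by (simp only:)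
  qed
  finally show ?thesis unfolding coulomb_integral_def by (simp only: integral_mult_right_zero)
qed

lemma C_reg_series:
  assumes eps: "0 < eps"
  shows "C_reg k (\<lambda>j. of_real (alpha j)) x b \<mu> eps lam L
    = of_real (prefactor * (\<Prod>j=1..k. exp (2 * (alpha j)\<^sup>2 * G_reg lam L (x j) (x j)))
       * (\<Sum>m. (- \<mu>) ^ m / fact m * (exp (- (2 * b / sqrt (8 * pi * eps) * (real m - real n))\<^sup>2 / 2) * neutral_moment m)))"
proof -
  define \<kappa> where "\<kappa> = 2 * b / sqrt (8 * pi * eps)"
  let ?K = "prefactor * (\<Prod>j=1..k. exp (2 * (alpha j)\<^sup>2 * G_reg lam L (x j) (x j)))"
  let ?c = "field_coeff \<kappa> lam L" and ?d = "self_energy lam L" and ?a = "source_coeff \<kappa> lam L"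
  have integrand: "(\<Prod>j=1..k. V_tilde b lam L X (of_real (alpha j)) (x j))
        * exp (- 2 * of_real b * w_param k (\<lambda>j. of_real (alpha j)) b * of_real (D_var eps X)
               - of_real (\<mu> * exp (2 * b * D_var eps X)
                   * (LINT y|area. exp (2 * b * X_reg lam L X y + 2 * b\<^sup>2 * G_reg lam L y y))))
     = of_real ?K * exp (of_real ((\<Sum>i\<in>modes L. ?a i * X i) - \<mu> * (LINT y|area. exp ((\<Sum>i\<in>modes L. ?c i y * X i) + ?d y))))"
    for X :: "nat \<times> int \<Rightarrow> real"
  proof -
    have D: "2 * b * D_var eps X = \<kappa> * X (0, 0)" by (simp add: D_var_def \<kappa>_def)
    have "(\<Prod>j=1..k. V_tilde b lam L X (of_real (alpha j)) (x j))
       = of_real (\<Prod>j=1..k. vertex_const j * exp (2 * alpha j * X_reg lam L X (x j) + 2 * (alpha j)\<^sup>2 * G_reg lam L (x j) (x j)))"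
      unfolding V_tilde_real by (rule of_real_prod[symmetric])
    also have "(\<Prod>j=1..k. vertex_const j * exp (2 * alpha j * X_reg lam L X (x j) + 2 * (alpha j)\<^sup>2 * G_reg lam L (x j) (x j)))
       = ?K * exp (\<Sum>j=1..k. 2 * alpha j * X_reg lam L X (x j))"
      unfolding prefactor_def exp_add by (simp add: prod.distrib exp_sum)
    finally have 1: "(\<Prod>j=1..k. V_tilde b lam L X (of_real (alpha j)) (x j))
       = of_real (?K * exp (\<Sum>j=1..k. 2 * alpha j * X_reg lam L X (x j)))" .
    have 2: "\<mu> * exp (2 * b * D_var eps X) * (LINT y|area. exp (2 * b * X_reg lam L X y + 2 * b\<^sup>2 * G_reg lam L y y))
       = \<mu> * (LINT y|area. exp ((\<Sum>i\<in>modes L. ?c i y * X i) + ?d y))"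
      unfolding sum_field_coeff self_energy_def D
      by (simp add: exp_add mult.assoc flip: integral_mult_right_zero)
    have 3: "- 2 * of_real b * w_param k (\<lambda>j. of_real (alpha j)) b * of_real (D_var eps X)
       = (of_real (- \<kappa> * real n * X (0, 0)) :: complex)"
    proof -
      have "- 2 * of_real b * of_nat n * of_real d = (of_real (- (2 * b * d) * real n) :: complex)" for d by simp
      moreover have "- (\<kappa> * X (0, 0)) * real n = - \<kappa> * real n * X (0, 0)" by simp
      ultimately show ?thesis unfolding w using D by metis
    qed
    have "of_real (?K * exp (\<Sum>j=1..k. 2 * alpha j * X_reg lam L X (x j))) * exp (of_real p - of_real q)
       = (of_real ?K * exp (of_real (p + (\<Sum>j=1..k. 2 * alpha j * X_reg lam L X (x j)) - q)) :: complex)" for p q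
      by (simp only: of_real_mult exp_of_real[symmetric] mult.assoc exp_add[symmetric] of_real_add of_real_diff)
        (simp only: algebra_simps)
    then show ?thesis unfolding 1 2 3 sum_source_coeff by blast
  qed
  obtain B where B: "\<And>i y. y \<in> space area \<Longrightarrow> \<bar>?c i y\<bar> \<le> B" "\<And>y. y \<in> space area \<Longrightarrow> \<bar>?d y\<bar> \<le> B"
    using field_coeff_bounded by metis
  have "C_reg k (\<lambda>j. of_real (alpha j)) x b \<mu> eps lam L
     = of_real ?K * of_real (\<Sum>m. (- \<mu>) ^ m / fact m * gauss_moment area (modes L) ?c ?d ?a m)"
    unfolding C_reg_def integrand
    by (rule wrong_sign_expectation_series[OF finite_measure_area finite_modes field_coeff_measurable self_energy_measurable B])
  then show ?thesis unfolding gauss_moment_eq \<kappa>_def by (simp only: of_real_mult)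
qed

text \<open>The coefficient of the zero mode diverges, so every term of the series with \<open>m \<noteq> n\<close>
vanishes; the bound \<open>abs_gauss_moment_le\<close> dominates the series.\<close>

lemma C_reg_eps_limit:
  "((\<lambda>eps. C_reg k (\<lambda>j. of_real (alpha j)) x b \<mu> eps lam L)
     \<longlongrightarrow> of_real (prefactor * ((- \<mu>) ^ n / fact n) * vertex_interaction (G_reg lam L) * coulomb_integral (G_reg lam L) n)) (at_right 0)"
proof -
  let ?K = "prefactor * (\<Prod>j=1..k. exp (2 * (alpha j)\<^sup>2 * G_reg lam L (x j) (x j)))"
  define t where "t m eps = (- \<mu>) ^ m / fact m * (exp (- (2 * b / sqrt (8 * pi * eps) * (real m - real n))\<^sup>2 / 2) * neutral_moment m)"
    for m eps
  define l where "l m = (if m = n then (- \<mu>) ^ n / fact n * neutral_moment n else 0)" for m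
  obtain B where B: "\<And>i y. y \<in> space area \<Longrightarrow> \<bar>field_coeff 0 lam L i y\<bar> \<le> B"
    "\<And>y. y \<in> space area \<Longrightarrow> \<bar>self_energy lam L y\<bar> \<le> B"
    using field_coeff_bounded by metis
  define C where "C = exp B * measure area (space area)"
  have nm: "\<bar>neutral_moment m\<bar> \<le> C ^ m" for m
    unfolding neutral_moment_def C_def
    by (rule abs_gauss_moment_le[OF finite_measure_area finite_modes field_coeff_measurable self_energy_measurable B])
  have tl: "((\<lambda>eps. t m eps) \<longlongrightarrow> l m) (at_right 0)" for m
  proof (cases "m = n")
    case True
    then show ?thesis by (simp add: t_def l_def)
  next
    case False
    define v where "v = b\<^sup>2 * (real m - real n)\<^sup>2 / (4 * pi)"
    have v: "0 < v" using False b by (simp add: v_def)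
    have ev: "\<forall>\<^sub>F eps in at_right 0. exp (- (v * inverse eps)) = exp (- (2 * b / sqrt (8 * pi * eps) * (real m - real n))\<^sup>2 / 2)"
      using eventually_at_right_less[of "0::real"]
    proof eventually_elim
      case (elim eps)
      then have "(2 * b / sqrt (8 * pi * eps) * (real m - real n))\<^sup>2 / 2 = v * inverse eps"
      proof -
        have "(2 * b / sqrt (8 * pi * eps) * \<delta>)\<^sup>2 / 2 = b\<^sup>2 * \<delta>\<^sup>2 / (4 * pi) * inverse eps" for \<delta>
          using elim by (simp add: power_mult_distrib power_divide divide_simps)
        then show ?thesis unfolding v_def .
      qed
      then show ?case by (simp add: minus_divide_left[symmetric])
    qed
    have "filterlim (\<lambda>eps. v * inverse eps) at_top (at_right 0)"
      using v filterlim_inverse_at_top_right by (intro filterlim_tendsto_pos_mult_at_top[OF tendsto_const])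
    then have "((\<lambda>eps. exp (- (v * inverse eps))) \<longlongrightarrow> 0) (at_right 0)"
      by (intro filterlim_compose[OF exp_at_bot]) (simp add: filterlim_uminus_at_top)
    from Lim_transform_eventually[OF this ev]
    have "((\<lambda>eps. exp (- (2 * b / sqrt (8 * pi * eps) * (real m - real n))\<^sup>2 / 2)) \<longlongrightarrow> 0) (at_right 0)" .
    then have "((\<lambda>eps. t m eps) \<longlongrightarrow> (- \<mu>) ^ m / fact m * (0 * neutral_moment m)) (at_right 0)"
      unfolding t_def by (intro tendsto_mult tendsto_const)
    then show ?thesis using False by (simp add: l_def)
  qed
  have bound: "\<bar>t m eps\<bar> \<le> (\<bar>\<mu>\<bar> * C) ^ m / fact m" for m eps
  proof -
    have "\<bar>exp (- (2 * b / sqrt (8 * pi * eps) * (real m - real n))\<^sup>2 / 2) * neutral_moment m\<bar> \<le> 1 * C ^ m"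
      unfolding abs_mult using nm by (intro mult_mono) auto
    then have "\<bar>(- \<mu>) ^ m / fact m\<bar> * \<bar>exp (- (2 * b / sqrt (8 * pi * eps) * (real m - real n))\<^sup>2 / 2) * neutral_moment m\<bar>
       \<le> \<bar>(- \<mu>) ^ m / fact m\<bar> * (1 * C ^ m)" by (intro mult_left_mono) auto
    then show ?thesis unfolding t_def by (simp add: abs_mult power_abs power_mult_distrib)
  qed
  have "((\<lambda>eps. \<Sum>m. t m eps) \<longlongrightarrow> (\<Sum>m. l m)) (at_right 0)"
  proof -
    have sm: "summable (\<lambda>m. (\<bar>\<mu>\<bar> * C) ^ m / fact m)"
      using summable_exp_generic[of "\<bar>\<mu>\<bar> * C"] by (simp add: field_simps)
    have "\<forall>\<^sub>F (m, eps) in at_top \<times>\<^sub>F at_right 0. norm (t m eps) \<le> (\<bar>\<mu>\<bar> * C) ^ m / fact m"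
      using bound by (intro always_eventually) auto
    from tannerys_theorem[OF tl this sm] show ?thesis by simp
  qed
  also have "(\<Sum>m. l m) = (- \<mu>) ^ n / fact n * neutral_moment n"
    unfolding l_def using suminf_finite[of "{n}" "\<lambda>m. if m = n then (- \<mu>) ^ n / fact n * neutral_moment n else 0"] by simp
  finally have "((\<lambda>eps. of_real (?K * (\<Sum>m. t m eps)) :: complex) \<longlongrightarrow> of_real (?K * ((- \<mu>) ^ n / fact n * neutral_moment n))) (at_right 0)"
    by (intro tendsto_intros)
  moreover have "\<forall>\<^sub>F eps in at_right 0. of_real (?K * (\<Sum>m. t m eps)) = C_reg k (\<lambda>j. of_real (alpha j)) x b \<mu> eps lam L"
    using eventually_at_right_less[of "0::real"] by eventually_elim (simp only: C_reg_series t_def)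
  ultimately have "((\<lambda>eps. C_reg k (\<lambda>j. of_real (alpha j)) x b \<mu> eps lam L)
     \<longlongrightarrow> of_real (?K * ((- \<mu>) ^ n / fact n * neutral_moment n))) (at_right 0)"
    by (rule Lim_transform_eventually)
  also have "?K * ((- \<mu>) ^ n / fact n * neutral_moment n)
     = prefactor * ((- \<mu>) ^ n / fact n) * ((\<Prod>j=1..k. exp (2 * (alpha j)\<^sup>2 * G_reg lam L (x j) (x j))) * neutral_moment n)"
    by simp
  also have "\<dots> = prefactor * ((- \<mu>) ^ n / fact n) * vertex_interaction (G_reg lam L) * coulomb_integral (G_reg lam L) n"
    unfolding neutral_moment_eq by simp
  finally show ?thesis .
qed

end

end

section \<open>Exponential integrability around several points\<close>

text \<open>The preimage of a null set under a projection is a null set of the product.\<close>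

lemma AE_PiM_component:
  fixes J :: "nat set"
  assumes fin: "finite J" and r: "r \<in> J" and P: "AE x in area. P x"
  shows "AE y in \<Pi>\<^sub>M r\<in>J. area. P (y r)"
proof -
  obtain N where N: "{x \<in> space area. \<not> P x} \<subseteq> N" "emeasure area N = 0" "N \<in> sets area"
    using AE_E[OF P] by blast
  let ?M = "\<Pi>\<^sub>M r\<in>J. area"
  have "(\<integral>\<^sup>+y. indicator N (y r) \<partial>?M) = (\<integral>\<^sup>+y. (\<Prod>s\<in>J. if s = r then indicator N (y s) else 1) \<partial>?M)"
    using fin r by (intro nn_integral_cong) (simp add: prod.delta)
  also have "\<dots> = (\<Prod>s\<in>J. \<integral>\<^sup>+u. (if s = r then indicator N u else 1) \<partial>area)"
    by (rule area_prod.product_nn_integral_prod[OF fin]) (use N(3) in simp)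
  also have "\<dots> = 0"
  proof (rule prod_zero[OF fin bexI[OF _ r]])
    show "(\<integral>\<^sup>+u. (if r = r then indicator N u else 1) \<partial>area) = 0" using N by simp
  qed
  finally have "(\<integral>\<^sup>+y. indicator N (y r) \<partial>?M) = 0" .
  then have "AE y in ?M. indicator N (y r) = (0::ennreal)"
    using nn_integral_0_iff_AE[OF measurable_PiM_comp[OF r borel_measurable_indicator[OF N(3)]]] by blast
  with AE_space show ?thesis
  proof eventually_elim
    case (elim y)
    then have "y r \<in> space area" "y r \<notin> N" using space_PiM_areaD[OF _ r, of y] by (auto simp: indicator_def split: if_splits)
    then show ?case using N(1) by blast
  qed
qed

lemma integrable_exp_Green:
  assumes "0 \<le> p" "p < 2" "x \<in> S2" shows "integrable area (\<lambda>y. exp (p * Green x y))"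
proof (rule integrableI_bounded)
  show "(\<lambda>y. exp (p * Green x y)) \<in> borel_measurable area"
    by measurable
  obtain C where "(\<integral>\<^sup>+y. ennreal (exp (p * Green x y)) \<partial>area) \<le> ennreal C"
    using nn_integral_exp_Green_bounded[OF assms(1,2)] assms(3) by blast
  then show "(\<integral>\<^sup>+y. ennreal (norm (exp (p * Green x y))) \<partial>area) < \<infinity>"
    by (simp add: le_less_trans)
qed

lemma separation_radius:
  fixes x :: "'i \<Rightarrow> 'a :: real_normed_vector"
  assumes "finite J" "inj_on x J"
  obtains r where "0 < r" "\<And>i j. i \<in> J \<Longrightarrow> j \<in> J \<Longrightarrow> i \<noteq> j \<Longrightarrow> 2 * r \<le> norm (x i - x j)"
proof -
  let ?D = "insert 1 ((\<lambda>(i, j). norm (x i - x j)) ` {(i, j). i \<in> J \<and> j \<in> J \<and> i \<noteq> j})"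
  have "{(i, j). i \<in> J \<and> j \<in> J \<and> i \<noteq> j} \<subseteq> J \<times> J" by auto
  then have fin: "finite ?D" using assms(1) by (meson finite_SigmaI finite_imageI finite_insert finite_subset)
  have "0 < Min ?D" using fin assms(2) by (subst Min_gr_iff) (auto dest: inj_onD)
  moreover have "Min ?D \<le> norm (x i - x j)" if "i \<in> J" "j \<in> J" "i \<noteq> j" for i j
    using fin that by (intro Min_le) auto
  ultimately show ?thesis using that[of "Min ?D / 2"] by auto
qed

text \<open>A point of the sphere is close to at most one of the points \<open>x j\<close>, and the terms of the other
points are bounded there.\<close>

lemma integrable_exp_sum_Green:
  assumes fin: "finite J" and inj: "inj_on x J" and x: "\<And>j. j \<in> J \<Longrightarrow> x j \<in> S2"
    and p: "\<And>j. j \<in> J \<Longrightarrow> 0 \<le> p j \<and> p j < 2"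
  shows "integrable area (\<lambda>y. exp (\<Sum>j\<in>J. p j * Green (x j) y))"
proof -
  obtain r where r: "0 < r" "\<And>i j. i \<in> J \<Longrightarrow> j \<in> J \<Longrightarrow> i \<noteq> j \<Longrightarrow> 2 * r \<le> norm (x i - x j)"
    using separation_radius[OF fin inj] by blast
  define B where "B = \<bar>ln 2 - ln r\<bar>"
  have far: "p j * Green (x j) y \<le> 2 * B" if j: "j \<in> J" and n: "r \<le> norm (x j - y)" for j y
  proof -
    have "ln r \<le> ln (norm (x j - y))" by (subst ln_le_cancel_iff) (use r(1) n in auto)
    then have "Green (x j) y \<le> B" unfolding Green_def B_def by linarith
    then have "p j * Green (x j) y \<le> p j * B" using p[OF j] by (intro mult_left_mono) auto
    also have "\<dots> \<le> 2 * B" using p[OF j] by (intro mult_right_mono) (auto simp: B_def)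
    finally show ?thesis .
  qed
  let ?K = "exp (real (card J) * (2 * B))"
  show ?thesis
  proof (rule Bochner_Integration.integrable_bound)
    show "integrable area (\<lambda>y. ?K * (1 + (\<Sum>j\<in>J. exp (p j * Green (x j) y))))"
      using p x integrable_exp_Green
      by (intro integrable_mult_right Bochner_Integration.integrable_add Bochner_Integration.integrable_sum) simp_all
    show "(\<lambda>y. exp (\<Sum>j\<in>J. p j * Green (x j) y)) \<in> borel_measurable area"
      by measurable
    show "AE y in area. norm (exp (\<Sum>j\<in>J. p j * Green (x j) y)) \<le> norm (?K * (1 + (\<Sum>j\<in>J. exp (p j * Green (x j) y))))"
    proof (intro AE_I2 norm_le_normI)
      fix y
      have nn: "0 \<le> (\<Sum>j\<in>J. exp (p j * Green (x j) y))" by (intro sum_nonneg) simp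
      have "exp (\<Sum>j\<in>J. p j * Green (x j) y) \<le> ?K * (1 + (\<Sum>j\<in>J. exp (p j * Green (x j) y)))"
      proof (cases "\<exists>i\<in>J. norm (x i - y) < r")
        case False
        then have "(\<Sum>j\<in>J. p j * Green (x j) y) \<le> real (card J) * (2 * B)"
          using far by (intro sum_bounded_above) auto
        then have "exp (\<Sum>j\<in>J. p j * Green (x j) y) \<le> ?K * 1" by simp
        also have "\<dots> \<le> ?K * (1 + (\<Sum>j\<in>J. exp (p j * Green (x j) y)))" using nn by (intro mult_left_mono) auto
        finally show ?thesis .
      next
        case True
        then obtain i where i: "i \<in> J" "norm (x i - y) < r" by blast
        have "p j * Green (x j) y \<le> 2 * B" if j: "j \<in> J - {i}" for j
        proof -
          have "2 * r \<le> norm (x i - x j)" using r(2) i j by auto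
          also have "\<dots> \<le> norm (x i - y) + norm (x j - y)" using norm_triangle_ineq4[of "x i - y" "x j - y"] by simp
          finally show ?thesis using i(2) j by (intro far) auto
        qed
        then have "(\<Sum>j\<in>J - {i}. p j * Green (x j) y) \<le> real (card (J - {i})) * (2 * B)"
          by (intro sum_bounded_above) auto
        also have "\<dots> \<le> real (card J) * (2 * B)"
          using fin by (intro mult_right_mono) (auto simp: B_def intro: card_mono)
        finally have "(\<Sum>j\<in>J. p j * Green (x j) y) \<le> real (card J) * (2 * B) + p i * Green (x i) y"
          using fin i(1) by (simp add: sum.remove)
        then have "exp (\<Sum>j\<in>J. p j * Green (x j) y) \<le> ?K * exp (p i * Green (x i) y)"
          by (simp flip: exp_add)
        also have "\<dots> \<le> ?K * (1 + (\<Sum>j\<in>J. exp (p j * Green (x j) y)))"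
          using member_le_sum[of i J "\<lambda>j. exp (p j * Green (x j) y)"] fin i(1) by (intro mult_left_mono) auto
        finally show ?thesis .
      qed
      then show "\<bar>exp (\<Sum>j\<in>J. p j * Green (x j) y)\<bar> \<le> ?K * (1 + (\<Sum>j\<in>J. exp (p j * Green (x j) y)))" by simp
    qed
  qed
qed

section \<open>Removing the regularisation\<close>

context correlation
begin

lemma coulomb_weight_measurable:
  assumes K: "\<And>(f :: (nat \<Rightarrow> real^3) \<Rightarrow> real^3) g M. f \<in> M \<rightarrow>\<^sub>M area \<Longrightarrow> g \<in> M \<rightarrow>\<^sub>M area \<Longrightarrow> (\<lambda>p. K (f p) (g p)) \<in> borel_measurable M"
  shows "coulomb_weight K m \<in> borel_measurable (\<Pi>\<^sub>M r\<in>{..<m}. area)"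
proof -
  have 1: "pair_sum K m \<in> borel_measurable (\<Pi>\<^sub>M r\<in>{..<m}. area)"
    by (rule measurable_pair_sum) (intro K measurable_component_singleton, auto)
  have 2: "(\<lambda>y. K (x j) (y r)) \<in> borel_measurable (\<Pi>\<^sub>M r\<in>{..<m}. area)" if "j \<in> {1..k}" "r < m" for j r
    by (rule K) (use that x in \<open>auto intro!: measurable_component_singleton\<close>)
  have 3: "(\<lambda>y. \<Sum>r<m. \<Sum>j=1..k. 4 * al j * K (x j) (y r)) \<in> borel_measurable (\<Pi>\<^sub>M r\<in>{..<m}. area)"
    by (intro borel_measurable_sum borel_measurable_times borel_measurable_const 2) auto
  show ?thesis unfolding coulomb_weight_def[abs_def] using 1 3 by measurable
qed

text \<open>Any bounds on the pair and on the single particle terms give a bound by a product, hence integrable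
majorants for the two limits below.\<close>

lemma coulomb_weight_le:
  assumes pair: "\<And>s t. s < m \<Longrightarrow> t < m \<Longrightarrow> s \<noteq> t \<Longrightarrow> - M \<le> K (y s) (y t)"
    and single: "\<And>r. r < m \<Longrightarrow> - (\<Sum>j=1..k. 4 * al j * K (x j) (y r)) \<le> U (y r)"
  shows "coulomb_weight K m y \<le> exp (2 * b\<^sup>2 * (real m * (real m - 1) * M)) * (\<Prod>r<m. exp (U (y r)))"
proof -
  define T where "T = 2 * b\<^sup>2 * (real m * (real m - 1) * M)"
  define P where "P = 2 * b\<^sup>2 * pair_sum K m y"
  have "real m * (real m - 1) * (- M) \<le> pair_sum K m y" by (rule pair_sum_ge) (rule pair)
  then have "2 * b\<^sup>2 * (real m * (real m - 1) * (- M)) \<le> P" unfolding P_def by (intro mult_left_mono) auto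
  then have "- T \<le> P" unfolding T_def by (simp only: mult_minus_right)
  moreover have "- (\<Sum>r<m. \<Sum>j=1..k. 4 * al j * K (x j) (y r)) \<le> (\<Sum>r<m. U (y r))"
    unfolding sum_negf[symmetric] using single by (intro sum_mono) (auto simp: sum_negf)
  ultimately have "coulomb_weight K m y \<le> exp (T + (\<Sum>r<m. U (y r)))"
    unfolding coulomb_weight_def P_def[symmetric] by simp
  then show ?thesis unfolding T_def by (simp add: exp_add exp_sum)
qed

lemma coulomb_weight_tendsto:
  assumes "\<And>s t. s < m \<Longrightarrow> t < m \<Longrightarrow> s \<noteq> t \<Longrightarrow> (\<lambda>i. K i (y s) (y t)) \<longlonglongrightarrow> K' (y s) (y t)"
    and "\<And>j r. j \<in> {1..k} \<Longrightarrow> r < m \<Longrightarrow> (\<lambda>i. K i (x j) (y r)) \<longlonglongrightarrow> K' (x j) (y r)"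
  shows "(\<lambda>i. coulomb_weight (K i) m y) \<longlonglongrightarrow> coulomb_weight K' m y"
  unfolding coulomb_weight_def pair_sum_def
  by (intro tendsto_exp tendsto_diff tendsto_minus tendsto_mult tendsto_const tendsto_sum assms) auto

lemma vertex_interaction_tendsto:
  assumes "\<And>j j'. j \<in> {1..k} \<Longrightarrow> j' \<in> {1..k} \<Longrightarrow> j \<noteq> j' \<Longrightarrow> ((\<lambda>i. K i (x j) (x j')) \<longlongrightarrow> K' (x j) (x j')) F"
  shows "((\<lambda>i. vertex_interaction (K i)) \<longlongrightarrow> vertex_interaction K') F"
  unfolding vertex_interaction_def
  by (intro tendsto_exp tendsto_mult tendsto_const tendsto_sum assms) auto

lemma coulomb_integral_G_reg_tendsto:
  assumes lam: "0 < lam" "lam < 1"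
  shows "(\<lambda>L. coulomb_integral (G_reg lam L) m) \<longlonglongrightarrow> coulomb_integral (G_abel lam) m"
  unfolding coulomb_integral_def
proof (rule integral_dominated_convergence)
  let ?P = "\<Pi>\<^sub>M r\<in>{..<m}. area"
  let ?M = "1 / (1 - lam)"
  let ?U = "\<Sum>j=1..k. 4 * \<bar>al j\<bar> * ?M"
  have lam0: "0 \<le> lam" using lam by simp
  show "coulomb_weight (G_abel lam) m \<in> borel_measurable ?P"
    by (rule coulomb_weight_measurable, rule measurable_G_abel) (use lam in auto)
  show "coulomb_weight (G_reg lam L) m \<in> borel_measurable ?P" for L
    by (rule coulomb_weight_measurable, rule measurable_G_reg)
  interpret finite_measure ?P by (rule finite_measure_area_PiM) simp
  show "integrable ?P (\<lambda>y. exp (2 * b\<^sup>2 * (real m * (real m - 1) * ?M)) * (\<Prod>r<m. exp ?U))" by simp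
  show "AE y in ?P. (\<lambda>L. coulomb_weight (G_reg lam L) m y) \<longlonglongrightarrow> coulomb_weight (G_abel lam) m y"
    by (intro AE_I2 coulomb_weight_tendsto G_reg_tendsto lam lam0 x space_PiM_areaD[of _ "{..<m}"]) auto
  show "AE y in ?P. norm (coulomb_weight (G_reg lam L) m y) \<le> exp (2 * b\<^sup>2 * (real m * (real m - 1) * ?M)) * (\<Prod>r<m. exp ?U)" for L
  proof (rule AE_I2)
    fix y assume y: "y \<in> space ?P"
    have "coulomb_weight (G_reg lam L) m y \<le> exp (2 * b\<^sup>2 * (real m * (real m - 1) * ?M)) * (\<Prod>r<m. exp ((\<lambda>_. ?U) (y r)))"
    proof (rule coulomb_weight_le)
      fix s t assume "s < m" "t < m"
      then have "y s \<in> S2" "y t \<in> S2" using space_PiM_areaD[OF y] by auto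
      from abs_G_reg_le[OF this lam0 lam(2), of L] show "- ?M \<le> G_reg lam L (y s) (y t)" by linarith
    next
      fix r assume r: "r < m"
      have "- (4 * al j * G_reg lam L (x j) (y r)) \<le> 4 * \<bar>al j\<bar> * ?M" if j: "j \<in> {1..k}" for j
      proof -
        have "- (4 * al j * G_reg lam L (x j) (y r)) \<le> \<bar>4 * al j * G_reg lam L (x j) (y r)\<bar>" by linarith
        also have "\<dots> = 4 * \<bar>al j\<bar> * \<bar>G_reg lam L (x j) (y r)\<bar>" by (simp add: abs_mult)
        also have "\<dots> \<le> 4 * \<bar>al j\<bar> * ?M"
          using space_PiM_areaD[OF y] r x[OF j] lam by (intro mult_left_mono abs_G_reg_le) auto
        finally show ?thesis .
      qed
      then show "- (\<Sum>j=1..k. 4 * al j * G_reg lam L (x j) (y r)) \<le> ?U"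
        unfolding sum_negf[symmetric] by (rule sum_mono)
    qed
    then show "norm (coulomb_weight (G_reg lam L) m y) \<le> exp (2 * b\<^sup>2 * (real m * (real m - 1) * ?M)) * (\<Prod>r<m. exp ?U)"
      by (simp add: coulomb_weight_def)
  qed
qed

text \<open>A negative \<open>al j\<close> attracts the particles to \<open>x j\<close>. There the Abel kernel is bounded by
the logarithmic one, and \<open>al j > -1/2\<close> is precisely what makes the resulting majorant
integrable.\<close>

lemma coulomb_integral_G_abel_tendsto:
  assumes inj: "inj_on x {1..k}" and al: "\<And>j. j \<in> {1..k} \<Longrightarrow> - 1 / 2 < al j"
  shows "((\<lambda>lam. coulomb_integral (G_abel lam) m) \<longlongrightarrow> coulomb_integral Green m) (at_left 1)"
proof (rule tendsto_at_left_sequentially[of "1/2"])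
  fix u :: "nat \<Rightarrow> real" assume u: "\<And>i. u i < 1" "\<And>i. 1 / 2 < u i" and lim: "u \<longlonglongrightarrow> 1"
  have u1: "1 / 2 \<le> u i" for i using u(2)[of i] by simp
  have u0: "0 \<le> u i" for i using u1[of i] by linarith
  have ulim: "filterlim u (at_left 1) sequentially"
    by (rule tendsto_imp_filterlim_at_left[OF lim]) (use u in auto)
  let ?P = "\<Pi>\<^sub>M r\<in>{..<m}. area"
  (* positive al j use that the Abel kernel is at least -4, negative ones that it is at most Green + 4 *)
  define U where "U y = (\<Sum>j=1..k. 16 * \<bar>al j\<bar>) + (\<Sum>j=1..k. 4 * max 0 (- al j) * Green (x j) y)" for y
  let ?w = "\<lambda>y. exp (2 * b\<^sup>2 * (real m * (real m - 1) * 4)) * (\<Prod>r<m. exp (U (y r)))"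
  have ae: "AE y in ?P. \<forall>r<m. \<forall>j\<in>{1..k}. x j \<noteq> y r"
  proof -
    have "AE y in area. x j \<noteq> y" if "j \<in> {1..k}" for j
      using AE_area_neq[OF x[OF that]] by eventually_elim auto
    then have "AE y in area. \<forall>j\<in>{1..k}. x j \<noteq> y" by (intro AE_finite_allI) auto
    then have "AE y in ?P. \<forall>r\<in>{..<m}. \<forall>j\<in>{1..k}. x j \<noteq> y r"
      by (intro AE_finite_allI AE_PiM_component) auto
    then show ?thesis by eventually_elim auto
  qed
  have ae2: "AE y in ?P. \<forall>s\<in>{..<m}. \<forall>t\<in>{..<m}. s \<noteq> t \<longrightarrow> y s \<noteq> y t" by (rule AE_PiM_area_distinct) simp
  show "(\<lambda>i. coulomb_integral (G_abel (u i)) m) \<longlonglongrightarrow> coulomb_integral Green m"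
    unfolding coulomb_integral_def
  proof (rule integral_dominated_convergence[where w="?w"])
    show "coulomb_weight Green m \<in> borel_measurable ?P"
      by (rule coulomb_weight_measurable, rule measurable_Green_area)
    show "coulomb_weight (G_abel (u i)) m \<in> borel_measurable ?P" for i
      by (rule coulomb_weight_measurable, rule measurable_G_abel) (use u u0 in auto)
    have "integrable area (\<lambda>y. exp (U y))"
      unfolding U_def exp_add using al x
      by (intro integrable_mult_right integrable_exp_sum_Green inj) (fastforce simp: max_def)+
    then show "integrable ?P ?w"
      by (intro integrable_mult_right area_prod.product_integrable_prod) simp_all
    show "AE y in ?P. (\<lambda>i. coulomb_weight (G_abel (u i)) m y) \<longlonglongrightarrow> coulomb_weight Green m y"
      using ae ae2 AE_space
    proof eventually_elim
      case (elim y)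
      have yS: "y r \<in> S2" if "r < m" for r using space_PiM_areaD[OF elim(3)] that by simp
      show ?case
      proof (rule coulomb_weight_tendsto)
        fix s t assume st: "s < m" "t < m" "s \<noteq> t"
        then have "y s \<noteq> y t" using elim by simp
        from filterlim_compose[OF G_abel_tendsto[OF yS yS this] ulim]
        show "(\<lambda>i. G_abel (u i) (y s) (y t)) \<longlonglongrightarrow> Green (y s) (y t)" using st by simp
      next
        fix j r assume jr: "j \<in> {1..k}" "r < m"
        then have "x j \<noteq> y r" using elim by simp
        from filterlim_compose[OF G_abel_tendsto[OF x yS this] ulim]
        show "(\<lambda>i. G_abel (u i) (x j) (y r)) \<longlonglongrightarrow> Green (x j) (y r)" using jr by simp
      qed
    qed
    show "AE y in ?P. norm (coulomb_weight (G_abel (u i)) m y) \<le> ?w y" for i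
      using ae AE_space
    proof eventually_elim
      case (elim y)
      have yS: "y r \<in> S2" if "r < m" for r using space_PiM_areaD[OF elim(2)] that by simp
      have "coulomb_weight (G_abel (u i)) m y \<le> ?w y"
      proof (rule coulomb_weight_le)
        show "- 4 \<le> G_abel (u i) (y s) (y t)" if "s < m" "t < m" for s t
          by (rule G_abel_ge[OF yS[OF that(1)] yS[OF that(2)] u1 u(1)])
      next
        fix r assume r: "r < m"
        have "- (4 * al j * G_abel (u i) (x j) (y r)) \<le> 16 * \<bar>al j\<bar> + 4 * max 0 (- al j) * Green (x j) (y r)" if j: "j \<in> {1..k}" for j
        proof (cases "0 \<le> al j")
          case True
          have "4 * al j * (- 4) \<le> 4 * al j * G_abel (u i) (x j) (y r)"
            using True by (intro mult_left_mono G_abel_ge x j yS r u u1) simp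
          then show ?thesis using True by simp
        next
          case False
          have "x j \<noteq> y r" using elim r j by simp
          have "3 * (1 - u i) \<le> 4" using u0[of i] by simp
          with G_abel_le_Green[OF x[OF j] yS[OF r] \<open>x j \<noteq> y r\<close> u1[of i] u(1)[of i]]
          have "G_abel (u i) (x j) (y r) \<le> Green (x j) (y r) + 4"
            by (meson add_left_mono order_trans)
          then have "4 * (- al j) * G_abel (u i) (x j) (y r) \<le> 4 * (- al j) * (Green (x j) (y r) + 4)"
            using False by (intro mult_left_mono) auto
          then show ?thesis using False by (simp add: algebra_simps)
        qed
        then have "(\<Sum>j=1..k. - (4 * al j * G_abel (u i) (x j) (y r))) \<le> U (y r)"
          unfolding U_def sum.distrib[symmetric] by (rule sum_mono)
        then show "- (\<Sum>j=1..k. 4 * al j * G_abel (u i) (x j) (y r)) \<le> U (y r)"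
          by (simp add: sum_negf)
      qed
      then show ?case by (simp add: coulomb_weight_def)
    qed
  qed
qed simp

text \<open>The value of \<open>C_tilde\<close> up to the sign \<open>(-1)^n\<close>, see \<open>C_tilde_eq\<close>.\<close>

definition residual :: real where
  "residual = prefactor * \<mu> ^ n / fact n * vertex_interaction Green * coulomb_integral Green n"

lemma C_tilde_eq:
  assumes inj: "inj_on x {1..k}" and al: "\<And>j. j \<in> {1..k} \<Longrightarrow> - 1 / 2 < al j"
  shows "C_tilde k (\<lambda>j. of_real (alpha j)) x b \<mu> = of_real ((- 1) ^ n * residual)"
proof -
  define c where "c = prefactor * ((- \<mu>) ^ n / fact n)"
  define v where "v K = c * vertex_interaction K * coulomb_integral K n" for K
  have inner: "lim (\<lambda>L. Lim (at_right 0) (\<lambda>eps. C_reg k (\<lambda>j. of_real (alpha j)) x b \<mu> eps lam L)) = of_real (v (G_abel lam))"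
    if lam: "0 < lam" "lam < 1" for lam
  proof -
    have "Lim (at_right 0) (\<lambda>eps. C_reg k (\<lambda>j. of_real (alpha j)) x b \<mu> eps lam L) = of_real (v (G_reg lam L))" for L
      unfolding v_def c_def by (rule tendsto_Lim[OF _ C_reg_eps_limit[OF lam]]) simp
    moreover have "(\<lambda>L. complex_of_real (v (G_reg lam L))) \<longlonglongrightarrow> of_real (v (G_abel lam))"
      unfolding v_def using lam
      by (intro tendsto_of_real tendsto_mult tendsto_const vertex_interaction_tendsto coulomb_integral_G_reg_tendsto G_reg_tendsto x) auto
    ultimately show ?thesis by (simp add: limI)
  qed
  have "((\<lambda>lam. complex_of_real (v (G_abel lam))) \<longlongrightarrow> of_real (v Green)) (at_left 1)"
    unfolding v_def
    by (intro tendsto_of_real tendsto_mult tendsto_const vertex_interaction_tendsto coulomb_integral_G_abel_tendsto inj al G_abel_tendsto x)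
      (auto dest: inj_onD[OF inj])
  moreover have "\<forall>\<^sub>F lam in at_left 1. complex_of_real (v (G_abel lam)) = lim (\<lambda>L. Lim (at_right 0) (\<lambda>eps. C_reg k (\<lambda>j. of_real (alpha j)) x b \<mu> eps lam L))"
    using eventually_at_left_real[of 0 "1::real", OF zero_less_one] by eventually_elim (use inner in auto)
  ultimately have "((\<lambda>lam. lim (\<lambda>L. Lim (at_right 0) (\<lambda>eps. C_reg k (\<lambda>j. of_real (alpha j)) x b \<mu> eps lam L))) \<longlongrightarrow> of_real (v Green)) (at_left 1)"
    by (rule Lim_transform_eventually)
  then have "C_tilde k (\<lambda>j. of_real (alpha j)) x b \<mu> = of_real (v Green)"
    unfolding C_tilde_def by (intro tendsto_Lim) simp
  also have "v Green = (- 1) ^ n * residual"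
    unfolding v_def c_def residual_def power_minus[of \<mu>] by simp
  finally show ?thesis .
qed

lemma log_C_tilde_eq:
  assumes inj: "inj_on x {1..k}" and al: "\<And>j. j \<in> {1..k} \<Longrightarrow> - 1 / 2 < al j" and pos: "0 < residual"
  shows "log_C_tilde k (\<lambda>j. of_real (alpha j)) x b \<mu> = - \<i> * of_real pi * of_nat n + of_real (ln residual)"
proof -
  have "exp (\<i> * of_real pi * of_nat n) = (- 1 :: complex) ^ n"
    by (metis exp_of_nat2_mult exp_pi_i mult.commute)
  moreover have "(- 1 :: complex) ^ n * of_real ((- 1) ^ n * residual) = of_real residual"
    by (simp flip: mult.assoc power_mult_distrib)
  ultimately show ?thesis
    unfolding log_C_tilde_def log_branch_def w by (simp only: C_tilde_eq[OF inj al] Ln_of_real[OF pos])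
qed

end

section \<open>Stirling's formula and symmetric sums\<close>

text \<open>Crude forms of Stirling's formula, by induction from \<open>ln x \<le> x - 1\<close>.\<close>

lemma ln_fact_bounds:
  "real n * ln (real n) - real n \<le> ln (fact n)" "1 \<le> n \<Longrightarrow> ln (fact n) \<le> (real n + 1) * ln (real n) + 1 - real n"
proof -
  show "real n * ln (real n) - real n \<le> ln (fact n)"
  proof (induction n)
    case (Suc n)
    show ?case
    proof (cases "n = 0")
      case False
      have "ln (real (Suc n) / real n) \<le> real (Suc n) / real n - 1" using False by (intro ln_le_minus_one) simp
      then have "real n * (ln (real (Suc n)) - ln (real n)) \<le> real n * (real (Suc n) / real n - 1)"
        using False by (intro mult_left_mono) (auto simp: ln_div)
      also have "\<dots> = 1" using False by (simp add: field_simps)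
      finally have "real (Suc n) * ln (real (Suc n)) - real (Suc n) \<le> ln (real (Suc n)) + (real n * ln (real n) - real n)"
        by (simp add: algebra_simps)
      also have "\<dots> \<le> ln (real (Suc n)) + ln (fact n)" using Suc by simp
      also have "\<dots> = ln (fact (Suc n))" by (simp add: ln_mult)
      finally show ?thesis .
    qed simp
  qed simp
  show "1 \<le> n \<Longrightarrow> ln (fact n) \<le> (real n + 1) * ln (real n) + 1 - real n"
  proof (induction n rule: dec_induct)
    case (step n)
    have n: "0 < real n" using step by simp
    have "ln (real n / real (Suc n)) \<le> real n / real (Suc n) - 1" using n by (intro ln_le_minus_one) simp
    then have "real (Suc n) * (ln (real n) - ln (real (Suc n))) \<le> real (Suc n) * (real n / real (Suc n) - 1)"
      using n by (intro mult_left_mono) (auto simp: ln_div)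
    also have "\<dots> = - 1" by (simp add: field_simps)
    finally have "(real n + 1) * ln (real n) + 1 \<le> real (Suc n) * ln (real (Suc n))"
      by (simp add: algebra_simps)
    then have "ln (real (Suc n)) + ln (fact n) \<le> (real (Suc n) + 1) * ln (real (Suc n)) + 1 - real (Suc n)"
      using step.IH by (simp add: algebra_simps)
    then show ?case using step by (simp add: ln_mult)
  qed simp
qed

lemma ln_fact_over_n: "(\<lambda>n. ln (fact n) / real n - ln (real n)) \<longlonglongrightarrow> - 1"
proof (rule tendsto_sandwich)
  show "\<forall>\<^sub>F n in sequentially. - 1 \<le> ln (fact n) / real n - ln (real n)"
    using eventually_gt_at_top[of "0::nat"]
  proof eventually_elim
    case (elim n) then show ?case using ln_fact_bounds(1)[of n] by (simp add: field_simps)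
  qed
  show "\<forall>\<^sub>F n in sequentially. ln (fact n) / real n - ln (real n) \<le> ln (real n) / real n + 1 / real n - 1"
    using eventually_gt_at_top[of "0::nat"]
  proof eventually_elim
    case (elim n)
    then have "ln (fact n) / real n \<le> ((real n + 1) * ln (real n) + 1 - real n) / real n"
      using ln_fact_bounds(2)[of n] by (intro divide_right_mono) auto
    also have "\<dots> = ln (real n) + ln (real n) / real n + 1 / real n - 1"
      using elim by (simp add: field_simps)
    finally show ?case by simp
  qed
  have "(\<lambda>n. ln (real n) / real n + 1 / real n - 1) \<longlonglongrightarrow> 0 + 0 - 1"
    by (intro tendsto_add tendsto_diff tendsto_const lim_const_over_n lim_ln_over_n)
  then show "(\<lambda>n. ln (real n) / real n + 1 / real n - 1) \<longlonglongrightarrow> - 1" by simp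
qed simp

lemma sum_symmetric_pairs:
  fixes f :: "nat \<Rightarrow> nat \<Rightarrow> real"
  assumes sym: "\<And>i j. f i j = f j i"
  shows "(\<Sum>j=1..k. \<Sum>j'\<in>{1..k} - {j}. f j j') = 2 * (\<Sum>(j, j')\<in>{(j, j'). 1 \<le> j \<and> j < j' \<and> j' \<le> k}. f j j')"
proof -
  let ?A = "{(j, j'). 1 \<le> j \<and> j < j' \<and> j' \<le> k}" and ?B = "{(j, j'). 1 \<le> j' \<and> j' < j \<and> j \<le> k}"
  have fin: "finite ?A" "finite ?B"
    by (rule finite_subset[of _ "{1..k} \<times> {1..k}"]; auto)+
  have "(\<Sum>j=1..k. \<Sum>j'\<in>{1..k} - {j}. f j j') = (\<Sum>(j, j')\<in>(SIGMA j:{1..k}. {1..k} - {j}). f j j')"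
    by (rule sum.Sigma) auto
  also have "(SIGMA j:{1..k}. {1..k} - {j}) = ?A \<union> ?B" by auto
  also have "(\<Sum>(j, j')\<in>?A \<union> ?B. f j j') = (\<Sum>(j, j')\<in>?A. f j j') + (\<Sum>(j, j')\<in>?B. f j j')"
    using fin by (intro sum.union_disjoint) auto
  also have "(\<Sum>(j, j')\<in>?B. f j j') = (\<Sum>(j, j')\<in>?A. f j j')"
    by (rule sum.reindex_bij_witness[of _ prod.swap prod.swap]) (auto simp: sym)
  finally show ?thesis by simp
qed

section \<open>The semiclassical limit\<close>

definition source_potential :: "nat \<Rightarrow> (nat \<Rightarrow> real) \<Rightarrow> (nat \<Rightarrow> real^3) \<Rightarrow> real^3 \<Rightarrow> real" where
  "source_potential k al x y = (\<Sum>j=1..k. 4 * al j * Green (x j) y)"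

text \<open>The logarithmic singularities of the source potential have exponential moments of order \<open>q\<close> as
long as \<open>4 * q * (- al j) < 2\<close>, and \<open>al j > -1/2\<close> leaves room for some
\<open>q > 1\<close>.\<close>

lemma mean_field_source_potential:
  assumes x: "\<And>j. j \<in> {1..k} \<Longrightarrow> x j \<in> S2" and inj: "inj_on x {1..k}"
    and al: "\<And>j. j \<in> {1..k} \<Longrightarrow> - 1 / 2 < al j" and \<beta>: "0 < \<beta>"
  obtains c q where "mean_field (source_potential k al x) \<beta> c q"
proof -
  (* 1/4 keeps A positive, so that the midpoint q of 1 and 1 / (2 * A) is defined *)
  define A where "A = Max (insert (1 / 4) ((\<lambda>j. - al j) ` {1..k}))"
  have A: "1 / 4 \<le> A" "A < 1 / 2" "\<And>j. j \<in> {1..k} \<Longrightarrow> - al j \<le> A"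
  proof -
    show "1 / 4 \<le> A" unfolding A_def by (rule Max_ge) auto
    show "- al j \<le> A" if "j \<in> {1..k}" for j unfolding A_def using that by (intro Max_ge) auto
    have "- al j < 1 / 2" if "j \<in> {1..k}" for j using al[OF that] by simp
    then show "A < 1 / 2" unfolding A_def by (subst Max_less_iff) auto
  qed
  define q where "q = (1 + 1 / (2 * A)) / 2"
  have q: "1 < q" "q * A < 1 / 2" using A(1,2) by (auto simp: q_def field_simps)
  define s where "s = (\<Sum>j=1..k. \<bar>al j\<bar>)"
  have s: "0 \<le> s" "\<And>j. j \<in> {1..k} \<Longrightarrow> \<bar>al j\<bar> \<le> s"
    unfolding s_def by (auto intro!: sum_nonneg member_le_sum)
  (* 4 * c * \<bar>al j\<bar> is then below 1 *)
  define c where "c = 1 / (4 * (1 + s))"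
  have c: "0 < c" using s(1) by (simp add: c_def)
  have V_meas: "source_potential k al x \<in> borel_measurable area"
    unfolding source_potential_def[abs_def] by measurable
  have abs: "integrable area (\<lambda>y. exp (c * \<bar>source_potential k al x y\<bar>))"
  proof (rule Bochner_Integration.integrable_bound)
    have "4 * c * \<bar>al j\<bar> < 2" if "j \<in> {1..k}" for j
      using s(2)[OF that] s(1) by (simp add: c_def divide_less_eq)
    then show "integrable area (\<lambda>y. exp (\<Sum>j=1..k. 4 * c * \<bar>al j\<bar>) * exp (\<Sum>j=1..k. 4 * c * \<bar>al j\<bar> * Green (x j) y))"
      using c by (intro integrable_mult_right integrable_exp_sum_Green inj x) auto
    show "(\<lambda>y. exp (c * \<bar>source_potential k al x y\<bar>)) \<in> borel_measurable area" using V_meas by measurable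
    show "AE y in area. norm (exp (c * \<bar>source_potential k al x y\<bar>))
      \<le> norm (exp (\<Sum>j=1..k. 4 * c * \<bar>al j\<bar>) * exp (\<Sum>j=1..k. 4 * c * \<bar>al j\<bar> * Green (x j) y))"
    proof (rule AE_I2)
      fix y assume "y \<in> space area"
      then have y: "y \<in> S2" by simp
      have "\<bar>source_potential k al x y\<bar> \<le> (\<Sum>j=1..k. \<bar>4 * al j * Green (x j) y\<bar>)"
        unfolding source_potential_def by (rule sum_abs)
      also have "\<dots> \<le> (\<Sum>j=1..k. 4 * \<bar>al j\<bar> * (Green (x j) y + 1))"
      proof (rule sum_mono)
        fix j assume "j \<in> {1..k}"
        then have "\<bar>Green (x j) y\<bar> \<le> Green (x j) y + 1" using x y by (intro abs_Green_le)
        then show "\<bar>4 * al j * Green (x j) y\<bar> \<le> 4 * \<bar>al j\<bar> * (Green (x j) y + 1)"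
          unfolding abs_mult by (intro mult_mono) auto
      qed
      finally have "c * \<bar>source_potential k al x y\<bar> \<le> c * (\<Sum>j=1..k. 4 * \<bar>al j\<bar> * (Green (x j) y + 1))"
        using c by (intro mult_left_mono) auto
      also have "\<dots> = (\<Sum>j=1..k. 4 * c * \<bar>al j\<bar>) + (\<Sum>j=1..k. 4 * c * \<bar>al j\<bar> * Green (x j) y)"
        unfolding sum_distrib_left sum.distrib[symmetric] by (intro sum.cong refl) (simp add: algebra_simps)
      finally show "norm (exp (c * \<bar>source_potential k al x y\<bar>))
         \<le> norm (exp (\<Sum>j=1..k. 4 * c * \<bar>al j\<bar>) * exp (\<Sum>j=1..k. 4 * c * \<bar>al j\<bar> * Green (x j) y))"
        by (simp flip: exp_add)
    qed
  qed
  have neg: "integrable area (\<lambda>y. exp (- q * source_potential k al x y))"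
  proof (rule Bochner_Integration.integrable_bound)
    have "q * (4 * max 0 (- al j)) < 2" if j: "j \<in> {1..k}" for j
    proof -
      have "q * (4 * max 0 (- al j)) \<le> q * (4 * A)" using A(1) A(3)[OF j] q by (intro mult_left_mono) auto
      also have "\<dots> = 4 * (q * A)" by simp
      also have "\<dots> < 2" using q(2) by linarith
      finally show ?thesis .
    qed
    then show "integrable area (\<lambda>y. exp (\<Sum>j=1..k. 2 * q * \<bar>al j\<bar>) * exp (\<Sum>j=1..k. q * (4 * max 0 (- al j)) * Green (x j) y))"
      using q by (intro integrable_mult_right integrable_exp_sum_Green inj x) auto
    show "(\<lambda>y. exp (- q * source_potential k al x y)) \<in> borel_measurable area" using V_meas by measurable
    show "AE y in area. norm (exp (- q * source_potential k al x y))
      \<le> norm (exp (\<Sum>j=1..k. 2 * q * \<bar>al j\<bar>) * exp (\<Sum>j=1..k. q * (4 * max 0 (- al j)) * Green (x j) y))"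
    proof (rule AE_I2)
      fix y assume "y \<in> space area"
      then have y: "y \<in> S2" by simp
      have "- q * source_potential k al x y = (\<Sum>j=1..k. - q * (4 * al j * Green (x j) y))"
        unfolding source_potential_def sum_distrib_left ..
      also have "\<dots> \<le> (\<Sum>j=1..k. 2 * q * \<bar>al j\<bar> + q * (4 * max 0 (- al j)) * Green (x j) y)"
      proof (rule sum_mono)
        fix j assume j: "j \<in> {1..k}"
        show "- q * (4 * al j * Green (x j) y) \<le> 2 * q * \<bar>al j\<bar> + q * (4 * max 0 (- al j)) * Green (x j) y"
        proof (cases "0 \<le> al j")
          case True
          have "(4 * q * al j) * (- 1 / 2) \<le> (4 * q * al j) * Green (x j) y"
            using True q by (intro mult_left_mono Green_ge x j y) auto
          then show ?thesis using True by simp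
        next
          case False
          then have "- q * (4 * al j * Green (x j) y) = q * (4 * max 0 (- al j)) * Green (x j) y" by simp
          moreover have "0 \<le> 2 * q * \<bar>al j\<bar>" using q by simp
          ultimately show ?thesis by linarith
        qed
      qed
      finally show "norm (exp (- q * source_potential k al x y))
        \<le> norm (exp (\<Sum>j=1..k. 2 * q * \<bar>al j\<bar>) * exp (\<Sum>j=1..k. q * (4 * max 0 (- al j)) * Green (x j) y))"
        by (simp add: sum.distrib flip: exp_add)
    qed
  qed
  show ?thesis by (rule that[of c q], unfold_locales) (fact V_meas \<beta> c abs q(1) neg)+
qed

lemma S_fun_eq_mean_field:
  assumes mf: "mean_field (source_potential k al x) \<beta> c q" and x: "\<And>j. j \<in> {1..k} \<Longrightarrow> x j \<in> S2"
    and \<rho>: "\<rho> \<in> finite_entropy_densities"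
  shows "S_fun k al x \<beta> \<rho> = mean_field.S (source_potential k al x) \<beta> \<rho>"
proof -
  have "(LINT y|area. source_potential k al x y * \<rho> y) = (LINT y|area. (\<Sum>j=1..k. 4 * al j * (Green (x j) y * \<rho> y)))"
    unfolding source_potential_def by (simp add: sum_distrib_right mult.assoc)
  also have "\<dots> = (\<Sum>j=1..k. LINT y|area. 4 * al j * (Green (x j) y * \<rho> y))"
    using integrable_Green_density[OF \<rho> x] by (intro Bochner_Integration.integral_sum integrable_mult_right)
  finally have "(LINT y|area. source_potential k al x y * \<rho> y) = L_fun k al x \<rho>"
    unfolding L_fun_def by simp
  then show ?thesis
    unfolding S_fun_def mean_field.S_def[OF mf] R_fun_eq_energy[OF \<rho>] finite_entropyD(6)[OF \<rho>] by simp
qed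

lemma (in correlation) coulomb_integral_eq_Z:
  assumes mf: "mean_field (source_potential k al x) \<beta> c q" and b2: "b\<^sup>2 = \<beta> / (real n - 1)"
  shows "coulomb_integral Green n = mean_field.Z (source_potential k al x) \<beta> n"
  unfolding coulomb_integral_def coulomb_weight_def mean_field.Z_def[OF mf] mean_field.weight_def[OF mf] b2
  by (simp add: source_potential_def)

lemma (in correlation) ln_residual:
  assumes mu: "0 < \<mu>" and pos: "0 < coulomb_integral Green n"
  shows "ln residual = (\<Sum>j=1..k. chi_const * (al j - (al j)\<^sup>2 / b\<^sup>2)
       + (- al j + al j / b\<^sup>2 + (al j)\<^sup>2 / b\<^sup>2) * ln (round_metric (stereo (x j))))
     + real n * ln \<mu> - ln (fact n)
     - 4 * (\<Sum>(j, j') \<in> {(j, j'). 1 \<le> j \<and> j < j' \<and> j' \<le> k}. al j * al j' * Green (x j) (x j')) / b\<^sup>2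
     + ln (coulomb_integral Green n)"
proof -
  have p: "ln (vertex_const j) = chi_const * (al j - (al j)\<^sup>2 / b\<^sup>2)
       + (- al j + al j / b\<^sup>2 + (al j)\<^sup>2 / b\<^sup>2) * ln (round_metric (stereo (x j)))" for j
  proof -
    have "chi_const * alpha j * (b - alpha j) = chi_const * (al j - (al j)\<^sup>2 / b\<^sup>2)"
      using b by (simp add: power2_eq_square field_simps)
    moreover have "- (alpha j * (Q_const b - alpha j)) = - al j + al j / b\<^sup>2 + (al j)\<^sup>2 / b\<^sup>2"
      using b by (simp add: Q_const_def power2_eq_square field_simps)
    ultimately show ?thesis
      unfolding vertex_const_def using round_metric_pos[of "stereo (x j)"] by (simp add: ln_mult ln_powr)
  qed
  have "(\<Sum>j=1..k. \<Sum>j'\<in>{1..k} - {j}. alpha j * alpha j' * Green (x j) (x j'))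
     = (\<Sum>j=1..k. \<Sum>j'\<in>{1..k} - {j}. al j * al j' * Green (x j) (x j')) / b\<^sup>2"
    using b by (simp add: sum_divide_distrib power2_eq_square)
  also have "(\<Sum>j=1..k. \<Sum>j'\<in>{1..k} - {j}. al j * al j' * Green (x j) (x j'))
     = 2 * (\<Sum>(j, j') \<in> {(j, j'). 1 \<le> j \<and> j < j' \<and> j' \<le> k}. al j * al j' * Green (x j) (x j'))"
    by (rule sum_symmetric_pairs) (simp add: Green_commute mult.commute)
  finally have v: "ln (vertex_interaction Green) = - 4 * (\<Sum>(j, j') \<in> {(j, j'). 1 \<le> j \<and> j < j' \<and> j' \<le> k}. al j * al j' * Green (x j) (x j')) / b\<^sup>2"
    unfolding vertex_interaction_def by simp
  have "ln prefactor = (\<Sum>j=1..k. ln (vertex_const j))"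
    unfolding prefactor_def using vertex_const_pos by (intro ln_prod) (auto simp: less_imp_neq[symmetric])
  moreover have "ln residual = ln prefactor + (real n * ln \<mu> - ln (fact n)) + ln (vertex_interaction Green) + ln (coulomb_integral Green n)"
  proof -
    have "0 < vertex_interaction Green" by (simp add: vertex_interaction_def)
    then show ?thesis unfolding residual_def using prefactor_pos mu pos
      by (simp add: ln_mult ln_div ln_realpow)
  qed
  ultimately show ?thesis unfolding p v by simp
qed

text \<open>This is why \<open>b\<close> is chosen with \<open>b\<^sup>2 = \<beta> / (n - 1)\<close>.\<close>

lemma w_param_eq_of_nat:
  assumes n: "2 \<le> n" and \<beta>: "\<beta> = - 1 - (\<Sum>j=1..k. al j)" "0 < \<beta>" and b: "0 < b" "b\<^sup>2 = \<beta> / (real n - 1)"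
  shows "w_param k (\<lambda>j. of_real (al j / b)) b = of_nat n"
proof -
  have "(Q_const b - (\<Sum>j=1..k. al j / b)) / b = 1 + \<beta> / b\<^sup>2"
    using b(1) unfolding \<beta>(1) Q_const_def sum_divide_distrib[symmetric]
    by (simp add: power2_eq_square field_simps)
  also have "\<beta> / b\<^sup>2 = real n - 1" using n \<beta>(2) unfolding b(2) by (simp add: field_simps)
  finally have "complex_of_real ((Q_const b - (\<Sum>j=1..k. al j / b)) / b) = of_real (real n)" by simp
  then show ?thesis unfolding w_param_def by simp
qed

text \<open>The growth \<open>n * ln n\<close> of the power of \<open>\<mu> / b\<^sup>2\<close> is compensated by the factorial,
which leaves the constant \<open>1\<close>.\<close>

lemma normalised_residual_limit:
  fixes F :: "nat \<Rightarrow> real" and g :: "nat \<Rightarrow> real"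
  assumes \<beta>: "0 < \<beta>" and \<mu>: "0 < \<mu>" and F: "(\<lambda>n. F n / real n) \<longlonglongrightarrow> f"
  shows "(\<lambda>n. ((\<Sum>j=1..k. chi_const * (al j - (al j)\<^sup>2 / (\<beta> / (real n - 1)))
       + (- al j + al j / (\<beta> / (real n - 1)) + (al j)\<^sup>2 / (\<beta> / (real n - 1))) * g j)
     + real n * ln (\<mu> / (\<beta> / (real n - 1))) - ln (fact n) - 4 * E / (\<beta> / (real n - 1)) + F n) / real n)
    \<longlonglongrightarrow> 1 + ln \<mu> - ln \<beta> + ((1 - ln 4) * (\<Sum>j=1..k. (al j)\<^sup>2 / \<beta>) + (\<Sum>j=1..k. al j * (1 + al j) / \<beta> * g j)
        - 4 / \<beta> * E + f)"
proof -
  define h where "h n = (real n - 1) / real n" for n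
  have h: "h \<longlonglongrightarrow> 1"
  proof (rule Lim_transform_eventually)
    show "(\<lambda>n. 1 - 1 / real n) \<longlonglongrightarrow> 1" using tendsto_diff[OF tendsto_const lim_const_over_n, of 1 1] by simp
    show "\<forall>\<^sub>F n in sequentially. 1 - 1 / real n = h n"
      using eventually_gt_at_top[of "0::nat"] by eventually_elim (simp add: h_def field_simps)
  qed
  define t where "t n = (\<Sum>j=1..k. chi_const * (al j / real n - (al j)\<^sup>2 / \<beta> * h n)
      + (- (al j / real n) + al j / \<beta> * h n + (al j)\<^sup>2 / \<beta> * h n) * g j)
     + (ln \<mu> - ln \<beta> + ln (h n)) - (ln (fact n) / real n - ln (real n)) - 4 * E / \<beta> * h n + F n / real n" for n
  have "t \<longlonglongrightarrow> (\<Sum>j=1..k. chi_const * (0 - (al j)\<^sup>2 / \<beta> * 1) + (- 0 + al j / \<beta> * 1 + (al j)\<^sup>2 / \<beta> * 1) * g j)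
     + (ln \<mu> - ln \<beta> + ln 1) - (- 1) - 4 * E / \<beta> * 1 + f"
    unfolding t_def by (intro tendsto_intros h F ln_fact_over_n lim_const_over_n) simp_all
  also have "(\<Sum>j=1..k. chi_const * (0 - (al j)\<^sup>2 / \<beta> * 1) + (- 0 + al j / \<beta> * 1 + (al j)\<^sup>2 / \<beta> * 1) * g j)
     = (1 - ln 4) * (\<Sum>j=1..k. (al j)\<^sup>2 / \<beta>) + (\<Sum>j=1..k. al j * (1 + al j) / \<beta> * g j)"
    unfolding sum_distrib_left sum.distrib[symmetric]
  proof (intro sum.cong refl)
    fix j
    have "al j * (1 + al j) / \<beta> = al j / \<beta> + (al j)\<^sup>2 / \<beta>"
      by (simp add: power2_eq_square add_divide_distrib distrib_left)
    moreover have "(ln 4 - 1) * (0 - s * 1) + (- 0 + t * 1 + s * 1) * u = (1 - ln 4) * s + (t + s) * u" for s t u :: real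
      by (simp add: algebra_simps)
    ultimately show "chi_const * (0 - (al j)\<^sup>2 / \<beta> * 1) + (- 0 + al j / \<beta> * 1 + (al j)\<^sup>2 / \<beta> * 1) * g j
      = (1 - ln 4) * ((al j)\<^sup>2 / \<beta>) + al j * (1 + al j) / \<beta> * g j"
      unfolding chi_const_def by (simp only:)
  qed
  finally have lim: "t \<longlonglongrightarrow> 1 + ln \<mu> - ln \<beta> + ((1 - ln 4) * (\<Sum>j=1..k. (al j)\<^sup>2 / \<beta>)
     + (\<Sum>j=1..k. al j * (1 + al j) / \<beta> * g j) - 4 / \<beta> * E + f)" by (simp add: algebra_simps)
  have "\<forall>\<^sub>F n in sequentially. t n = ((\<Sum>j=1..k. chi_const * (al j - (al j)\<^sup>2 / (\<beta> / (real n - 1)))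
       + (- al j + al j / (\<beta> / (real n - 1)) + (al j)\<^sup>2 / (\<beta> / (real n - 1))) * g j)
     + real n * ln (\<mu> / (\<beta> / (real n - 1))) - ln (fact n) - 4 * E / (\<beta> / (real n - 1)) + F n) / real n"
    using eventually_gt_at_top[of "1::nat"]
  proof eventually_elim
    case (elim n)
    have 1: "(chi_const * (al j - (al j)\<^sup>2 / (\<beta> / (real n - 1)))
       + (- al j + al j / (\<beta> / (real n - 1)) + (al j)\<^sup>2 / (\<beta> / (real n - 1))) * g j) / real n
      = chi_const * (al j / real n - (al j)\<^sup>2 / \<beta> * h n)
      + (- (al j / real n) + al j / \<beta> * h n + (al j)\<^sup>2 / \<beta> * h n) * g j" for j
      using elim \<beta> by (simp add: h_def field_simps)
    have 2: "real n * ln (\<mu> / (\<beta> / (real n - 1))) / real n = ln \<mu> - ln \<beta> + ln (h n) + ln (real n)"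
      using elim \<beta> \<mu> by (simp add: h_def ln_div ln_mult)
    have 3: "4 * E / (\<beta> / (real n - 1)) / real n = 4 * E / \<beta> * h n"
      using elim \<beta> by (simp add: h_def field_simps)
    show ?case
      unfolding t_def add_divide_distrib diff_divide_distrib sum_divide_distrib[of _ _ "real n"] 2 3
      unfolding 1[unfolded add_divide_distrib diff_divide_distrib] by simp
  qed
  with lim show ?thesis by (rule Lim_transform_eventually)
qed

theorem theorem1p3p3:
  fixes k :: nat and x :: "nat \<Rightarrow> real^3" and \<alpha> :: "nat \<Rightarrow> real" and \<mu> \<beta> :: real
    and b :: "nat \<Rightarrow> real"
  assumes "k \<ge> 3"
    and "\<And>j. j \<in> {1..k} \<Longrightarrow> x j \<in> S2 - {axis 3 1}"
    and "inj_on x {1..k}"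
    and "\<mu> > 0"
    and "\<And>j. j \<in> {1..k} \<Longrightarrow> \<alpha> j > - 1/2"
    and "\<beta> = - 1 - (\<Sum>j=1..k. \<alpha> j)"
    and "\<beta> > 0"
    and "\<And>n. n \<ge> 2 \<Longrightarrow> b n = sqrt (\<beta> / (real n - 1))"
  shows "(\<lambda>n. log_C_tilde k (\<lambda>j. of_real (\<alpha> j / b n)) x (b n) (\<mu> / (b n)\<^sup>2) / of_nat n)
      \<longlonglongrightarrow> of_real (1 + ln \<mu> - ln \<beta>) - \<i> * of_real pi
        + of_real ((1 - ln 4) * (\<Sum>j=1..k. (\<alpha> j)\<^sup>2 / \<beta>)
            + (\<Sum>j=1..k. \<alpha> j * (1 + \<alpha> j) / \<beta> * ln (round_metric (stereo (x j))))
            - 4 / \<beta> * (\<Sum>(j, j') \<in> {(j, j'). 1 \<le> j \<and> j < j' \<and> j' \<le> k}.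
                \<alpha> j * \<alpha> j' * Green (x j) (x j'))
            - (INF \<rho> \<in> finite_entropy_densities. S_fun k \<alpha> x \<beta> \<rho>))
    \<and> bdd_below (S_fun k \<alpha> x \<beta> ` finite_entropy_densities)
    \<and> (\<exists>\<rho>\<^sub>0 \<in> finite_entropy_densities.
          S_fun k \<alpha> x \<beta> \<rho>\<^sub>0 = (INF \<rho> \<in> finite_entropy_densities. S_fun k \<alpha> x \<beta> \<rho>)
        \<and> (\<forall>\<rho> \<in> finite_entropy_densities.
              S_fun k \<alpha> x \<beta> \<rho> = (INF \<rho> \<in> finite_entropy_densities. S_fun k \<alpha> x \<beta> \<rho>)
              \<longrightarrow> (AE y in area. \<rho> y = \<rho>\<^sub>0 y)))"
proof -
  have xS: "\<And>j. j \<in> {1..k} \<Longrightarrow> x j \<in> S2" using assms(2) by blast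
  have al: "\<And>j. j \<in> {1..k} \<Longrightarrow> - 1 / 2 < \<alpha> j" using assms(5) by simp
  let ?V = "source_potential k \<alpha> x"
  obtain c q where mf: "mean_field ?V \<beta> c q"
    by (rule mean_field_source_potential[of k x \<alpha> \<beta>, OF xS assms(3) al assms(7)])
  interpret mean_field ?V \<beta> c q by (rule mf)
  have S_eq: "S_fun k \<alpha> x \<beta> \<rho> = S \<rho>" if "\<rho> \<in> finite_entropy_densities" for \<rho>
    by (rule S_fun_eq_mean_field[OF mf xS that])
  show ?thesis
  proof (rule mean_field_equilibrium)
    fix \<sigma> assume \<sigma>: "\<sigma> \<in> finite_entropy_densities" "\<And>y. \<sigma> y = gibbs (mf_pot \<sigma>) y"
      and S_\<sigma>: "S \<sigma> = - 2 * \<beta> * energy \<sigma> \<sigma> - ln (partition (mf_pot \<sigma>))"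
      and min: "\<And>\<rho>. \<rho> \<in> finite_entropy_densities \<Longrightarrow> S \<sigma> \<le> S \<rho>"
      and uniq: "\<And>\<rho>. \<rho> \<in> finite_entropy_densities \<Longrightarrow> S \<rho> = S \<sigma> \<Longrightarrow> AE y in area. \<rho> y = \<sigma> y"
    have image: "S_fun k \<alpha> x \<beta> ` finite_entropy_densities = S ` finite_entropy_densities"
      by (rule image_cong[OF refl S_eq])
    have INF: "(INF \<rho> \<in> finite_entropy_densities. S_fun k \<alpha> x \<beta> \<rho>) = S \<sigma>"
      unfolding image by (rule cInf_eq_minimum) (use \<sigma>(1) min in auto)
    define g where "g j = ln (round_metric (stereo (x j)))" for j
    define E where "E = (\<Sum>(j, j') \<in> {(j, j'). 1 \<le> j \<and> j < j' \<and> j' \<le> k}. \<alpha> j * \<alpha> j' * Green (x j) (x j'))"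
    define R where "R n = ((\<Sum>j=1..k. chi_const * (\<alpha> j - (\<alpha> j)\<^sup>2 / (\<beta> / (real n - 1)))
         + (- \<alpha> j + \<alpha> j / (\<beta> / (real n - 1)) + (\<alpha> j)\<^sup>2 / (\<beta> / (real n - 1))) * g j)
       + real n * ln (\<mu> / (\<beta> / (real n - 1))) - ln (fact n) - 4 * E / (\<beta> / (real n - 1)) + ln (Z n)) / real n" for n
    let ?l = "1 + ln \<mu> - ln \<beta> + ((1 - ln 4) * (\<Sum>j=1..k. (\<alpha> j)\<^sup>2 / \<beta>) + (\<Sum>j=1..k. \<alpha> j * (1 + \<alpha> j) / \<beta> * g j)
          - 4 / \<beta> * E + - S \<sigma>)"
    have "(\<lambda>n. ln (Z n) / real n) \<longlonglongrightarrow> - S \<sigma>"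
      using free_energy_limit[OF \<sigma>] unfolding S_\<sigma> by (simp add: algebra_simps)
    then have R_lim: "R \<longlonglongrightarrow> ?l"
      unfolding R_def by (rule normalised_residual_limit[OF assms(7,4)])
    have ev: "\<forall>\<^sub>F n in sequentially. - \<i> * of_real pi + of_real (R n)
        = log_C_tilde k (\<lambda>j. of_real (\<alpha> j / b n)) x (b n) (\<mu> / (b n)\<^sup>2) / of_nat n"
      using eventually_ge_at_top[of "2::nat"]
    proof eventually_elim
      case (elim n)
      have bn: "0 < b n" "(b n)\<^sup>2 = \<beta> / (real n - 1)"
        using elim assms(7) unfolding assms(8)[OF elim] by simp_all
      interpret correlation k x \<alpha> "b n" "\<mu> / (b n)\<^sup>2" n
        by unfold_locales (use xS bn w_param_eq_of_nat[OF elim assms(6,7) bn] in auto)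
      have Z: "coulomb_integral Green n = Z n" by (rule coulomb_integral_eq_Z[OF mf bn(2)])
      have Zpos: "0 < Z n" using Z_lower_bound[OF \<sigma> elim] by (rule less_le_trans[OF exp_gt_zero])
      have mu: "0 < \<mu> / (b n)\<^sup>2" using assms(4) bn(1) by simp
      have pos: "0 < residual"
        unfolding residual_def Z using prefactor_pos mu Zpos by (simp add: vertex_interaction_def)
      have "ln residual / real n = R n"
        using ln_residual[OF mu] Zpos unfolding Z bn(2) R_def E_def g_def by simp
      then have "ln residual = R n * real n" using elim by (simp add: divide_eq_eq)
      moreover have "log_C_tilde k (\<lambda>j. of_real (\<alpha> j / b n)) x (b n) (\<mu> / (b n)\<^sup>2) = - \<i> * of_real pi * of_nat n + of_real (ln residual)"
        by (rule log_C_tilde_eq[OF assms(3) al pos])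
      ultimately have "log_C_tilde k (\<lambda>j. of_real (\<alpha> j / b n)) x (b n) (\<mu> / (b n)\<^sup>2) = (- \<i> * of_real pi + of_real (R n)) * of_nat n"
        by (simp only: of_real_mult of_real_of_nat_eq distrib_right)
      then show ?case using elim by simp
    qed
    have "(\<lambda>n. - \<i> * of_real pi + of_real (R n)) \<longlonglongrightarrow> - \<i> * of_real pi + of_real ?l"
      by (intro tendsto_intros R_lim)
    from Lim_transform_eventually[OF this ev]
    have lim: "(\<lambda>n. log_C_tilde k (\<lambda>j. of_real (\<alpha> j / b n)) x (b n) (\<mu> / (b n)\<^sup>2) / of_nat n) \<longlonglongrightarrow> - \<i> * of_real pi + of_real ?l" .
    have "- \<i> * of_real pi + of_real ?l = of_real (1 + ln \<mu> - ln \<beta>) - \<i> * of_real pi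
          + of_real ((1 - ln 4) * (\<Sum>j=1..k. (\<alpha> j)\<^sup>2 / \<beta>)
              + (\<Sum>j=1..k. \<alpha> j * (1 + \<alpha> j) / \<beta> * ln (round_metric (stereo (x j))))
              - 4 / \<beta> * (\<Sum>(j, j') \<in> {(j, j'). 1 \<le> j \<and> j < j' \<and> j' \<le> k}. \<alpha> j * \<alpha> j' * Green (x j) (x j'))
              - (INF \<rho> \<in> finite_entropy_densities. S_fun k \<alpha> x \<beta> \<rho>))"
      unfolding INF E_def g_def by (simp only: of_real_add of_real_diff of_real_minus) (simp add: algebra_simps)
    with lim have "(\<lambda>n. log_C_tilde k (\<lambda>j. of_real (\<alpha> j / b n)) x (b n) (\<mu> / (b n)\<^sup>2) / of_nat n)
        \<longlonglongrightarrow> of_real (1 + ln \<mu> - ln \<beta>) - \<i> * of_real pi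
          + of_real ((1 - ln 4) * (\<Sum>j=1..k. (\<alpha> j)\<^sup>2 / \<beta>)
              + (\<Sum>j=1..k. \<alpha> j * (1 + \<alpha> j) / \<beta> * ln (round_metric (stereo (x j))))
              - 4 / \<beta> * (\<Sum>(j, j') \<in> {(j, j'). 1 \<le> j \<and> j < j' \<and> j' \<le> k}. \<alpha> j * \<alpha> j' * Green (x j) (x j'))
              - (INF \<rho> \<in> finite_entropy_densities. S_fun k \<alpha> x \<beta> \<rho>))" by (simp only:)
    moreover have "bdd_below (S_fun k \<alpha> x \<beta> ` finite_entropy_densities)"
      unfolding image by (rule bdd_below_S)
    moreover have "\<exists>\<rho>\<^sub>0 \<in> finite_entropy_densities.
            S_fun k \<alpha> x \<beta> \<rho>\<^sub>0 = (INF \<rho> \<in> finite_entropy_densities. S_fun k \<alpha> x \<beta> \<rho>)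
          \<and> (\<forall>\<rho> \<in> finite_entropy_densities.
                S_fun k \<alpha> x \<beta> \<rho> = (INF \<rho> \<in> finite_entropy_densities. S_fun k \<alpha> x \<beta> \<rho>)
                \<longrightarrow> (AE y in area. \<rho> y = \<rho>\<^sub>0 y))"
      unfolding INF using \<sigma>(1) uniq S_eq by (intro bexI[of _ \<sigma>]) auto
    ultimately show ?thesis by blast
  qed
qed

end
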